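(* Let $n$ be a positive integer. Then: (a) $\operatorname{ed}[\phi_{n,1}]=\operatorname{ed}[H_{n,1}]=0$. (b) $\operatorname{ed}[\phi_{n,2}]=n$ and $\operatorname{ed}[H_{n,2}]=n-1$. (c) $\operatorname{ed}[\phi_{2,3}]=2$ and $\operatorname{ed}[H_{2,3}]=1$. (d) $\operatorname{ed}[\phi_{2,4}]=3$ and $\operatorname{ed}[H_{2,4}]=2$. (e) $\operatorname{ed}[H_{3,3}]=3$.
   Context: $k$ is an algebraically closed field of characteristic zero. For positive integers $n,d$ let $N=\binom{n+d-1}{d}$, let $\mathbb{A}^N$ be the affine space of forms of degree $d$ in $n$ variables $x_1,\dots,x_n$, and let $\mathbb{P}^{N-1}$ be the corresponding projective space (degree $d$ hypersurfaces in $\mathbb{P}^{n-1}$); $\operatorname{GL}_n$ acts on both by linear substitutions of the variables. For a $\operatorname{GL}_n$-variety $X$ and a field extension $L/k$ put $\mathbf{Orb}_X(L)=X(L)/\operatorname{GL}_n(L)$. For a field extension $K/k$ and $z\in X(K)$ with class $[z]\in\mathbf{Orb}_X(K)$, $\operatorname{ed}[z]$ is the minimal value of $\operatorname{trdeg}_k(L)$ over intermediate fields $k\subset L\subset K$ such that $[z]$ lies in the image of $\mathbf{Orb}_X(L)\to\mathbf{Orb}_X(K)$, i.e. such that $g\cdot z\in X(L)$ for some $g\in\operatorname{GL}_n(K)$. The general form is $\phi_{n,d}(x)=\sum_{i_1+\dots+i_n=d}a_{i_1,\dots,i_n}x_1^{i_1}\cdots x_n^{i_n}$ with independent variables $a_{i_1,\dots,i_n}$;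 it is the generic point of $\mathbb{A}^N$, with $K=k(\mathbb{A}^N)$. The general hypersurface $H_{n,d}$ (given by $\phi_{n,d}=0$) is the generic point of $\mathbb{P}^{N-1}$, with $K=k(\mathbb{P}^{N-1})$. *)

theory Defs
  imports
    "HOL-Library.Poly_Mapping"
    "HOL-Library.Extended_Nat"
    "HOL-Computational_Algebra.Polynomial"
    "HOL-Computational_Algebra.Fraction_Field"
    "Jordan_Normal_Form.Matrix"
begin

section \<open>Field extensions inside a fixed field\<close>

text \<open>All fields that occur are subsets of one ambient field type \<open>'a\<close>.\<close>

definition is_subfield :: "'a::field set \<Rightarrow> bool" where
  "is_subfield L \<longleftrightarrow>
     0 \<in> L \<and> 1 \<in> L \<and>
     (\<forall>x\<in>L. \<forall>y\<in>L. x + y \<in> L \<and> x * y \<in> L) \<and>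
     (\<forall>x\<in>L. - x \<in> L \<and> inverse x \<in> L)"

definition adjoin :: "'a::field set \<Rightarrow> 'a set \<Rightarrow> 'a set" where
  "adjoin k S = \<Inter>{L. is_subfield L \<and> k \<subseteq> L \<and> S \<subseteq> L}"

text \<open>
  Polynomials are finitely supported maps from monomials to coefficients, a monomial being
  a finitely supported map from variables to exponents. For algebraic independence of
  a set \<open>S\<close>, the elements of \<open>S\<close> themselves serve as names of the variables.
\<close>

definition alg_independent :: "'a::field set \<Rightarrow> 'a set \<Rightarrow> bool" where
  "alg_independent k S \<longleftrightarrow>
     (\<forall>p :: ('a \<Rightarrow>\<^sub>0 nat) \<Rightarrow>\<^sub>0 'a.
        (\<forall>m\<in>Poly_Mapping.keys p. Poly_Mapping.lookup p m \<in> k \<and> Poly_Mapping.keys m \<subseteq> S) \<longrightarrow>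
        (\<Sum>m\<in>Poly_Mapping.keys p. Poly_Mapping.lookup p m *
           (\<Prod>s\<in>Poly_Mapping.keys m. s ^ Poly_Mapping.lookup m s)) = 0 \<longrightarrow> p = 0)"

definition trdeg :: "'a::field set \<Rightarrow> 'a set \<Rightarrow> enat" where
  "trdeg k L = Sup {enat (card S) | S. S \<subseteq> L \<and> finite S \<and> alg_independent k S}"


section \<open>Essential dimension of a point\<close>

definition GL :: "nat \<Rightarrow> 'a::field set \<Rightarrow> 'a mat set" where
  "GL n K = {g \<in> carrier_mat n n. elements_mat g \<subseteq> K \<and>
     (\<exists>h\<in>carrier_mat n n. elements_mat h \<subseteq> K \<and> g * h = 1\<^sub>m n \<and> h * g = 1\<^sub>m n)}"

text \<open>
  A \<open>GL\<^sub>n\<close>-variety enters through its functor of points: \<open>X L\<close> is the set of points over the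
  subfield \<open>L\<close>, regarded as a subset of the points over the ambient field, on which
  \<open>act\<close> is the action. Over the empty set the infimum would be \<open>\<infinity>\<close>, but \<open>L = K\<close>, \<open>g = 1\<close> is
  always available when \<open>z \<in> X K\<close>; infima of nonempty sets in \<open>enat\<close> are attained.
\<close>

definition ess_dim ::
  "nat \<Rightarrow> ('a::field set \<Rightarrow> 'x set) \<Rightarrow> ('a mat \<Rightarrow> 'x \<Rightarrow> 'x) \<Rightarrow> 'a set \<Rightarrow> 'a set \<Rightarrow> 'x \<Rightarrow> enat" where
  "ess_dim n X act k K z =
     Inf {trdeg k L | L. is_subfield L \<and> k \<subseteq> L \<and> L \<subseteq> K \<and> (\<exists>g\<in>GL n K. act g z \<in> X L)}"


section \<open>Forms and hypersurfaces\<close>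

text \<open>The variables of the forms are numbered \<open>0, \<dots>, n - 1\<close>.\<close>

definition monomials :: "nat \<Rightarrow> nat \<Rightarrow> (nat \<Rightarrow>\<^sub>0 nat) set" where
  "monomials n d = {m. Poly_Mapping.keys m \<subseteq> {..<n} \<and> (\<Sum>i<n. Poly_Mapping.lookup m i) = d}"

lemma finite_monomials: "finite (monomials n d)"
proof -
  let ?h = "\<lambda>m. (\<lambda>i\<in>{..<n}. Poly_Mapping.lookup m i)"
  have "inj_on ?h (monomials n d)"
  proof (rule inj_onI)
    fix a b assume a: "a \<in> monomials n d" and b: "b \<in> monomials n d" and e: "?h a = ?h b"
    show "a = b"
    proof (rule poly_mapping_eqI)
      fix i show "Poly_Mapping.lookup a i = Poly_Mapping.lookup b i"
      proof (cases "i < n")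
        case True then show ?thesis using fun_cong[OF e, of i] by (simp add: restrict_def)
      next
        case False
        then have "i \<notin> Poly_Mapping.keys a" "i \<notin> Poly_Mapping.keys b" using a b by (auto simp: monomials_def)
        then show ?thesis by (simp add: in_keys_iff)
      qed
    qed
  qed
  moreover have "?h ` monomials n d \<subseteq> PiE {..<n} (\<lambda>_. {..d})"
  proof (intro image_subsetI PiE_I)
    fix m i assume "m \<in> monomials n d" "i \<in> {..<n}"
    then show "?h m i \<in> {..d}" by (auto simp: monomials_def intro: member_le_sum)
  qed simp
  ultimately show ?thesis
    by (metis (no_types, lifting) finite_PiE finite_atMost finite_lessThan finite_subset finite_imageD)
qed

type_synonym 'a form = "(nat \<Rightarrow>\<^sub>0 nat) \<Rightarrow>\<^sub>0 'a"

definition forms :: "nat \<Rightarrow> nat \<Rightarrow> 'a::field set \<Rightarrow> 'a form set" where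
  "forms n d L =
     {f. Poly_Mapping.keys f \<subseteq> monomials n d \<and> (\<forall>m\<in>Poly_Mapping.keys f. Poly_Mapping.lookup f m \<in> L)}"

definition const :: "'a::zero \<Rightarrow> ('v \<Rightarrow>\<^sub>0 nat) \<Rightarrow>\<^sub>0 'a" where
  "const c = Poly_Mapping.single 0 c"

definition var :: "'v \<Rightarrow> ('v \<Rightarrow>\<^sub>0 nat) \<Rightarrow>\<^sub>0 'a::zero_neq_one" where
  "var v = Poly_Mapping.single (Poly_Mapping.single v 1) 1"

text \<open>
  \<open>(g \<cdot> f)(x) = f(x g)\<close> for the row vector \<open>x\<close> of variables; this is a left action.
\<close>

definition subst_act :: "'a::field mat \<Rightarrow> 'a form \<Rightarrow> 'a form" where
  "subst_act g f =
     (\<Sum>m\<in>Poly_Mapping.keys f. const (Poly_Mapping.lookup f m) *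
        (\<Prod>j\<in>Poly_Mapping.keys m.
           (\<Sum>i<dim_row g. const (g $$ (i, j)) * var i) ^ Poly_Mapping.lookup m j))"

text \<open>
  A hypersurface over the ambient field is the class of a nonzero form up to nonzero
  scalars. It is defined over \<open>L\<close> if the class contains a form over \<open>L\<close>; this identifies
  \<open>\<P>\<^bsup>N-1\<^esup>(L)\<close> with a subset of \<open>\<P>\<^bsup>N-1\<^esup>\<close> of the ambient field, since two forms over \<open>L\<close> that
  are proportional over a larger field are proportional over \<open>L\<close>.
\<close>

definition proj_class :: "'a::field form \<Rightarrow> 'a form set" where
  "proj_class f = {const c * f | c. c \<noteq> 0}"

definition hypersurfaces :: "nat \<Rightarrow> nat \<Rightarrow> 'a::field set \<Rightarrow> 'a form set set" where
  "hypersurfaces n d L = proj_class ` (forms n d L - {0})"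

definition hyp_act :: "'a::field mat \<Rightarrow> 'a form set \<Rightarrow> 'a form set" where
  "hyp_act g P = subst_act g ` P"


section \<open>The general form and the general hypersurface\<close>

text \<open>
  The ambient field is the field of rational functions over \<open>'k\<close> in one independent variable
  \<open>a\<^sub>m\<close> for every monomial \<open>m\<close>, of any degree and in any number of the variables \<open>x\<^sub>i\<close>. For
  fixed \<open>n\<close> and \<open>d\<close> only the finitely many \<open>a\<^sub>m\<close> with \<open>m \<in> monomials n d\<close> are used: the
  fields below are the function fields \<open>k(\<A>\<^sup>N)\<close> and \<open>k(\<P>\<^bsup>N-1\<^esup>)\<close>.
\<close>

type_synonym 'k ratfun = "(((nat \<Rightarrow>\<^sub>0 nat) \<Rightarrow>\<^sub>0 nat) \<Rightarrow>\<^sub>0 'k) fract"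

definition base_field :: "'k::field ratfun set" where
  "base_field = range (\<lambda>c. Fract (const c) 1)"

definition gen_coeff :: "(nat \<Rightarrow>\<^sub>0 nat) \<Rightarrow> 'k::field ratfun" where
  "gen_coeff m = Fract (var m) 1"

definition affine_function_field :: "nat \<Rightarrow> nat \<Rightarrow> 'k::field ratfun set" where
  "affine_function_field n d = adjoin base_field (gen_coeff ` monomials n d)"

definition proj_function_field :: "nat \<Rightarrow> nat \<Rightarrow> 'k::field ratfun set" where
  "proj_function_field n d =
     adjoin base_field {gen_coeff m / gen_coeff m' | m m'. m \<in> monomials n d \<and> m' \<in> monomials n d}"

definition general_form :: "nat \<Rightarrow> nat \<Rightarrow> 'k::field ratfun form" where
  "general_form n d = (\<Sum>m\<in>monomials n d. Poly_Mapping.single m (gen_coeff m))"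

lemma lookup_general_form:
  "Poly_Mapping.lookup (general_form n d) m = (if m \<in> monomials n d then gen_coeff m else 0)"
  by (simp add: general_form_def lookup_sum lookup_single when_def finite_monomials)

definition general_hypersurface :: "nat \<Rightarrow> nat \<Rightarrow> 'k::field ratfun form set" where
  "general_hypersurface n d = proj_class (general_form n d)"

definition ed_general_form :: "'k::field itself \<Rightarrow> nat \<Rightarrow> nat \<Rightarrow> enat" where
  "ed_general_form _ n d =
     ess_dim n (forms n d) subst_act base_field (affine_function_field n d)
       (general_form n d :: 'k ratfun form)"

definition ed_general_hypersurface :: "'k::field itself \<Rightarrow> nat \<Rightarrow> nat \<Rightarrow> enat" where
  "ed_general_hypersurface _ n d =
     ess_dim n (hypersurfaces n d) hyp_act base_field (proj_function_field n d)
       (general_hypersurface n d :: 'k ratfun form set)"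

end

theory Submission
 imports Defs "Jordan_Normal_Form.Determinant" "Berlekamp_Zassenhaus.Unique_Factorization_Poly"
begin

text \<open>
 \<^emph>\<open>Upper bounds\<close> are normal forms over the function field. Linear forms become \<open>x\<^sub>0\<close>; a quadratic form is
 diagonalised. In a binary form the term \<open>x\<^sup>d\<^sup>-\<^sup>1 y\<close> is removed by completing a power, and scaling \<open>y\<close> makes two
 coefficients equal. A ternary cubic becomes \<open>a x\<^sup>3 + x q(y, z) + c(y, z)\<close>; a basis orthogonal for \<open>q\<close> is chosen
 such that \<open>c\<close> satisfies one apolarity condition, and scaling removes two further parameters. For hypersurfaces
 the same is done after division by one coefficient.

 \<^emph>\<open>Lower bounds for quadratic and binary forms\<close> use the leading monomial as a valuation \<open>deg\<close> with values in a
 free abelian group: elements with independent degrees are algebraically independent. If \<open>f = c g\<phi>\<close> has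
 coefficients in \<open>L\<close>, then \<open>L\<close> contains its values at basis vectors and its classical invariants (the diagonal entries,
 or the discriminant, or \<open>I\<close> and \<open>J\<close>). The matrix \<open>g\<close> is arbitrary, but it changes the degrees in a controlled way:
 modulo 2 or 3 the degree of \<open>\<phi>(y)\<close> is that of a pure coefficient, since the values of
 the pure terms have distinct degrees and dominate the mixed ones (\<open>general_form_degree\<close>), and
 the invariants change by powers of \<open>c\<close> and \<open>det g\<close>.

 \<^emph>\<open>The lower bound for plane cubics\<close> cannot come from such invariants, as there is only one, the
 \<open>j\<close>-invariant; it comes from the Heisenberg group of order 27. Over a larger field the general cubic is equivalent to a Hesse cubic
 \<open>\<psi> = x\<^sup>3 + y\<^sup>3 + z\<^sup>3 + m x y z\<close>, so it may be taken to be \<open>\<psi>(x h)\<close>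
 over \<open>k(m, h)\<close> with a generic matrix \<open>h\<close>. The automorphism group of \<open>\<psi>\<close> contains \<open>A\<close>, multiplying
 column \<open>j\<close> of \<open>h\<close> by \<open>\<omega>\<^sup>j\<close>, and \<open>B\<close>, permuting the columns cyclically; they fix the coefficients of
 \<open>\<psi>(x h)\<close>. Suppose that a cubic over \<open>L\<close> is equivalent to the general one, by \<open>g\<close>, and let \<open>M = g h\<close>. The stabiliser
 of \<open>\<psi>\<close> is finite modulo scalars, so \<open>m\<close> and the ratios \<open>u = M\<^sub>0\<^sub>1 / M\<^sub>0\<^sub>0\<close>, \<open>v = M\<^sub>0\<^sub>2 / M\<^sub>0\<^sub>0\<close> are
 algebraic over \<open>L\<close> (\<open>hesse_tangent\<close>, in terms of derivations). If \<open>trdeg L \<le> 2\<close>, then \<open>v\<close> is algebraic over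
 \<open>k(m, u)\<close>. So \<open>k(m)(u, v)\<close> is the function field of a curve over \<open>k(m)\<close>; restriction to a line
 embeds it into \<open>k(m)(t)\<close>, and by Lueroth's theorem (\<open>luroth\<close>) it is \<open>k(m)(s)\<close>. On it \<open>A\<close>, \<open>B\<close> are commuting
 Moebius transformations of order 3 with \<open>A u = \<omega> u\<close> and \<open>u \<sqdot> B u \<sqdot> B\<^sup>2 u = 1\<close>. They have a common fixed
 point, and the values of \<open>u\<close> there contradict these relations
 (\<open>rational_function_field_no_heisenberg_action\<close>).

 Transcendence degree is handled by derivations throughout: over a field of characteristic zero, \<open>x\<close> is
 transcendental over \<open>L\<close> if and only if some derivation kills \<open>L\<close> but not \<open>x\<close>.
\<close>

hide_const (open) Module.smult comm_monoid_mult_class.coprime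

abbreviation lookup :: "('a \<Rightarrow>\<^sub>0 'b::zero) \<Rightarrow> 'a \<Rightarrow> 'b" where "lookup \<equiv> Poly_Mapping.lookup"
abbreviation single :: "'a \<Rightarrow> 'b \<Rightarrow> 'a \<Rightarrow>\<^sub>0 'b::zero" where "single \<equiv> Poly_Mapping.single"
abbreviation keys :: "('a \<Rightarrow>\<^sub>0 'b::zero) \<Rightarrow> 'a set" where "keys \<equiv> Poly_Mapping.keys"

section \<open>Evaluation of polynomials\<close>

definition is_hom :: "('a::comm_ring_1 \<Rightarrow> 'b::comm_ring_1) \<Rightarrow> bool" where
 "is_hom h \<longleftrightarrow> h 0 = 0 \<and> h 1 = 1 \<and> (\<forall>x y. h (x + y) = h x + h y \<and> h (x * y) = h x * h y)"

lemma homD: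
 assumes "is_hom h"
 shows "h 0 = 0" "h 1 = 1" "h (x + y) = h x + h y" "h (x * y) = h x * h y"
 using assms by (auto simp: is_hom_def)

lemma hom_uminus: assumes "is_hom h" shows "h (- x) = - h x"
proof -
 have "h (-x) + h x = 0" using homD[OF assms] by (metis add.left_inverse)
 then show ?thesis by (simp add: eq_neg_iff_add_eq_0)
qed

lemma hom_diff: assumes "is_hom h" shows "h (x - y) = h x - h y"
 using homD(3)[OF assms, of x "-y"] hom_uminus[OF assms] by simp

lemma hom_power: assumes "is_hom h" shows "h (x ^ n) = h x ^ n"
 by (induction n) (simp_all add: homD[OF assms])

lemma hom_sum: assumes "is_hom h" shows "h (sum f A) = (\<Sum>x\<in>A. h (f x))"
 by (induction A rule: infinite_finite_induct) (simp_all add: homD[OF assms])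

lemma hom_prod: assumes "is_hom h" shows "h (prod f A) = (\<Prod>x\<in>A. h (f x))"
 by (induction A rule: infinite_finite_induct) (simp_all add: homD[OF assms])

lemma hom_of_nat: assumes "is_hom h" shows "h (of_nat n) = of_nat n"
 by (induction n) (simp_all add: homD[OF assms])

lemma hom_divide:
 fixes h :: "'a::field \<Rightarrow> 'b::field"
 assumes h: "is_hom h" shows "h (x / y) = h x / h y"
proof (cases "y = 0")
 case True then show ?thesis by (simp add: homD[OF h])
next
 case False
 have "h (x / y) * h y = h x" using False by (simp flip: homD(4)[OF h])
 moreover have "h y \<noteq> 0"
  using False homD(4)[OF h, of y "inverse y"] homD(2)[OF h] by auto
 ultimately show ?thesis by (simp add: field_simps)
qed

lemma hom_inj:
 fixes h :: "'a::field \<Rightarrow> 'b::field"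
 assumes h: "is_hom h" "h x = h y" shows "x = y"
proof (rule ccontr)
 assume "x \<noteq> y"
 then have "h ((x - y) * inverse (x - y)) = 1" using homD(2)[OF h(1)] by simp
 then show False using h(2) by (simp add: homD(4)[OF h(1)] hom_diff[OF h(1)])
qed

definition mon :: "('v \<Rightarrow> 'c::comm_semiring_1) \<Rightarrow> ('v \<Rightarrow>\<^sub>0 nat) \<Rightarrow> 'c" where
 "mon x m = (\<Prod>v\<in>keys m. x v ^ lookup m v)"

definition ev :: "('b \<Rightarrow> 'c::comm_ring_1) \<Rightarrow> ('v \<Rightarrow> 'c) \<Rightarrow> (('v \<Rightarrow>\<^sub>0 nat) \<Rightarrow>\<^sub>0 'b::zero) \<Rightarrow> 'c" where
 "ev h x p = (\<Sum>m\<in>keys p. h (lookup p m) * mon x m)"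

lemma mon_superset:
 assumes "finite A" "keys m \<subseteq> A"
 shows "mon x m = (\<Prod>v\<in>A. x v ^ lookup m v)"
 unfolding mon_def using assms
 by (intro prod.mono_neutral_left) (auto simp: in_keys_iff)

lemma mon_0 [simp]: "mon x 0 = 1"
 by (simp add: mon_def)

lemma mon_single [simp]: "mon x (single v n) = x v ^ n"
 by (cases "n = 0") (simp_all add: mon_def)

lemma mon_add: "mon x (m + m') = mon x m * mon x m'"
proof -
 let ?A = "keys m \<union> keys m'"
 have "keys (m + m') \<subseteq> ?A" by (rule Poly_Mapping.keys_add)
 then show ?thesis
  using mon_superset[of ?A m x] mon_superset[of ?A m' x] mon_superset[of ?A "m + m'" x]
  by (simp add: lookup_add power_add prod.distrib)
qed

lemma mon_mult: "mon (\<lambda>v. x v * y v) m = mon x m * mon y m"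
 by (simp add: mon_def power_mult_distrib prod.distrib)

lemma ev_superset:
 assumes "h 0 = 0" "finite A" "keys p \<subseteq> A"
 shows "ev h x p = (\<Sum>m\<in>A. h (lookup p m) * mon x m)"
 unfolding ev_def using assms
 by (intro sum.mono_neutral_left) (auto simp: in_keys_iff)

lemma ev_0 [simp]: "ev h x 0 = 0"
 by (simp add: ev_def)

lemma ev_single: assumes "h 0 = 0" shows "ev h x (single m c) = h c * mon x m"
 using assms by (cases "c = 0") (simp_all add: ev_def)

lemma ev_add:
 assumes "is_hom h" shows "ev h x (p + q) = ev h x p + ev h x q"
proof -
 let ?A = "keys p \<union> keys q"
 have "keys (p + q) \<subseteq> ?A" by (rule Poly_Mapping.keys_add)
 then show ?thesis
  using ev_superset[of h ?A p x] ev_superset[of h ?A q x] ev_superset[of h ?A "p + q" x]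
  by (simp add: lookup_add homD[OF assms] sum.distrib algebra_simps)
qed

lemma ev_sum:
 assumes "is_hom h" shows "ev h x (sum f A) = (\<Sum>a\<in>A. ev h x (f a))"
 by (induction A rule: infinite_finite_induct) (simp_all add: ev_add[OF assms])

lemma poly_mapping_as_sum:
 "p = (\<Sum>m\<in>keys p. single m (lookup p m))"
 by (rule poly_mapping_eqI) (auto simp: lookup_sum lookup_single when_def in_keys_iff)

lemma ev_mult:
 assumes "is_hom h" shows "ev h x (p * q) = ev h x p * ev h x q"
proof -
 have "p * q = (\<Sum>a\<in>keys p. single a (lookup p a)) *
   (\<Sum>b\<in>keys q. single b (lookup q b))"
  using poly_mapping_as_sum[of p] poly_mapping_as_sum[of q] by simp
 also have "\<dots> = (\<Sum>a\<in>keys p. \<Sum>b\<in>keys q.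
   single (a + b) (lookup p a * lookup q b))"
  by (simp add: sum_product mult_single)
 also have "ev h x \<dots> = (\<Sum>a\<in>keys p. \<Sum>b\<in>keys q.
   (h (lookup p a) * mon x a) * (h (lookup q b) * mon x b))"
  by (simp add: ev_sum[OF assms] ev_single homD[OF assms] mon_add mult_ac)
 also have "\<dots> = ev h x p * ev h x q"
  by (simp add: ev_def sum_product)
 finally show ?thesis .
qed

lemma ev_hom: assumes "is_hom h" shows "is_hom (ev h x)"
proof -
 have "ev h x 1 = 1" using ev_single[of h x 0 1] homD[OF assms] by simp
 then show ?thesis by (simp add: is_hom_def ev_add[OF assms] ev_mult[OF assms])
qed

lemma ev_const: assumes "is_hom h" shows "ev h x (const c) = h c"
 using homD(1)[OF assms] by (simp add: const_def ev_single)

lemma ev_var: assumes "is_hom h" shows "ev h x (var v) = x v"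
 using homD[OF assms] by (simp add: var_def ev_single)

lemma hom_id [simp]: "is_hom id" "is_hom (\<lambda>x. x)"
 by (simp_all add: is_hom_def)

text \<open>Dedekind's argument for the linear independence of characters.\<close>

lemma monomials_independent:
 fixes c :: "('v \<Rightarrow>\<^sub>0 nat) \<Rightarrow> 'a::field_char_0"
 assumes "finite A"
  and "\<And>x. (\<And>v. x v \<in> of_nat ` {1..}) \<Longrightarrow> (\<Sum>m\<in>A. c m * mon x m) = 0"
  and "m \<in> A"
 shows "c m = 0"
 using assms
proof (induction "card A" arbitrary: A c m rule: less_induct)
 case less
 have van: "(\<Sum>m\<in>A. c m * mon x m) = 0" if "\<And>v. x v \<in> of_nat ` {1..}" for x
  using less.prems(2) that by blast
 have shrink: "c m1 = 0" if m: "m1 \<in> A" "m2 \<in> A" "m1 \<noteq> m2" for m1 m2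
 proof -
  obtain v where v: "lookup m1 v \<noteq> lookup m2 v"
   using m(3) by (meson poly_mapping_eqI)
  define y where "y = (\<lambda>w. if w = v then 2 else 1 :: 'a)"
  have mony: "mon y m = 2 ^ lookup m v" for m
  proof -
   have "mon y m = (\<Prod>w\<in>insert v (keys m). if w = v then 2 ^ lookup m v else 1)"
    unfolding mon_superset[of "insert v (keys m)" m y, OF _ subset_insertI, simplified]
    by (rule prod.cong) (auto simp: y_def)
   also have "\<dots> = 2 ^ lookup m v" by (simp add: prod.delta)
   finally show ?thesis .
  qed
  define c' where "c' = (\<lambda>m. c m * (mon y m - mon y m2))"
  have "(\<Sum>m\<in>A - {m2}. c' m * mon x m) = 0" if x: "\<And>v. x v \<in> of_nat ` {1..}" for x
  proof -
   have y: "(x v * y v) \<in> of_nat ` {1..}" for v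
   proof -
    obtain n where "x v = of_nat n" "n \<ge> 1" using x[of v] by auto
    then show ?thesis
     by (cases "w = v") (auto simp: y_def image_iff intro!: bexI[of _ "if v = _ then 2 * n else n"])
   qed
   have "(\<Sum>m\<in>A - {m2}. c' m * mon x m) = (\<Sum>m\<in>A. c' m * mon x m)"
    using less.prems(1) by (intro sum.mono_neutral_left) (auto simp: c'_def)
   also have "\<dots> = (\<Sum>m\<in>A. c m * mon (\<lambda>v. x v * y v) m) - mon y m2 * (\<Sum>m\<in>A. c m * mon x m)"
    unfolding sum_distrib_left sum_subtractf[symmetric]
    by (rule sum.cong) (auto simp: c'_def mon_mult algebra_simps)
   also have "\<dots> = 0" using van[of "\<lambda>v. x v * y v"] van[of x] x y by simp
   finally show ?thesis .
  qed
  moreover have "card (A - {m2}) < card A" using m less.prems(1) by (intro psubset_card_mono) auto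
  ultimately have "c' m1 = 0" using less.hyps[of "A - {m2}" c' m1] m less.prems(1) by auto
  moreover have "mon y m1 \<noteq> mon y m2"
  proof
   assume "mon y m1 = mon y m2"
   then have "(of_nat (2 ^ lookup m1 v) :: 'a) = of_nat (2 ^ lookup m2 v)"
    by (simp add: mony)
   then have "(2::nat) ^ lookup m1 v = 2 ^ lookup m2 v"
    by (rule of_nat_eq_iff[THEN iffD1])
   then show False using v by simp
  qed
  ultimately show ?thesis by (simp add: c'_def)
 qed
 show ?case
 proof (cases "A = {m}")
  case True
  have "(\<Sum>m\<in>A. c m * mon (\<lambda>_. 1) m) = 0" by (rule van) (auto intro!: image_eqI[of _ _ 1])
  then show ?thesis using True by (simp add: mon_def)
 next
  case False
  then obtain m2 where "m2 \<in> A" "m2 \<noteq> m" using less.prems(3) by blast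
  then show ?thesis using shrink less.prems(3) by blast
 qed
qed

lemma polynomial_nonvanishing_point:
 fixes h :: "'b::comm_ring_1 \<Rightarrow> 'a::field_char_0"
 assumes "is_hom h" "\<And>c. h c = 0 \<Longrightarrow> c = 0" "p \<noteq> 0"
 shows "\<exists>x. (\<forall>v. x v \<in> of_nat ` {1..}) \<and> ev h x p \<noteq> 0"
proof (rule ccontr)
 assume a: "\<not> ?thesis"
 then have "h (lookup p m) = 0" if "m \<in> keys p" for m
  using monomials_independent[of "keys p" "\<lambda>m. h (lookup p m)" m] that
  by (auto simp: ev_def)
 then have "keys p = {}" using assms(2) by (fastforce simp: in_keys_iff)
 then show False using assms(3) by simp
qed

lemma form_eqI:
 fixes p q :: "('v \<Rightarrow>\<^sub>0 nat) \<Rightarrow>\<^sub>0 'a::field_char_0"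
 assumes "\<And>x. (\<And>v. x v \<in> of_nat ` {1..}) \<Longrightarrow> ev id x p = ev id x q"
 shows "p = q"
proof (rule ccontr)
 assume "p \<noteq> q"
 then have "p - q \<noteq> 0" by simp
 then obtain x where x: "\<forall>v. x v \<in> of_nat ` {1..}" "ev id x (p - q) \<noteq> 0"
  using polynomial_nonvanishing_point[of id "p - q"] by auto
 moreover have "ev id x (p - q) = ev id x p - ev id x q" by (rule hom_diff[OF ev_hom[OF hom_id(1)]])
 ultimately show False using assms[of x] by auto
qed

section \<open>Subfields and algebraic elements\<close>

lemma subfieldD:
 assumes "is_subfield L"
 shows "0 \<in> L" "1 \<in> L" "x \<in> L \<Longrightarrow> y \<in> L \<Longrightarrow> x + y \<in> L" "x \<in> L \<Longrightarrow> y \<in> L \<Longrightarrow> x * y \<in> L"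
  "x \<in> L \<Longrightarrow> - x \<in> L" "x \<in> L \<Longrightarrow> inverse x \<in> L"
 using assms by (auto simp: is_subfield_def)

lemma subfield_diff: "is_subfield L \<Longrightarrow> x \<in> L \<Longrightarrow> y \<in> L \<Longrightarrow> x - y \<in> L"
 using subfieldD(3)[of L x "- y"] subfieldD(5)[of L y] by simp

lemma subfield_divide: "is_subfield L \<Longrightarrow> x \<in> L \<Longrightarrow> y \<in> L \<Longrightarrow> x / y \<in> L"
 by (simp add: divide_inverse subfieldD)

lemma subfield_power: "is_subfield L \<Longrightarrow> x \<in> L \<Longrightarrow> x ^ n \<in> L"
 by (induction n) (auto simp: subfieldD)

lemma subfield_sum: "is_subfield L \<Longrightarrow> (\<And>a. a \<in> A \<Longrightarrow> f a \<in> L) \<Longrightarrow> sum f A \<in> L"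
 by (induction A rule: infinite_finite_induct) (auto simp: subfieldD)

lemma subfield_prod: "is_subfield L \<Longrightarrow> (\<And>a. a \<in> A \<Longrightarrow> f a \<in> L) \<Longrightarrow> prod f A \<in> L"
 by (induction A rule: infinite_finite_induct) (auto simp: subfieldD)

lemma subfield_of_nat: "is_subfield L \<Longrightarrow> of_nat n \<in> L"
 by (induction n) (auto simp: subfieldD)

lemma subfield_numeral: "is_subfield L \<Longrightarrow> numeral n \<in> L"
 using subfield_of_nat[of L "numeral n"] by simp

lemmas subfield_closed = subfieldD subfield_diff subfield_divide subfield_power subfield_sum
 subfield_prod subfield_of_nat subfield_numeral

lemma is_subfieldI:
 assumes "0 \<in> L" "1 \<in> L" "\<And>x y. x \<in> L \<Longrightarrow> y \<in> L \<Longrightarrow> x + y \<in> L"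
  "\<And>x y. x \<in> L \<Longrightarrow> y \<in> L \<Longrightarrow> x * y \<in> L" "\<And>x. x \<in> L \<Longrightarrow> - x \<in> L"
  "\<And>x. x \<in> L \<Longrightarrow> x \<noteq> 0 \<Longrightarrow> inverse x \<in> L"
 shows "is_subfield L"
proof -
 have "inverse x \<in> L" if "x \<in> L" for x
  using assms(1) assms(6)[OF that] by (cases "x = 0") auto
 then show ?thesis using assms by (auto simp: is_subfield_def)
qed

lemma subfield_UNIV: "is_subfield UNIV"
 by (simp add: is_subfield_def)

lemma subfield_adjoin: "is_subfield (adjoin k S)"
 by (auto simp: is_subfield_def adjoin_def)

lemma adjoin_base: "k \<subseteq> adjoin k S"
 by (auto simp: adjoin_def)

lemma adjoin_gen: "S \<subseteq> adjoin k S"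
 by (auto simp: adjoin_def)

lemma adjoin_least: "is_subfield L \<Longrightarrow> k \<subseteq> L \<Longrightarrow> S \<subseteq> L \<Longrightarrow> adjoin k S \<subseteq> L"
 by (auto simp: adjoin_def)

definition coeffs_in :: "'a::field set \<Rightarrow> 'a poly \<Rightarrow> bool" where
 "coeffs_in L p \<longleftrightarrow> (\<forall>i. coeff p i \<in> L)"

lemma coeffs_in_mult: "is_subfield L \<Longrightarrow> coeffs_in L p \<Longrightarrow> coeffs_in L q \<Longrightarrow> coeffs_in L (p * q)"
 by (simp add: coeffs_in_def coeff_mult subfield_closed)

lemma coeffs_in_add: "is_subfield L \<Longrightarrow> coeffs_in L p \<Longrightarrow> coeffs_in L q \<Longrightarrow> coeffs_in L (p + q)"
 by (simp add: coeffs_in_def subfield_closed)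

lemma coeffs_in_diff: "is_subfield L \<Longrightarrow> coeffs_in L p \<Longrightarrow> coeffs_in L q \<Longrightarrow> coeffs_in L (p - q)"
 by (simp add: coeffs_in_def subfield_closed)

lemma coeffs_in_0: "is_subfield L \<Longrightarrow> coeffs_in L 0"
 by (simp add: coeffs_in_def subfield_closed)

lemma coeffs_in_smult: "is_subfield L \<Longrightarrow> c \<in> L \<Longrightarrow> coeffs_in L p \<Longrightarrow> coeffs_in L (smult c p)"
 by (simp add: coeffs_in_def subfield_closed)

lemma coeffs_in_pderiv: "is_subfield L \<Longrightarrow> coeffs_in L p \<Longrightarrow> coeffs_in L (pderiv p)"
 using subfield_of_nat[of L "Suc _"] by (simp add: coeffs_in_def coeff_pderiv subfieldD)

lemma coeffs_in_monom: "is_subfield L \<Longrightarrow> c \<in> L \<Longrightarrow> coeffs_in L (Polynomial.monom c n)"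
 by (simp add: coeffs_in_def subfield_closed)

lemma division_over_subfield:
 assumes L: "is_subfield L" and g: "coeffs_in L g" "g \<noteq> 0" and f: "coeffs_in L f"
 shows "\<exists>q r. coeffs_in L q \<and> coeffs_in L r \<and> f = q * g + r \<and> (r = 0 \<or> degree r < degree g)"
 using f
proof (induction "if f = 0 then 0 else Suc (degree f)" arbitrary: f rule: less_induct)
 case less
 show ?case
 proof (cases "f = 0 \<or> degree f < degree g")
  case True
  then show ?thesis using less.prems L by (intro exI[of _ 0] exI[of _ f]) (auto simp: coeffs_in_0)
 next
  case False
  define h where "h = Polynomial.monom (lead_coeff f / lead_coeff g) (degree f - degree g)"
  have h: "coeffs_in L h"
   unfolding h_def using L less.prems g
   by (intro coeffs_in_monom subfield_closed) (auto simp: coeffs_in_def)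
  let ?f' = "f - h * g"
  have h0: "h \<noteq> 0" using False g by (simp add: h_def monom_eq_0_iff)
  have dh: "degree (h * g) = degree f"
   using False g h0 by (simp add: degree_mult_eq) (simp add: h_def degree_monom_eq)
  have lc: "coeff (h * g) (degree f) = lead_coeff f"
  proof -
   have "coeff (h * g) (degree h + degree g) = lead_coeff h * lead_coeff g" by (rule coeff_mult_degree_sum)
   moreover have "degree h + degree g = degree f" using dh h0 g by (simp add: degree_mult_eq)
   moreover have "lead_coeff h * lead_coeff g = lead_coeff f" using g False by (simp add: h_def degree_monom_eq)
   ultimately show ?thesis by simp
  qed
  have "?f' = 0 \<or> degree ?f' < degree f"
   by (rule eq_zero_or_degree_less) (use dh lc in \<open>auto intro: degree_diff_le\<close>)
  moreover have "coeffs_in L ?f'" using L less.prems h g by (intro coeffs_in_diff coeffs_in_mult)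
  ultimately obtain q r where "coeffs_in L q" "coeffs_in L r" "?f' = q * g + r" "r = 0 \<or> degree r < degree g"
   using less.hyps[of ?f'] False by (cases "?f' = 0") auto
  then show ?thesis using L h
   by (intro exI[of _ "q + h"] exI[of _ r]) (auto simp: algebra_simps coeffs_in_add)
 qed
qed

definition algebraic_over :: "'a::field set \<Rightarrow> 'a \<Rightarrow> bool" where
 "algebraic_over L x \<longleftrightarrow> (\<exists>p. p \<noteq> 0 \<and> coeffs_in L p \<and> poly p x = 0)"

lemma minimal_polynomial:
 assumes L: "is_subfield L" and x: "algebraic_over L x"
 obtains c where "coeffs_in L c" "lead_coeff c = 1" "poly c x = 0" "degree c > 0"
  "\<And>p. coeffs_in L p \<Longrightarrow> poly p x = 0 \<Longrightarrow> \<exists>r. coeffs_in L r \<and> p = c * r"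
  "\<And>p. coeffs_in L p \<Longrightarrow> poly p x = 0 \<Longrightarrow> p \<noteq> 0 \<Longrightarrow> degree c \<le> degree p"
proof -
 let ?P = "\<lambda>p. p \<noteq> 0 \<and> coeffs_in L p \<and> poly p x = 0"
 define b where "b = arg_min degree ?P"
 obtain p0 where "?P p0" using x by (auto simp: algebraic_over_def)
 then have b: "?P b" unfolding b_def by (rule arg_min_natI)
 have min: "degree b \<le> degree p" if "?P p" for p unfolding b_def using that by (rule arg_min_nat_le)
 define c where "c = smult (inverse (lead_coeff b)) b"
 have cL: "coeffs_in L c" unfolding c_def using L b by (intro coeffs_in_smult subfieldD) (auto simp: coeffs_in_def)
 have c1: "lead_coeff c = 1" using b by (simp add: c_def)
 have c0: "poly c x = 0" using b by (simp add: c_def)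
 have dc: "degree c = degree b" using b by (simp add: c_def)
 have "degree c > 0"
 proof (rule ccontr)
  assume "\<not> degree c > 0"
  then obtain a where "c = [:a:]" by (metis degree_eq_zeroE gr_zeroI)
  then show False using c0 c1 by simp
 qed
 moreover have "\<exists>r. coeffs_in L r \<and> p = c * r" if p: "coeffs_in L p" "poly p x = 0" for p
 proof -
  have "c \<noteq> 0" using c1 by auto
  from division_over_subfield[OF L cL this p(1)] obtain q r where qr:
   "coeffs_in L q" "coeffs_in L r" "p = q * c + r" "r = 0 \<or> degree r < degree c" by blast
  have "poly r x = 0" using qr(3) p(2) c0 by simp
  then have "r = 0" using min[of r] qr dc by (cases "r = 0") auto
  then show ?thesis using qr by (intro exI[of _ q]) (simp add: mult.commute)
 qed
 ultimately show ?thesis using that[of c] cL c1 c0 dc min by auto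
qed

section \<open>Derivations\<close>

definition derivation :: "('a::field \<Rightarrow> 'a) \<Rightarrow> bool" where
 "derivation d \<longleftrightarrow> (\<forall>x y. d (x + y) = d x + d y \<and> d (x * y) = x * d y + d x * y)"

lemma derivationD:
 assumes "derivation d"
 shows "d (x + y) = d x + d y" "d (x * y) = x * d y + d x * y"
 using assms by (auto simp: derivation_def)

lemma derivation_0: assumes "derivation d" shows "d 0 = 0"
 by (metis derivationD(1)[OF assms] add_0 add_cancel_right_right)

lemma derivation_1: assumes "derivation d" shows "d 1 = 0"
 by (metis derivationD(2)[OF assms] mult_1 mult_1_right add_cancel_right_right)

lemma derivation_uminus: assumes "derivation d" shows "d (- x) = - d x"
proof -
 have "d (-x) + d x = 0" using derivationD(1)[OF assms, of "-x" x] by (simp add: derivation_0[OF assms])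
 then show ?thesis by (simp add: eq_neg_iff_add_eq_0)
qed

lemma derivation_diff: assumes "derivation d" shows "d (x - y) = d x - d y"
 using derivationD(1)[OF assms, of x "-y"] by (simp add: derivation_uminus[OF assms])

lemma derivation_inverse: assumes "derivation d" "x \<noteq> 0" shows "d (inverse x) = - d x / (x * x)"
proof -
 have "x * d (inverse x) + d x * inverse x = 0"
  using derivationD(2)[OF assms(1), of x "inverse x"] assms(2) by (simp add: derivation_1[OF assms(1)])
 then have "x * d (inverse x) = - (d x * inverse x)" by (simp add: eq_neg_iff_add_eq_0)
 then show ?thesis using assms(2) by (simp add: field_simps)
qed

lemma derivation_sum: assumes "derivation d" shows "d (sum f A) = (\<Sum>a\<in>A. d (f a))"
 by (induction A rule: infinite_finite_induct)
  (simp_all add: derivation_0[OF assms] derivationD[OF assms])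

lemma derivation_kernel: assumes "derivation d" shows "is_subfield {x. d x = 0}"
 by (rule is_subfieldI)
  (auto simp: derivation_0[OF assms] derivation_1[OF assms] derivationD[OF assms]
   derivation_uminus[OF assms] derivation_inverse[OF assms])

lemma derivation_adjoin:
 assumes "derivation d" "\<And>x. x \<in> k \<Longrightarrow> d x = 0" "\<And>x. x \<in> S \<Longrightarrow> d x = 0" "x \<in> adjoin k S"
 shows "d x = 0"
 using adjoin_least[OF derivation_kernel[OF assms(1)], of k S] assms by auto

lemma derivation_of_nat: assumes "derivation d" shows "d (of_nat n) = 0"
 using subfield_of_nat[OF derivation_kernel[OF assms]] by simp

lemma derivation_combination:
 assumes "\<And>i. i \<in> I \<Longrightarrow> derivation (d i)"
 shows "derivation (\<lambda>x. \<Sum>i\<in>I. c i * d i x)"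
proof -
 have "(\<Sum>i\<in>I. c i * d i (x * y)) = x * (\<Sum>i\<in>I. c i * d i y) + (\<Sum>i\<in>I. c i * d i x) * y" for x y
  unfolding sum_distrib_left sum_distrib_right sum.distrib[symmetric]
  by (rule sum.cong) (auto simp: derivationD[OF assms] algebra_simps)
 moreover have "(\<Sum>i\<in>I. c i * d i (x + y)) = (\<Sum>i\<in>I. c i * d i x) + (\<Sum>i\<in>I. c i * d i y)" for x y
  unfolding sum.distrib[symmetric]
  by (rule sum.cong) (auto simp: derivationD[OF assms] algebra_simps)
 ultimately show ?thesis by (simp add: derivation_def)
qed

lemma derivation_power: assumes "derivation d" shows "d (x ^ n) = of_nat n * x ^ (n - 1) * d x"
proof (induction n)
 case 0 then show ?case by (simp add: derivation_1[OF assms])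
next
 case (Suc n)
 then show ?case by (cases n) (simp_all add: derivationD[OF assms] algebra_simps)
qed

lemma derivation_poly:
 assumes d: "derivation d" and "\<And>i. d (coeff p i) = 0"
 shows "d (poly p x) = poly (pderiv p) x * d x"
 using assms(2)
proof (induction p)
 case 0 then show ?case by (simp add: derivation_0[OF d])
next
 case (pCons a p)
 have "d a = 0" using pCons.prems[of 0] by simp
 moreover have "d (coeff p i) = 0" for i using pCons.prems[of "Suc i"] by simp
 ultimately show ?case using pCons.IH
  by (simp add: derivationD[OF d] pderiv_pCons algebra_simps)
qed

lemma derivation_algebraic:
 fixes x :: "'a::field_char_0"
 assumes d: "derivation d" "\<And>x. x \<in> L \<Longrightarrow> d x = 0" and L: "is_subfield L" and x: "algebraic_over L x"
 shows "d x = 0"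
proof -
 obtain c where c: "coeffs_in L c" "lead_coeff c = 1" "poly c x = 0" "degree c > 0"
  "\<And>p. coeffs_in L p \<Longrightarrow> poly p x = 0 \<Longrightarrow> p \<noteq> 0 \<Longrightarrow> degree c \<le> degree p"
  using minimal_polynomial[OF L x] by metis
 have "poly (pderiv c) x \<noteq> 0"
  using c(5)[of "pderiv c"] coeffs_in_pderiv[OF L c(1)] c(4)
  by (auto simp: degree_pderiv pderiv_eq_0_iff)
 moreover have "poly (pderiv c) x * d x = 0"
  using derivation_poly[OF d(1), of c x] c(1,3) d(2) by (auto simp: coeffs_in_def derivation_0[OF d(1)])
 ultimately show ?thesis by simp
qed

text \<open>The graph of a derivation defined on the subfield \<open>Domain G\<close>. Written as a set of pairs it is a subfield of
 the dual numbers that meets the multiples of \<open>\<epsilon>\<close> only in 0; this form makes unions of chains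
 immediate.\<close>

definition partial_derivation :: "('a::field \<times> 'a) set \<Rightarrow> bool" where
 "partial_derivation G \<longleftrightarrow>
   (1, 0) \<in> G \<and>
   (\<forall>a a' b b'. (a, a') \<in> G \<longrightarrow> (b, b') \<in> G \<longrightarrow>
    (a + b, a' + b') \<in> G \<and> (a * b, a * b' + a' * b) \<in> G) \<and>
   (\<forall>a a'. (a, a') \<in> G \<longrightarrow> (- a, - a') \<in> G \<and> (a \<noteq> 0 \<longrightarrow> (inverse a, - a' / (a * a)) \<in> G)) \<and>
   (\<forall>w. (0, w) \<in> G \<longrightarrow> w = 0)"

lemma partial_derivationD:
 assumes "partial_derivation G"
 shows "(1, 0) \<in> G" "(0, 0) \<in> G"
  "(a, a') \<in> G \<Longrightarrow> (b, b') \<in> G \<Longrightarrow> (a + b, a' + b') \<in> G"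
  "(a, a') \<in> G \<Longrightarrow> (b, b') \<in> G \<Longrightarrow> (a * b, a * b' + a' * b) \<in> G"
  "(a, a') \<in> G \<Longrightarrow> (- a, - a') \<in> G"
  "(a, a') \<in> G \<Longrightarrow> a \<noteq> 0 \<Longrightarrow> (inverse a, - a' / (a * a)) \<in> G"
  "(0, w) \<in> G \<Longrightarrow> w = 0"
proof -
 have neg: "(- a, - a') \<in> G" if "(a, a') \<in> G" for a a'
  using assms that unfolding partial_derivation_def by meson
 have add: "(a + b, a' + b') \<in> G" "(a * b, a * b' + a' * b) \<in> G"
  if "(a, a') \<in> G" "(b, b') \<in> G" for a a' b b'
  using assms that unfolding partial_derivation_def by meson+
 show one: "(1, 0) \<in> G" using assms unfolding partial_derivation_def by meson
 show "(0, 0) \<in> G" using add(1)[OF one neg[OF one]] by simp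
 show "(a, a') \<in> G \<Longrightarrow> (b, b') \<in> G \<Longrightarrow> (a + b, a' + b') \<in> G" by (rule add(1))
 show "(a, a') \<in> G \<Longrightarrow> (b, b') \<in> G \<Longrightarrow> (a * b, a * b' + a' * b) \<in> G" by (rule add(2))
 show "(a, a') \<in> G \<Longrightarrow> (- a, - a') \<in> G" by (rule neg)
 show "(a, a') \<in> G \<Longrightarrow> a \<noteq> 0 \<Longrightarrow> (inverse a, - a' / (a * a)) \<in> G"
  using assms unfolding partial_derivation_def by meson
 show "(0, w) \<in> G \<Longrightarrow> w = 0"
  using assms unfolding partial_derivation_def by meson
qed

lemma partial_derivation_single_valued:
 assumes G: "partial_derivation G" and "(a, b) \<in> G" "(a, b') \<in> G"
 shows "b = b'"
proof -
 have "(a + - a, b + - b') \<in> G" using partial_derivationD(3,5)[OF G] assms(2,3) by blast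
 then show ?thesis using partial_derivationD(7)[OF G, of "b + - b'"] by simp
qed

lemma partial_derivation_domain: assumes G: "partial_derivation G" shows "is_subfield (Domain G)"
proof (rule is_subfieldI)
 show "0 \<in> Domain G" "1 \<in> Domain G" using partial_derivationD(1,2)[OF G] by (auto intro: DomainI)
 show "x + y \<in> Domain G" "x * y \<in> Domain G" if "x \<in> Domain G" "y \<in> Domain G" for x y
  using that partial_derivationD(3,4)[OF G] by (meson Domain_iff)+
 show "- x \<in> Domain G" if "x \<in> Domain G" for x
  using that partial_derivationD(5)[OF G] by (meson Domain_iff)
 show "inverse x \<in> Domain G" if "x \<in> Domain G" "x \<noteq> 0" for x
  using that partial_derivationD(6)[OF G] by (meson Domain_iff)
qed

lemma partial_derivation_sum:
 assumes G: "partial_derivation G" and "\<And>i. i \<in> I \<Longrightarrow> (f i, g i) \<in> G"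
 shows "(sum f I, sum g I) \<in> G"
 using assms(2)
proof (induction I rule: infinite_finite_induct)
 case (insert i I)
 then have "(f i + sum f I, g i + sum g I) \<in> G" by (intro partial_derivationD(3)[OF G]) auto
 then show ?case using insert.hyps by simp
qed (simp_all add: partial_derivationD(2)[OF G])

text \<open>The image of a polynomial under the derivation; a relation, as \<open>G\<close> is one.\<close>

definition coeffwise :: "('a::field \<times> 'a) set \<Rightarrow> 'a poly \<Rightarrow> 'a poly \<Rightarrow> bool" where
 "coeffwise G p p' \<longleftrightarrow> (\<forall>i. (coeff p i, coeff p' i) \<in> G)"

lemma coeffwise_mult:
 assumes G: "partial_derivation G" and "coeffwise G p p'" "coeffwise G q q'"
 shows "coeffwise G (p * q) (p * q' + p' * q)"
 unfolding coeffwise_def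
proof
 fix n
 have "(\<Sum>i\<le>n. coeff p i * coeff q (n - i),
   \<Sum>i\<le>n. coeff p i * coeff q' (n - i) + coeff p' i * coeff q (n - i)) \<in> G"
  using assms by (intro partial_derivation_sum partial_derivationD(4)) (auto simp: coeffwise_def)
 then show "(coeff (p * q) n, coeff (p * q' + p' * q) n) \<in> G"
  by (simp add: coeff_mult sum.distrib)
qed

lemma coeffwise_exists:
 assumes G: "partial_derivation G" and "coeffs_in (Domain G) p"
 shows "\<exists>p'. coeffwise G p p'"
 using assms(2)
proof (induction p)
 case 0 then show ?case by (intro exI[of _ 0]) (simp add: coeffwise_def partial_derivationD(2)[OF G])
next
 case (pCons a p)
 have "coeffs_in (Domain G) p"
  unfolding coeffs_in_def
 proof
  fix i show "coeff p i \<in> Domain G" using pCons.prems[unfolded coeffs_in_def, rule_format, of "Suc i"] by simp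
 qed
 then obtain p' where p': "coeffwise G p p'" using pCons.IH by blast
 have "a \<in> Domain G" using pCons.prems[unfolded coeffs_in_def, rule_format, of 0] by simp
 then obtain a' where "(a, a') \<in> G" by blast
 then have "coeffwise G (pCons a p) (pCons a' p')"
  using p' by (auto simp: coeffwise_def coeff_pCons split: nat.splits)
 then show ?case by blast
qed

lemma coeffwise_unique:
 assumes G: "partial_derivation G" and "coeffwise G p q" "coeffwise G p q'"
 shows "q = q'"
proof (rule poly_eqI)
 fix n show "coeff q n = coeff q' n"
  by (rule partial_derivation_single_valued[OF G, of "coeff p n"]) (use assms in \<open>auto simp: coeffwise_def\<close>)
qed

text \<open>One-step extension to \<open>Domain G(y)\<close>: the value \<open>w\<close> at \<open>y\<close> is free if \<open>y\<close> is transcendental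
 and forced by the minimal polynomial otherwise, whose derivative at \<open>y\<close> is not zero in
 characteristic zero.\<close>

lemma partial_derivation_extend:
 fixes y :: "'a::field_char_0"
 assumes G: "partial_derivation G"
 shows "\<exists>w G'. partial_derivation G' \<and> G \<subseteq> G' \<and> (y, w) \<in> G' \<and>
  (\<not> algebraic_over (Domain G) y \<longrightarrow> w = 1)"
proof -
 define M where "M = Domain G"
 have M: "is_subfield M" unfolding M_def by (rule partial_derivation_domain[OF G])
 have coeffwise_M: "coeffs_in M p" if "coeffwise G p p'" for p p'
  using that by (auto simp: coeffwise_def coeffs_in_def M_def)
 have "\<exists>w. (\<forall>p p'. coeffwise G p p' \<longrightarrow> poly p y = 0 \<longrightarrow> poly p' y + poly (pderiv p) y * w = 0) \<and>
   (\<not> algebraic_over M y \<longrightarrow> w = 1)"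
 proof (cases "algebraic_over M y")
  case False
  have "poly p' y + poly (pderiv p) y * 1 = 0" if "coeffwise G p p'" "poly p y = 0" for p p'
  proof -
   have "p = 0" using False that coeffwise_M by (auto simp: algebraic_over_def)
   moreover have "coeffwise G 0 0" by (simp add: coeffwise_def partial_derivationD(2)[OF G])
   ultimately have "p' = 0" using coeffwise_unique[OF G] that by blast
   then show ?thesis using \<open>p = 0\<close> by simp
  qed
  then show ?thesis by blast
 next
  case True
  obtain c where c: "coeffs_in M c" "lead_coeff c = 1" "poly c y = 0" "degree c > 0"
   "\<And>p. coeffs_in M p \<Longrightarrow> poly p y = 0 \<Longrightarrow> \<exists>r. coeffs_in M r \<and> p = c * r"
   "\<And>p. coeffs_in M p \<Longrightarrow> poly p y = 0 \<Longrightarrow> p \<noteq> 0 \<Longrightarrow> degree c \<le> degree p"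
   using minimal_polynomial[OF M True] by metis
  have nz: "poly (pderiv c) y \<noteq> 0"
   using c(6)[of "pderiv c"] coeffs_in_pderiv[OF M c(1)] c(4)
   by (auto simp: degree_pderiv pderiv_eq_0_iff)
  obtain c' where c': "coeffwise G c c'" using coeffwise_exists[OF G] c(1) by (auto simp: M_def)
  define w where "w = - poly c' y / poly (pderiv c) y"
  have w: "poly c' y + poly (pderiv c) y * w = 0" using nz by (simp add: w_def)
  have "poly p' y + poly (pderiv p) y * w = 0" if p: "coeffwise G p p'" "poly p y = 0" for p p'
  proof -
   obtain r where r: "coeffs_in M r" "p = c * r" using c(5)[of p] coeffwise_M p by blast
   obtain r' where r': "coeffwise G r r'" using coeffwise_exists[OF G] r(1) by (auto simp: M_def)
   have p': "p' = c * r' + c' * r"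
    using coeffwise_unique[OF G p(1)] coeffwise_mult[OF G c' r'] r(2) by blast
   have "poly p' y + poly (pderiv p) y * w = (poly c' y + poly (pderiv c) y * w) * poly r y"
    by (simp add: p' r(2) pderiv_mult c(3) algebra_simps)
   then show ?thesis by (simp add: w)
  qed
  then show ?thesis using True by blast
 qed
 then obtain w where w: "\<And>p p'. coeffwise G p p' \<Longrightarrow> poly p y = 0 \<Longrightarrow> poly p' y + poly (pderiv p) y * w = 0"
  and w1: "\<not> algebraic_over M y \<longrightarrow> w = 1" by blast
 \<comment> \<open>the graph on the ring generated by \<open>y\<close>; \<open>G'\<close> adds the quotients\<close>
 define R where "R = {(poly p y, poly p' y + poly (pderiv p) y * w) | p p'. coeffwise G p p'}"
 have R0: "b = 0" if "(0, b) \<in> R" for b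
 proof -
  from that obtain p p' where "coeffwise G p p'" "0 = poly p y" "b = poly p' y + poly (pderiv p) y * w"
   unfolding R_def by auto
  then show ?thesis using w[of p p'] by metis
 qed
 have Radd: "(a + b, a' + b') \<in> R" if "(a, a') \<in> R" "(b, b') \<in> R" for a a' b b'
 proof -
  from that obtain p p' q q' where pq: "coeffwise G p p'" "coeffwise G q q'"
   "a = poly p y" "a' = poly p' y + poly (pderiv p) y * w" "b = poly q y" "b' = poly q' y + poly (pderiv q) y * w"
   by (auto simp: R_def)
  have "coeffwise G (p + q) (p' + q')"
   using pq(1,2) unfolding coeffwise_def coeff_add by (intro allI partial_derivationD(3)[OF G]) auto
  then show ?thesis unfolding R_def using pq(3-)
   by (intro CollectI exI[of _ "p + q"] exI[of _ "p' + q'"]) (simp add: pderiv_add algebra_simps)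
 qed
 have Rmult: "(a * b, a * b' + a' * b) \<in> R" if "(a, a') \<in> R" "(b, b') \<in> R" for a a' b b'
 proof -
  from that obtain p p' q q' where pq: "coeffwise G p p'" "coeffwise G q q'"
   "a = poly p y" "a' = poly p' y + poly (pderiv p) y * w" "b = poly q y" "b' = poly q' y + poly (pderiv q) y * w"
   by (auto simp: R_def)
  show ?thesis unfolding R_def using pq(3-) coeffwise_mult[OF G pq(1,2)]
   by (intro CollectI exI[of _ "p * q"] exI[of _ "p * q' + p' * q"]) (simp add: pderiv_mult algebra_simps)
 qed
 have Rneg: "(- a, - a') \<in> R" if "(a, a') \<in> R" for a a'
 proof -
  from that obtain p p' where p: "coeffwise G p p'" "a = poly p y" "a' = poly p' y + poly (pderiv p) y * w"
   by (auto simp: R_def)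
  have "coeffwise G (- p) (- p')"
   using p(1) unfolding coeffwise_def coeff_minus by (intro allI partial_derivationD(5)[OF G]) auto
  then show ?thesis unfolding R_def using p(2-)
   by (intro CollectI exI[of _ "- p"] exI[of _ "- p'"]) (simp add: pderiv_minus)
 qed
 have RG: "(a, a') \<in> R" if "(a, a') \<in> G" for a a'
 proof -
  have "coeffwise G [:a:] [:a':]"
   using that by (auto simp: coeffwise_def coeff_pCons partial_derivationD(1,2)[OF G] split: nat.splits)
  then show ?thesis unfolding R_def
   by (intro CollectI exI[of _ "[:a:]"] exI[of _ "[:a':]"]) (simp add: pderiv_pCons)
 qed
 have Ry: "(y, w) \<in> R"
 proof -
  have "coeffwise G [:0, 1:] 0"
   by (auto simp: coeffwise_def coeff_pCons partial_derivationD(1,2)[OF G] split: nat.splits)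
  then show ?thesis unfolding R_def
   by (intro CollectI exI[of _ "[:0, 1:]"] exI[of _ 0]) (simp add: pderiv_pCons)
 qed
 define G' where "G' = {(a / b, (a' * b - a * b') / (b * b)) | a a' b b'. (a, a') \<in> R \<and> (b, b') \<in> R \<and> b \<noteq> 0}"
 have G'I: "(u, v) \<in> G'" if "(a, a') \<in> R" "(b, b') \<in> R" "b \<noteq> 0" "u = a / b" "v = (a' * b - a * b') / (b * b)"
  for a a' b b' u v using that by (auto simp: G'_def)
 have G'E: "\<exists>a a' b b'. (a, a') \<in> R \<and> (b, b') \<in> R \<and> b \<noteq> 0 \<and> u = a / b \<and> v = (a' * b - a * b') / (b * b)"
  if "(u, v) \<in> G'" for u v using that unfolding G'_def by auto
 have RG': "(a, a') \<in> G'" if "(a, a') \<in> R" for a a'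
  by (rule G'I[OF that RG[OF partial_derivationD(1)[OF G]]]) auto
 have "partial_derivation G'"
  unfolding partial_derivation_def
 proof (intro conjI allI impI)
  show "(1, 0) \<in> G'" using RG' RG partial_derivationD(1)[OF G] by blast
 next
  fix a a' b b' assume a: "(a, a') \<in> G'" and b: "(b, b') \<in> G'"
  obtain p p' q q' where *: "(p, p') \<in> R" "(q, q') \<in> R" "q \<noteq> 0" "a = p / q" "a' = (p' * q - p * q') / (q * q)"
   using G'E[OF a] by (elim exE conjE)
  obtain r r' s s' where **: "(r, r') \<in> R" "(s, s') \<in> R" "s \<noteq> 0" "b = r / s" "b' = (r' * s - r * s') / (s * s)"
   using G'E[OF b] by (elim exE conjE)
  have 1: "(p * s + r * q, (p * s' + p' * s) + (r * q' + r' * q)) \<in> R"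
   by (intro Radd Rmult *(1,2) **(1,2))
  have 2: "(q * s, q * s' + q' * s) \<in> R" "(p * r, p * r' + p' * r) \<in> R"
   by (intro Rmult *(1,2) **(1,2))+
  have qs: "q * s \<noteq> 0" using *(3) **(3) by simp
  have e1: "p / q + r / s = (p * s + r * q) / (q * s)" "p / q * (r / s) = p * r / (q * s)"
   using *(3) **(3) by (simp_all add: add_frac_eq)
  have e2: "(p' * q - p * q') / (q * q) + (r' * s - r * s') / (s * s)
    = ((p * s' + p' * s + (r * q' + r' * q)) * (q * s) - (p * s + r * q) * (q * s' + q' * s)) / (q * s * (q * s))"
   using *(3) **(3) by (simp add: divide_simps) (simp add: algebra_simps)
  have e3: "p / q * ((r' * s - r * s') / (s * s)) + (p' * q - p * q') / (q * q) * (r / s)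
    = ((p * r' + p' * r) * (q * s) - p * r * (q * s' + q' * s)) / (q * s * (q * s))"
   using *(3) **(3) by (simp add: divide_simps) (simp add: algebra_simps)
  show "(a + b, a' + b') \<in> G'"
   unfolding *(4,5) **(4,5) by (rule G'I[OF 1 2(1) qs e1(1) e2])
  show "(a * b, a * b' + a' * b) \<in> G'"
   unfolding *(4,5) **(4,5) by (rule G'I[OF 2(2) 2(1) qs e1(2) e3])
 next
  fix a a' assume a: "(a, a') \<in> G'"
  obtain p p' q q' where *: "(p, p') \<in> R" "(q, q') \<in> R" "q \<noteq> 0" "a = p / q" "a' = (p' * q - p * q') / (q * q)"
   using G'E[OF a] by (elim exE conjE)
  have "- (p / q) = - p / q" "- ((p' * q - p * q') / (q * q)) = (- p' * q - - p * q') / (q * q)"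
   by (rule minus_divide_left, subst minus_divide_left, simp)
  then show "(- a, - a') \<in> G'"
   unfolding *(4,5) by (rule G'I[OF Rneg[OF *(1)] *(2,3)])
  show "(inverse a, - a' / (a * a)) \<in> G'" if "a \<noteq> 0"
  proof (rule G'I[OF *(2,1)])
   show "p \<noteq> 0" using that *(4) by auto
   then have "- (x / (q * q)) / (p / q * (p / q)) = (- x) / (p * p)" for x
    using *(3) by simp
   from this[of "p' * q - p * q'"] show "- a' / (a * a) = (q' * p - q * p') / (p * p)"
    unfolding *(4,5) by (simp add: mult.commute)
   show "inverse a = q / p" unfolding *(4) by simp
  qed
 next
  fix v assume v: "(0, v) \<in> G'"
  obtain a a' b b' where *: "(a, a') \<in> R" "(b, b') \<in> R" "b \<noteq> 0" "0 = a / b" "v = (a' * b - a * b') / (b * b)"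
   using G'E[OF v] by (elim exE conjE)
  then have "a = 0" by simp
  then show "v = 0" using R0[of a'] * by simp
 qed
 moreover have "G \<subseteq> G'" using RG RG' by auto
 moreover note RG'[OF Ry] w1[unfolded M_def]
 ultimately have "partial_derivation G' \<and> G \<subseteq> G' \<and> (y, w) \<in> G' \<and>
  (\<not> algebraic_over (Domain G) y \<longrightarrow> w = 1)" by (simp only: simp_thms)
 then show ?thesis by (intro exI)
qed

lemma partial_derivation_total:
 fixes G :: "('a::field_char_0 \<times> 'a) set"
 assumes G: "partial_derivation G"
 shows "\<exists>d. derivation d \<and> (\<forall>(a, a')\<in>G. d a = a')"
proof -
 let ?A = "{H. partial_derivation H \<and> G \<subseteq> H}"
 have "\<Union>C \<in> ?A" if C: "C \<noteq> {}" "subset.chain ?A C" for C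
 proof -
  have sub: "\<And>H. H \<in> C \<Longrightarrow> partial_derivation H \<and> G \<subseteq> H" using C(2) by (auto simp: subset.chain_def)
  have two: "\<exists>H\<in>C. s \<in> H \<and> t \<in> H" if st: "s \<in> \<Union>C" "t \<in> \<Union>C" for s t
  proof -
   obtain X Y where "X \<in> C" "Y \<in> C" "s \<in> X" "t \<in> Y" using st by blast
   moreover from this have "X \<subseteq> Y \<or> Y \<subseteq> X" using C(2) unfolding subset.chain_def by blast
   ultimately show ?thesis by blast
  qed
  have "partial_derivation (\<Union>C)"
   unfolding partial_derivation_def
  proof (intro conjI allI impI)
   obtain H where "H \<in> C" using C(1) by blast
   then show "(1, 0) \<in> \<Union>C" using sub[of H] partial_derivationD(1)[of H] by blast
  next
   fix a a' b b' assume "(a, a') \<in> \<Union>C" "(b, b') \<in> \<Union>C"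
   from two[OF this] obtain H where H: "H \<in> C" "(a, a') \<in> H" "(b, b') \<in> H" by (elim bexE conjE)
   have pd: "partial_derivation H" using sub[OF H(1)] by simp
   show "(a + b, a' + b') \<in> \<Union>C" "(a * b, a * b' + a' * b) \<in> \<Union>C"
    by (rule UnionI[OF H(1)], rule partial_derivationD(3)[OF pd H(2,3)])
     (rule UnionI[OF H(1)], rule partial_derivationD(4)[OF pd H(2,3)])
  next
   fix a a' assume "(a, a') \<in> \<Union>C"
   then obtain H where H: "H \<in> C" "(a, a') \<in> H" by (elim UnionE)
   have pd: "partial_derivation H" using sub[OF H(1)] by simp
   show "(- a, - a') \<in> \<Union>C" by (rule UnionI[OF H(1)], rule partial_derivationD(5)[OF pd H(2)])
   show "(inverse a, - a' / (a * a)) \<in> \<Union>C" if "a \<noteq> 0"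
    by (rule UnionI[OF H(1)], rule partial_derivationD(6)[OF pd H(2) that])
  next
   fix w assume "(0, w) \<in> \<Union>C"
   then obtain H where H: "H \<in> C" "(0, w) \<in> H" by (elim UnionE)
   then show "w = 0" using sub[OF H(1)] partial_derivationD(7)[of H w] by simp
  qed
  then show ?thesis using C(1) sub by blast
 qed
 note chain = this
 have "?A \<noteq> {}" using G by blast
 then have "\<exists>H\<in>?A. \<forall>X\<in>?A. H \<subseteq> X \<longrightarrow> X = H"
  by (rule subset_Zorn_nonempty) (rule chain)
 then obtain H where H': "H \<in> ?A" "\<forall>X\<in>?A. H \<subseteq> X \<longrightarrow> X = H" by (elim bexE)
 have H: "partial_derivation H" "G \<subseteq> H" using H'(1) by auto
 have max: "K = H" if "partial_derivation K" "H \<subseteq> K" for K using H'(2) H(2) that by auto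
 have dom: "\<exists>w. (y, w) \<in> H" for y
 proof -
  from partial_derivation_extend[OF H(1), of y] obtain w G' where "partial_derivation G'" "H \<subseteq> G'" "(y, w) \<in> G'"
   by (elim exE conjE)
  then show ?thesis using max[of G'] by auto
 qed
 define d where "d y = (THE w. (y, w) \<in> H)" for y
 have d: "(y, w) \<in> H \<longleftrightarrow> d y = w" for y w
 proof -
  obtain v where v: "(y, v) \<in> H" using dom by blast
  have "(THE w. (y, w) \<in> H) = v"
  proof (rule the_equality)
   show "(y, v) \<in> H" by (rule v)
   show "w = v" if "(y, w) \<in> H" for w by (rule partial_derivation_single_valued[OF H(1) that v])
  qed
  then have dv: "d y = v" by (simp only: d_def)
  show ?thesis
  proof
   assume "(y, w) \<in> H"
   from partial_derivation_single_valued[OF H(1) v this] show "d y = w" using dv by simp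
  next
   assume "d y = w" then show "(y, w) \<in> H" using v dv by simp
  qed
 qed
 have "derivation d"
  unfolding derivation_def
 proof (intro allI conjI)
  fix x y
  have "(x, d x) \<in> H" "(y, d y) \<in> H" using d by auto
  from partial_derivationD(3,4)[OF H(1) this] show "d (x + y) = d x + d y" "d (x * y) = x * d y + d x * y"
   using d by auto
 qed
 then show ?thesis using d H(2) by blast
qed

text \<open>At a transcendental element the value 1 can be prescribed, and by Zorn's lemma every partial
 derivation extends to the whole field.\<close>

lemma transcendental_derivation:
 fixes x :: "'a::field_char_0"
 assumes L: "is_subfield L" and x: "\<not> algebraic_over L x"
 obtains d where "derivation d" "\<And>y. y \<in> L \<Longrightarrow> d y = 0" "d x = 1"
proof -
 let ?G = "L \<times> {0::'a}"
 have G: "partial_derivation ?G"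
  unfolding partial_derivation_def by (auto simp: subfield_closed[OF L])
 have "Domain ?G = L" by auto
 then obtain G' where G': "partial_derivation G'" "?G \<subseteq> G'" "(x, 1) \<in> G'"
  using partial_derivation_extend[OF G, of x] x by auto
 obtain d where d: "derivation d" "\<forall>(a, a')\<in>G'. d a = a'"
  using partial_derivation_total[OF G'(1)] by (elim exE conjE)
 show ?thesis
 proof (rule that[OF d(1)])
  show "d x = 1" using bspec[OF d(2) G'(3)] by simp
  fix y assume "y \<in> L"
  then have "(y, 0) \<in> G'" using G'(2) by blast
  from bspec[OF d(2) this] show "d y = 0" by simp
 qed
qed

section \<open>Transcendence degree\<close>

definition poly_over :: "'a::field set \<Rightarrow> 'v set \<Rightarrow> (('v \<Rightarrow>\<^sub>0 nat) \<Rightarrow>\<^sub>0 'a) \<Rightarrow> bool" where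
 "poly_over k S p \<longleftrightarrow> (\<forall>m\<in>keys p. lookup p m \<in> k \<and> keys m \<subseteq> S)"

lemma alg_independent_iff:
 "alg_independent k S \<longleftrightarrow> (\<forall>p. poly_over k S p \<longrightarrow> ev id id p = 0 \<longrightarrow> p = 0)"
 by (simp add: alg_independent_def poly_over_def ev_def mon_def)

lemma poly_over_lookup: "is_subfield k \<Longrightarrow> poly_over k S p \<Longrightarrow> lookup p m \<in> k"
 by (cases "m \<in> keys p") (auto simp: poly_over_def in_keys_iff subfield_closed)

lemma poly_over_single:
 "is_subfield k \<Longrightarrow> c \<in> k \<Longrightarrow> keys m \<subseteq> S \<Longrightarrow> poly_over k S (single m c)"
 by (auto simp: poly_over_def lookup_single when_def split: if_splits)

lemma poly_over_add:
 assumes "is_subfield k" "poly_over k S p" "poly_over k S q" shows "poly_over k S (p + q)"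
 unfolding poly_over_def
proof (intro ballI conjI)
 fix m assume m: "m \<in> keys (p + q)"
 show "lookup (p + q) m \<in> k"
  using assms by (simp add: lookup_add poly_over_lookup subfield_closed)
 show "keys m \<subseteq> S"
  using m Poly_Mapping.keys_add[of p q] assms(2,3) by (auto simp: poly_over_def)
qed

lemma poly_over_sum:
 assumes "is_subfield k" "\<And>i. i \<in> I \<Longrightarrow> poly_over k S (f i)" shows "poly_over k S (sum f I)"
 using assms(2) by (induction I rule: infinite_finite_induct)
  (auto simp: poly_over_add[OF assms(1)] poly_over_def[of k S 0])

lemma poly_over_mult:
 assumes k: "is_subfield k" and p: "poly_over k S p" and q: "poly_over k S q" shows "poly_over k S (p * q)"
proof -
 have "p * q = (\<Sum>a\<in>keys p. single a (lookup p a)) *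
   (\<Sum>b\<in>keys q. single b (lookup q b))"
  using poly_mapping_as_sum[of p] poly_mapping_as_sum[of q] by simp
 also have "\<dots> = (\<Sum>a\<in>keys p. \<Sum>b\<in>keys q.
   single (a + b) (lookup p a * lookup q b))"
  by (simp add: sum_product mult_single)
 finally have *: "p * q = \<dots>" .
 have "keys (a + b) \<subseteq> S" if "a \<in> keys p" "b \<in> keys q" for a b
  using that p q Poly_Mapping.keys_add[of a b] by (fastforce simp: poly_over_def)
 then show ?thesis unfolding *
  using poly_over_lookup[OF k p] poly_over_lookup[OF k q]
  by (intro poly_over_sum[OF k] poly_over_single[OF k] subfieldD(4)[OF k]) auto
qed

lemma poly_over_prod:
 assumes "is_subfield k" "\<And>i. i \<in> I \<Longrightarrow> poly_over k S (f i)" shows "poly_over k S (prod f I)"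
 using assms(2)
proof (induction I rule: infinite_finite_induct)
 case (insert i I) then show ?case by (simp add: poly_over_mult[OF assms(1)])
qed (use poly_over_single[OF assms(1), of 1 0 S] subfieldD(2)[OF assms(1)] in auto)

lemma adjoin_fraction:
 assumes k: "is_subfield k" and x: "x \<in> adjoin k S"
 obtains p q where "poly_over k S p" "poly_over k S q" "ev id id q \<noteq> 0" "x = ev id id p / ev id id q"
proof -
 have h: "is_hom (ev id id :: (('a \<Rightarrow>\<^sub>0 nat) \<Rightarrow>\<^sub>0 'a) \<Rightarrow> 'a)" by (rule ev_hom) simp
 let ?A = "{x. \<exists>p q. poly_over k S p \<and> poly_over k S q \<and> ev id id q \<noteq> 0 \<and> x = ev id id p / ev id id q}"
 have AI: "x \<in> ?A" if "poly_over k S p" "poly_over k S q" "ev id id q \<noteq> 0" "x = ev id id p / ev id id q" for x p q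
  using that by blast
 have single: "single m c = p \<Longrightarrow> ev id id p = c * mon id m" for m p and c :: 'a
  using ev_single[of id id m c] by auto
 have one: "poly_over k S 1" "ev id id (1 :: ('a \<Rightarrow>\<^sub>0 nat) \<Rightarrow>\<^sub>0 'a) = 1"
  using poly_over_single[OF k subfieldD(2)[OF k], of 0 S] homD(2)[OF h] by auto
 have ring: "c \<in> ?A" if "c \<in> k" for c
  by (rule AI[OF poly_over_single[OF k that, of 0] one(1)]) (use one(2) single[of 0 c] in auto)
 have "is_subfield ?A"
 proof (rule is_subfieldI)
  show "0 \<in> ?A" "1 \<in> ?A" using ring subfieldD(1,2)[OF k] by blast+
 next
  fix x y assume "x \<in> ?A" "y \<in> ?A"
  then obtain p q r s where *: "poly_over k S p" "poly_over k S q" "poly_over k S r" "poly_over k S s"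
   "ev id id q \<noteq> 0" "ev id id s \<noteq> 0" and xy: "x = ev id id p / ev id id q" "y = ev id id r / ev id id s"
   by (elim CollectE exE conjE)
  show "x + y \<in> ?A" unfolding xy
   by (rule AI[of "p * s + r * q" "q * s"]) (use * in \<open>auto simp: homD[OF h] add_frac_eq intro!: poly_over_add poly_over_mult k\<close>)
  show "x * y \<in> ?A" unfolding xy
   by (rule AI[of "p * r" "q * s"]) (use * in \<open>auto simp: homD[OF h] intro!: poly_over_mult k\<close>)
 next
  fix x assume "x \<in> ?A"
  then obtain p q where *: "poly_over k S p" "poly_over k S q" "ev id id q \<noteq> 0" and x: "x = ev id id p / ev id id q"
   by (elim CollectE exE conjE)
  have "poly_over k S (single 0 (- 1))"
   using subfield_closed[OF k] by (intro poly_over_single[OF k]) auto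
  then show "- x \<in> ?A" unfolding x
   by (intro AI[of "single 0 (- 1) * p" q])
    (use * single[of 0 "-1"] in \<open>auto simp: homD[OF h] intro!: poly_over_mult k\<close>)
  show "inverse x \<in> ?A" if "x \<noteq> 0" using that unfolding x
   by (intro AI[of q p]) (use * in auto)
 qed
 moreover have "S \<subseteq> ?A"
 proof
  fix s assume s: "s \<in> S"
  show "s \<in> ?A"
   by (rule AI[OF poly_over_single[OF k subfieldD(2)[OF k], of "single s 1"] one(1)])
    (use s one(2) single[of "single s 1" 1] in auto)
 qed
 ultimately have "x \<in> ?A" using adjoin_least[of ?A k S] ring x by blast
 then show ?thesis using that by blast
qed

lemma alg_independent_transcendental:
 assumes k: "is_subfield k" and S: "alg_independent k S" and s: "s \<in> S"
 shows "\<not> algebraic_over (adjoin k (S - {s})) s"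
proof
 assume "algebraic_over (adjoin k (S - {s})) s"
 then obtain f where f: "f \<noteq> 0" "\<And>i. coeff f i \<in> adjoin k (S - {s})" "poly f s = 0"
  by (auto simp: algebraic_over_def coeffs_in_def)
 have h: "is_hom (ev id id :: (('a \<Rightarrow>\<^sub>0 nat) \<Rightarrow>\<^sub>0 'a) \<Rightarrow> 'a)" by (rule ev_hom) simp
 let ?n = "degree f" and ?T = "S - {s}"
 have "\<exists>p q. poly_over k ?T p \<and> poly_over k ?T q \<and> ev id id q \<noteq> 0 \<and> coeff f i = ev id id p / ev id id q" for i
  using adjoin_fraction[OF k f(2)[of i]] by metis
 then obtain P Q where PQ: "\<And>i. poly_over k ?T (P i)" "\<And>i. poly_over k ?T (Q i)" "\<And>i. ev id id (Q i) \<noteq> 0"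
  "\<And>i. coeff f i = ev id id (P i) / ev id id (Q i)" by metis
 define B where "B = (\<Prod>i\<le>?n. ev id id (Q i))"
 have B: "B \<noteq> 0" using PQ(3) by (simp add: B_def)
 define R where "R i = P i * (\<Prod>j\<in>{..?n} - {i}. Q j)" for i
 have R: "poly_over k ?T (R i)" for i
  unfolding R_def by (intro poly_over_mult poly_over_prod k PQ)
 have evR: "ev id id (R i) = coeff f i * B" if "i \<le> ?n" for i
 proof -
  have "B = ev id id (Q i) * (\<Prod>j\<in>{..?n} - {i}. ev id id (Q j))"
   unfolding B_def using that by (subst prod.remove[of _ i]) auto
  then show ?thesis using PQ(3)[of i] by (simp add: R_def homD[OF h] hom_prod[OF h] PQ(4))
 qed
 define Z where "Z = (\<Sum>i\<le>?n. \<Sum>m\<in>keys (R i).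
   single (m + single s i) (lookup (R i) m))"
 have "poly_over k S Z"
  unfolding Z_def
 proof (intro poly_over_sum[OF k] poly_over_single[OF k])
  fix i m assume m: "m \<in> keys (R i)"
  show "lookup (R i) m \<in> k" by (rule poly_over_lookup[OF k R])
  show "keys (m + single s i) \<subseteq> S"
   using m R[of i] s Poly_Mapping.keys_add[of m "single s i"]
   by (fastforce simp: poly_over_def split: if_splits)
 qed
 moreover have "ev id id Z = 0"
 proof -
  have "ev id id Z = (\<Sum>i\<le>?n. ev id id (R i) * s ^ i)"
   unfolding Z_def by (simp add: hom_sum[OF h] ev_single mon_add sum_distrib_left ev_def[of id id "R _"] mult_ac)
  also have "\<dots> = B * poly f s"
   unfolding poly_altdef sum_distrib_left by (rule sum.cong) (auto simp: evR)
  finally show ?thesis using f(3) by simp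
 qed
 ultimately have Z0: "Z = 0" using S by (simp add: alg_independent_iff)
 have "ev id id (R ?n) \<noteq> 0" using evR[of ?n] B f(1) by simp
 then have "R ?n \<noteq> 0" by auto
 then obtain m where m: "m \<in> keys (R ?n)" by (metis Poly_Mapping.keys_eq_empty ex_in_conv)
 have notin: "lookup m' s = 0" if "m' \<in> keys (R i)" for m' i
 proof -
  have "keys m' \<subseteq> S - {s}" using R[of i] that unfolding poly_over_def by blast
  then have "s \<notin> keys m'" by blast
  then show ?thesis by (simp add: in_keys_iff)
 qed
 have inj: "m' + single s i = m + single s ?n \<longleftrightarrow> i = ?n \<and> m' = m"
  if "m' \<in> keys (R i)" for i m'
 proof
  assume e: "m' + single s i = m + single s ?n"
  have "lookup (m' + single s i) s = lookup (m + single s ?n) s"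
   using e by simp
  then have "i = ?n" using notin[OF that] notin[OF m] by (simp add: lookup_add)
  then show "i = ?n \<and> m' = m" using e by simp
 qed auto
 have "lookup Z (m + single s ?n) =
   (\<Sum>i\<le>?n. \<Sum>m'\<in>keys (R i). if i = ?n \<and> m' = m then lookup (R i) m' else 0)"
  unfolding Z_def lookup_sum
  by (intro sum.cong refl) (auto simp: lookup_single when_def inj)
 also have "\<dots> = (\<Sum>i\<le>?n. if i = ?n then lookup (R ?n) m else 0)"
 proof (intro sum.cong refl)
  fix i
  show "(\<Sum>m'\<in>keys (R i). if i = ?n \<and> m' = m then lookup (R i) m' else 0) =
    (if i = ?n then lookup (R ?n) m else 0)"
   using m by (cases "i = ?n") (auto simp: sum.delta)
 qed
 also have "\<dots> = lookup (R ?n) m" by simp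
 finally show False using m Z0 by (simp add: in_keys_iff)
qed

text \<open>Each \<open>s \<in> S\<close> is transcendental over the field generated by the others, so some derivation kills
 these and maps \<open>s\<close> to 1.\<close>

lemma alg_independent_dual_basis:
 fixes S :: "'a::field_char_0 set"
 assumes k: "is_subfield k" and S: "alg_independent k S"
 shows "\<exists>d. \<forall>s\<in>S. derivation (d s) \<and> (\<forall>x\<in>k. d s x = 0) \<and> (\<forall>t\<in>S. t \<noteq> s \<longrightarrow> d s t = 0) \<and> d s s = 1"
proof (rule bchoice, rule ballI)
 fix s assume s: "s \<in> S"
 obtain e where e: "derivation e" "\<And>y. y \<in> adjoin k (S - {s}) \<Longrightarrow> e y = 0" "e s = 1"
  using transcendental_derivation[OF subfield_adjoin alg_independent_transcendental[OF k S s]] by metis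
 have "e x = 0" if "x \<in> k" for x using e(2) adjoin_base that by blast
 moreover have "e t = 0" if "t \<in> S" "t \<noteq> s" for t using e(2) adjoin_gen[of "S - {s}" k] that by blast
 ultimately show "\<exists>d. derivation d \<and> (\<forall>x\<in>k. d x = 0) \<and> (\<forall>t\<in>S. t \<noteq> s \<longrightarrow> d t = 0) \<and> d s = 1"
  using e(1,3) by (intro exI[of _ e]) simp
qed

lemma derivation_mon:
 fixes d :: "'a::field \<Rightarrow> 'a"
 assumes d: "derivation d" and 0: "\<And>w. w \<in> keys m \<Longrightarrow> w \<noteq> v \<Longrightarrow> d (x w) = 0" and 1: "d (x v) = 1"
 shows "x v * d (mon x m) = of_nat (lookup m v) * mon x m"
proof -
 let ?P = "\<Prod>w\<in>keys m - {v}. x w ^ lookup m w"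
 have m: "mon x m = x v ^ lookup m v * ?P"
 proof (cases "v \<in> keys m")
  case True then show ?thesis unfolding mon_def by (subst prod.remove[of _ v]) auto
 next
  case False then show ?thesis by (simp add: mon_def in_keys_iff)
 qed
 have "?P \<in> {x. d x = 0}"
  using 0 by (intro subfield_prod subfield_power derivation_kernel[OF d]) auto
 then have "d (mon x m) = of_nat (lookup m v) * x v ^ (lookup m v - 1) * ?P"
  by (simp add: m derivationD[OF d] derivation_power[OF d] 1)
 then show ?thesis unfolding m
  by (cases "lookup m v") (simp_all add: algebra_simps)
qed

text \<open>Monomials are joint eigenvectors of the operators \<open>x\<^sub>v d\<^sub>v\<close>, with different eigenvalues.\<close>

lemma dual_derivations_monomials_independent:
 fixes x :: "'v \<Rightarrow> 'a::field_char_0"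
 assumes d: "\<And>v. v \<in> V \<Longrightarrow> derivation (d v)" "\<And>v y. v \<in> V \<Longrightarrow> y \<in> k \<Longrightarrow> d v y = 0"
  "\<And>v w. v \<in> V \<Longrightarrow> w \<in> V \<Longrightarrow> v \<noteq> w \<Longrightarrow> d v (x w) = 0" "\<And>v. v \<in> V \<Longrightarrow> d v (x v) = 1"
  and k: "is_subfield k"
  and "finite A" "\<And>m. m \<in> A \<Longrightarrow> keys m \<subseteq> V" "\<And>m. m \<in> A \<Longrightarrow> c m \<in> k"
   "(\<Sum>m\<in>A. c m * mon x m) = 0" "m \<in> A"
 shows "c m = 0"
 using assms(6-)
proof (induction "card A" arbitrary: A m c rule: less_induct)
 case less
 have x0: "x v \<noteq> 0" if "v \<in> V" for v using d(1,4)[OF that] derivation_0 by fastforce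
 have shrink: "c m1 = 0" if m: "m1 \<in> A" "m2 \<in> A" "m1 \<noteq> m2" for m1 m2
 proof -
  obtain v where v: "lookup m1 v \<noteq> lookup m2 v"
   using m(3) by (meson poly_mapping_eqI)
  have "v \<in> keys m1 \<union> keys m2" using v by (auto simp: in_keys_iff)
  then have vV: "v \<in> V" using less.prems(2) m by blast
  define c' where "c' m = c m * (of_nat (lookup m v) - of_nat (lookup m2 v))" for m
  have dm: "x v * d v (mon x m) = of_nat (lookup m v) * mon x m" if "m \<in> A" for m
   using less.prems(2)[OF that] d(3)[OF vV] by (intro derivation_mon d vV) auto
  have "x v * d v (\<Sum>m\<in>A. c m * mon x m) = (\<Sum>m\<in>A. c m * (x v * d v (mon x m)))"
   unfolding derivation_sum[OF d(1)[OF vV]] sum_distrib_left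
   by (rule sum.cong) (auto simp: derivationD[OF d(1)[OF vV]] d(2)[OF vV less.prems(3)])
  also have "\<dots> = (\<Sum>m\<in>A. c m * (of_nat (lookup m v) * mon x m))"
   by (rule sum.cong) (auto simp: dm)
  finally have 1: "(\<Sum>m\<in>A. c m * (of_nat (lookup m v) * mon x m)) = 0"
   using less.prems(4) derivation_0[OF d(1)[OF vV]] by simp
  have "(\<Sum>m\<in>A - {m2}. c' m * mon x m) = (\<Sum>m\<in>A. c' m * mon x m)"
   using less.prems(1) by (intro sum.mono_neutral_left) (auto simp: c'_def)
  also have "\<dots> = (\<Sum>m\<in>A. c m * (of_nat (lookup m v) * mon x m)) -
    of_nat (lookup m2 v) * (\<Sum>m\<in>A. c m * mon x m)"
   unfolding sum_distrib_left sum_subtractf[symmetric]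
   by (rule sum.cong) (auto simp: c'_def algebra_simps)
  also have "\<dots> = 0" using 1 less.prems(4) by simp
  finally have "(\<Sum>m\<in>A - {m2}. c' m * mon x m) = 0" .
  moreover have "card (A - {m2}) < card A" using m less.prems(1) by (intro psubset_card_mono) auto
  moreover have "c' m \<in> k" if "m \<in> A" for m
   unfolding c'_def using less.prems(3)[OF that] by (intro subfield_closed k)
  ultimately have "c' m1 = 0" using less.hyps[of "A - {m2}" c' m1] m less.prems(1,2) by auto
  then show ?thesis using v by (simp add: c'_def)
 qed
 show ?case
 proof (cases "A = {m}")
  case True
  have "mon x m \<noteq> 0" using x0 less.prems(2)[OF less.prems(5)] by (auto simp: mon_def)
  then show ?thesis using less.prems(4) True by simp
 next
  case False
  then obtain m2 where "m2 \<in> A" "m2 \<noteq> m" using less.prems(5) by blast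
  then show ?thesis using shrink less.prems(5) by blast
 qed
qed

lemma dual_derivations_alg_independent:
 fixes S :: "'a::field_char_0 set"
 assumes d: "\<And>s. s \<in> S \<Longrightarrow> derivation (d s)" "\<And>s x. s \<in> S \<Longrightarrow> x \<in> k \<Longrightarrow> d s x = 0"
  "\<And>s t. s \<in> S \<Longrightarrow> t \<in> S \<Longrightarrow> s \<noteq> t \<Longrightarrow> d s t = 0" "\<And>s. s \<in> S \<Longrightarrow> d s s = 1"
  and k: "is_subfield k"
 shows "alg_independent k S"
 unfolding alg_independent_iff
proof (intro allI impI)
 fix p assume p: "poly_over k S p" "ev id id p = 0"
 have "lookup p m = 0" if "m \<in> keys p" for m
  by (rule dual_derivations_monomials_independent[of S d k id "keys p" "lookup p"])
   (use d k p that in \<open>auto simp: poly_over_def ev_def\<close>)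
 then show "p = 0" by (intro poly_mapping_eqI) (metis in_keys_iff lookup_zero)
qed

lemma nontrivial_linear_relation:
 fixes M :: "'s \<Rightarrow> 'c \<Rightarrow> 'a::field"
 assumes "finite C" "finite S" "card C < card S"
 shows "\<exists>l. (\<exists>s\<in>S. l s \<noteq> 0) \<and> (\<forall>c\<in>C. (\<Sum>s\<in>S. l s * M s c) = 0)"
 using assms
proof (induction C arbitrary: S M rule: finite_induct)
 case empty
 then obtain s where "s \<in> S" by fastforce
 then show ?case by (intro exI[of _ "\<lambda>_. 1"]) auto
next
 case (insert c C)
 show ?case
 proof (cases "\<forall>s\<in>S. M s c = 0")
  case True
  have "card C < card S" using insert.prems insert.hyps by simp
  then obtain l where l: "\<exists>s\<in>S. l s \<noteq> 0" "\<forall>c\<in>C. (\<Sum>s\<in>S. l s * M s c) = 0"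
   using insert.IH[of S M] insert.prems by blast
  moreover have "(\<Sum>s\<in>S. l s * M s c) = 0" using True by simp
  ultimately show ?thesis by blast
 next
  case False
  then obtain s0 where s0: "s0 \<in> S" "M s0 c \<noteq> 0" by blast
  define N where "N s x = M s x - M s c / M s0 c * M s0 x" for s x
  let ?T = "S - {s0}"
  have "card C < card ?T" using insert.prems insert.hyps s0 by simp
  then obtain l where l: "\<exists>s\<in>?T. l s \<noteq> 0" "\<And>x. x \<in> C \<Longrightarrow> (\<Sum>s\<in>?T. l s * N s x) = 0"
   using insert.IH[of ?T N] insert.prems by blast
  define l' where "l' s = (if s = s0 then - (\<Sum>s\<in>?T. l s * (M s c / M s0 c)) else l s)" for s
  have sum: "(\<Sum>s\<in>S. l' s * M s x) = (\<Sum>s\<in>?T. l s * N s x)" for x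
  proof -
   have "(\<Sum>s\<in>S. l' s * M s x) = l' s0 * M s0 x + (\<Sum>s\<in>?T. l s * M s x)"
    using s0 insert.prems by (subst sum.remove[of _ s0]) (auto simp: l'_def)
   also have "\<dots> = (\<Sum>s\<in>?T. l s * N s x)"
    by (simp add: l'_def N_def sum_distrib_left sum_subtractf algebra_simps)
   finally show ?thesis .
  qed
  have "N s c = 0" for s using s0 by (simp add: N_def)
  then have "(\<Sum>s\<in>S. l' s * M s x) = 0" if "x \<in> insert c C" for x
   using that l(2) by (auto simp: sum)
  moreover have "\<exists>s\<in>S. l' s \<noteq> 0" using l(1) by (auto simp: l'_def)
  ultimately show ?thesis by blast
 qed
qed

lemma trdeg_adjoin_le:
 fixes C :: "'a::field_char_0 set"
 assumes k: "is_subfield k" and C: "finite C"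
 shows "trdeg k (adjoin k C) \<le> enat (card C)"
 unfolding trdeg_def
proof (rule Sup_least)
 fix n assume "n \<in> {enat (card S) |S. S \<subseteq> adjoin k C \<and> finite S \<and> alg_independent k S}"
 then obtain S where S: "n = enat (card S)" "S \<subseteq> adjoin k C" "finite S" "alg_independent k S" by blast
 have "card S \<le> card C"
 proof (rule ccontr)
  assume "\<not> card S \<le> card C"
  obtain d where d0: "\<forall>s\<in>S. derivation (d s) \<and> (\<forall>x\<in>k. d s x = 0) \<and> (\<forall>t\<in>S. t \<noteq> s \<longrightarrow> d s t = 0) \<and> d s s = 1"
   using alg_independent_dual_basis[OF k S(4)] by (elim exE)
  have d: "\<And>s. s \<in> S \<Longrightarrow> derivation (d s)" "\<And>s x. s \<in> S \<Longrightarrow> x \<in> k \<Longrightarrow> d s x = 0"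
   "\<And>s t. s \<in> S \<Longrightarrow> t \<in> S \<Longrightarrow> t \<noteq> s \<Longrightarrow> d s t = 0" "\<And>s. s \<in> S \<Longrightarrow> d s s = 1"
   using d0 by auto
  obtain l where l: "\<exists>s\<in>S. l s \<noteq> 0" "\<forall>c\<in>C. (\<Sum>s\<in>S. l s * d s c) = 0"
   using nontrivial_linear_relation[OF C S(3), of d] \<open>\<not> card S \<le> card C\<close> by auto
  let ?e = "\<lambda>x. \<Sum>s\<in>S. l s * d s x"
  have e0: "?e x = 0" if "x \<in> adjoin k C" for x
   by (rule derivation_adjoin[OF derivation_combination[OF d(1)] _ _ that]) (use d(2) l(2) in auto)
  obtain s where s: "s \<in> S" "l s \<noteq> 0" using l(1) by blast
  have "?e s = (\<Sum>t\<in>S. if t = s then l s else 0)"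
   by (rule sum.cong) (use d(3,4) s in auto)
  then show False using e0[of s] s S(2,3) by (simp add: subset_iff)
 qed
 then show "n \<le> enat (card C)" using S(1) by simp
qed

lemma trdeg_ge:
 assumes "S \<subseteq> L" "finite S" "alg_independent k S"
 shows "enat (card S) \<le> trdeg k L"
 unfolding trdeg_def by (rule Sup_upper) (use assms in blast)

text \<open>A derivation that kills \<open>k\<close> is determined on \<open>L\<close> by its values at a transcendence basis, which has
 at most \<open>r\<close> elements; so more than \<open>r\<close> derivations are linearly dependent on \<open>L\<close>.\<close>

lemma trdeg_derivation_relation:
 fixes L :: "'a::field_char_0 set"
 assumes k: "is_subfield k" and L: "is_subfield L" "k \<subseteq> L" and tr: "trdeg k L \<le> enat r"
  and I: "finite I" "card I > r" and d: "\<And>i. i \<in> I \<Longrightarrow> derivation (d i)"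
  "\<And>i x. i \<in> I \<Longrightarrow> x \<in> k \<Longrightarrow> d i x = 0"
 shows "\<exists>l. (\<exists>i\<in>I. l i \<noteq> 0) \<and> (\<forall>x\<in>L. (\<Sum>i\<in>I. l i * d i x) = 0)"
proof -
 let ?P = "\<lambda>S. S \<subseteq> L \<and> finite S \<and> alg_independent k S"
 have bound: "card S \<le> r" if "?P S" for S
  using trdeg_ge[of S L k] that order_trans[OF _ tr] by fastforce
 have "?P {}" using dual_derivations_alg_independent[of "{}" _ k] k by auto
 then have "\<exists>S. ?P S \<and> (\<forall>T. ?P T \<longrightarrow> card T \<le> card S)"
  by (rule ex_has_greatest_nat[of ?P _ _ "Suc r"]) (use bound in \<open>simp add: less_Suc_eq_le\<close>)
 then obtain S where S: "?P S" and max: "\<And>T. ?P T \<Longrightarrow> card T \<le> card S" by blast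
 have alg: "algebraic_over (adjoin k S) x" if x: "x \<in> L" for x
 proof (rule ccontr)
  assume na: "\<not> algebraic_over (adjoin k S) x"
  obtain e where e: "derivation e" "\<And>y. y \<in> adjoin k S \<Longrightarrow> e y = 0" "e x = 1"
   using transcendental_derivation[OF subfield_adjoin na] by metis
  have xS: "x \<notin> S" using e(2)[of x] e(3) adjoin_gen[of S k] by auto
  have indep: "alg_independent k S" using S by simp
  obtain f where f0: "\<forall>s\<in>S. derivation (f s) \<and> (\<forall>x\<in>k. f s x = 0) \<and> (\<forall>t\<in>S. t \<noteq> s \<longrightarrow> f s t = 0) \<and> f s s = 1"
   using alg_independent_dual_basis[OF k indep] by (elim exE)
  have f: "\<And>s. s \<in> S \<Longrightarrow> derivation (f s)" "\<And>s x. s \<in> S \<Longrightarrow> x \<in> k \<Longrightarrow> f s x = 0"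
   "\<And>s t. s \<in> S \<Longrightarrow> t \<in> S \<Longrightarrow> t \<noteq> s \<Longrightarrow> f s t = 0" "\<And>s. s \<in> S \<Longrightarrow> f s s = 1"
   using f0 by auto
  define g where "g s = (if s = x then e else (\<lambda>y. f s y - f s x * e y))" for s
  have ek: "e y = 0" if "y \<in> k" for y using e(2) adjoin_base that by blast
  have eS: "e y = 0" if "y \<in> S" for y using e(2) adjoin_gen[of S k] that by blast
  have "alg_independent k (insert x S)"
  proof (rule dual_derivations_alg_independent[of _ g])
   show "derivation (g s)" if "s \<in> insert x S" for s
   proof (cases "s = x")
    case True then show ?thesis using e by (simp add: g_def)
   next
    case False
    then have "derivation (f s)" using f(1) that by blast
    then show ?thesis using False
     by (simp add: g_def derivation_def e(1)[unfolded derivation_def] algebra_simps)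
   qed
   show "g s y = 0" if "s \<in> insert x S" "y \<in> k" for s y using that f(2) ek by (auto simp: g_def)
   show "g s t = 0" if "s \<in> insert x S" "t \<in> insert x S" "s \<noteq> t" for s t
    using that f(3) eS e(3) by (auto simp: g_def)
   show "g s s = 1" if "s \<in> insert x S" for s using that f(4) eS e(3) by (auto simp: g_def)
  qed (rule k)
  then have "card (insert x S) \<le> card S" using max x S by auto
  then show False using S xS by simp
 qed
 obtain l where l: "\<exists>i\<in>I. l i \<noteq> 0" "\<forall>s\<in>S. (\<Sum>i\<in>I. l i * d i s) = 0"
  using nontrivial_linear_relation[of S I d] S I bound[OF S] by auto
 let ?e = "\<lambda>x. \<Sum>i\<in>I. l i * d i x"
 have de: "derivation ?e" by (rule derivation_combination[OF d(1)])
 have ek: "?e x = 0" if "x \<in> k" for x using d(2) that by simp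
 have "?e x = 0" if x: "x \<in> L" for x
  by (rule derivation_algebraic[OF de _ subfield_adjoin alg[OF x]])
   (rule derivation_adjoin[OF de], use ek l(2) in auto)
 then show ?thesis using l(1) by blast
qed

section \<open>The field of rational functions\<close>

instance fract :: ("{idom,ring_char_0}") field_char_0
proof
 show "inj (of_nat :: nat \<Rightarrow> 'a fract)"
  by (rule injI) (simp add: of_nat_fract eq_fract)
qed

text \<open>A substitution \<open>f\<close> is defined only on those fractions whose denominator it does not kill.\<close>

definition place_ring :: "('r::idom \<Rightarrow> 'b::field) \<Rightarrow> 'r fract set" where
 "place_ring f = {Fract p q | p q. f q \<noteq> 0}"

definition place :: "('r::idom \<Rightarrow> 'b::field) \<Rightarrow> 'r fract \<Rightarrow> 'b" where
 "place f z = (SOME w. \<exists>p q. z = Fract p q \<and> f q \<noteq> 0 \<and> w = f p / f q)"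

lemma place_Fract:
 assumes f: "is_hom f" and q: "f q \<noteq> 0"
 shows "place f (Fract p q) = f p / f q"
proof -
 have "\<exists>w. \<exists>p' q'. Fract p q = Fract p' q' \<and> f q' \<noteq> 0 \<and> w = f p' / f q'" using q by blast
 from someI_ex[OF this] obtain p' q' where *: "Fract p q = Fract p' q'" "f q' \<noteq> 0"
  "place f (Fract p q) = f p' / f q'" unfolding place_def by blast
 have "q \<noteq> 0" "q' \<noteq> 0" using q *(2) homD(1)[OF f] by auto
 then have "p * q' = p' * q" using *(1) by (simp add: eq_fract)
 then have "f p * f q' = f p' * f q" using homD(4)[OF f] by metis
 then show ?thesis using * q by (simp add: frac_eq_eq)
qed

lemma place_ringE:
 assumes "z \<in> place_ring f"
 obtains p q where "z = Fract p q" "f q \<noteq> 0"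
 using assms by (auto simp: place_ring_def)

lemma place_closed:
 assumes f: "is_hom f" and x: "x \<in> place_ring f" and y: "y \<in> place_ring f"
 shows "x + y \<in> place_ring f" "place f (x + y) = place f x + place f y"
  "x * y \<in> place_ring f" "place f (x * y) = place f x * place f y"
  "place f x \<noteq> 0 \<Longrightarrow> inverse x \<in> place_ring f" "- x \<in> place_ring f"
proof -
 obtain p q where p: "x = Fract p q" "f q \<noteq> 0" by (rule place_ringE[OF x])
 obtain r s where r: "y = Fract r s" "f s \<noteq> 0" by (rule place_ringE[OF y])
 have nz: "q \<noteq> 0" "s \<noteq> 0" using p(2) r(2) homD(1)[OF f] by auto
 have qs: "f (q * s) \<noteq> 0" using p(2) r(2) by (simp add: homD[OF f])
 have sum: "x + y = Fract (p * s + r * q) (q * s)" using p(1) r(1) nz by simp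
 have prod: "x * y = Fract (p * r) (q * s)" using p(1) r(1) by simp
 show "x + y \<in> place_ring f" "x * y \<in> place_ring f"
  unfolding sum prod place_ring_def using qs by blast+
 show "place f (x + y) = place f x + place f y"
  unfolding sum place_Fract[OF f qs] using p r
  by (simp add: place_Fract[OF f] homD[OF f] add_frac_eq)
 show "place f (x * y) = place f x * place f y"
  unfolding prod place_Fract[OF f qs] using p r
  by (simp add: place_Fract[OF f] homD[OF f])
 show "inverse x \<in> place_ring f" if "place f x \<noteq> 0"
 proof -
  have "f p \<noteq> 0" using that p place_Fract[OF f p(2)] by auto
  then show ?thesis unfolding p(1) inverse_fract place_ring_def by blast
 qed
 show "- x \<in> place_ring f" unfolding p(1) minus_fract place_ring_def using p(2) by blast
qed

lemma place_of_ring: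
 assumes f: "is_hom f"
 shows "Fract p 1 \<in> place_ring f" "place f (Fract p 1) = f p"
proof -
 have 1: "f 1 \<noteq> 0" using homD(2)[OF f] by simp
 then show "Fract p 1 \<in> place_ring f" by (auto simp: place_ring_def)
 show "place f (Fract p 1) = f p" using place_Fract[OF f 1] homD(2)[OF f] by simp
qed

lemma place_hom:
 assumes f: "is_hom f" and inj: "\<And>p. f p = 0 \<Longrightarrow> p = 0"
 shows "is_hom (place f)"
proof -
 have all: "z \<in> place_ring f" for z
 proof (cases z)
  case (Fract p q)
  then have "f q \<noteq> 0" using inj by blast
  then show ?thesis using Fract by (auto simp: place_ring_def)
 qed
 have "place f 0 = 0" "place f 1 = 1"
  using place_of_ring(2)[OF f, of 0] place_of_ring(2)[OF f, of 1] homD[OF f]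
  by (simp_all add: Zero_fract_def One_fract_def)
 then show ?thesis unfolding is_hom_def using place_closed(2,4)[OF f all all] by blast
qed

lemma Fract_hom: "is_hom (\<lambda>p. Fract p 1)"
 by (simp add: is_hom_def Zero_fract_def One_fract_def)

lemma const_hom: "is_hom (const :: 'k::comm_ring_1 \<Rightarrow> ('v \<Rightarrow>\<^sub>0 nat) \<Rightarrow>\<^sub>0 'k)"
 by (simp add: is_hom_def const_def single_add mult_single)

definition scalar :: "'k::field \<Rightarrow> 'k ratfun" where
 "scalar c = Fract (const c) 1"

lemma scalar_hom: "is_hom scalar"
 unfolding is_hom_def scalar_def homD[OF const_hom]
 by (intro conjI allI) (rule homD[OF Fract_hom])+

lemma base_field_eq: "base_field = range scalar"
 by (simp add: base_field_def scalar_def)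

lemma subfield_base: "is_subfield (base_field :: 'k::field ratfun set)"
proof (rule is_subfieldI)
 show "0 \<in> (base_field :: 'k ratfun set)" "1 \<in> (base_field :: 'k ratfun set)"
  unfolding base_field_eq using homD(1,2)[OF scalar_hom] by (metis rangeI)+
next
 fix x y :: "'k ratfun" assume "x \<in> base_field" "y \<in> base_field"
 then obtain a b where "x = scalar a" "y = scalar b" by (auto simp: base_field_eq)
 then show "x + y \<in> base_field" "x * y \<in> base_field"
  unfolding base_field_eq using homD(3,4)[OF scalar_hom] by (metis rangeI)+
next
 fix x :: "'k ratfun" assume "x \<in> base_field"
 then obtain a where a: "x = scalar a" by (auto simp: base_field_eq)
 then show "- x \<in> base_field" unfolding base_field_eq using hom_uminus[OF scalar_hom] by (metis rangeI)
 have "scalar (1 :: 'k) = 1" by (rule homD(2)[OF scalar_hom])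
 then have "inverse x = scalar (inverse a)"
  using hom_divide[OF scalar_hom, of 1 a] by (simp add: a divide_inverse)
 then show "inverse x \<in> base_field" by (simp add: base_field_eq)
qed

lemma mon_var: "mon var m = single m (1 :: 'k::comm_ring_1)"
proof -
 have pow: "single (single v 1) (1::'k) ^ n = single (single v n) 1"
  for v :: 'a and n
  by (induction n) (simp_all add: mult_single single_add[symmetric])
 have "mon var m = (\<Prod>v\<in>keys m. single (single v (lookup m v)) (1::'k))"
  unfolding mon_def
 proof (rule prod.cong[OF refl])
  fix v
  show "var v ^ lookup m v =
   single (single v (lookup m v)) (1::'k)"
   by (simp only: var_def pow)
 qed
 also have "\<dots> = single (\<Sum>v\<in>keys m. single v (lookup m v)) 1"
 proof -
  have "(\<Prod>v\<in>A. single (g v) (1::'k)) = single (sum g A) 1" if "finite A"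
   for A and g :: "'a \<Rightarrow> 'a \<Rightarrow>\<^sub>0 nat"
   using that by (induction A rule: finite_induct) (simp_all add: mult_single)
  then show ?thesis by simp
 qed
 also have "\<dots> = single m 1" using poly_mapping_as_sum[of m] by simp
 finally show ?thesis .
qed

lemma Fract_eq_ev: "Fract p 1 = ev scalar gen_coeff p"
proof -
 have "Fract p 1 = Fract (\<Sum>m\<in>keys p. const (lookup p m) * mon var m) 1"
  using poly_mapping_as_sum[of p] by (simp add: const_def mon_var mult_single)
 also have "\<dots> = (\<Sum>m\<in>keys p. Fract (const (lookup p m)) 1 * Fract (mon var m) 1)"
  unfolding hom_sum[OF Fract_hom] homD(4)[OF Fract_hom] ..
 also have "\<dots> = ev scalar gen_coeff p"
  by (simp add: ev_def scalar_def mon_def gen_coeff_def hom_prod[OF Fract_hom] hom_power[OF Fract_hom])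
 finally show ?thesis .
qed

lemma ratfun_quotient:
 fixes z :: "'k::field ratfun"
 obtains p q where "q \<noteq> 0" "z = Fract p q" "z = ev scalar gen_coeff p / ev scalar gen_coeff q" "ev scalar gen_coeff q \<noteq> 0"
proof (cases z)
 case (Fract p q)
 then have "z = Fract p 1 / Fract q 1" "Fract q 1 \<noteq> 0" by (simp_all add: eq_fract Zero_fract_def)
 then show ?thesis using Fract that[of q p] by (simp add: Fract_eq_ev)
qed

lemma ratfun_hom_eqI:
 fixes F G :: "'k::field ratfun \<Rightarrow> 'b::field"
 assumes F: "is_hom F" and G: "is_hom G"
  and "\<And>c. F (scalar c) = G (scalar c)" "\<And>v. F (gen_coeff v) = G (gen_coeff v)"
 shows "F z = G z"
proof -
 have ev: "H (ev scalar gen_coeff p) = ev (H \<circ> scalar) (H \<circ> gen_coeff) p" if "is_hom H"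
  for H :: "'k ratfun \<Rightarrow> 'b" and p
  by (simp add: ev_def hom_sum[OF that] homD[OF that] mon_def hom_prod[OF that] hom_power[OF that])
 have "F \<circ> scalar = G \<circ> scalar" "F \<circ> gen_coeff = G \<circ> gen_coeff" using assms(3,4) by auto
 then have "F (ev scalar gen_coeff p) = G (ev scalar gen_coeff p)" for p by (simp add: ev[OF F] ev[OF G])
 moreover obtain p q where "z = ev scalar gen_coeff p / ev scalar gen_coeff q" by (rule ratfun_quotient)
 ultimately show ?thesis by (simp add: hom_divide[OF F] hom_divide[OF G])
qed

lemma ratfun_hom_exists:
 fixes h :: "'k::field \<Rightarrow> 'b::field"
 assumes h: "is_hom h" and inj: "\<And>p. ev h y p = 0 \<Longrightarrow> p = 0"
 shows "\<exists>F. is_hom F \<and> (\<forall>c. F (scalar c) = h c) \<and> (\<forall>v. F (gen_coeff v) = y v)"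
proof (intro exI conjI allI)
 let ?F = "place (ev h y) :: 'k ratfun \<Rightarrow> 'b"
 show "is_hom ?F" by (rule place_hom[OF ev_hom[OF h] inj])
 show "?F (scalar c) = h c" for c
  by (simp add: scalar_def place_of_ring[OF ev_hom[OF h]] ev_const[OF h])
 show "?F (gen_coeff v) = y v" for v
  by (simp add: gen_coeff_def place_of_ring[OF ev_hom[OF h]] ev_var[OF h])
qed

section \<open>The leading monomial as a valuation\<close>

definition lead_monomial :: "(('v::linorder \<Rightarrow>\<^sub>0 nat) \<Rightarrow>\<^sub>0 'k::zero) \<Rightarrow> 'v \<Rightarrow>\<^sub>0 nat" where
 "lead_monomial p = Max (keys p)"

lemma lead_monomial_in: "p \<noteq> 0 \<Longrightarrow> lead_monomial p \<in> keys p"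
 unfolding lead_monomial_def by (rule Max_in) auto

lemma lead_monomial_ge: "m \<in> keys p \<Longrightarrow> m \<le> lead_monomial p"
 unfolding lead_monomial_def by (rule Max_ge) auto

lemma lead_monomial_eqI:
 "m \<in> keys p \<Longrightarrow> (\<And>m'. m' \<in> keys p \<Longrightarrow> m' \<le> m) \<Longrightarrow> lead_monomial p = m"
 unfolding lead_monomial_def by (rule Max_eqI) auto

lemma lead_monomial_mult:
 fixes p q :: "('v::linorder \<Rightarrow>\<^sub>0 nat) \<Rightarrow>\<^sub>0 'k::idom"
 assumes "p \<noteq> 0" "q \<noteq> 0"
 shows "lead_monomial (p * q) = lead_monomial p + lead_monomial q"
proof (rule lead_monomial_eqI)
 let ?a = "lead_monomial p" and ?b = "lead_monomial q"
 have "p * q = (\<Sum>a\<in>keys p. single a (lookup p a)) *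
   (\<Sum>b\<in>keys q. single b (lookup q b))"
  using poly_mapping_as_sum[of p] poly_mapping_as_sum[of q] by simp
 then have "p * q = (\<Sum>a\<in>keys p. \<Sum>b\<in>keys q.
   single (a + b) (lookup p a * lookup q b))"
  by (simp add: sum_product mult_single)
 then have "lookup (p * q) (?a + ?b) = (\<Sum>a\<in>keys p. \<Sum>b\<in>keys q.
   if a = ?a then if b = ?b then lookup p ?a * lookup q ?b else 0 else 0)"
 proof (simp add: lookup_sum, intro sum.cong refl)
  fix a b assume ab: "a \<in> keys p" "b \<in> keys q"
  have "a + b = ?a + ?b \<longleftrightarrow> a = ?a \<and> b = ?b"
   using lead_monomial_ge[OF ab(1)] lead_monomial_ge[OF ab(2)]
   by (metis add_less_le_mono add_le_less_mono order_le_less less_irrefl)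
  then show "lookup (single (a + b) (lookup p a * lookup q b)) (?a + ?b)
   = (if a = ?a then if b = ?b then lookup p ?a * lookup q ?b else 0 else 0)"
   by (auto simp: lookup_single when_def)
 qed
 also have "\<dots> = lookup p ?a * lookup q ?b"
 proof -
  have "(\<Sum>b\<in>keys q.
   if a = ?a then if b = ?b then lookup p ?a * lookup q ?b else 0 else 0) =
   (if a = ?a then lookup p ?a * lookup q ?b else 0)" for a
   using lead_monomial_in[OF assms(2)] by (cases "a = ?a") (simp_all add: sum.delta)
  then show ?thesis using lead_monomial_in[OF assms(1)] by (simp add: sum.delta)
 qed
 finally show "?a + ?b \<in> keys (p * q)"
  using lead_monomial_in[OF assms(1)] lead_monomial_in[OF assms(2)] by (simp add: in_keys_iff)
 fix m assume "m \<in> keys (p * q)"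
 then obtain a b where "a \<in> keys p" "b \<in> keys q" "m = a + b"
  using keys_mult[of p q] by blast
 then show "m \<le> ?a + ?b" by (auto intro: add_mono lead_monomial_ge)
qed

type_synonym exponents = "(nat \<Rightarrow>\<^sub>0 nat) \<Rightarrow>\<^sub>0 int"

definition int_exponents :: "((nat \<Rightarrow>\<^sub>0 nat) \<Rightarrow>\<^sub>0 nat) \<Rightarrow> exponents" where
 "int_exponents = Poly_Mapping.map int"

lemma lookup_int_exponents: "lookup (int_exponents m) v = int (lookup m v)"
 by (simp add: int_exponents_def Poly_Mapping.map.rep_eq when_def)

lemma int_exponents_add: "int_exponents (m + m') = int_exponents m + int_exponents m'"
 by (rule poly_mapping_eqI) (simp add: lookup_int_exponents lookup_add)

lemma less_exponents_iff: "(f::'a::linorder \<Rightarrow>\<^sub>0 'b::{zero,linorder}) < g \<longleftrightarrow>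
 (\<exists>v. lookup f v < lookup g v \<and> (\<forall>w<v. lookup f w = lookup g w))"
 by (simp add: less_poly_mapping.rep_eq less_fun_def)

lemma int_exponents_less: "int_exponents m < int_exponents m' \<longleftrightarrow> m < m'"
 by (simp add: less_exponents_iff lookup_int_exponents)

text \<open>The leading exponents of the numerator minus those of the denominator. This does not depend on the fraction,
 since leading monomials are multiplicative.\<close>

definition deg :: "'k::field ratfun \<Rightarrow> exponents" where
 "deg z = (SOME g. \<exists>p q. z = Fract p q \<and> p \<noteq> 0 \<and> q \<noteq> 0 \<and>
   g = int_exponents (lead_monomial p) - int_exponents (lead_monomial q))"

lemma deg_Fract:
 assumes "p \<noteq> 0" "q \<noteq> 0"
 shows "deg (Fract p q) = int_exponents (lead_monomial p) - int_exponents (lead_monomial q)"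
proof -
 let ?P = "\<lambda>g. \<exists>p' q'. Fract p q = Fract p' q' \<and> p' \<noteq> 0 \<and> q' \<noteq> 0 \<and>
   g = int_exponents (lead_monomial p') - int_exponents (lead_monomial q')"
 have "\<exists>g. ?P g" using assms by blast
 from someI_ex[OF this] obtain p' q' where *: "Fract p q = Fract p' q'" "p' \<noteq> 0" "q' \<noteq> 0"
   "deg (Fract p q) = int_exponents (lead_monomial p') - int_exponents (lead_monomial q')"
  unfolding deg_def by blast
 have "p * q' = p' * q" using * assms by (simp add: eq_fract)
 then have "lead_monomial p + lead_monomial q' = lead_monomial p' + lead_monomial q"
  using * assms by (metis lead_monomial_mult)
 then have "int_exponents (lead_monomial p) + int_exponents (lead_monomial q') =
   int_exponents (lead_monomial p') + int_exponents (lead_monomial q)"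
  by (metis int_exponents_add)
 note e = this
 have "int_exponents (lead_monomial p) - int_exponents (lead_monomial q) =
  (int_exponents (lead_monomial p) + int_exponents (lead_monomial q')) -
  (int_exponents (lead_monomial q) + int_exponents (lead_monomial q'))" by simp
 also have "\<dots> = int_exponents (lead_monomial p') - int_exponents (lead_monomial q')"
  unfolding e by simp
 finally show ?thesis using *(4) by simp
qed

lemma ratfun_nonzeroE:
 fixes z :: "'k::field ratfun"
 assumes "z \<noteq> 0" obtains p q where "z = Fract p q" "p \<noteq> 0" "q \<noteq> 0"
proof (cases z)
 case (Fract p q)
 then have "p \<noteq> 0" using assms by (auto simp: Zero_fract_def eq_fract)
 then show ?thesis using Fract that by blast
qed

lemma deg_mult: assumes "x \<noteq> 0" "y \<noteq> 0" shows "deg (x * y) = deg x + deg y"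
proof -
 obtain p q where p: "x = Fract p q" "p \<noteq> 0" "q \<noteq> 0" by (rule ratfun_nonzeroE[OF assms(1)])
 obtain r s where r: "y = Fract r s" "r \<noteq> 0" "s \<noteq> 0" by (rule ratfun_nonzeroE[OF assms(2)])
 show ?thesis using p r by (simp add: deg_Fract lead_monomial_mult int_exponents_add)
qed

lemma single_nonzero: "single m (c :: 'c::zero) = 0 \<longleftrightarrow> c = 0"
 by (metis lookup_single_eq lookup_zero single_zero)

lemma deg_scalar: assumes "c \<noteq> 0" shows "deg (scalar c) = 0"
proof -
 have "(const c :: ((nat \<Rightarrow>\<^sub>0 nat) \<Rightarrow>\<^sub>0 nat) \<Rightarrow>\<^sub>0 'a) \<noteq> 0"
  "lead_monomial (const c :: ((nat \<Rightarrow>\<^sub>0 nat) \<Rightarrow>\<^sub>0 nat) \<Rightarrow>\<^sub>0 'a) = 0" "lead_monomial (1 :: ((nat \<Rightarrow>\<^sub>0 nat) \<Rightarrow>\<^sub>0 nat) \<Rightarrow>\<^sub>0 'a) = 0"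
  using assms by (auto simp: const_def lead_monomial_def single_nonzero)
 then show ?thesis by (simp add: scalar_def deg_Fract)
qed

lemma deg_base: "x \<in> base_field \<Longrightarrow> x \<noteq> 0 \<Longrightarrow> deg x = 0"
 using deg_scalar homD(1)[OF scalar_hom] by (metis base_field_eq rangeE)

lemma deg_1: "deg (1 :: 'k::field ratfun) = 0"
 using deg_base[of 1] subfieldD(2)[OF subfield_base] by simp

lemma gen_coeff_nonzero: "gen_coeff v \<noteq> 0"
 by (simp add: gen_coeff_def var_def Zero_fract_def eq_fract single_nonzero)

lemma deg_gen_coeff: "deg (gen_coeff v) = single v 1"
proof -
 have "var v \<noteq> (0 :: ((nat \<Rightarrow>\<^sub>0 nat) \<Rightarrow>\<^sub>0 nat) \<Rightarrow>\<^sub>0 'a)" "lead_monomial (var v :: ((nat \<Rightarrow>\<^sub>0 nat) \<Rightarrow>\<^sub>0 nat) \<Rightarrow>\<^sub>0 'a) = single v 1"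
  "lead_monomial (1 :: ((nat \<Rightarrow>\<^sub>0 nat) \<Rightarrow>\<^sub>0 nat) \<Rightarrow>\<^sub>0 'a) = 0"
  by (auto simp: var_def lead_monomial_def single_nonzero)
 then show ?thesis
  by (simp add: gen_coeff_def deg_Fract)
   (rule poly_mapping_eqI, simp add: lookup_int_exponents lookup_minus lookup_single when_def)
qed

lemma deg_inverse: assumes "x \<noteq> 0" shows "deg (inverse x) = - deg x"
proof -
 have "deg (x * inverse x) = deg x + deg (inverse x)" by (rule deg_mult) (use assms in auto)
 then show ?thesis using assms by (simp add: deg_1 eq_neg_iff_add_eq_0 add.commute)
qed

lemma deg_divide: "x \<noteq> 0 \<Longrightarrow> y \<noteq> 0 \<Longrightarrow> deg (x / y) = deg x - deg y"
 by (simp add: divide_inverse deg_mult deg_inverse)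

lemma deg_power: "x \<noteq> 0 \<Longrightarrow> deg (x ^ n) = frag_cmul (int n) (deg x)"
 by (induction n) (simp_all add: deg_1 deg_mult frag_cmul_distrib)

lemma deg_prod: "finite A \<Longrightarrow> (\<And>a. a \<in> A \<Longrightarrow> f a \<noteq> 0) \<Longrightarrow> deg (prod f A) = (\<Sum>a\<in>A. deg (f a))"
 by (induction A rule: finite_induct) (simp_all add: deg_1 deg_mult)

lemma deg_uminus: "x \<noteq> 0 \<Longrightarrow> deg (- x) = deg x"
 using deg_mult[of "-1" x] deg_base[of "-1"] subfieldD(5)[OF subfield_base subfieldD(2)[OF subfield_base]] by simp

lemma common_denominator:
 fixes x y :: "'k::field ratfun"
 assumes "x \<noteq> 0" "y \<noteq> 0"
 obtains p r q where "x = Fract p q" "y = Fract r q" "p \<noteq> 0" "r \<noteq> 0" "q \<noteq> 0"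
proof -
 obtain p q where p: "x = Fract p q" "p \<noteq> 0" "q \<noteq> 0" by (rule ratfun_nonzeroE[OF assms(1)])
 obtain r s where r: "y = Fract r s" "r \<noteq> 0" "s \<noteq> 0" by (rule ratfun_nonzeroE[OF assms(2)])
 show ?thesis using p r by (intro that[of "p * s" "q * s" "r * q"]) (auto simp: eq_fract)
qed

lemma deg_less_iff:
 assumes "p \<noteq> 0" "r \<noteq> 0" "q \<noteq> 0"
 shows "deg (Fract p q) < deg (Fract r q) \<longleftrightarrow> lead_monomial p < lead_monomial r"
 using assms by (simp add: deg_Fract int_exponents_less)

lemma deg_add_dominant:
 fixes x y :: "'k::field ratfun"
 assumes x: "x \<noteq> 0" and y: "y \<noteq> 0" "deg y < deg x"
 shows "x + y \<noteq> 0 \<and> deg (x + y) = deg x"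
proof -
 obtain p r q where *: "x = Fract p q" "y = Fract r q" "p \<noteq> 0" "r \<noteq> 0" "q \<noteq> 0"
  by (rule common_denominator[OF x y(1)])
 have lt: "lead_monomial r < lead_monomial p" using y(2) * by (simp add: deg_less_iff)
 have "lead_monomial p \<notin> keys r" using lead_monomial_ge[of "lead_monomial p" r] lt by auto
 then have in1: "lead_monomial p \<in> keys (p + r)"
  using lead_monomial_in[OF *(3)] by (simp add: in_keys_iff lookup_add)
 have lm: "lead_monomial (p + r) = lead_monomial p"
 proof (rule lead_monomial_eqI[OF in1])
  fix m assume "m \<in> keys (p + r)"
  then have "m \<in> keys p \<or> m \<in> keys r" using Poly_Mapping.keys_add[of p r] by blast
  then show "m \<le> lead_monomial p" using lead_monomial_ge[of m p] lead_monomial_ge[of m r] lt by auto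
 qed
 have nz: "p + r \<noteq> 0" using in1 by auto
 have "x + y = Fract ((p + r) * q) (q * q)" using * by (simp add: algebra_simps)
 also have "\<dots> = Fract (p + r) q" using * by (simp add: eq_fract)
 finally have xy: "x + y = Fract (p + r) q" .
 show ?thesis unfolding xy using nz * lm by (simp add: deg_Fract) (simp add: Zero_fract_def eq_fract)
qed

lemma deg_sum_less:
 fixes f :: "'i \<Rightarrow> 'k::field ratfun"
 assumes "finite A" "\<And>i. i \<in> A \<Longrightarrow> f i = 0 \<or> deg (f i) < g"
 shows "sum f A = 0 \<or> deg (sum f A) < g"
 using assms
proof (induction A rule: finite_induct)
 case (insert a A)
 have IH: "sum f A = 0 \<or> deg (sum f A) < g" using insert by simp
 have fa: "f a = 0 \<or> deg (f a) < g" using insert by simp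
 have eq: "sum f (insert a A) = f a + sum f A" using insert by simp
 show ?case
 proof (cases "f a = 0 \<or> sum f A = 0 \<or> f a + sum f A = 0")
  case True then show ?thesis using IH fa unfolding eq by auto
 next
  case False
  let ?x = "f a" and ?y = "sum f A"
  consider "deg ?y < deg ?x" | "deg ?x < deg ?y" | "deg ?x = deg ?y" by force
  then show ?thesis
  proof cases
   case 1 then show ?thesis using deg_add_dominant[of ?x ?y] False fa unfolding eq by auto
  next
   case 2 then show ?thesis using deg_add_dominant[of ?y ?x] False IH unfolding eq by (auto simp: add.commute)
  next
   case 3
   have "\<not> deg ?x < deg (?x + ?y)"
   proof
    assume lt: "deg ?x < deg (?x + ?y)"
    have "(?x + ?y) + - ?x \<noteq> 0 \<and> deg ((?x + ?y) + - ?x) = deg (?x + ?y)"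
     by (rule deg_add_dominant) (use False lt in \<open>auto simp: deg_uminus\<close>)
    then show False using lt 3 by simp
   qed
   then show ?thesis using False fa unfolding eq by auto
  qed
 qed
qed simp

lemma deg_sum_dominant:
 fixes f :: "'i \<Rightarrow> 'k::field ratfun"
 assumes "finite A" "i \<in> A" "f i \<noteq> 0" "\<And>j. j \<in> A \<Longrightarrow> j \<noteq> i \<Longrightarrow> f j = 0 \<or> deg (f j) < deg (f i)"
 shows "sum f A \<noteq> 0 \<and> deg (sum f A) = deg (f i)"
proof -
 have "sum f A = f i + sum f (A - {i})" using assms by (simp add: sum.remove)
 moreover have "sum f (A - {i}) = 0 \<or> deg (sum f (A - {i})) < deg (f i)"
  by (rule deg_sum_less) (use assms in auto)
 ultimately show ?thesis
  using deg_add_dominant[OF assms(3), of "sum f (A - {i})"] assms(3)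
  by (cases "sum f (A - {i}) = 0") auto
qed

text \<open>Different monomials in elements with independent degrees have different degrees, so they
 cannot cancel.\<close>

lemma independent_degrees_alg_independent:
 fixes S :: "'k::field ratfun set"
 assumes S: "finite S" "0 \<notin> S"
  and ind: "\<And>c. (\<Sum>s\<in>S. frag_cmul (c s) (deg s)) = 0 \<Longrightarrow> \<forall>s\<in>S. c s = 0"
 shows "alg_independent base_field S"
 unfolding alg_independent_iff
proof (intro allI impI, rule ccontr)
 fix p :: "('k ratfun \<Rightarrow>\<^sub>0 nat) \<Rightarrow>\<^sub>0 'k ratfun"
 assume p: "poly_over base_field S p" "ev id id p = 0" "p \<noteq> 0"
 let ?K = "keys p" and ?t = "\<lambda>m. lookup p m * mon id m"
 let ?D = "\<lambda>m. \<Sum>s\<in>S. frag_cmul (int (lookup m s)) (deg s)"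
 have keys: "keys m \<subseteq> S" if "m \<in> ?K" for m using p(1) that by (auto simp: poly_over_def)
 have mon: "mon id m = (\<Prod>s\<in>S. s ^ lookup m s)" if "m \<in> ?K" for m
  using mon_superset[OF S(1) keys[OF that], of id] by simp
 have t0: "?t m \<noteq> 0" if "m \<in> ?K" for m
  using that S by (auto simp: mon in_keys_iff)
 have degt: "deg (?t m) = ?D m" if "m \<in> ?K" for m
 proof -
  have c: "lookup p m \<noteq> 0" "deg (lookup p m) = 0"
   using that p(1) by (auto simp: poly_over_def in_keys_iff deg_base)
  have s: "s ^ lookup m s \<noteq> 0" if "s \<in> S" for s using S that by auto
  have "deg (mon id m) = ?D m"
   unfolding mon[OF that] by (subst deg_prod[OF S(1) s], assumption, rule sum.cong)
    (use S in \<open>auto intro!: deg_power\<close>)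
  then show ?thesis using c t0[OF that] by (simp add: deg_mult)
 qed
 have inj: "m = m'" if "m \<in> ?K" "m' \<in> ?K" "?D m = ?D m'" for m m'
 proof (rule poly_mapping_eqI)
  fix s
  have "(\<Sum>s\<in>S. frag_cmul (int (lookup m s) - int (lookup m' s)) (deg s)) = 0"
   using that(3) by (simp add: frag_cmul_diff_distrib sum_subtractf)
  from ind[OF this] have "\<forall>s\<in>S. lookup m s = lookup m' s" by simp
  moreover have "lookup m s = 0" "lookup m' s = 0" if "s \<notin> S"
   using keys[OF \<open>m \<in> ?K\<close>] keys[OF \<open>m' \<in> ?K\<close>] that by (auto simp: in_keys_iff subset_iff)
  ultimately show "lookup m s = lookup m' s" by (cases "s \<in> S") auto
 qed
 have "?K \<noteq> {}" using p(3) by simp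
 then have "Max (?D ` ?K) \<in> ?D ` ?K" by (intro Max_in) auto
 then obtain m where m: "m \<in> ?K" "Max (?D ` ?K) = ?D m" by auto
 have "sum ?t ?K \<noteq> 0 \<and> deg (sum ?t ?K) = deg (?t m)"
 proof (rule deg_sum_dominant)
  show "?t m \<noteq> 0" by (rule t0[OF m(1)])
  fix m' assume m': "m' \<in> ?K" "m' \<noteq> m"
  have "?D m' \<le> ?D m" unfolding m(2)[symmetric] using m'(1) by (intro Max_ge) auto
  then show "?t m' = 0 \<or> deg (?t m') < deg (?t m)"
   using inj[OF m'(1) m(1)] m'(2) unfolding degt[OF m(1)] degt[OF m'(1)] by (auto simp: order_less_le)
 qed (use m in auto)
 then show False using p(2) by (simp add: ev_def)
qed

text \<open>Infinite descent: in an integral relation all coefficients are divisible by \<open>q\<close>, and dividing by \<open>q\<close>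
 gives a relation again.\<close>

lemma independent_mod:
 fixes g :: "'s \<Rightarrow> exponents" and q :: int
 assumes S: "finite S" and q: "q > 1"
  and mod: "\<And>c. (\<And>v. q dvd (\<Sum>s\<in>S. c s * lookup (g s) v)) \<Longrightarrow> \<forall>s\<in>S. q dvd c s"
  and c: "(\<Sum>s\<in>S. frag_cmul (c s) (g s)) = 0"
 shows "\<forall>s\<in>S. c s = 0"
 using c
proof (induction "\<Sum>s\<in>S. nat \<bar>c s\<bar>" arbitrary: c rule: less_induct)
 case less
 have lk: "(\<Sum>s\<in>S. c s * lookup (g s) v) = 0" for v
  using arg_cong[OF less.prems, of "\<lambda>x. lookup x v"] by (simp add: lookup_sum)
 then have dv: "\<forall>s\<in>S. q dvd c s" by (intro mod) simp
 define c' where "c' s = c s div q" for s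
 have cc: "c s = q * c' s" if "s \<in> S" for s using dv that by (simp add: c'_def)
 show ?case
 proof (rule ccontr)
  assume "\<not> ?case"
  then obtain s where s: "s \<in> S" "c s \<noteq> 0" by blast
  have "(\<Sum>s\<in>S. nat \<bar>c' s\<bar>) < (\<Sum>s\<in>S. nat \<bar>c s\<bar>)"
  proof (rule sum_strict_mono_ex1[OF S])
   show "\<forall>s\<in>S. nat \<bar>c' s\<bar> \<le> nat \<bar>c s\<bar>"
   proof
    fix s assume "s \<in> S"
    have "\<bar>c' s\<bar> \<le> q * \<bar>c' s\<bar>" using q mult_right_mono[of 1 q "\<bar>c' s\<bar>"] by simp
    then show "nat \<bar>c' s\<bar> \<le> nat \<bar>c s\<bar>" using cc[OF \<open>s \<in> S\<close>] q by (simp add: abs_mult)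
   qed
   have "c' s \<noteq> 0" using cc[OF s(1)] s(2) by auto
   then have "\<bar>c' s\<bar> < q * \<bar>c' s\<bar>" using q by simp
   then show "\<exists>a\<in>S. nat \<bar>c' a\<bar> < nat \<bar>c a\<bar>"
    using cc[OF s(1)] s q by (intro bexI[of _ s]) (auto simp: abs_mult)
  qed
  moreover have "(\<Sum>s\<in>S. frag_cmul (c' s) (g s)) = 0"
  proof (rule poly_mapping_eqI)
   fix v
   have "q * (\<Sum>s\<in>S. c' s * lookup (g s) v) = (\<Sum>s\<in>S. c s * lookup (g s) v)"
    unfolding sum_distrib_left by (rule sum.cong) (auto simp: cc)
   then show "lookup (\<Sum>s\<in>S. frag_cmul (c' s) (g s)) v = lookup 0 v"
    using lk[of v] q by (simp add: lookup_sum)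
  qed
  ultimately have "\<forall>s\<in>S. c' s = 0" by (rule less.hyps)
  then show False using cc[OF s(1)] s by simp
 qed
qed

lemma gen_coeff_inj: "gen_coeff v = gen_coeff w \<longleftrightarrow> v = w"
proof
 assume "gen_coeff v = (gen_coeff w :: 'a ratfun)"
 then have "deg (gen_coeff v :: 'a ratfun) = deg (gen_coeff w :: 'a ratfun)" by simp
 then have "single v (1::int) = single w 1" by (simp add: deg_gen_coeff)
 then show "v = w" by (metis lookup_single_eq lookup_single_not_eq zero_neq_one)
qed simp

lemma trdeg_ge_degrees:
 fixes z :: "'i \<Rightarrow> 'k::field ratfun" and q :: int
 assumes I: "finite I" and z: "\<And>i. i \<in> I \<Longrightarrow> z i \<noteq> 0" "\<And>i. i \<in> I \<Longrightarrow> z i \<in> L" and q: "q > 1"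
  and mod: "\<And>c. (\<And>v. q dvd (\<Sum>i\<in>I. c i * lookup (deg (z i)) v)) \<Longrightarrow> \<forall>i\<in>I. q dvd c i"
 shows "alg_independent base_field (z ` I)" "enat (card I) \<le> trdeg base_field L"
proof -
 have inj: "inj_on z I"
 proof (rule inj_onI, rule ccontr)
  fix i j assume ij: "i \<in> I" "j \<in> I" "z i = z j" "i \<noteq> j"
  define c where "c = (\<lambda>l. if l = i then 1 else if l = j then - 1 else (0::int))"
  have "(\<Sum>l\<in>I. c l * lookup (deg (z l)) v) = 0" for v
  proof -
   have "(\<Sum>l\<in>I. c l * lookup (deg (z l)) v) = (\<Sum>l\<in>{i, j}. c l * lookup (deg (z l)) v)"
    using ij I by (intro sum.mono_neutral_right) (auto simp: c_def)
   then show ?thesis using ij by (simp add: c_def)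
  qed
  then have "\<forall>l\<in>I. q dvd c l" by (intro mod) simp
  then have "q dvd 1" using ij(1) by (auto simp: c_def dest: bspec[of _ _ i])
  then show False using q by (simp add: zdvd1_eq)
 qed
 show ind: "alg_independent base_field (z ` I)"
 proof (rule independent_degrees_alg_independent)
  show "finite (z ` I)" "0 \<notin> z ` I" using I z by auto
  fix c assume "(\<Sum>s\<in>z ` I. frag_cmul (c s) (deg s)) = 0"
  then have "(\<Sum>i\<in>I. frag_cmul ((c \<circ> z) i) ((deg \<circ> z) i)) = 0" by (simp add: sum.reindex[OF inj])
  from independent_mod[OF I q _ this] show "\<forall>s\<in>z ` I. c s = 0" using mod by auto
 qed
 show "enat (card I) \<le> trdeg base_field L"
  using trdeg_ge[OF _ _ ind, of L] z(2) I by (simp add: card_image[OF inj] image_subset_iff)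
qed

lemma gen_coeff_alg_independent:
 assumes "finite V" shows "alg_independent base_field (gen_coeff ` V :: 'k::field ratfun set)"
proof (rule trdeg_ge_degrees(1)[of _ _ UNIV 2])
 fix c :: "(nat \<Rightarrow>\<^sub>0 nat) \<Rightarrow> int"
 assume *: "\<And>v. 2 dvd (\<Sum>i\<in>V. c i * lookup (deg (gen_coeff i :: 'k ratfun)) v)"
 show "\<forall>i\<in>V. 2 dvd c i"
 proof
  fix i assume i: "i \<in> V"
  have "(\<Sum>j\<in>V. c j * lookup (deg (gen_coeff j :: 'k ratfun)) i) = (\<Sum>j\<in>V. if j = i then c i else 0)"
   by (rule sum.cong) (auto simp: deg_gen_coeff lookup_single when_def)
  then show "2 dvd c i" using *[of i] i assms by simp
 qed
qed (use assms gen_coeff_nonzero in auto)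

lemma gen_coeff_dual_derivations:
 assumes "finite V"
 shows "\<exists>D :: (nat \<Rightarrow>\<^sub>0 nat) \<Rightarrow> 'k::field_char_0 ratfun \<Rightarrow> 'k ratfun. \<forall>v\<in>V. derivation (D v) \<and>
  (\<forall>x\<in>base_field. D v x = 0) \<and> (\<forall>w\<in>V. D v (gen_coeff w) = (if v = w then 1 else 0))"
proof -
 obtain d where d: "\<forall>s\<in>gen_coeff ` V. derivation (d s) \<and> (\<forall>x\<in>base_field. d s x = 0) \<and>
   (\<forall>t\<in>gen_coeff ` V. t \<noteq> s \<longrightarrow> d s t = 0) \<and> d s s = (1 :: 'k ratfun)"
  using alg_independent_dual_basis[OF subfield_base gen_coeff_alg_independent[OF assms]] by (elim exE)
 show ?thesis
  by (rule exI[of _ "\<lambda>v. d (gen_coeff v)"]) (use d in \<open>auto simp: gen_coeff_inj\<close>)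
qed

text \<open>If a substitution has an invertible Jacobian matrix, the substituted elements are
 algebraically independent: every dual derivation for the variables yields one for them.\<close>

lemma jacobian_criterion:
 fixes y :: "(nat \<Rightarrow>\<^sub>0 nat) \<Rightarrow> 'k::field_char_0 ratfun"
 assumes fin: "finite V0" and out: "\<And>v. v \<notin> V0 \<Longrightarrow> y v = gen_coeff v"
  and jac: "\<And>d. derivation d \<Longrightarrow> \<forall>x\<in>base_field. d x = 0 \<Longrightarrow> \<forall>v\<in>V0. d (y v) = 0 \<Longrightarrow> \<forall>v\<in>V0. d (gen_coeff v) = 0"
  and p: "ev scalar y p = 0"
 shows "p = 0"
proof -
 define V where "V = V0 \<union> (\<Union>m\<in>keys p. keys m)"
 have V: "finite V" using fin by (auto simp: V_def)
 obtain D :: "(nat \<Rightarrow>\<^sub>0 nat) \<Rightarrow> 'k ratfun \<Rightarrow> 'k ratfun" where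
  D0: "\<forall>v\<in>V. derivation (D v) \<and> (\<forall>x\<in>base_field. D v x = 0) \<and>
   (\<forall>w\<in>V. D v (gen_coeff w) = (if v = w then 1 else 0))"
  using gen_coeff_dual_derivations[OF V] by (elim exE)
 have D: "\<And>v. v \<in> V \<Longrightarrow> derivation (D v)" "\<And>v x. v \<in> V \<Longrightarrow> x \<in> base_field \<Longrightarrow> D v x = 0"
  "\<And>v w. v \<in> V \<Longrightarrow> w \<in> V \<Longrightarrow> D v (gen_coeff w) = (if v = w then 1 else 0)"
  using D0 by auto
 let ?Q = "\<lambda>v e. derivation e \<and> (\<forall>x\<in>base_field. e x = 0) \<and> (\<forall>w\<in>V. w \<noteq> v \<longrightarrow> e (y w) = 0) \<and> e (y v) = 1"
 have "\<forall>v\<in>V. \<exists>e. ?Q v e"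
 proof
  fix v assume v: "v \<in> V"
  have "card (V - {v}) < card V" using v V by (intro psubset_card_mono) auto
  then obtain l where l: "\<exists>s\<in>V. l s \<noteq> 0" "\<forall>c\<in>V - {v}. (\<Sum>s\<in>V. l s * D s (y c)) = 0"
   using nontrivial_linear_relation[of "V - {v}" V "\<lambda>s c. D s (y c)"] V by blast
  let ?e = "\<lambda>x. \<Sum>s\<in>V. l s * D s x"
  have e: "derivation ?e" by (rule derivation_combination[OF D(1)])
  have eb: "\<forall>x\<in>base_field. ?e x = 0" using D(2) by simp
  have eg: "?e (gen_coeff w) = l w" if "w \<in> V" for w
  proof -
   have "?e (gen_coeff w) = (\<Sum>s\<in>V. if s = w then l w else 0)"
    by (rule sum.cong) (use D(3) that in auto)
   then show ?thesis using that V by simp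
  qed
  have nz: "?e (y v) \<noteq> 0"
  proof
   assume "?e (y v) = 0"
   then have all: "\<forall>c\<in>V. ?e (y c) = 0" using l(2) by blast
   have "?e (gen_coeff w) = 0" if "w \<in> V" for w
   proof (cases "w \<in> V0")
    case True
    have "\<forall>v\<in>V0. ?e (y v) = 0" using all by (auto simp: V_def)
    show ?thesis by (rule bspec[OF jac[OF e eb \<open>\<forall>v\<in>V0. ?e (y v) = 0\<close>] True])
   next
    case False then show ?thesis using bspec[OF all that] out[of w] by simp
   qed
   then show False using l(1) eg by auto
  qed
  have "derivation (\<lambda>x. ?e x / ?e (y v))"
   using e unfolding derivation_def by (simp add: add_divide_distrib)
  then show "\<exists>e. ?Q v e"
   by (rule_tac x="\<lambda>x. ?e x / ?e (y v)" in exI) (use nz eb l(2) in auto)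
 qed
 then obtain e where e: "\<forall>v\<in>V. ?Q v (e v)" using bchoice[of V ?Q] by auto
 have "scalar (lookup p m) = 0" if "m \<in> keys p" for m
  by (rule dual_derivations_monomials_independent[of V e base_field y "keys p"
     "\<lambda>m. scalar (lookup p m)"])
   (use e p that in \<open>auto simp: ev_def V_def base_field_eq subfield_base[unfolded base_field_eq]\<close>)
 then have "lookup p m = 0" if "m \<in> keys p" for m
  using hom_inj[OF scalar_hom, of "lookup p m" 0] homD(1)[OF scalar_hom] that by metis
 then show "p = 0" by (intro poly_mapping_eqI) (metis in_keys_iff lookup_zero)
qed

section \<open>Linear substitutions\<close>

definition row_times :: "nat \<Rightarrow> (nat \<Rightarrow> 'a::comm_ring_1) \<Rightarrow> 'a mat \<Rightarrow> nat \<Rightarrow> 'a" where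
 "row_times n x g j = (\<Sum>i<n. x i * g $$ (i, j))"

lemma det_in_subfield:
 assumes L: "is_subfield L" and A: "A \<in> carrier_mat n n" "\<And>i j. i < n \<Longrightarrow> j < n \<Longrightarrow> A $$ (i, j) \<in> L"
 shows "det A \<in> L"
proof -
 have "det A = (\<Sum>p\<in>{p. p permutes {0..<n}}. signof p * (\<Prod>i = 0..<n. A $$ (i, p i)))"
  using A(1) by (rule det_def')
 also have "\<dots> \<in> L"
 proof (intro subfield_sum[OF L] subfieldD(4)[OF L] subfield_prod[OF L])
  fix p assume p: "p \<in> {p. p permutes {0..<n}}"
  show "signof p \<in> L" using subfield_closed[OF L] by (simp add: sign_def)
  fix i assume "i \<in> {0..<n}"
  then show "A $$ (i, p i) \<in> L" using p A(2)[of i "p i"] permutes_in_image[of p "{0..<n}" i] by auto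
 qed
 finally show ?thesis .
qed

lemma GL_I:
 assumes L: "is_subfield L" and A: "A \<in> carrier_mat n n" "\<And>i j. i < n \<Longrightarrow> j < n \<Longrightarrow> A $$ (i, j) \<in> L"
  and d: "det A \<noteq> 0"
 shows "A \<in> GL n L"
proof -
 have el: "elements_mat B \<subseteq> L" if "B \<in> carrier_mat n n" "\<And>i j. i < n \<Longrightarrow> j < n \<Longrightarrow> B $$ (i, j) \<in> L" for B
  using that by (auto simp: elements_mat_def)
 define h where "h = inverse (det A) \<cdot>\<^sub>m adj_mat A"
 note adj = adj_mat[OF A(1)]
 have h: "h \<in> carrier_mat n n" using adj(1) by (simp add: h_def)
 have "h $$ (i, j) \<in> L" if ij: "i < n" "j < n" for i j
 proof -
  have "det (mat_delete A j i) \<in> L"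
  proof (rule det_in_subfield[OF L])
   show "mat_delete A j i \<in> carrier_mat (n - 1) (n - 1)" using A(1) by (rule mat_delete_carrier)
   fix k l assume kl: "k < n - 1" "l < n - 1"
   then have "insert_index j k < n" "insert_index i l < n" by (auto simp: insert_index_def)
   moreover have "mat_delete A j i $$ (k, l) = A $$ (insert_index j k, insert_index i l)"
    using kl A(1) by (auto simp: mat_delete_def insert_index_def)
   ultimately show "mat_delete A j i $$ (k, l) \<in> L" using A(2) by simp
  qed
  then show ?thesis using ij A(1) adj(1) det_in_subfield[OF L A]
   by (auto simp: h_def adj_mat_def cofactor_def intro!: subfield_closed L)
 qed
 moreover have "A * h = 1\<^sub>m n" "h * A = 1\<^sub>m n"
 proof -
  have "A * h = inverse (det A) \<cdot>\<^sub>m (A * adj_mat A)"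
   unfolding h_def by (rule mult_smult_distrib[OF A(1) adj(1)])
  then show "A * h = 1\<^sub>m n" using adj(2) d by (auto intro!: eq_matI)
  have "h * A = inverse (det A) \<cdot>\<^sub>m (adj_mat A * A)"
   unfolding h_def by (rule mult_smult_assoc_mat[OF adj(1) A(1)])
  then show "h * A = 1\<^sub>m n" using adj(3) d by (auto intro!: eq_matI)
 qed
 ultimately show ?thesis unfolding GL_def using A el[OF A] el[OF h] h by blast
qed

lemma GL_D:
 assumes g: "g \<in> GL n L"
 shows "g \<in> carrier_mat n n" "i < n \<Longrightarrow> j < n \<Longrightarrow> g $$ (i, j) \<in> L" "det g \<noteq> 0"
  "\<exists>h\<in>carrier_mat n n. \<forall>x. \<forall>l<n. row_times n (row_times n x g) h l = x l"
proof -
 show c: "g \<in> carrier_mat n n" using g by (simp add: GL_def)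
 show "i < n \<Longrightarrow> j < n \<Longrightarrow> g $$ (i, j) \<in> L" using g elements_matI[OF c, of i j] by (auto simp: GL_def)
 obtain h where h: "h \<in> carrier_mat n n" "g * h = 1\<^sub>m n" using g by (auto simp: GL_def)
 have "det g * det h = 1" using det_mult[OF c h(1)] h(2) by simp
 then show "det g \<noteq> 0" by auto
 have "row_times n (row_times n x g) h l = x l" if l: "l < n" for x l
 proof -
  have "row_times n (row_times n x g) h l = (\<Sum>j<n. \<Sum>i<n. x i * (g $$ (i, j) * h $$ (j, l)))"
   by (simp add: row_times_def sum_distrib_right mult.assoc)
  also have "\<dots> = (\<Sum>i<n. \<Sum>j<n. x i * (g $$ (i, j) * h $$ (j, l)))" by (rule sum.swap)
  also have "\<dots> = (\<Sum>i<n. x i * (\<Sum>j<n. g $$ (i, j) * h $$ (j, l)))" by (simp add: sum_distrib_left)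
  also have "\<dots> = (\<Sum>i<n. if i = l then x l else 0)"
  proof (rule sum.cong[OF refl])
   fix i assume i: "i \<in> {..<n}"
   have "(\<Sum>j<n. g $$ (i, j) * h $$ (j, l)) = (g * h) $$ (i, l)"
    using i l c h(1) by (simp add: scalar_prod_def lessThan_atLeast0)
   then show "x i * (\<Sum>j<n. g $$ (i, j) * h $$ (j, l)) = (if i = l then x l else 0)"
    using h(2) i l by simp
  qed
  finally show ?thesis using l by simp
 qed
 then show "\<exists>h\<in>carrier_mat n n. \<forall>x. \<forall>l<n. row_times n (row_times n x g) h l = x l" using h(1) by blast
qed

lemma row_times_nonzero:
 assumes g: "g \<in> GL n L" and x: "i < n" "x i \<noteq> 0"
 shows "\<exists>j<n. row_times n x g j \<noteq> 0"
proof (rule ccontr)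
 assume a: "\<not> ?thesis"
 obtain h where "\<forall>x. \<forall>l<n. row_times n (row_times n x g) h l = x l" using GL_D(4)[OF g] by blast
 then have "x i = row_times n (row_times n x g) h i" using x by simp
 also have "\<dots> = 0" unfolding row_times_def[of n "row_times n x g"] using a by (intro sum.neutral) auto
 finally show False using x by simp
qed

lemma ev_subst_act:
 assumes "g \<in> carrier_mat n n"
 shows "ev id x (subst_act g f) = ev id (row_times n x g) f"
proof -
 note h = ev_hom[OF hom_id(1), of x]
 have s: "(\<Sum>i<dim_row g. g $$ (i, j) * x i) = row_times n x g j" for j
  using assms by (simp add: row_times_def mult.commute)
 show ?thesis
  unfolding subst_act_def ev_def[of id "row_times n x g"] mon_def
  by (simp add: hom_sum[OF h] homD(4)[OF h] hom_prod[OF h] hom_power[OF h]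
    ev_const[OF hom_id(1)] ev_var[OF hom_id(1)] s)
qed

lemma monomials_keys: "m \<in> monomials n d \<Longrightarrow> j \<in> keys m \<Longrightarrow> j < n"
 by (auto simp: monomials_def)

lemma ev_cong_variables:
 assumes "keys f \<subseteq> monomials n d" "\<And>i. i < n \<Longrightarrow> x i = y i"
 shows "ev id x f = ev id y f"
proof -
 have "mon x m = mon y m" if "m \<in> keys f" for m
  unfolding mon_def using assms monomials_keys[of m n d] that by (intro prod.cong) auto
 then show ?thesis by (simp add: ev_def)
qed

lemma ev_in_subfield:
 assumes L: "is_subfield L" and f: "f \<in> forms n d L" and x: "\<And>i. i < n \<Longrightarrow> x i \<in> L"
 shows "ev id x f \<in> L"
 unfolding ev_def mon_def
 using f x by (intro subfield_closed L) (auto simp: forms_def monomials_def)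

lemma ev_const_mult: "ev id x (const c * f) = c * ev id x f"
 by (simp add: ev_mult ev_const)

lemma ev_general_form:
 "ev id x (general_form n d) = (\<Sum>m\<in>monomials n d. gen_coeff m * mon x m)"
proof -
 have "keys (general_form n d) \<subseteq> monomials n d"
  by (auto simp: in_keys_iff lookup_general_form split: if_splits)
 then have "ev id x (general_form n d) =
   (\<Sum>m\<in>monomials n d. id (lookup (general_form n d) m) * mon x m)"
  by (intro ev_superset finite_monomials) auto
 then show ?thesis by (simp add: lookup_general_form)
qed

lemma keys_general_form: "keys (general_form n d) \<subseteq> monomials n d"
 by (auto simp: in_keys_iff lookup_general_form split: if_splits)

section \<open>Values of the general form\<close>

lemma frag_cmul_strict_mono: "c > 0 \<Longrightarrow> (frag_cmul c x < frag_cmul c y) = (x < (y :: exponents))"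
 by (simp add: less_exponents_iff)

lemma sum_frag_cmul_mono:
 fixes g h :: "'i \<Rightarrow> exponents"
 assumes "finite A" "\<And>i. i \<in> A \<Longrightarrow> g i \<le> h i" "\<And>i. i \<in> A \<Longrightarrow> c i > 0"
 shows "(\<Sum>i\<in>A. frag_cmul (int (c i)) (g i)) \<le> (\<Sum>i\<in>A. frag_cmul (int (c i)) (h i))"
proof (rule sum_mono)
 fix i assume i: "i \<in> A"
 show "frag_cmul (int (c i)) (g i) \<le> frag_cmul (int (c i)) (h i)"
  using assms(2)[OF i] assms(3)[OF i] frag_cmul_strict_mono[of "int (c i)" "g i" "h i"]
  by (auto simp: order_le_less)
qed

lemma pure_monomial_less:
 assumes "i < j" "e > 0" shows "single j (d::nat) < single i e"
 unfolding less_exponents_iff using assms by (intro exI[of _ i]) (auto simp: lookup_single when_def)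

lemma single_in_monomials: "i < n \<Longrightarrow> single i d \<in> monomials n d"
 by (auto simp: monomials_def lookup_single when_def)

lemma monomial_degree:
 assumes "m \<in> monomials n d" shows "(\<Sum>j\<in>keys m. lookup m j) = d"
proof -
 have "(\<Sum>j\<in>keys m. lookup m j) = (\<Sum>j<n. lookup m j)"
  using assms by (intro sum.mono_neutral_left) (auto simp: monomials_def in_keys_iff)
 then show ?thesis using assms by (simp add: monomials_def)
qed

text \<open>The lexicographic comparison is decided by the smallest variable that occurs, which is the coefficient
 of the pure power of the last \<open>x\<^sub>j\<close> in \<open>m\<close>; it occurs only on the right.\<close>

lemma mixed_monomial_less:
 assumes m: "m \<in> monomials n d" and d: "d > 0" and mixed: "\<And>j. m \<noteq> single j d"
 shows "frag_cmul (int d) (single m 1) <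
  (\<Sum>j\<in>keys m. frag_cmul (int (lookup m j)) (single (single j d) 1))"
  (is "?l < ?r")
proof -
 let ?K = "keys m"
 have "?K \<noteq> {}" using monomial_degree[OF m] d by auto
 define j0 where "j0 = Max ?K"
 have j0: "j0 \<in> ?K" "\<And>j. j \<in> ?K \<Longrightarrow> j \<le> j0" unfolding j0_def using \<open>?K \<noteq> {}\<close> by auto
 have K: "\<exists>i\<in>?K. i < j0"
 proof (rule ccontr)
  assume "\<not> ?thesis"
  then have "?K = {j0}" using j0 by force
  then have "lookup m j0 = d" using monomial_degree[OF m] by simp
  then have "m = single j0 d"
   using \<open>?K = {j0}\<close> by (intro poly_mapping_eqI) (auto simp: lookup_single when_def in_keys_iff)
  then show False using mixed by blast
 qed
 define i where "i = Min ?K"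
 have i: "i \<in> ?K" "i < j0" "\<And>j. j \<in> ?K \<Longrightarrow> i \<le> j"
  unfolding i_def using \<open>?K \<noteq> {}\<close> K by (auto simp: Min_less_iff)
 let ?v = "single j0 d"
 have vm: "?v < m" unfolding less_exponents_iff
 proof (intro exI conjI allI impI)
  show "lookup ?v i < lookup m i" using i by (simp add: lookup_single when_def in_keys_iff)
  fix w assume "w < i"
  then have "w \<notin> ?K" using i(3) by force
  then show "lookup ?v w = lookup m w"
   using \<open>w < i\<close> i(2) by (simp add: lookup_single when_def in_keys_iff)
 qed
 have vj: "?v < single j d" if "j \<in> ?K" "j \<noteq> j0" for j
  using pure_monomial_less[of j j0 d d] j0(2)[OF that(1)] that d by auto
 have lr: "lookup ?r w = (\<Sum>j\<in>?K. if single j d = w then int (lookup m j) else 0)" for w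
  unfolding lookup_sum by (rule sum.cong) (auto simp: lookup_single when_def)
 show ?thesis unfolding less_exponents_iff[of ?l ?r]
 proof (intro exI[of _ ?v] conjI allI impI)
  have "lookup ?r ?v = (\<Sum>j\<in>?K. if j = j0 then int (lookup m j0) else 0)"
  proof -
   have "(if single j d = ?v then int (lookup m j) else 0) =
    (if j = j0 then int (lookup m j0) else 0)" if "j \<in> ?K" for j
   proof -
    have "single j d = ?v \<longleftrightarrow> j = j0" using vj[of j] that by (cases "j = j0") auto
    then show ?thesis by simp
   qed
   then show ?thesis unfolding lr by (rule sum.cong[OF refl])
  qed
  also have "\<dots> > 0" using j0(1) by (simp add: in_keys_iff)
  finally show "lookup ?l ?v < lookup ?r ?v"
   using vm by (simp add: lookup_single when_def)
  fix w assume w: "w < ?v"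
  have "lookup ?r w = 0"
  proof (unfold lr, rule sum.neutral, rule ballI)
   fix j assume j: "j \<in> ?K"
   have "w < single j d" using vj[OF j] w by (cases "j = j0") auto
   then show "(if single j d = w then int (lookup m j) else 0) = 0" by auto
  qed
  then show "lookup ?l w = lookup ?r w"
   using order.asym[OF w] vm by (cases "w = m") (auto simp: lookup_single when_def)
 qed
qed

definition pure_degree :: "nat \<Rightarrow> (nat \<Rightarrow> 'k::field ratfun) \<Rightarrow> nat \<Rightarrow> exponents" where
 "pure_degree d y i = single (single i d) 1 + frag_cmul (int d) (deg (y i))"

lemma pure_degree_inj:
 assumes d: "d \<ge> 2" and e: "pure_degree d y i = pure_degree d z j" shows "i = j"
proof (rule ccontr)
 assume "i \<noteq> j"
 then have "single j d \<noteq> single i d"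
  using d by (metis lookup_single_eq lookup_single_not_eq not_numeral_le_zero)
 then have "1 + int d * lookup (deg (y i)) (single i d) =
   int d * lookup (deg (z j)) (single i d)"
  using arg_cong[OF e, of "\<lambda>g. lookup g (single i d)"]
  by (simp add: pure_degree_def lookup_add lookup_single when_def)
 then have "int d dvd 1" by (metis dvd_add_left_iff dvd_triv_left)
 then show False using d by simp
qed

text \<open>The pure terms \<open>a y\<^sub>i\<^sup>d\<close> have degrees that differ modulo \<open>d\<close>, so one of them is strictly
 largest; it dominates the mixed terms by \<open>mixed_monomial_less\<close>. Hence nothing cancels.\<close>

lemma general_form_degree:
 fixes y :: "nat \<Rightarrow> 'k::field ratfun"
 assumes d: "d \<ge> 2" and y: "i0 < n" "y i0 \<noteq> 0"
 shows "\<exists>i<n. y i \<noteq> 0 \<and> (\<forall>j<n. j \<noteq> i \<longrightarrow> y j \<noteq> 0 \<longrightarrow> pure_degree d y j < pure_degree d y i) \<and>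
  ev id y (general_form n d) \<noteq> 0 \<and> deg (ev id y (general_form n d)) = pure_degree d y i"
proof -
 let ?I = "{i. i < n \<and> y i \<noteq> 0}" and ?N = "pure_degree d y"
 have "Max (?N ` ?I) \<in> ?N ` ?I" using y by (intro Max_in) auto
 then obtain i where i: "i < n" "y i \<noteq> 0" "Max (?N ` ?I) = ?N i" by auto
 have le: "?N j \<le> ?N i" if "j < n" "y j \<noteq> 0" for j
  unfolding i(3)[symmetric] using that by (intro Max_ge) auto
 have less: "?N j < ?N i" if "j < n" "y j \<noteq> 0" "j \<noteq> i" for j
  using le[OF that(1,2)] pure_degree_inj[OF d, of y j y i] that(3) by (auto simp: order_less_le)
 let ?t = "\<lambda>m. gen_coeff m * mon y m :: 'k ratfun" and ?p = "\<lambda>j. single j d"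
 have pure: "?t (?p j) \<noteq> 0 \<and> deg (?t (?p j)) = ?N j" if "y j \<noteq> 0" for j
  using that d by (simp add: deg_mult gen_coeff_nonzero deg_gen_coeff deg_power pure_degree_def)
 have "sum ?t (monomials n d) \<noteq> 0 \<and> deg (sum ?t (monomials n d)) = deg (?t (?p i))"
 proof (rule deg_sum_dominant[OF finite_monomials single_in_monomials[OF i(1)]])
  show "?t (?p i) \<noteq> 0" using pure[OF i(2)] by blast
  fix m assume m: "m \<in> monomials n d" "m \<noteq> ?p i"
  show "?t m = 0 \<or> deg (?t m) < deg (?t (?p i))"
  proof (cases "mon y m = 0")
   case False
   have yj: "y j \<noteq> 0" "j < n" if "j \<in> keys m" for j
    using False that monomials_keys[OF m(1)] by (auto simp: mon_def in_keys_iff)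
   show ?thesis
   proof (cases "\<exists>j. m = ?p j")
    case True
    then obtain j where j: "m = ?p j" by blast
    then have "j \<in> keys m" using d by simp
    from yj[OF this] have yj': "y j \<noteq> 0" "j < n" by blast+
    have "j \<noteq> i" using j m(2) by blast
    from less[OF yj'(2,1) this] have "deg (?t m) < deg (?t (?p i))"
     unfolding j using pure[OF yj'(1)] pure[OF i(2)] by simp
    then show ?thesis by blast
   next
    case mixed: False
    let ?K = "keys m" and ?c = "lookup m"
    have cp: "?c j > 0" if "j \<in> ?K" for j using that by (simp add: in_keys_iff)
    have "deg (mon y m) = (\<Sum>j\<in>?K. frag_cmul (int (?c j)) (deg (y j)))"
    proof -
     have "y j ^ ?c j \<noteq> 0" if "j \<in> ?K" for j using yj(1)[OF that] by simp
     then have "deg (mon y m) = (\<Sum>j\<in>?K. deg (y j ^ ?c j))"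
      unfolding mon_def by (intro deg_prod) auto
     also have "\<dots> = (\<Sum>j\<in>?K. frag_cmul (int (?c j)) (deg (y j)))"
      using yj(1) by (intro sum.cong refl deg_power)
     finally show ?thesis .
    qed
    then have dt: "deg (?t m) = single m 1 + (\<Sum>j\<in>?K. frag_cmul (int (?c j)) (deg (y j)))"
     using False by (simp add: deg_mult gen_coeff_nonzero deg_gen_coeff)
    have "frag_cmul (int d) (deg (?t m)) =
      frag_cmul (int d) (single m 1) + (\<Sum>j\<in>?K. frag_cmul (int (?c j)) (frag_cmul (int d) (deg (y j))))"
     unfolding dt by (simp add: frag_cmul_distrib2 frag_cmul_sum mult.commute)
    also have "\<dots> < (\<Sum>j\<in>?K. frag_cmul (int (?c j)) (single (?p j) 1)) +
      (\<Sum>j\<in>?K. frag_cmul (int (?c j)) (frag_cmul (int d) (deg (y j))))"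
     using mixed_monomial_less[OF m(1)] mixed d by (intro add_strict_right_mono) auto
    also have "\<dots> = (\<Sum>j\<in>?K. frag_cmul (int (?c j)) (?N j))"
     by (simp add: pure_degree_def frag_cmul_distrib2 sum.distrib)
    also have "\<dots> \<le> (\<Sum>j\<in>?K. frag_cmul (int (?c j)) (?N i))"
     using le yj cp by (intro sum_frag_cmul_mono) auto
    also have "\<dots> = frag_cmul (\<Sum>j\<in>?K. int (?c j)) (?N i)"
     by (rule poly_mapping_eqI) (simp add: lookup_sum sum_distrib_right)
    also have "(\<Sum>j\<in>?K. int (?c j)) = int d" using monomial_degree[OF m(1)] by (simp flip: of_nat_sum)
    finally have "deg (?t m) < ?N i" using d by (simp add: frag_cmul_strict_mono)
    then show ?thesis using pure[OF i(2)] by simp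
   qed
  qed simp
 qed
 then have "sum ?t (monomials n d) \<noteq> 0" "deg (sum ?t (monomials n d)) = ?N i"
  using pure[OF i(2)] by simp_all
 then show ?thesis using i(1,2) less unfolding ev_general_form by (intro exI[of _ i] conjI allI impI)
qed

section \<open>Bounding the essential dimension\<close>

lemma ess_dim_le:
 assumes "is_subfield L" "k \<subseteq> L" "L \<subseteq> K" "g \<in> GL n K" "act g z \<in> X L"
 shows "ess_dim n X act k K z \<le> trdeg k L"
 unfolding ess_dim_def by (rule Inf_lower) (use assms in blast)

lemma ess_dim_ge:
 assumes "\<And>L g. is_subfield L \<Longrightarrow> k \<subseteq> L \<Longrightarrow> L \<subseteq> K \<Longrightarrow> g \<in> GL n K \<Longrightarrow> act g z \<in> X L \<Longrightarrow> r \<le> trdeg k L"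
 shows "r \<le> ess_dim n X act k K z"
 unfolding ess_dim_def by (rule Inf_greatest) (use assms in blast)

lemma GL_UNIV: assumes "g \<in> GL n K" shows "g \<in> GL n UNIV"
 using GL_I[OF subfield_UNIV GL_D(1)[OF assms] _ GL_D(3)[OF assms]] by simp

lemma subst_act_eqI:
 fixes f :: "'a::field_char_0 form"
 assumes "g \<in> carrier_mat n n" "\<And>x. ev id x T = ev id (row_times n x g) f"
 shows "subst_act g f = T"
 by (rule form_eqI) (simp add: ev_subst_act[OF assms(1)] assms(2))

lemma proj_class_mult:
 assumes "c \<noteq> 0" shows "proj_class (const c * f) = proj_class f"
proof -
 have 1: "const a * (const b * f) = const (a * b) * f" for a b
  by (simp add: const_def mult_single flip: mult.assoc)
 show ?thesis
 proof (rule equalityI; rule subsetI)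
  fix h assume "h \<in> proj_class (const c * f)"
  then obtain a where "a \<noteq> 0" "h = const (a * c) * f" by (auto simp: proj_class_def 1)
  then show "h \<in> proj_class f" using assms by (auto simp: proj_class_def intro!: exI[of _ "a * c"])
 next
  fix h assume "h \<in> proj_class f"
  then obtain a where "a \<noteq> 0" "h = const (a / c * c) * f" using assms by (auto simp: proj_class_def)
  then have "a / c \<noteq> 0" "h = const (a / c) * (const c * f)" using assms by (simp_all only: 1) simp
  then show "h \<in> proj_class (const c * f)" unfolding proj_class_def by blast
 qed
qed

lemma hyp_act_class:
 fixes f :: "'a::field_char_0 form"
 assumes g: "g \<in> carrier_mat n n"
 shows "hyp_act g (proj_class f) = proj_class (subst_act g f)"
proof -
 have "subst_act g (const c * f) = const c * subst_act g f" for c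
  by (rule subst_act_eqI[OF g]) (simp add: ev_const_mult ev_subst_act[OF g])
 moreover have "proj_class h = (\<lambda>c. const c * h) ` {c. c \<noteq> 0}" for h :: "'a form"
  by (auto simp: proj_class_def)
 ultimately show ?thesis by (simp add: hyp_act_def image_image)
qed

lemma base_subset_fields:
 "base_field \<subseteq> affine_function_field n d" "base_field \<subseteq> proj_function_field n d"
 by (simp_all add: affine_function_field_def proj_function_field_def adjoin_base)

lemma subfield_function_fields:
 "is_subfield (affine_function_field n d)" "is_subfield (proj_function_field n d)"
 by (simp_all add: affine_function_field_def proj_function_field_def subfield_adjoin)

lemma ed_general_form_le:
 fixes C :: "'k::field_char_0 ratfun set"
 assumes g: "g \<in> GL n (affine_function_field n d)" and C: "finite C" "C \<subseteq> affine_function_field n d" "card C \<le> r"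
  and T: "T \<in> forms n d (adjoin base_field C)" "\<And>x. ev id x T = ev id (row_times n x g) (general_form n d)"
 shows "ed_general_form TYPE('k) n d \<le> enat r"
proof -
 have "ed_general_form TYPE('k) n d \<le> trdeg base_field (adjoin base_field C)"
  unfolding ed_general_form_def
 proof (rule ess_dim_le[OF subfield_adjoin adjoin_base _ g])
  show "adjoin base_field C \<subseteq> affine_function_field n d"
   by (rule adjoin_least[OF subfield_function_fields(1) base_subset_fields(1) C(2)])
  show "subst_act g (general_form n d) \<in> forms n d (adjoin base_field C)"
   using subst_act_eqI[OF GL_D(1)[OF g] T(2)] T(1) by simp
 qed
 also have "\<dots> \<le> enat (card C)" by (rule trdeg_adjoin_le[OF subfield_base C(1)])
 also have "\<dots> \<le> enat r" using C(3) by simp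
 finally show ?thesis .
qed

lemma ed_general_hypersurface_le:
 fixes C :: "'k::field_char_0 ratfun set"
 assumes g: "g \<in> GL n (proj_function_field n d)" and C: "finite C" "C \<subseteq> proj_function_field n d" "card C \<le> r"
  and T: "T \<in> forms n d (adjoin base_field C)" "T \<noteq> 0" "c \<noteq> 0"
   "\<And>x. ev id x T = c * ev id (row_times n x g) (general_form n d)"
 shows "ed_general_hypersurface TYPE('k) n d \<le> enat r"
proof -
 have "ed_general_hypersurface TYPE('k) n d \<le> trdeg base_field (adjoin base_field C)"
  unfolding ed_general_hypersurface_def
 proof (rule ess_dim_le[OF subfield_adjoin adjoin_base _ g])
  show "adjoin base_field C \<subseteq> proj_function_field n d"
   by (rule adjoin_least[OF subfield_function_fields(2) base_subset_fields(2) C(2)])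
  have "subst_act g (const c * general_form n d) = T"
   by (rule subst_act_eqI[OF GL_D(1)[OF g]]) (simp add: T(4) ev_const_mult)
  then have "hyp_act g (general_hypersurface n d) = proj_class T"
   using hyp_act_class[OF GL_D(1)[OF g], of "const c * general_form n d"]
   by (simp add: general_hypersurface_def proj_class_mult[OF T(3)])
  then show "hyp_act g (general_hypersurface n d) \<in> hypersurfaces n d (adjoin base_field C)"
   using T(1,2) by (auto simp: hypersurfaces_def)
 qed
 also have "\<dots> \<le> enat (card C)" by (rule trdeg_adjoin_le[OF subfield_base C(1)])
 also have "\<dots> \<le> enat r" using C(3) by simp
 finally show ?thesis .
qed

lemma ed_general_form_ge:
 assumes "\<And>L g f. is_subfield L \<Longrightarrow> base_field \<subseteq> L \<Longrightarrow> g \<in> GL n UNIV \<Longrightarrow> f \<in> forms n d L \<Longrightarrow>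
   (\<And>x. ev id x f = ev id (row_times n x g) (general_form n d)) \<Longrightarrow>
   enat r \<le> trdeg base_field (L :: 'k::field_char_0 ratfun set)"
 shows "enat r \<le> ed_general_form TYPE('k) n d"
 unfolding ed_general_form_def
proof (rule ess_dim_ge)
 fix L :: "'k ratfun set" and g
 assume a: "is_subfield L" "base_field \<subseteq> L" "g \<in> GL n (affine_function_field n d)"
  "subst_act g (general_form n d) \<in> forms n d L"
 show "enat r \<le> trdeg base_field L"
  by (rule assms[OF a(1,2) GL_UNIV[OF a(3)] a(4)]) (rule ev_subst_act[OF GL_D(1)[OF a(3)]])
qed

lemma ed_general_hypersurface_ge:
 assumes "\<And>L g f c. is_subfield L \<Longrightarrow> base_field \<subseteq> L \<Longrightarrow> g \<in> GL n UNIV \<Longrightarrow> f \<in> forms n d L \<Longrightarrow> c \<noteq> 0 \<Longrightarrow>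
   (\<And>x. ev id x f = c * ev id (row_times n x g) (general_form n d)) \<Longrightarrow>
   enat r \<le> trdeg base_field (L :: 'k::field_char_0 ratfun set)"
 shows "enat r \<le> ed_general_hypersurface TYPE('k) n d"
 unfolding ed_general_hypersurface_def
proof (rule ess_dim_ge)
 fix L :: "'k ratfun set" and g
 assume a: "is_subfield L" "base_field \<subseteq> L" "g \<in> GL n (proj_function_field n d)"
  "hyp_act g (general_hypersurface n d) \<in> hypersurfaces n d L"
 have "proj_class (subst_act g (general_form n d)) \<in> hypersurfaces n d L"
  using a(4) by (simp add: general_hypersurface_def hyp_act_class[OF GL_D(1)[OF a(3)]])
 then obtain f where f: "f \<in> forms n d L" "proj_class f = proj_class (subst_act g (general_form n d))"
  by (auto simp: hypersurfaces_def)
 have "const 1 * f = f" by (simp add: const_def)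
 then have "f \<in> proj_class f" unfolding proj_class_def by (auto intro!: exI[of _ 1])
 then obtain c where c: "c \<noteq> 0" "f = const c * subst_act g (general_form n d)"
  unfolding f(2) by (auto simp: proj_class_def)
 show "enat r \<le> trdeg base_field L"
  by (rule assms[OF a(1,2) GL_UNIV[OF a(3)] f(1) c(1)])
   (simp add: c(2) ev_const_mult ev_subst_act[OF GL_D(1)[OF a(3)]])
qed

lemma sum_in_forms:
 assumes L: "is_subfield L" and "\<And>i. i \<in> I \<Longrightarrow> m i \<in> monomials n d" "\<And>i. i \<in> I \<Longrightarrow> c i \<in> L"
 shows "(\<Sum>i\<in>I. single (m i) (c i)) \<in> forms n d L"
proof -
 have "lookup (\<Sum>i\<in>I. single (m i) (c i)) w \<in> L" for w
  unfolding lookup_sum using assms(3) subfieldD(1)[OF L]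
  by (intro subfield_sum[OF L]) (auto simp: lookup_single when_def)
 moreover have "keys (\<Sum>i\<in>I. single (m i) (c i)) \<subseteq> monomials n d"
 proof
  fix w assume "w \<in> keys (\<Sum>i\<in>I. single (m i) (c i))"
  then have "(\<Sum>i\<in>I. lookup (single (m i) (c i)) w) \<noteq> 0"
   by (simp add: in_keys_iff lookup_sum)
  then obtain i where "i \<in> I" "lookup (single (m i) (c i)) w \<noteq> 0"
   by (rule sum.not_neutral_contains_not_neutral)
  then show "w \<in> monomials n d" using assms(2) by (auto simp: lookup_single when_def split: if_splits)
 qed
 ultimately show ?thesis by (auto simp: forms_def)
qed

lemma general_form_in_forms: "general_form n d \<in> forms n d (affine_function_field n d)"
 unfolding general_form_def
 by (rule sum_in_forms[OF subfield_function_fields(1)])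
  (auto simp: affine_function_field_def intro: subsetD[OF adjoin_gen])

lemma ratio_in_proj_function_field:
 assumes "m \<in> monomials n d" "w \<in> monomials n d"
 shows "gen_coeff m / gen_coeff w \<in> proj_function_field n d"
 unfolding proj_function_field_def using assms
 by (intro subsetD[OF adjoin_gen] CollectI exI[of _ m] exI[of _ w]) simp

lemma scaled_general_form_in_forms:
 assumes "w \<in> monomials n d"
 shows "const (1 / gen_coeff w) * general_form n d \<in> forms n d (proj_function_field n d)"
proof -
 have "const (1 / gen_coeff w) * general_form n d =
   (\<Sum>m\<in>monomials n d. single m (gen_coeff m / gen_coeff w))"
  by (simp add: general_form_def sum_distrib_left const_def mult_single)
 also have "\<dots> \<in> forms n d (proj_function_field n d)"
 proof (rule sum_in_forms[OF subfield_function_fields(2)])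
  fix m assume "m \<in> monomials n d"
  then show "gen_coeff m / gen_coeff w \<in> proj_function_field n d"
   by (rule ratio_in_proj_function_field[OF _ assms])
 qed
 finally show ?thesis .
qed

lemma GL_lower_triangular:
 assumes L: "is_subfield L" and "\<And>i j. i < n \<Longrightarrow> j < n \<Longrightarrow> G i j \<in> L"
  "\<And>i j. i < j \<Longrightarrow> j < n \<Longrightarrow> G i j = 0" "\<And>i. i < n \<Longrightarrow> G i i \<noteq> 0"
 shows "mat n n (\<lambda>(i, j). G i j) \<in> GL n L"
proof (rule GL_I[OF L])
 let ?A = "mat n n (\<lambda>(i, j). G i j)"
 show A: "?A \<in> carrier_mat n n" by simp
 show "?A $$ (i, j) \<in> L" if "i < n" "j < n" for i j using that assms(2) by simp
 have "det ?A = prod_list (diag_mat ?A)"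
  by (rule det_lower_triangular[OF _ A]) (use assms(3) in auto)
 moreover have "0 \<notin> set (diag_mat ?A)" using assms(4) by (auto simp: diag_mat_def)
 ultimately show "det ?A \<noteq> 0" by (simp add: prod_list_zero_iff)
qed

lemma row_times_mat: "j < n \<Longrightarrow> row_times n x (mat n n (\<lambda>(i, j). G i j)) j = (\<Sum>i<n. x i * G i j)"
 by (simp add: row_times_def)

section \<open>Linear forms\<close>

lemma monomials_Suc_cases:
 assumes m: "m \<in> monomials n (Suc d)"
 shows "\<exists>a<n. \<exists>m'\<in>monomials n d. m = single a 1 + m'"
proof -
 have "keys m \<noteq> {}" using monomial_degree[OF m] by auto
 then obtain a where a: "a \<in> keys m" by blast
 have an: "a < n" by (rule monomials_keys[OF m a])
 define m' where "m' = m - single a 1"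
 have le: "lookup (single a 1) i \<le> lookup m i" for i
  using a by (cases "i = a") (auto simp: in_keys_iff lookup_single)
 have eq: "m = single a 1 + m'"
 proof (rule poly_mapping_eqI)
  fix i show "lookup m i = lookup (single a 1 + m') i"
   using le[of i] by (simp add: m'_def lookup_add lookup_minus)
 qed
 have "keys m' \<subseteq> keys m"
  by (auto simp: m'_def in_keys_iff lookup_minus)
 moreover have "(\<Sum>i<n. lookup m i) = 1 + (\<Sum>i<n. lookup m' i)"
 proof -
  have "(\<Sum>i<n. lookup (single a (1::nat)) i) = (\<Sum>i<n. if i = a then 1 else 0)"
   by (rule sum.cong) (auto simp: lookup_single when_def)
  then show ?thesis unfolding eq using an by (simp add: lookup_add sum.distrib)
 qed
 ultimately have "m' \<in> monomials n d" using m by (auto simp: monomials_def)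
 then show ?thesis using an eq by blast
qed

lemma single_index_inj: "c \<noteq> 0 \<Longrightarrow> single a c = single b c \<longleftrightarrow> a = b"
 by (metis lookup_single_eq lookup_single_not_eq)

lemma monomials_0: "monomials n 0 = {0}"
proof -
 have "m = 0" if "m \<in> monomials n 0" for m
  using monomial_degree[OF that] by (intro poly_mapping_eqI) (auto simp: in_keys_iff)
 then show ?thesis by (auto simp: monomials_def)
qed

lemma monomials_1: "monomials n 1 = (\<lambda>i. single i 1) ` {..<n}"
proof -
 have "m \<in> (\<lambda>i. single i 1) ` {..<n}" if "m \<in> monomials n 1" for m
  using monomials_Suc_cases[of m n 0] that by (force simp: monomials_0)
 then show ?thesis by (auto intro: single_in_monomials)
qed

lemma general_linear_form_reduction:
 fixes K :: "'k::field_char_0 ratfun set" and u :: "'k ratfun"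
 assumes n: "n > 0" and K: "is_subfield K" and u: "u \<in> K" "u \<noteq> 0"
  and a: "\<And>i. i < n \<Longrightarrow> gen_coeff (single i 1) / gen_coeff (single 0 1) \<in> K"
 obtains g where "g \<in> GL n K"
  "\<And>x. ev id (row_times n x g) (general_form n 1) = u * gen_coeff (single 0 1) * x 0"
proof -
 let ?a = "\<lambda>i. gen_coeff (single i 1) :: 'k ratfun"
 define G where "G i j = (if i = 0 \<and> j = 0 then u else if i = j then 1 else if j = 0 then - (?a i / ?a 0) else 0)" for i j :: nat
 have g: "mat n n (\<lambda>(i, j). G i j) \<in> GL n K"
  by (rule GL_lower_triangular[OF K]) (use u a subfield_closed[OF K] in \<open>auto simp: G_def\<close>)
 have lin: "ev id y (general_form n 1) = (\<Sum>j<n. ?a j * y j)" for y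
  unfolding ev_general_form monomials_1
  by (subst sum.reindex) (auto simp: inj_on_def single_index_inj)
 have "ev id (row_times n x (mat n n (\<lambda>(i, j). G i j))) (general_form n 1) = u * ?a 0 * x 0" for x
 proof -
  have a0: "?a 0 \<noteq> 0" by (rule gen_coeff_nonzero)
  have "(\<Sum>j<n. ?a j * G i j) = (if i = 0 then u * ?a 0 else 0)" if i: "i < n" for i
  proof (cases "i = 0")
   case True
   have "(\<Sum>j<n. ?a j * G i j) = (\<Sum>j<n. if j = 0 then u * ?a 0 else 0)"
    by (rule sum.cong) (auto simp: True G_def)
   then show ?thesis using True n by simp
  next
   case False
   have "(\<Sum>j<n. ?a j * G i j) = (\<Sum>j\<in>{0, i}. ?a j * G i j)"
    using i n False by (intro sum.mono_neutral_right) (auto simp: G_def)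
   then show ?thesis using False a0 by (simp add: G_def)
  qed
  note inner = this
  have "(\<Sum>j<n. ?a j * row_times n x (mat n n (\<lambda>(i, j). G i j)) j) = (\<Sum>j<n. \<Sum>i<n. x i * (?a j * G i j))"
   by (rule sum.cong) (auto simp: row_times_mat sum_distrib_left mult_ac)
  also have "\<dots> = (\<Sum>i<n. x i * (\<Sum>j<n. ?a j * G i j))"
   by (subst sum.swap) (simp add: sum_distrib_left)
  also have "\<dots> = (\<Sum>i<n. if i = 0 then u * ?a 0 * x 0 else 0)"
   by (rule sum.cong) (auto simp: inner[unfolded One_nat_def])
  finally show ?thesis using n unfolding lin by simp
 qed
 then show ?thesis using that g by blast
qed

lemma ev_single_id: "ev id x (single m c) = c * mon x m"
 by (simp add: ev_single)

lemma linear_upper: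
 assumes n: "n > 0"
 shows "ed_general_form TYPE('k::field_char_0) n 1 \<le> enat 0"
  "ed_general_hypersurface TYPE('k) n 1 \<le> enat 0"
proof -
 let ?a = "\<lambda>i. gen_coeff (single i 1) :: 'k ratfun"
 let ?T = "single (single 0 1) 1 :: 'k ratfun form"
 have "(\<Sum>i\<in>{()}. single (single 0 1) 1) \<in> forms n 1 (adjoin (base_field :: 'k ratfun set) {})"
  by (rule sum_in_forms[OF subfield_adjoin]) (use single_in_monomials[OF n, of 1] subfieldD(2)[OF subfield_adjoin] in auto)
 then have T: "?T \<in> forms n 1 (adjoin base_field {})" by simp
 have aA: "?a i \<in> affine_function_field n 1" if "i < n" for i
  using single_in_monomials[OF that, of 1] by (auto simp: affine_function_field_def intro: subsetD[OF adjoin_gen])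
 obtain g where g: "g \<in> GL n (affine_function_field n 1)"
  "\<And>x. ev id (row_times n x g) (general_form n 1) = inverse (?a 0) * ?a 0 * x 0"
  by (rule general_linear_form_reduction[OF n subfield_function_fields(1), of "inverse (?a 0)" n 1])
   (use aA n in \<open>auto intro!: subfield_closed subfield_function_fields simp: gen_coeff_nonzero\<close>)
 show "ed_general_form TYPE('k) n 1 \<le> enat 0"
  by (rule ed_general_form_le[OF g(1), of "{}" 0 ?T])
   (use T in \<open>auto simp: g(2)[unfolded One_nat_def] ev_single_id gen_coeff_nonzero\<close>)
 have aP: "?a i / ?a 0 \<in> proj_function_field n 1" if "i < n" for i
  by (rule ratio_in_proj_function_field[OF single_in_monomials[OF that] single_in_monomials[OF n]])
 obtain g' where g': "g' \<in> GL n (proj_function_field n 1)"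
  "\<And>x. ev id (row_times n x g') (general_form n 1) = 1 * ?a 0 * x 0"
  by (rule general_linear_form_reduction[OF n subfield_function_fields(2), of 1 n 1])
   (use aP subfieldD(2)[OF subfield_function_fields(2)] in auto)
 show "ed_general_hypersurface TYPE('k) n 1 \<le> enat 0"
  by (rule ed_general_hypersurface_le[OF g'(1), of "{}" 0 ?T "inverse (?a 0)"])
   (use T in \<open>auto simp: g'(2)[unfolded One_nat_def] ev_single_id gen_coeff_nonzero single_nonzero\<close>)
qed

section \<open>Quadratic forms\<close>

definition polar :: "'a::field form \<Rightarrow> (nat \<Rightarrow> 'a) \<Rightarrow> (nat \<Rightarrow> 'a) \<Rightarrow> 'a" where
 "polar f x y = ev id (\<lambda>i. x i + y i) f - ev id x f - ev id y f"

lemma quadratic_monomials: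
 assumes "keys f \<subseteq> monomials n 2"
 obtains a b where "\<And>x. ev id x f = (\<Sum>m\<in>keys f. lookup f m * (x (a m) * x (b m)))"
proof -
 have "\<exists>a b. \<forall>x. mon x m = (x a * x b :: 'a)" if "m \<in> monomials n 2" for m
 proof -
  obtain a m' where a: "m' \<in> monomials n 1" "m = single a 1 + m'"
   using monomials_Suc_cases[of m n 1] \<open>m \<in> monomials n 2\<close> unfolding Suc_1 by blast
  then obtain b where "m' = single b 1" unfolding monomials_1 by blast
  then show ?thesis using a(2) by (auto simp: mon_add)
 qed
 then have "\<exists>a b. \<forall>m\<in>keys f. \<forall>x. mon x m = (x (a m) * x (b m) :: 'a)"
  using assms by (meson subsetD)
 then obtain a b where ab: "\<forall>m\<in>keys f. \<forall>x. mon x m = (x (a m) * x (b m) :: 'a)" by blast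
 show ?thesis by (rule that[of a b]) (simp add: ev_def ab)
qed

lemma polar_properties:
 assumes f: "keys f \<subseteq> monomials n 2"
 shows "polar f (\<lambda>i. \<Sum>k\<in>A. c k * u k i) y = (\<Sum>k\<in>A. c k * polar f (u k) y)"
  "polar f x y = polar f y x" "polar f x x = 2 * ev id x f"
  "ev id (\<lambda>i. s * x i) f = s\<^sup>2 * ev id x f"
  "polar f (\<lambda>i. x i - z i) y = polar f x y - polar f z y"
  "polar f x (\<lambda>i. s * y i) = s * polar f x y"
proof -
 obtain a b where ev: "\<And>x. ev id x f = (\<Sum>m\<in>keys f. lookup f m * (x (a m) * x (b m)))"
  using quadratic_monomials[OF f] by metis
 let ?K = "keys f" and ?c = "lookup f"
 have p: "polar f x y = (\<Sum>m\<in>?K. ?c m * (x (a m) * y (b m) + y (a m) * x (b m)))" for x y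
  unfolding polar_def ev sum_subtractf[symmetric] by (rule sum.cong) (auto simp: algebra_simps)
 show "polar f (\<lambda>i. \<Sum>k\<in>A. c k * u k i) y = (\<Sum>k\<in>A. c k * polar f (u k) y)"
 proof -
  have "(\<Sum>k\<in>A. c k * polar f (u k) y) = (\<Sum>m\<in>?K. \<Sum>k\<in>A. c k * (?c m * (u k (a m) * y (b m) + y (a m) * u k (b m))))"
   unfolding p sum_distrib_left by (rule sum.swap)
  also have "\<dots> = (\<Sum>m\<in>?K. ?c m * ((\<Sum>k\<in>A. c k * u k (a m)) * y (b m) + y (a m) * (\<Sum>k\<in>A. c k * u k (b m))))"
   by (rule sum.cong) (auto simp: sum_distrib_left sum_distrib_right sum.distrib[symmetric] algebra_simps)
  finally show ?thesis unfolding p by simp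
 qed
 show "polar f x y = polar f y x" unfolding p by (rule sum.cong) (auto simp: algebra_simps)
 show "polar f x x = 2 * ev id x f" unfolding p ev sum_distrib_left by (rule sum.cong) (auto simp: algebra_simps)
 show "ev id (\<lambda>i. s * x i) f = s\<^sup>2 * ev id x f"
  unfolding ev sum_distrib_left by (rule sum.cong) (auto simp: power2_eq_square algebra_simps)
 show "polar f (\<lambda>i. x i - z i) y = polar f x y - polar f z y"
  unfolding p sum_subtractf[symmetric] by (rule sum.cong) (auto simp: algebra_simps)
 show "polar f x (\<lambda>i. s * y i) = s * polar f x y"
  unfolding p sum_distrib_left by (rule sum.cong) (auto simp: algebra_simps)
qed

lemma ev_add_polar: "ev id (\<lambda>i. x i + y i) f = ev id x f + ev id y f + polar f x y"
 by (simp add: polar_def)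

text \<open>Gram-Schmidt: anisotropy keeps the values by which one has to divide away from zero.\<close>

lemma orthogonal_basis:
 fixes f :: "'a::field_char_0 form"
 assumes L: "is_subfield L" and f: "f \<in> forms n 2 L"
  and aniso: "\<And>x i. i < n \<Longrightarrow> x i \<noteq> 0 \<Longrightarrow> ev id x f \<noteq> 0" and "r \<le> n"
 shows "\<exists>v. \<forall>i<r. (\<forall>j. v i j \<in> L) \<and> v i i = 1 \<and> (\<forall>j>i. v i j = 0) \<and> (\<forall>j<r. j \<noteq> i \<longrightarrow> polar f (v i) (v j) = 0)"
 using \<open>r \<le> n\<close>
proof (induction r)
 case 0 then show ?case by simp
next
 case (Suc r)
 have keys: "keys f \<subseteq> monomials n 2" using f by (simp add: forms_def)
 note polar = polar_properties[OF keys]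
 obtain v where v: "\<And>i j. i < r \<Longrightarrow> v i j \<in> L" "\<And>i. i < r \<Longrightarrow> v i i = 1" "\<And>i j. i < r \<Longrightarrow> i < j \<Longrightarrow> v i j = 0"
  "\<And>i j. i < r \<Longrightarrow> j < r \<Longrightarrow> j \<noteq> i \<Longrightarrow> polar f (v i) (v j) = 0"
  using Suc by (metis Suc_leD)
 define e where "e l = (if l = r then 1 else 0 :: 'a)" for l
 define c where "c j = polar f e (v j) / (2 * ev id (v j) f)" for j
 define w where "w l = e l - (\<Sum>j<r. c j * v j l)" for l
 have evL: "ev id x f \<in> L" if "\<And>l. x l \<in> L" for x using ev_in_subfield[OF L f] that by blast
 have eL: "e l \<in> L" for l by (simp add: e_def subfield_closed[OF L])
 have cL: "c j \<in> L" if "j < r" for j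
  unfolding c_def polar_def using v(1)[OF that] eL by (intro subfield_closed L evL)
 have wL: "w l \<in> L" for l
  unfolding w_def by (intro subfield_closed L eL) (use cL v(1) in auto)
 have orth: "polar f w (v i) = 0" if i: "i < r" for i
 proof -
  have nz: "ev id (v i) f \<noteq> 0" using aniso[of i "v i"] v(2)[OF i] i Suc.prems by simp
  have "polar f w (v i) = polar f e (v i) - (\<Sum>j<r. c j * polar f (v j) (v i))"
   unfolding w_def polar(5) polar(1) ..
  also have "(\<Sum>j<r. c j * polar f (v j) (v i)) = (\<Sum>j<r. if j = i then c i * (2 * ev id (v i) f) else 0)"
   by (rule sum.cong) (use v(4) i in \<open>auto simp: polar(3)\<close>)
  also have "\<dots> = polar f e (v i)" using i nz by (simp add: c_def)
  finally show ?thesis by simp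
 qed
 define v' where "v' i = (if i = r then w else v i)" for i
 have "\<forall>i<Suc r. (\<forall>j. v' i j \<in> L) \<and> v' i i = 1 \<and> (\<forall>j>i. v' i j = 0) \<and> (\<forall>j<Suc r. j \<noteq> i \<longrightarrow> polar f (v' i) (v' j) = 0)"
 proof (intro allI impI)
  fix i assume i: "i < Suc r"
  have "w l = (if l = r then 1 else 0)" if "l \<ge> r" for l
   using that v(3) by (auto simp: w_def e_def intro!: sum.neutral)
  then have 1: "v' i i = 1" "\<forall>j>i. v' i j = 0" using i v(2,3) by (auto simp: v'_def)
  have "\<forall>j<Suc r. j \<noteq> i \<longrightarrow> polar f (v' i) (v' j) = 0"
   using i v(4) orth polar(2)[of w] by (auto simp: v'_def)
  then show "(\<forall>j. v' i j \<in> L) \<and> v' i i = 1 \<and> (\<forall>j>i. v' i j = 0) \<and> (\<forall>j<Suc r. j \<noteq> i \<longrightarrow> polar f (v' i) (v' j) = 0)"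
   using 1 i v(1) wL by (auto simp: v'_def)
 qed
 then show ?case by blast
qed

lemma ev_orthogonal:
 fixes r :: nat
 assumes f: "keys f \<subseteq> monomials n 2"
  and "\<And>i j. i < r \<Longrightarrow> j < r \<Longrightarrow> i \<noteq> j \<Longrightarrow> polar f (v i) (v j) = 0"
 shows "ev id (\<lambda>l. \<Sum>i<r. x i * v i l) f = (\<Sum>i<r. (x i)\<^sup>2 * ev id (v i) f)"
 using assms(2)
proof (induction r)
 case 0
 have "ev id (\<lambda>l. 0 * (0 :: 'a)) f = 0\<^sup>2 * ev id (\<lambda>_. 0) f" by (rule polar_properties(4)[OF f])
 then show ?case by (simp only: mult_zero_left sum.empty lessThan_0 zero_power2)
next
 case (Suc r)
 note polar = polar_properties[OF f]
 have "polar f (\<lambda>l. \<Sum>i<r. x i * v i l) (\<lambda>l. x r * v r l) = (\<Sum>i<r. x i * (x r * polar f (v i) (v r)))"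
  unfolding polar(1) polar(6) ..
 also have "\<dots> = 0" using Suc.prems by (intro sum.neutral) auto
 finally have h: "polar f (\<lambda>l. \<Sum>i<r. x i * v i l) (\<lambda>l. x r * v r l) = 0" .
 have IH: "ev id (\<lambda>l. \<Sum>i<r. x i * v i l) f = (\<Sum>i<r. (x i)\<^sup>2 * ev id (v i) f)"
  using Suc.prems by (intro Suc.IH) auto
 show ?case unfolding sum.lessThan_Suc ev_add_polar h polar(4) IH add_0_right ..
qed

lemma general_form_anisotropic:
 assumes "d \<ge> 2" "i < n" "y i \<noteq> 0" shows "ev id y (general_form n d) \<noteq> (0 :: 'k::field ratfun)"
 using general_form_degree[of d i n y] assms by blast

lemma quadratic_upper:
 shows "ed_general_form TYPE('k::field_char_0) n 2 \<le> enat n"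
  "n > 0 \<Longrightarrow> ed_general_hypersurface TYPE('k) n 2 \<le> enat (n - 1)"
proof -
 have row: "row_times n x (mat n n (\<lambda>(i, j). v i j)) j = (\<Sum>i<n. x i * v i j)" if "j < n"
  for x and v :: "nat \<Rightarrow> nat \<Rightarrow> 'k ratfun" and j using that by (rule row_times_mat)
 have diag: "\<exists>v. mat n n (\<lambda>(i, j). v i j) \<in> GL n K \<and> (\<forall>i<n. ev id (v i) f \<in> K \<and> ev id (v i) f \<noteq> 0) \<and>
   (\<forall>x. ev id (row_times n x (mat n n (\<lambda>(i, j). v i j))) f = (\<Sum>i<n. (x i)\<^sup>2 * ev id (v i) f))"
  if K: "is_subfield K" and f: "f \<in> forms n 2 K" "\<And>x i. i < n \<Longrightarrow> x i \<noteq> 0 \<Longrightarrow> ev id x f \<noteq> 0"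
  for K :: "'k ratfun set" and f
 proof -
  have "\<exists>v. \<forall>i<n. (\<forall>j. v i j \<in> K) \<and> v i i = 1 \<and> (\<forall>j>i. v i j = 0) \<and>
   (\<forall>j<n. j \<noteq> i \<longrightarrow> polar f (v i) (v j) = 0)"
   by (rule orthogonal_basis[OF K f(1) _ order_refl]) (rule f(2))
  then obtain v where v0: "\<forall>i<n. (\<forall>j. v i j \<in> K) \<and> v i i = 1 \<and> (\<forall>j>i. v i j = 0) \<and>
   (\<forall>j<n. j \<noteq> i \<longrightarrow> polar f (v i) (v j) = 0)" by (elim exE)
  have v: "\<And>i j. i < n \<Longrightarrow> v i j \<in> K" "\<And>i. i < n \<Longrightarrow> v i i = 1" "\<And>i j. i < n \<Longrightarrow> i < j \<Longrightarrow> v i j = 0"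
   "\<And>i j. i < n \<Longrightarrow> j < n \<Longrightarrow> j \<noteq> i \<Longrightarrow> polar f (v i) (v j) = 0"
   using v0 by auto
  have keys: "keys f \<subseteq> monomials n 2" using f(1) by (simp add: forms_def)
  have "mat n n (\<lambda>(i, j). v i j) \<in> GL n K"
   by (rule GL_lower_triangular[OF K]) (use v in auto)
  moreover have "ev id (v i) f \<in> K \<and> ev id (v i) f \<noteq> 0" if "i < n" for i
   using ev_in_subfield[OF K f(1)] v(1,2)[OF that] f(2)[OF that, of "v i"] by simp
  moreover have "ev id (row_times n x (mat n n (\<lambda>(i, j). v i j))) f = (\<Sum>i<n. (x i)\<^sup>2 * ev id (v i) f)" for x
  proof -
   have "ev id (row_times n x (mat n n (\<lambda>(i, j). v i j))) f = ev id (\<lambda>l. \<Sum>i<n. x i * v i l) f"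
    by (rule ev_cong_variables[OF keys]) (rule row)
   also have "\<dots> = (\<Sum>i<n. (x i)\<^sup>2 * ev id (v i) f)" by (rule ev_orthogonal[OF keys]) (use v(4) in auto)
   finally show ?thesis .
  qed
  ultimately show ?thesis by blast
 qed
 have T: "(\<Sum>i<n. single (single i 2) (c i)) \<in> forms n 2 L"
  "ev id x (\<Sum>i<n. single (single i 2) (c i)) = (\<Sum>i<n. (x i)\<^sup>2 * c i)"
  if "is_subfield L" "\<And>i. i < n \<Longrightarrow> c i \<in> L" for c :: "nat \<Rightarrow> 'k ratfun" and L x
  using that by (auto intro!: sum_in_forms single_in_monomials simp: ev_sum ev_single_id mult.commute)
 show "ed_general_form TYPE('k) n 2 \<le> enat n"
 proof -
  have "\<exists>v. mat n n (\<lambda>(i, j). v i j) \<in> GL n (affine_function_field n 2) \<and>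
   (\<forall>i<n. ev id (v i) (general_form n 2) \<in> affine_function_field n 2 \<and> ev id (v i) (general_form n 2) \<noteq> (0 :: 'k ratfun)) \<and>
   (\<forall>x. ev id (row_times n x (mat n n (\<lambda>(i, j). v i j))) (general_form n 2) = (\<Sum>i<n. (x i)\<^sup>2 * ev id (v i) (general_form n 2)))"
   by (rule diag[OF subfield_function_fields(1) general_form_in_forms]) (rule general_form_anisotropic[OF order_refl])
  then obtain v where v: "mat n n (\<lambda>(i, j). v i j) \<in> GL n (affine_function_field n 2)"
   "\<forall>i<n. ev id (v i) (general_form n 2) \<in> affine_function_field n 2 \<and> ev id (v i) (general_form n 2) \<noteq> (0 :: 'k ratfun)"
   "\<forall>x. ev id (row_times n x (mat n n (\<lambda>(i, j). v i j))) (general_form n 2) = (\<Sum>i<n. (x i)\<^sup>2 * ev id (v i) (general_form n 2))"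
   by (elim exE conjE)
  let ?c = "\<lambda>i. ev id (v i) (general_form n 2)"
  have C: "?c i \<in> adjoin base_field (?c ` {..<n})" if "i < n" for i
   using that by (intro subsetD[OF adjoin_gen]) auto
  show ?thesis
  proof (rule ed_general_form_le[OF v(1)])
   show "finite (?c ` {..<n})" "?c ` {..<n} \<subseteq> affine_function_field n 2" using v(2) by auto
   show "card (?c ` {..<n}) \<le> n" using card_image_le[of "{..<n}" ?c] by simp
   show "(\<Sum>i<n. single (single i 2) (?c i)) \<in> forms n 2 (adjoin base_field (?c ` {..<n}))"
    by (rule T(1)[OF subfield_adjoin C])
   show "ev id x (\<Sum>i<n. single (single i 2) (?c i)) =
     ev id (row_times n x (mat n n (\<lambda>(i, j). v i j))) (general_form n 2)" for x
    using T(2)[OF subfield_adjoin C] v(3) by simp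
  qed
 qed
 assume n: "n > 0"
 show "ed_general_hypersurface TYPE('k) n 2 \<le> enat (n - 1)"
 proof -
  let ?a = "gen_coeff (single 0 2) :: 'k ratfun"
  let ?f = "const (1 / ?a) * general_form n 2"
  have evf: "ev id x ?f = ev id x (general_form n 2) / ?a" for x by (simp add: ev_const_mult)
  have "\<exists>v. mat n n (\<lambda>(i, j). v i j) \<in> GL n (proj_function_field n 2) \<and>
   (\<forall>i<n. ev id (v i) ?f \<in> proj_function_field n 2 \<and> ev id (v i) ?f \<noteq> (0 :: 'k ratfun)) \<and>
   (\<forall>x. ev id (row_times n x (mat n n (\<lambda>(i, j). v i j))) ?f = (\<Sum>i<n. (x i)\<^sup>2 * ev id (v i) ?f))"
  proof (rule diag[OF subfield_function_fields(2) scaled_general_form_in_forms[OF single_in_monomials[OF n]]])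
   fix x :: "nat \<Rightarrow> 'k ratfun" and i assume "i < n" "x i \<noteq> 0"
   from general_form_anisotropic[of 2 i n x, OF order_refl this] show "ev id x ?f \<noteq> 0"
    unfolding evf by (simp add: gen_coeff_nonzero)
  qed
  then obtain v where v: "mat n n (\<lambda>(i, j). v i j) \<in> GL n (proj_function_field n 2)"
   "\<forall>i<n. ev id (v i) ?f \<in> proj_function_field n 2 \<and> ev id (v i) ?f \<noteq> (0 :: 'k ratfun)"
   "\<forall>x. ev id (row_times n x (mat n n (\<lambda>(i, j). v i j))) ?f = (\<Sum>i<n. (x i)\<^sup>2 * ev id (v i) ?f)"
   by (elim exE conjE)
  let ?c = "\<lambda>i. ev id (v i) ?f / ev id (v 0) ?f"
  let ?C = "?c ` {1..<n}"
  have c0: "ev id (v 0) ?f \<noteq> 0" using v(2) n by blast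
  have C: "?c i \<in> adjoin base_field ?C" if "i < n" for i
  proof (cases "i = 0")
   case True
   have "?c 0 = 1" using c0 by (rule divide_self)
   then show ?thesis using True subfieldD(2)[OF subfield_adjoin] by metis
  next
   case False then show ?thesis using that by (intro subsetD[OF adjoin_gen]) auto
  qed
  have T': "(\<Sum>i<n. single (single i 2) (?c i)) \<in> forms n 2 (adjoin base_field ?C)"
   "ev id x (\<Sum>i<n. single (single i 2) (?c i)) = (\<Sum>i<n. (x i)\<^sup>2 * ?c i)" for x
   by (rule T(1)[OF subfield_adjoin C], assumption, rule T(2)[OF subfield_adjoin C], assumption)
  show ?thesis
  proof (rule ed_general_hypersurface_le[OF v(1)])
   show "finite ?C" by simp
   show "?C \<subseteq> proj_function_field n 2"
    using v(2) n by (auto intro!: subfield_divide subfield_function_fields)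
   show "card ?C \<le> n - 1" using card_image_le[of "{1..<n}" ?c] by simp
   show "(\<Sum>i<n. single (single i 2) (?c i)) \<in> forms n 2 (adjoin base_field ?C)"
    by (rule T'(1))
   show "1 / (?a * ev id (v 0) ?f) \<noteq> 0" using c0 by (simp add: gen_coeff_nonzero)
   show ev: "ev id x (\<Sum>i<n. single (single i 2) (?c i)) =
     1 / (?a * ev id (v 0) ?f) * ev id (row_times n x (mat n n (\<lambda>(i, j). v i j))) (general_form n 2)" for x
   proof -
    have "ev id x (\<Sum>i<n. single (single i 2) (?c i)) =
      (\<Sum>i<n. (x i)\<^sup>2 * ev id (v i) ?f) / ev id (v 0) ?f"
     unfolding T'(2) by (simp add: sum_divide_distrib)
    also have "\<dots> = ev id (row_times n x (mat n n (\<lambda>(i, j). v i j))) ?f / ev id (v 0) ?f"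
     using v(3) by simp
    finally show ?thesis unfolding evf[of "row_times n x _"] by (simp add: mult.commute)
   qed
   have "ev id (\<lambda>i. if i = 0 then 1 else 0) (\<Sum>i<n. single (single i 2) (?c i)) =
     (\<Sum>i<n. if i = 0 then ?c 0 else 0)"
    unfolding T'(2) by (rule sum.cong) auto
   also have "\<dots> = 1" using n c0 by (simp add: divide_self)
   finally show "(\<Sum>i<n. single (single i 2) (?c i) :: 'k ratfun form) \<noteq> 0" by auto
  qed
 qed
qed

text \<open>Over the big field the classes modulo 2 of the degrees of the diagonal entries of a
 diagonalisation are a permutation of those of the generic diagonal form: if two entries had the
 same class, then rescaling one of the two basis vectors makes the leading parts of their sum and
 difference behave differently, although orthogonal vectors satisfy \<open>q(y + z) = q(y - z)\<close>.\<close>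

lemma orthogonal_classes_distinct:
 fixes y z :: "nat \<Rightarrow> 'k::field_char_0 ratfun"
 assumes s: "s < n"
  and y: "y s \<noteq> 0" "\<And>j. j < n \<Longrightarrow> j \<noteq> s \<Longrightarrow> y j \<noteq> 0 \<Longrightarrow> pure_degree 2 y j < pure_degree 2 y s"
  and z: "z s \<noteq> 0" "\<And>j. j < n \<Longrightarrow> j \<noteq> s \<Longrightarrow> z j \<noteq> 0 \<Longrightarrow> pure_degree 2 z j < pure_degree 2 z s"
  and orth: "polar (general_form n 2) y z = 0"
 shows False
proof -
 let ?f = "general_form n 2 :: 'k ratfun form"
 note polar = polar_properties[OF keys_general_form[of n 2]]
 define c where "c = y s / z s"
 have c0: "c \<noteq> 0" using y(1) z(1) by (simp add: c_def)
 define w where "w i = c * z i" for i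
 have ws: "w s = y s" using z(1) by (simp add: w_def c_def)
 have orth': "polar ?f y w = 0" unfolding w_def polar(6) using orth by simp
 have wdeg: "pure_degree 2 w j = pure_degree 2 z j + frag_cmul 2 (deg c)" if "z j \<noteq> 0" for j
  using that c0 by (simp add: pure_degree_def w_def deg_mult frag_cmul_distrib2)
 have w: "pure_degree 2 w j < pure_degree 2 y s" if "j < n" "j \<noteq> s" "w j \<noteq> 0" for j
 proof -
  have "z j \<noteq> 0" using that(3) by (auto simp: w_def)
  then have "pure_degree 2 w j < pure_degree 2 w s" using z(2)[OF that(1,2)] wdeg z(1) by simp
  then show ?thesis using ws by (simp add: pure_degree_def)
 qed
 define p m where "p i = y i + w i" and "m i = y i + (- 1) * w i" for i
 have eq: "ev id p ?f = ev id m ?f"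
  unfolding p_def m_def ev_add_polar polar(6) polar(4) orth' by simp
 have p0: "p s \<noteq> 0" using y(1) by (simp add: p_def ws)
 have "deg (2 * y s) = deg (y s)"
 proof -
  have "(2 :: 'k ratfun) \<in> base_field" by (rule subfield_numeral[OF subfield_base])
  then show ?thesis using y(1) by (simp add: deg_mult deg_base)
 qed
 then have ps: "pure_degree 2 p s = pure_degree 2 y s" by (simp add: pure_degree_def p_def ws)
 obtain t where t: "t < n" "p t \<noteq> 0" "\<And>j. j < n \<Longrightarrow> j \<noteq> t \<Longrightarrow> p j \<noteq> 0 \<Longrightarrow> pure_degree 2 p j < pure_degree 2 p t"
  "ev id p ?f \<noteq> 0" "deg (ev id p ?f) = pure_degree 2 p t"
  using general_form_degree[of 2 s n p] s p0 by auto
 have big: "pure_degree 2 y s \<le> deg (ev id p ?f)"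
  using t(3)[of s] s p0 t(5) ps by (cases "s = t") auto
 show False
 proof (cases "\<exists>j<n. m j \<noteq> 0")
  case False
  have "ev id m ?f = ev id (\<lambda>_. 0 * 0) ?f"
   by (rule ev_cong_variables[OF keys_general_form]) (use False in auto)
  also have "\<dots> = 0\<^sup>2 * ev id (\<lambda>_. 0) ?f" by (rule polar(4))
  also have "\<dots> = 0" by simp
  finally show False using eq t(4) by simp
 next
  case True
  then obtain j where "j < n" "m j \<noteq> 0" by blast
  from general_form_degree[of 2 j n m, OF order_refl this] obtain t' where
   t': "t' < n" "m t' \<noteq> 0" "deg (ev id m ?f) = pure_degree 2 m t'" by blast
  have ts: "t' \<noteq> s" using t'(2) by (auto simp: m_def ws)
  have less: "pure_degree 2 m t' < pure_degree 2 y s"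
  proof -
   have "m t' = y t' + - w t'" by (simp add: m_def)
   consider "y t' = 0" | "w t' = 0" | "y t' \<noteq> 0" "w t' \<noteq> 0" by blast
   then have "deg (m t') = deg (y t') \<and> y t' \<noteq> 0 \<or> deg (m t') = deg (w t') \<and> w t' \<noteq> 0 \<or>
     (y t' \<noteq> 0 \<and> w t' \<noteq> 0 \<and> deg (m t') \<le> deg (y t'))"
   proof cases
    case 1 then show ?thesis using t'(2) by (auto simp: m_def deg_uminus)
   next
    case 2 then show ?thesis using t'(2) by (auto simp: m_def)
   next
    case 3
    have "deg (w t') < deg (y t') \<or> deg (y t') < deg (w t') \<or> deg (w t') = deg (y t')" by force
    then show ?thesis
    proof (elim disjE)
     assume "deg (w t') < deg (y t')"
     then show ?thesis using deg_add_dominant[of "y t'" "- w t'"] 3 by (simp add: m_def deg_uminus)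
    next
     assume "deg (y t') < deg (w t')"
     then show ?thesis using deg_add_dominant[of "- w t'" "y t'"] 3 by (simp add: m_def deg_uminus)
    next
     assume e: "deg (w t') = deg (y t')"
     have "\<not> deg (y t') < deg (m t')"
     proof
      assume lt: "deg (y t') < deg (m t')"
      have "deg (m t' + - y t') = deg (m t')"
       using deg_add_dominant[of "m t'" "- y t'"] lt t'(2) 3 by (simp add: deg_uminus)
      then show False using lt e 3 by (simp add: m_def deg_uminus)
     qed
     then show ?thesis using 3 by auto
    qed
   qed
   then show ?thesis
   proof (elim disjE conjE)
    assume "deg (m t') = deg (y t')" "y t' \<noteq> 0"
    then show ?thesis using y(2)[OF t'(1) ts] by (simp add: pure_degree_def)
   next
    assume "deg (m t') = deg (w t')" "w t' \<noteq> 0"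
    then show ?thesis using w[OF t'(1) ts] by (simp add: pure_degree_def)
   next
    assume a: "y t' \<noteq> 0" "w t' \<noteq> 0" "deg (m t') \<le> deg (y t')"
    then have "frag_cmul 2 (deg (m t')) \<le> frag_cmul 2 (deg (y t'))"
     using frag_cmul_strict_mono[of 2 "deg (m t')" "deg (y t')"] by (auto simp: order_le_less)
    then have "pure_degree 2 m t' \<le> pure_degree 2 y t'" by (simp add: pure_degree_def)
    then show ?thesis using y(2)[OF t'(1) ts a(1)] by simp
   qed
  qed
  then show False using big eq t'(3) by simp
 qed
qed

lemma row_times_add: "row_times n (\<lambda>l. x l + y l) g = (\<lambda>j. row_times n x g j + row_times n y g j)"
 by (rule ext) (simp add: row_times_def sum.distrib distrib_right)

lemma quadratic_diagonal_degrees: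
 fixes L :: "'k::field_char_0 ratfun set"
 assumes L: "is_subfield L" and g: "g \<in> GL n UNIV" and f: "f \<in> forms n 2 L" and c: "c \<noteq> 0"
  and fg: "\<And>x. ev id x f = c * ev id (row_times n x g) (general_form n 2)"
 shows "\<exists>D s (y :: nat \<Rightarrow> nat \<Rightarrow> 'k ratfun). inj_on s {..<n} \<and> (\<forall>i<n. D i \<in> L \<and> D i \<noteq> 0 \<and> s i < n \<and> deg (D i) = deg c + pure_degree 2 (y i) (s i))"
proof -
 let ?p = "general_form n 2 :: 'k ratfun form"
 have aniso: "ev id x f \<noteq> 0" if "i < n" "x i \<noteq> 0" for x i
 proof -
  obtain j where "j < n" "row_times n x g j \<noteq> 0" using row_times_nonzero[OF g, of i x] \<open>i < n\<close> \<open>x i \<noteq> 0\<close> by blast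
  then show ?thesis using general_form_anisotropic[of 2 j n "row_times n x g"] c by (simp add: fg)
 qed
 have "\<exists>v. \<forall>i<n. (\<forall>j. v i j \<in> L) \<and> v i i = 1 \<and> (\<forall>j>i. v i j = 0) \<and>
   (\<forall>j<n. j \<noteq> i \<longrightarrow> polar f (v i) (v j) = 0)"
  by (rule orthogonal_basis[OF L f _ order_refl]) (rule aniso)
 then obtain v where v: "\<forall>i<n. (\<forall>j. v i j \<in> L) \<and> v i i = 1 \<and> (\<forall>j>i. v i j = 0) \<and>
   (\<forall>j<n. j \<noteq> i \<longrightarrow> polar f (v i) (v j) = 0)" by (elim exE)
 define y where "y i = row_times n (v i) g" for i
 let ?P = "\<lambda>i s. s < n \<and> y i s \<noteq> 0 \<and> (\<forall>j<n. j \<noteq> s \<longrightarrow> y i j \<noteq> 0 \<longrightarrow> pure_degree 2 (y i) j < pure_degree 2 (y i) s) \<and>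
   ev id (y i) ?p \<noteq> 0 \<and> deg (ev id (y i) ?p) = pure_degree 2 (y i) s"
 have "\<forall>i\<in>{..<n}. \<exists>s. ?P i s"
 proof
  fix i assume i: "i \<in> {..<n}"
  then have "v i i \<noteq> 0" "i < n" using v by auto
  then obtain j where "j < n" "y i j \<noteq> 0" using row_times_nonzero[OF g, of i "v i"] unfolding y_def by blast
  from general_form_degree[of 2 j n "y i", OF order_refl this] show "\<exists>s. ?P i s" by blast
 qed
 from bchoice[OF this] obtain s where s: "\<forall>i\<in>{..<n}. ?P i (s i)" by (elim exE)
 have inj: "inj_on s {..<n}"
 proof (rule inj_onI, rule ccontr)
  fix i j assume ij: "i \<in> {..<n}" "j \<in> {..<n}" "s i = s j" "i \<noteq> j"
  have "polar f (v i) (v j) = c * polar ?p (y i) (y j)"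
   by (simp only: polar_def fg row_times_add y_def) (simp add: algebra_simps)
  then have orth: "polar ?p (y i) (y j) = 0" using v ij c by auto
  have si: "?P i (s i)" "?P j (s j)" using s ij by blast+
  show False
   by (rule orthogonal_classes_distinct[of "s j" n "y i" "y j"]) (use si[unfolded ij(3)] orth in auto)
 qed
 have "ev id (v i) f \<in> L \<and> ev id (v i) f \<noteq> 0 \<and> s i < n \<and> deg (ev id (v i) f) = deg c + pure_degree 2 (y i) (s i)"
  if i: "i < n" for i
 proof -
  have P: "?P i (s i)" using s i by blast
  have "ev id (v i) f = c * ev id (y i) ?p" by (simp add: fg y_def)
  then have "ev id (v i) f \<noteq> 0" "deg (ev id (v i) f) = deg c + pure_degree 2 (y i) (s i)"
   using P c by (simp_all add: deg_mult)
  moreover have "ev id (v i) f \<in> L" using ev_in_subfield[OF L f] v i by blast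
  ultimately show ?thesis using P by blast
 qed
 then show ?thesis using inj by (intro exI[of _ "\<lambda>i. ev id (v i) f"] exI[of _ s] exI[of _ y]) blast
qed

lemma trdeg_ge_unit_degrees:
 fixes z :: "'i \<Rightarrow> 'k::field ratfun" and q :: int
 assumes I: "finite I" and z: "\<And>i. i \<in> I \<Longrightarrow> z i \<noteq> 0" "\<And>i. i \<in> I \<Longrightarrow> z i \<in> L" and q: "q > 1"
  and t: "\<And>i. i \<in> I \<Longrightarrow> \<exists>w. \<forall>j\<in>I. lookup (deg (z j)) (t i) = (if j = i then 1 else 0) + q * w j"
 shows "enat (card I) \<le> trdeg base_field L"
proof (rule trdeg_ge_degrees(2)[OF I z q])
 fix c :: "'i \<Rightarrow> int"
 assume dvd: "\<And>v. q dvd (\<Sum>i\<in>I. c i * lookup (deg (z i)) v)"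
 show "\<forall>i\<in>I. q dvd c i"
 proof
  fix i assume i: "i \<in> I"
  obtain w where w: "\<forall>j\<in>I. lookup (deg (z j)) (t i) = (if j = i then 1 else 0) + q * w j"
   using t[OF i] by blast
  have "(\<Sum>j\<in>I. c j * lookup (deg (z j)) (t i)) = (\<Sum>j\<in>I. (if j = i then c i else 0) + q * (c j * w j))"
   by (rule sum.cong) (use w in \<open>auto simp: algebra_simps\<close>)
  also have "\<dots> = c i + q * (\<Sum>j\<in>I. c j * w j)" using I i by (simp add: sum.distrib sum_distrib_left)
  finally show "q dvd c i" using dvd[of "t i"] by (simp add: dvd_add_left_iff)
 qed
qed auto

text \<open>Modulo 2 the degrees of the diagonal entries are those of the distinct coefficients of \<open>x\<^sub>i\<^sup>2\<close>, up to the
 common summand \<open>deg c\<close>, which disappears in the quotients of two entries.\<close>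

lemma quadratic_lower:
 "enat n \<le> ed_general_form TYPE('k::field_char_0) n 2"
 "enat (n - 1) \<le> ed_general_hypersurface TYPE('k) n 2"
proof -
 have lk: "lookup (pure_degree 2 y i) (single j 2) =
   (if i = j then 1 else 0) + 2 * lookup (deg (y i)) (single j 2)"
  for y :: "nat \<Rightarrow> 'k ratfun" and i j
  by (auto simp: pure_degree_def lookup_add lookup_single when_def single_index_inj)
 show "enat n \<le> ed_general_form TYPE('k) n 2"
 proof (rule ed_general_form_ge)
  fix L :: "'k ratfun set" and g f
  assume a: "is_subfield L" "g \<in> GL n UNIV" "f \<in> forms n 2 L"
   "\<And>x. ev id x f = ev id (row_times n x g) (general_form n 2)"
  obtain D s and y :: "nat \<Rightarrow> nat \<Rightarrow> 'k ratfun" where D: "inj_on s {..<n}"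
   "\<forall>i<n. D i \<in> L \<and> D i \<noteq> 0 \<and> s i < n \<and> deg (D i) = deg (1 :: 'k ratfun) + pure_degree 2 (y i) (s i)"
   using quadratic_diagonal_degrees[OF a(1-3), of 1] a(4) by auto
  have "enat (card {..<n}) \<le> trdeg base_field L"
  proof (rule trdeg_ge_unit_degrees[where z = D and q = 2 and t = "\<lambda>i. single (s i) 2"])
   fix i assume i: "i \<in> {..<n}"
   show "\<exists>w. \<forall>j\<in>{..<n}. lookup (deg (D j)) (single (s i) 2) = (if j = i then 1 else 0) + 2 * w j"
    by (rule exI[of _ "\<lambda>j. lookup (deg (y j (s j))) (single (s i) 2)"])
     (use D i in \<open>auto simp: lk deg_1 inj_on_def\<close>)
  qed (use D in auto)
  then show "enat n \<le> trdeg base_field L" by simp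
 qed
 show "enat (n - 1) \<le> ed_general_hypersurface TYPE('k) n 2"
 proof (rule ed_general_hypersurface_ge)
  fix L :: "'k ratfun set" and g f c
  assume a: "is_subfield L" "g \<in> GL n UNIV" "f \<in> forms n 2 L" "c \<noteq> 0"
   "\<And>x. ev id x f = c * ev id (row_times n x g) (general_form n 2)"
  obtain D s and y :: "nat \<Rightarrow> nat \<Rightarrow> 'k ratfun" where D: "inj_on s {..<n}"
   "\<forall>i<n. D i \<in> L \<and> D i \<noteq> 0 \<and> s i < n \<and> deg (D i) = deg c + pure_degree 2 (y i) (s i)"
   using quadratic_diagonal_degrees[OF a] by auto
  have "enat (card {1..<n}) \<le> trdeg base_field L"
  proof (rule trdeg_ge_unit_degrees[where z = "\<lambda>i. D i / D 0" and q = 2 and t = "\<lambda>i. single (s i) 2"])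
   fix i assume i: "i \<in> {1..<n}"
   show "\<exists>w. \<forall>j\<in>{1..<n}. lookup (deg (D j / D 0)) (single (s i) 2) = (if j = i then 1 else 0) + 2 * w j"
   proof (rule exI[of _ "\<lambda>j. lookup (deg (y j (s j))) (single (s i) 2) -
     lookup (deg (y 0 (s 0))) (single (s i) 2)"], rule ballI)
    fix j assume j: "j \<in> {1..<n}"
    have "s 0 \<noteq> s i" "s j = s i \<longleftrightarrow> j = i" using D(1) i j by (auto simp: inj_on_def)
    moreover have "deg (D j / D 0) = pure_degree 2 (y j) (s j) - pure_degree 2 (y 0) (s 0)"
     using D(2) j by (simp add: deg_divide)
    ultimately show "lookup (deg (D j / D 0)) (single (s i) 2) = (if j = i then 1 else 0) +
     2 * (lookup (deg (y j (s j))) (single (s i) 2) -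
      lookup (deg (y 0 (s 0))) (single (s i) 2))"
     by (simp add: lookup_minus lk)
   qed
  qed (use D a(1) in \<open>auto intro!: subfield_divide\<close>)
  then show "enat (n - 1) \<le> trdeg base_field L" by simp
 qed
qed

section \<open>Binary forms\<close>

definition bin_mon :: "nat \<Rightarrow> nat \<Rightarrow> nat \<Rightarrow>\<^sub>0 nat" where
 "bin_mon d i = single 0 (d - i) + single 1 i"

lemma lookup_bin_mon: "lookup (bin_mon d i) j = (if j = 0 then d - i else if j = 1 then i else 0)"
 by (auto simp: bin_mon_def lookup_add lookup_single when_def)

lemma bin_mon_inj: "bin_mon d i = bin_mon d j \<longleftrightarrow> i = j"
proof
 assume "bin_mon d i = bin_mon d j"
 then have "lookup (bin_mon d i) 1 = lookup (bin_mon d j) 1" by (rule arg_cong)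
 then show "i = j" by (simp only: lookup_bin_mon if_True if_False one_neq_zero simp_thms)
qed simp

lemma bin_mon_pure: "bin_mon d 0 = single 0 d" "bin_mon d d = single 1 d"
 by (simp_all add: bin_mon_def)

lemma bin_mon_less: "i < j \<Longrightarrow> j \<le> d \<Longrightarrow> bin_mon d j < bin_mon d i"
 unfolding less_exponents_iff by (intro exI[of _ 0]) (auto simp: lookup_bin_mon)

lemma bin_mon_less_iff: "i \<le> d \<Longrightarrow> j \<le> d \<Longrightarrow> bin_mon d i < bin_mon d j \<longleftrightarrow> j < i"
 using bin_mon_less[of i j d] bin_mon_less[of j i d] by (cases i j rule: linorder_cases) auto

lemma below_bin_mon: "w < bin_mon d j \<Longrightarrow> i \<le> j \<Longrightarrow> j \<le> d \<Longrightarrow> bin_mon d i \<noteq> w"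
 using bin_mon_less[of i j d] by (cases "i = j") auto

lemma monomials_2: "bij_betw (bin_mon d) {..d} (monomials 2 d)"
proof (rule bij_betwI')
 show "(bin_mon d i = bin_mon d j) = (i = j)" for i j by (rule bin_mon_inj)
 have two: "{..<2} = {0, 1 :: nat}" by auto
 show "bin_mon d i \<in> monomials 2 d" if "i \<in> {..d}" for i
  using that by (auto simp: monomials_def two lookup_bin_mon in_keys_iff split: if_splits)
 show "\<exists>i\<in>{..d}. m = bin_mon d i" if m: "m \<in> monomials 2 d" for m
 proof (rule bexI[of _ "lookup m 1"])
  have d: "lookup m 0 + lookup m 1 = d" using m by (simp add: monomials_def two)
  show "lookup m 1 \<in> {..d}" using d by simp
  have "lookup m j = 0" if "j \<noteq> 0" "j \<noteq> 1" for j
   using monomials_keys[OF m, of j] that by (auto simp: in_keys_iff)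
  then show "m = bin_mon d (lookup m 1)"
   using d by (intro poly_mapping_eqI) (auto simp: lookup_bin_mon)
 qed
qed

lemma mon_bin_mon: "mon x (bin_mon d i) = x 0 ^ (d - i) * x 1 ^ i"
 by (simp add: bin_mon_def mon_add)

lemma ev_binary:
 assumes "keys f \<subseteq> monomials 2 d"
 shows "ev id x f = (\<Sum>i\<le>d. lookup f (bin_mon d i) * (x 0 ^ (d - i) * x 1 ^ i))"
proof -
 have "ev id x f = (\<Sum>m\<in>monomials 2 d. id (lookup f m) * mon x m)"
  by (rule ev_superset) (use assms finite_monomials in auto)
 also have "\<dots> = (\<Sum>i\<le>d. lookup f (bin_mon d i) * mon x (bin_mon d i))"
  using sum.reindex_bij_betw[OF monomials_2, of "\<lambda>m. lookup f m * mon x m" d] by simp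
 finally show ?thesis by (simp add: mon_bin_mon)
qed

lemma lookup_general_form_bin: "i \<le> d \<Longrightarrow> lookup (general_form 2 d) (bin_mon d i) = gen_coeff (bin_mon d i)"
 using bij_betwE[OF monomials_2[of d]] by (simp add: lookup_general_form)

definition bin_form :: "nat \<Rightarrow> (nat \<Rightarrow> 'a::field) \<Rightarrow> 'a form" where
 "bin_form d t = (\<Sum>i\<le>d. single (bin_mon d i) (t i))"

lemma bin_form_in_forms: "is_subfield L \<Longrightarrow> (\<And>i. i \<le> d \<Longrightarrow> t i \<in> L) \<Longrightarrow> bin_form d t \<in> forms 2 d L"
 unfolding bin_form_def by (rule sum_in_forms) (use bij_betwE[OF monomials_2[of d]] in auto)

lemma ev_bin_form: "ev id x (bin_form d t) = (\<Sum>i\<le>d. t i * (x 0 ^ (d - i) * x 1 ^ i))"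
 by (simp add: bin_form_def ev_sum ev_single_id mon_bin_mon)

lemma row_times_2: "row_times 2 x g j = x 0 * g $$ (0, j) + x 1 * g $$ (1, j)"
 by (simp add: row_times_def numeral_2_eq_2)

lemma GL_2_det:
 assumes g: "g \<in> GL 2 L"
 shows "g $$ (0, 0) * g $$ (1, 1) - g $$ (0, 1) * g $$ (1, 0) \<noteq> 0"
proof
 assume d: "g $$ (0, 0) * g $$ (1, 1) - g $$ (0, 1) * g $$ (1, 0) = 0"
 have zero: "x 0 = 0 \<and> x 1 = 0" if "row_times 2 x g 0 = 0" "row_times 2 x g 1 = 0" for x
 proof (rule ccontr)
  assume "\<not> ?thesis"
  then obtain i where "i < 2" "x i \<noteq> 0" by (metis one_less_numeral_iff pos2 semiring_norm(76))
  then obtain j where "j < 2" "row_times 2 x g j \<noteq> 0" using row_times_nonzero[OF g, of i x] by blast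
  then show False using that by (auto simp: less_2_cases_iff)
 qed
 have z0: "g $$ (1, 0) = 0 \<and> g $$ (0, 0) = 0"
  using zero[of "\<lambda>i. if i = 0 then g $$ (1, 0) else - g $$ (0, 0)"] d by (simp add: row_times_2 algebra_simps)
 have z1: "g $$ (1, 1) = 0 \<and> g $$ (0, 1) = 0"
  using zero[of "\<lambda>i. if i = 0 then g $$ (1, 1) else - g $$ (0, 1)"] d by (simp add: row_times_2 algebra_simps)
 show False using zero[of "\<lambda>_. 1"] z0 z1 by (simp add: row_times_2)
qed

section \<open>Degrees of sums with a dominant term\<close>

lemma deg_numeral: "deg (numeral n :: 'k::field_char_0 ratfun) = 0"
 by (rule deg_base) (auto intro: subfield_numeral[OF subfield_base])

lemma deg_dominant_list:
 fixes x :: "'k::field ratfun"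
 assumes x: "x \<noteq> 0" and ys: "\<And>y. y \<in> set ys \<Longrightarrow> y \<noteq> 0 \<Longrightarrow> deg y < deg x"
 shows "x + sum_list ys \<noteq> 0 \<and> deg (x + sum_list ys) = deg x"
proof -
 have "sum_list ys = (\<Sum>i<length ys. ys ! i)" by (simp add: sum_list_sum_nth lessThan_atLeast0)
 moreover have "(\<Sum>i<length ys. ys ! i) = 0 \<or> deg (\<Sum>i<length ys. ys ! i) < deg x"
 proof (rule deg_sum_less)
  fix i assume "i \<in> {..<length ys}"
  then show "ys ! i = 0 \<or> deg (ys ! i) < deg x" using ys[of "ys ! i"] nth_mem[of i ys] by blast
 qed simp
 ultimately show ?thesis using deg_add_dominant[OF x, of "sum_list ys"] x by (cases "sum_list ys = 0") auto
qed

lemmas deg_simps = deg_mult deg_power deg_gen_coeff deg_numeral deg_uminus gen_coeff_nonzero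

section \<open>Lower bounds for binary forms\<close>

text \<open>The discriminant; its dominant term is the one with the highest power of the last coefficient, since
 that variable is the smallest one.\<close>

lemma general_cubic_discriminant_degree:
 fixes a b c e :: "'k::field_char_0 ratfun"
 assumes "a = gen_coeff (bin_mon 3 0)" "b = gen_coeff (bin_mon 3 1)" "c = gen_coeff (bin_mon 3 2)" "e = gen_coeff (bin_mon 3 3)"
 shows "b\<^sup>2 * c\<^sup>2 - 4 * a * c ^ 3 - 4 * b ^ 3 * e - 27 * a\<^sup>2 * e\<^sup>2 + 18 * a * b * c * e \<noteq> 0"
  "deg (b\<^sup>2 * c\<^sup>2 - 4 * a * c ^ 3 - 4 * b ^ 3 * e - 27 * a\<^sup>2 * e\<^sup>2 + 18 * a * b * c * e) =
   frag_cmul 2 (single (bin_mon 3 0) 1 + single (bin_mon 3 3) 1)"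
proof -
 have nz: "a \<noteq> 0" "b \<noteq> 0" "c \<noteq> 0" "e \<noteq> 0" using assms by (simp_all add: gen_coeff_nonzero)
 let ?x = "- (27 * a\<^sup>2 * e\<^sup>2)" and ?ys = "[b\<^sup>2 * c\<^sup>2, - (4 * a * c ^ 3), - (4 * b ^ 3 * e), 18 * a * b * c * e]"
 have dx: "deg ?x = frag_cmul 2 (single (bin_mon 3 0) 1 + single (bin_mon 3 3) 1)"
  using nz by (simp add: deg_simps assms frag_cmul_distrib2)
 have less: "deg y < deg ?x" if "y \<in> set ?ys" for y
 proof -
  have lt: "g < deg ?x"
   if "lookup g (bin_mon 3 3) < 2" "\<And>w. w < bin_mon 3 3 \<Longrightarrow> lookup g w = 0" for g
   unfolding dx less_exponents_iff[of g]
   using that by (intro exI[of _ "bin_mon 3 3"]) (auto simp: lookup_add lookup_single when_def bin_mon_inj bin_mon_less_iff)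
  show ?thesis
   by (rule lt; use that nz in \<open>auto simp: deg_simps assms lookup_add lookup_single when_def bin_mon_inj bin_mon_less_iff\<close>)
 qed
 have eq: "b\<^sup>2 * c\<^sup>2 - 4 * a * c ^ 3 - 4 * b ^ 3 * e - 27 * a\<^sup>2 * e\<^sup>2 + 18 * a * b * c * e = ?x + sum_list ?ys"
  by simp
 have x0: "?x \<noteq> 0" using nz by simp
 note dom = deg_dominant_list[OF x0 less]
 show "b\<^sup>2 * c\<^sup>2 - 4 * a * c ^ 3 - 4 * b ^ 3 * e - 27 * a\<^sup>2 * e\<^sup>2 + 18 * a * b * c * e \<noteq> 0"
  using dom unfolding eq by blast
 show "deg (b\<^sup>2 * c\<^sup>2 - 4 * a * c ^ 3 - 4 * b ^ 3 * e - 27 * a\<^sup>2 * e\<^sup>2 + 18 * a * b * c * e) =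
   frag_cmul 2 (single (bin_mon 3 0) 1 + single (bin_mon 3 3) 1)"
  using dom dx unfolding eq by metis
qed

text \<open>The invariants \<open>I\<close> and \<open>J\<close> of binary quartics, with dominant terms \<open>12 a e\<close> and \<open>72 a c e\<close>.\<close>

lemma general_quartic_invariant_degrees:
 fixes a b c d e :: "'k::field_char_0 ratfun"
 assumes "a = gen_coeff (bin_mon 4 0)" "b = gen_coeff (bin_mon 4 1)" "c = gen_coeff (bin_mon 4 2)"
  "d = gen_coeff (bin_mon 4 3)" "e = gen_coeff (bin_mon 4 4)"
 shows "12 * a * e - 3 * b * d + c\<^sup>2 \<noteq> 0"
  "deg (12 * a * e - 3 * b * d + c\<^sup>2) = single (bin_mon 4 0) 1 + single (bin_mon 4 4) 1"
  "72 * a * c * e + 9 * b * c * d - 27 * a * d\<^sup>2 - 27 * e * b\<^sup>2 - 2 * c ^ 3 \<noteq> 0"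
  "deg (72 * a * c * e + 9 * b * c * d - 27 * a * d\<^sup>2 - 27 * e * b\<^sup>2 - 2 * c ^ 3) =
   single (bin_mon 4 0) 1 + single (bin_mon 4 2) 1 + single (bin_mon 4 4) 1"
proof -
 have nz: "a \<noteq> 0" "b \<noteq> 0" "c \<noteq> 0" "d \<noteq> 0" "e \<noteq> 0" using assms by (simp_all add: gen_coeff_nonzero)
 let ?x = "12 * a * e" and ?ys = "[- (3 * b * d), c\<^sup>2]"
 let ?g = "single (bin_mon 4 0) 1 + single (bin_mon 4 4) 1 :: exponents"
 have dx: "deg ?x = ?g" using nz by (simp add: deg_simps assms)
 have less: "deg y < deg ?x" if "y \<in> set ?ys" for y
 proof -
  have lt: "g < deg ?x"
   if "lookup g (bin_mon 4 4) < 1" "\<And>w. w < bin_mon 4 4 \<Longrightarrow> lookup g w = 0" for g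
   unfolding dx less_exponents_iff[of g]
   using that by (intro exI[of _ "bin_mon 4 4"]) (auto simp: lookup_add lookup_single when_def bin_mon_inj bin_mon_less_iff)
  show ?thesis
   by (rule lt; use that nz in \<open>auto simp: deg_simps assms lookup_add lookup_single when_def bin_mon_inj bin_mon_less_iff\<close>)
 qed
 have x0: "?x \<noteq> 0" using nz by simp
 have eq: "12 * a * e - 3 * b * d + c\<^sup>2 = ?x + sum_list ?ys" by simp
 note dom = deg_dominant_list[OF x0 less]
 show "12 * a * e - 3 * b * d + c\<^sup>2 \<noteq> 0" "deg (12 * a * e - 3 * b * d + c\<^sup>2) = ?g"
  using dom dx unfolding eq by metis+
 let ?x = "72 * a * c * e" and ?ys = "[- (27 * e * b\<^sup>2), 9 * b * c * d, - (27 * a * d\<^sup>2), - (2 * c ^ 3)]"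
 let ?g = "single (bin_mon 4 0) 1 + single (bin_mon 4 2) 1 + single (bin_mon 4 4) 1 :: exponents"
 have dx: "deg ?x = ?g" using nz by (simp add: deg_simps assms)
 have less: "deg y < deg ?x" if "y \<in> set ?ys" for y
 proof -
  have lt: "g < deg ?x"
   if "lookup g (bin_mon 4 4) < 1" "\<And>w. w < bin_mon 4 4 \<Longrightarrow> lookup g w = 0" for g
   unfolding dx less_exponents_iff[of g]
   using that by (intro exI[of _ "bin_mon 4 4"]) (auto simp: lookup_add lookup_single when_def bin_mon_inj bin_mon_less_iff)
  have "deg (- (27 * e * b\<^sup>2)) < deg ?x"
   unfolding dx less_exponents_iff[of "deg (- (27 * e * b\<^sup>2))"]
  proof (intro exI[of _ "bin_mon 4 2"] conjI allI impI)
   have d: "deg (- (27 * e * b\<^sup>2)) = single (bin_mon 4 4) 1 + frag_cmul 2 (single (bin_mon 4 1) 1)"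
    using nz by (simp add: deg_simps assms)
   show "lookup (deg (- (27 * e * b\<^sup>2))) (bin_mon 4 2) < lookup ?g (bin_mon 4 2)"
    unfolding d by (simp add: lookup_add lookup_single when_def bin_mon_inj)
   fix w assume "w < bin_mon 4 2"
   then have "w \<noteq> bin_mon 4 0" "w \<noteq> bin_mon 4 1" "w \<noteq> bin_mon 4 2"
    using below_bin_mon[of w 4 2 0] below_bin_mon[of w 4 2 1] below_bin_mon[of w 4 2 2] by auto
   then show "lookup (deg (- (27 * e * b\<^sup>2))) w = lookup ?g w"
    unfolding d by (auto simp: lookup_add lookup_single when_def)
  qed
  moreover have "deg y < deg ?x" if "y \<in> set (tl ?ys)" for y
   by (rule lt; use that nz in \<open>auto simp: deg_simps assms lookup_add lookup_single when_def bin_mon_inj bin_mon_less_iff\<close>)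
  ultimately show ?thesis using \<open>y \<in> set ?ys\<close> by auto
 qed
 have x0: "?x \<noteq> 0" using nz by simp
 have eq: "72 * a * c * e + 9 * b * c * d - 27 * a * d\<^sup>2 - 27 * e * b\<^sup>2 - 2 * c ^ 3 = ?x + sum_list ?ys" by simp
 note dom = deg_dominant_list[OF x0 less]
 show "72 * a * c * e + 9 * b * c * d - 27 * a * d\<^sup>2 - 27 * e * b\<^sup>2 - 2 * c ^ 3 \<noteq> 0"
  "deg (72 * a * c * e + 9 * b * c * d - 27 * a * d\<^sup>2 - 27 * e * b\<^sup>2 - 2 * c ^ 3) = ?g"
  using dom dx unfolding eq by metis+
qed

text \<open>The new coefficients are determined by the values of the form at a few points, which leaves a polynomial identity.\<close>

lemma cubic_discriminant_covariance:
 fixes k :: "'a::field_char_0"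
 assumes h: "\<And>x y. a' * x ^ 3 + b' * x\<^sup>2 * y + c' * x * y\<^sup>2 + e' * y ^ 3 =
   k * (a * (x * p + y * r) ^ 3 + b * (x * p + y * r)\<^sup>2 * (x * q + y * s) +
    c * (x * p + y * r) * (x * q + y * s)\<^sup>2 + e * (x * q + y * s) ^ 3)"
 shows "b'\<^sup>2 * c'\<^sup>2 - 4 * a' * c' ^ 3 - 4 * b' ^ 3 * e' - 27 * a'\<^sup>2 * e'\<^sup>2 + 18 * a' * b' * c' * e' =
  k ^ 4 * (p * s - q * r) ^ 6 * (b\<^sup>2 * c\<^sup>2 - 4 * a * c ^ 3 - 4 * b ^ 3 * e - 27 * a\<^sup>2 * e\<^sup>2 + 18 * a * b * c * e)"
proof -
 define F where "F x y = k * (a * (x * p + y * r) ^ 3 + b * (x * p + y * r)\<^sup>2 * (x * q + y * s) +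
    c * (x * p + y * r) * (x * q + y * s)\<^sup>2 + e * (x * q + y * s) ^ 3)" for x y
 have F: "a' = F 1 0" "e' = F 0 1" "a' + b' + c' + e' = F 1 1" "a' - b' + c' - e' = F 1 (-1)"
  using h[of 1 0] h[of 0 1] h[of 1 1] h[of 1 "-1"] by (simp_all add: F_def)
 have a': "a' = k * (a * p ^ 3 + b * p\<^sup>2 * q + c * p * q\<^sup>2 + e * q ^ 3)"
  using F(1) by (simp add: F_def)
 have e': "e' = k * (a * r ^ 3 + b * r\<^sup>2 * s + c * r * s\<^sup>2 + e * s ^ 3)"
  using F(2) by (simp add: F_def)
 let ?B = "k * (3 * a * p\<^sup>2 * r + b * (p\<^sup>2 * s + 2 * p * q * r) + c * (2 * p * q * s + q\<^sup>2 * r) + 3 * e * q\<^sup>2 * s)"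
 let ?C = "k * (3 * a * p * r\<^sup>2 + b * (2 * p * r * s + q * r\<^sup>2) + c * (p * s\<^sup>2 + 2 * q * r * s) + 3 * e * q * s\<^sup>2)"
 have "2 * b' = (a' + b' + c' + e') - (a' - b' + c' - e') - 2 * e'" by simp
 also have "\<dots> = F 1 1 - F 1 (-1) - 2 * F 0 1" unfolding F(3,4) unfolding F(2) ..
 also have "\<dots> = 2 * ?B" unfolding F_def by Groebner_Basis.algebra
 finally have b': "b' = ?B" by simp
 have "2 * c' = (a' + b' + c' + e') + (a' - b' + c' - e') - 2 * a'" by simp
 also have "\<dots> = F 1 1 + F 1 (-1) - 2 * F 1 0" unfolding F(3,4) unfolding F(1) ..
 also have "\<dots> = 2 * ?C" unfolding F_def by Groebner_Basis.algebra
 finally have c': "c' = ?C" by simp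
 show ?thesis unfolding a' b' c' e' by Groebner_Basis.algebra
qed

lemma quartic_invariants_covariance:
 fixes k :: "'a::field_char_0"
 assumes h: "\<And>x y. a' * x ^ 4 + b' * x ^ 3 * y + c' * x\<^sup>2 * y\<^sup>2 + d' * x * y ^ 3 + e' * y ^ 4 =
   k * (a * (x * p + y * r) ^ 4 + b * (x * p + y * r) ^ 3 * (x * q + y * s) +
    c * (x * p + y * r)\<^sup>2 * (x * q + y * s)\<^sup>2 + d * (x * p + y * r) * (x * q + y * s) ^ 3 + e * (x * q + y * s) ^ 4)"
 shows "12 * a' * e' - 3 * b' * d' + c'\<^sup>2 = k\<^sup>2 * (p * s - q * r) ^ 4 * (12 * a * e - 3 * b * d + c\<^sup>2)"
  "72 * a' * c' * e' + 9 * b' * c' * d' - 27 * a' * d'\<^sup>2 - 27 * e' * b'\<^sup>2 - 2 * c' ^ 3 =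
   k ^ 3 * (p * s - q * r) ^ 6 * (72 * a * c * e + 9 * b * c * d - 27 * a * d\<^sup>2 - 27 * e * b\<^sup>2 - 2 * c ^ 3)"
proof -
 define F where "F x y = k * (a * (x * p + y * r) ^ 4 + b * (x * p + y * r) ^ 3 * (x * q + y * s) +
    c * (x * p + y * r)\<^sup>2 * (x * q + y * s)\<^sup>2 + d * (x * p + y * r) * (x * q + y * s) ^ 3 + e * (x * q + y * s) ^ 4)" for x y
 have F: "a' = F 1 0" "e' = F 0 1" "a' + b' + c' + d' + e' = F 1 1" "a' - b' + c' - d' + e' = F 1 (-1)"
  "a' + 2 * b' + 4 * c' + 8 * d' + 16 * e' = F 1 2"
  using h[of 1 0] h[of 0 1] h[of 1 1] h[of 1 "-1"] h[of 1 2] by (simp_all add: F_def mult_ac)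
 have a': "a' = k * (a * p ^ 4 + b * p ^ 3 * q + c * p\<^sup>2 * q\<^sup>2 + d * p * q ^ 3 + e * q ^ 4)"
  using F(1) by (simp add: F_def)
 have e': "e' = k * (a * r ^ 4 + b * r ^ 3 * s + c * r\<^sup>2 * s\<^sup>2 + d * r * s ^ 3 + e * s ^ 4)"
  using F(2) by (simp add: F_def)
 let ?B = "k * (4 * a * p ^ 3 * r + b * (p ^ 3 * s + 3 * p\<^sup>2 * q * r) + c * (2 * p\<^sup>2 * q * s + 2 * p * q\<^sup>2 * r)
  + d * (3 * p * q\<^sup>2 * s + q ^ 3 * r) + 4 * e * q ^ 3 * s)"
 let ?D = "k * (4 * a * p * r ^ 3 + b * (3 * p * r\<^sup>2 * s + q * r ^ 3) + c * (2 * p * r * s\<^sup>2 + 2 * q * r\<^sup>2 * s)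
  + d * (p * s ^ 3 + 3 * q * r * s\<^sup>2) + 4 * e * q * s ^ 3)"
 let ?C = "k * (6 * a * p\<^sup>2 * r\<^sup>2 + b * (3 * p\<^sup>2 * r * s + 3 * p * q * r\<^sup>2) + c * (p\<^sup>2 * s\<^sup>2 + 4 * p * q * r * s + q\<^sup>2 * r\<^sup>2)
  + d * (3 * p * q * s\<^sup>2 + 3 * q\<^sup>2 * r * s) + 6 * e * q\<^sup>2 * s\<^sup>2)"
 have "2 * c' = (a' + b' + c' + d' + e') + (a' - b' + c' - d' + e') - 2 * a' - 2 * e'" by simp
 also have "\<dots> = F 1 1 + F 1 (-1) - 2 * F 1 0 - 2 * F 0 1" unfolding F(3,4) unfolding F(1,2) ..
 also have "\<dots> = 2 * ?C" unfolding F_def by Groebner_Basis.algebra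
 finally have c': "c' = ?C" by simp
 have "6 * d' = (a' + 2 * b' + 4 * c' + 8 * d' + 16 * e') - (a' + b' + c' + d' + e') + (a' - b' + c' - d' + e')
   - (a' + 4 * c' + 16 * e')" by simp
 also have "\<dots> = F 1 2 - F 1 1 + F 1 (-1) - (F 1 0 + 4 * ?C + 16 * F 0 1)"
  unfolding F(3,4,5) unfolding F(1,2) c' ..
 also have "\<dots> = 6 * ?D" unfolding F_def by Groebner_Basis.algebra
 finally have d': "d' = ?D" by simp
 have "2 * b' = (a' + b' + c' + d' + e') - (a' - b' + c' - d' + e') - 2 * d'" by simp
 also have "\<dots> = F 1 1 - F 1 (-1) - 2 * ?D" unfolding F(3,4) unfolding d' ..
 also have "\<dots> = 2 * ?B" unfolding F_def by Groebner_Basis.algebra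
 finally have b': "b' = ?B" by simp
 show "12 * a' * e' - 3 * b' * d' + c'\<^sup>2 = k\<^sup>2 * (p * s - q * r) ^ 4 * (12 * a * e - 3 * b * d + c\<^sup>2)"
  unfolding a' b' c' d' e' by Groebner_Basis.algebra
 show "72 * a' * c' * e' + 9 * b' * c' * d' - 27 * a' * d'\<^sup>2 - 27 * e' * b'\<^sup>2 - 2 * c' ^ 3 =
   k ^ 3 * (p * s - q * r) ^ 6 * (72 * a * c * e + 9 * b * c * d - 27 * a * d\<^sup>2 - 27 * e * b\<^sup>2 - 2 * c ^ 3)"
  unfolding a' b' c' d' e' by Groebner_Basis.algebra
qed

lemma lookup_deg_general_pure:
 "lookup (pure_degree d y s) w =
  (if w = single s d then 1 else 0) + int d * lookup (deg (y s)) w"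
 by (auto simp: pure_degree_def lookup_add lookup_single when_def)

text \<open>The first coefficient of \<open>f\<close> is, up to \<open>k\<close>, the value of the general form at the first row of \<open>g\<close>,
 so that its degree is known modulo \<open>d\<close> by \<open>general_form_degree\<close>.\<close>

lemma binary_first_coefficient:
 fixes L :: "'k::field_char_0 ratfun set"
 assumes g: "g \<in> GL 2 UNIV" and f: "f \<in> forms 2 d L" and c: "c \<noteq> 0" and d: "d \<ge> 2" and L: "is_subfield L"
  and fg: "\<And>x. ev id x f = c * ev id (row_times 2 x g) (general_form 2 d)"
 shows "\<exists>s y. (s = 0 \<or> s = d) \<and> lookup f (bin_mon d 0) \<in> L \<and> lookup f (bin_mon d 0) \<noteq> 0 \<and>
  (\<forall>w. lookup (deg (lookup f (bin_mon d 0))) w =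
   lookup (deg c) w + (if w = bin_mon d s then 1 else 0) + int d * y w)"
proof -
 let ?e = "\<lambda>i. if i = 0 then 1 else 0 :: 'k ratfun"
 have keys: "keys f \<subseteq> monomials 2 d" using f by (simp add: forms_def)
 have "ev id ?e f = (\<Sum>i\<le>d. if i = 0 then lookup f (bin_mon d 0) else 0)"
  unfolding ev_binary[OF keys] by (rule sum.cong) (auto simp: zero_power)
 then have val: "lookup f (bin_mon d 0) = c * ev id (row_times 2 ?e g) (general_form 2 d)"
  using fg[of ?e] by simp
 obtain j where "j < 2" "row_times 2 ?e g j \<noteq> 0" using row_times_nonzero[OF g, of 0 ?e] by auto
 from general_form_degree[of d j 2 "row_times 2 ?e g", OF d this] obtain i where
  i: "i < 2" "ev id (row_times 2 ?e g) (general_form 2 d) \<noteq> 0"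
  "deg (ev id (row_times 2 ?e g) (general_form 2 d)) = pure_degree d (row_times 2 ?e g) i" by blast
 have "lookup f (bin_mon d 0) \<in> L"
  using f subfieldD(1)[OF L] by (cases "bin_mon d 0 \<in> keys f") (auto simp: forms_def in_keys_iff)
 moreover have "single i d = bin_mon d (if i = 0 then 0 else d)"
  using i(1) by (auto simp: bin_mon_pure less_2_cases_iff)
 ultimately show ?thesis
  using i(2,3) c unfolding val
  by (intro exI[of _ "if i = 0 then 0 else d"] exI[of _ "lookup (deg (row_times 2 ?e g i))"])
   (auto simp: deg_mult lookup_add lookup_deg_general_pure)
qed

lemma forms_lookup: "is_subfield L \<Longrightarrow> f \<in> forms n d L \<Longrightarrow> lookup f m \<in> L"
 using subfieldD(1)[of L] by (cases "m \<in> keys f") (auto simp: forms_def in_keys_iff)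

lemma binary_cubic_discriminant:
 fixes L :: "'k::field_char_0 ratfun set"
 assumes g: "g \<in> GL 2 UNIV" and f: "f \<in> forms 2 3 L" and c: "c \<noteq> 0" and L: "is_subfield L"
  and fg: "\<And>x. ev id x f = c * ev id (row_times 2 x g) (general_form 2 3)"
 shows "\<exists>D\<in>L. \<exists>u. D \<noteq> 0 \<and> deg D = frag_cmul 4 (deg c) + frag_cmul 6 u +
  frag_cmul 2 (single (bin_mon 3 0) 1 + single (bin_mon 3 3) 1)"
proof -
 let ?a = "\<lambda>i. gen_coeff (bin_mon 3 i) :: 'k ratfun" and ?b = "\<lambda>i. lookup f (bin_mon 3 i)"
 have keys: "keys f \<subseteq> monomials 2 3" using f by (simp add: forms_def)
 have four: "{..3} = {0, 1, 2, 3 :: nat}" by auto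
 have rel: "?b 0 * x ^ 3 + ?b 1 * x\<^sup>2 * y + ?b 2 * x * y\<^sup>2 + ?b 3 * y ^ 3 =
   c * (?a 0 * (x * g $$ (0, 0) + y * g $$ (1, 0)) ^ 3 + ?a 1 * (x * g $$ (0, 0) + y * g $$ (1, 0))\<^sup>2 * (x * g $$ (0, 1) + y * g $$ (1, 1)) +
    ?a 2 * (x * g $$ (0, 0) + y * g $$ (1, 0)) * (x * g $$ (0, 1) + y * g $$ (1, 1))\<^sup>2 + ?a 3 * (x * g $$ (0, 1) + y * g $$ (1, 1)) ^ 3)" for x y
 proof -
  let ?x = "\<lambda>i. if i = 0 then x else if i = 1 then y else 0 :: 'k ratfun"
  show ?thesis using fg[of ?x] unfolding ev_binary[OF keys] ev_binary[OF keys_general_form]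
   by (simp add: four lookup_general_form_bin row_times_2 mult_ac add_ac)
 qed
 let ?D = "(?b 1)\<^sup>2 * (?b 2)\<^sup>2 - 4 * ?b 0 * ?b 2 ^ 3 - 4 * ?b 1 ^ 3 * ?b 3 - 27 * (?b 0)\<^sup>2 * (?b 3)\<^sup>2 + 18 * ?b 0 * ?b 1 * ?b 2 * ?b 3"
 have DL: "?D \<in> L" by (intro subfield_closed L forms_lookup[OF L f])
 define det2 where "det2 = g $$ (0, 0) * g $$ (1, 1) - g $$ (0, 1) * g $$ (1, 0)"
 have det2: "det2 \<noteq> 0" unfolding det2_def by (rule GL_2_det[OF g])
 note inv = general_cubic_discriminant_degree[OF refl refl refl refl, where ?'k = 'k]
 have "?D \<noteq> 0 \<and> deg ?D = frag_cmul 4 (deg c) + frag_cmul 6 (deg det2) +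
   frag_cmul 2 (single (bin_mon 3 0) 1 + single (bin_mon 3 3) 1)"
  unfolding cubic_discriminant_covariance[OF rel] det2_def[symmetric]
  using inv c det2 by (simp add: deg_mult deg_power)
 then show ?thesis using DL by blast
qed

text \<open>Modulo 3 the first coefficient \<open>p\<close> has the degree of one pure coefficient, and the discriminant \<open>D\<close> twice that of
 both together. For hypersurfaces the factor \<open>c\<close> cancels in \<open>D / p\<^sup>4\<close>.\<close>

lemma binary_cubic_lower:
 "enat 2 \<le> ed_general_form TYPE('k::field_char_0) 2 3"
 "enat 1 \<le> ed_general_hypersurface TYPE('k) 2 3"
proof -
 have two: "{..<2} = {0, 1 :: nat}" by auto
 show "enat 2 \<le> ed_general_form TYPE('k) 2 3"
 proof (rule ed_general_form_ge)
  fix L :: "'k ratfun set" and g f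
  assume a: "is_subfield L" "g \<in> GL 2 UNIV" "f \<in> forms 2 3 L"
   "\<And>x. ev id x f = ev id (row_times 2 x g) (general_form 2 3)"
  have a4: "ev id x f = 1 * ev id (row_times 2 x g) (general_form 2 3)" for x using a(4) by simp
  let ?p = "lookup f (bin_mon 3 0)"
  obtain s y where p: "s = 0 \<or> s = 3" "?p \<in> L" "?p \<noteq> 0"
   "\<forall>w. lookup (deg ?p) w = lookup (deg (1::'k ratfun)) w + (if w = bin_mon 3 s then 1 else 0) + int 3 * y w"
   using binary_first_coefficient[OF a(2,3) one_neq_zero _ a(1) a4] by fastforce
  obtain D u where D: "D \<in> L" "D \<noteq> 0" "deg D = frag_cmul 4 (deg (1::'k ratfun)) + frag_cmul 6 u +
    frag_cmul 2 (single (bin_mon 3 0) 1 + single (bin_mon 3 3) 1)"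
   using binary_cubic_discriminant[OF a(2,3) one_neq_zero a(1) a4] by blast
  have "enat (card {..<2::nat}) \<le> trdeg base_field L"
  proof (rule trdeg_ge_degrees(2)[where z = "\<lambda>i. if i = 0 then ?p else D" and q = 3])
   fix c :: "nat \<Rightarrow> int"
   assume "\<And>v. 3 dvd (\<Sum>i<2. c i * lookup (deg (if i = 0 then ?p else D)) v)"
   then have dvd: "3 dvd c 0 * lookup (deg ?p) v + c 1 * lookup (deg D) v" for v
    by (simp add: two)
   have D': "lookup (deg D) (bin_mon 3 i) = 2 + 3 * (2 * lookup u (bin_mon 3 i))"
    if "i = 0 \<or> i = 3" for i
    using that by (auto simp: D(3) deg_1 lookup_add lookup_single when_def bin_mon_inj)
   have p': "lookup (deg ?p) (bin_mon 3 i) = (if i = s then 1 else 0) + 3 * y (bin_mon 3 i)" for i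
    using p(4) by (auto simp: deg_1 bin_mon_inj)
   have 1: "3 dvd (if i = s then c 0 else 0) + 2 * c 1" if "i = 0 \<or> i = 3" for i
   proof -
    have "c 0 * lookup (deg ?p) (bin_mon 3 i) + c 1 * lookup (deg D) (bin_mon 3 i) =
     (if i = s then c 0 else 0) + 2 * c 1 + 3 * (c 0 * y (bin_mon 3 i) + c 1 * (2 * lookup u (bin_mon 3 i)))"
     unfolding D'[OF that] p' by (simp add: algebra_simps)
    then show ?thesis using dvd[of "bin_mon 3 i"] by (simp add: dvd_add_left_iff)
   qed
   have "3 dvd c 0 \<and> 3 dvd c 1" using 1[of 0] 1[of 3] p(1) by auto presburger+
   then show "\<forall>i\<in>{..<2}. 3 dvd c i" by (auto simp: two)
  qed (use p D in auto)
  then show "enat 2 \<le> trdeg base_field L" by simp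
 qed
 show "enat 1 \<le> ed_general_hypersurface TYPE('k) 2 3"
 proof (rule ed_general_hypersurface_ge)
  fix L :: "'k ratfun set" and g f k
  assume a: "is_subfield L" "g \<in> GL 2 UNIV" "f \<in> forms 2 3 L" "k \<noteq> 0"
   "\<And>x. ev id x f = k * ev id (row_times 2 x g) (general_form 2 3)"
  let ?p = "lookup f (bin_mon 3 0)"
  obtain s y where p: "s = 0 \<or> s = 3" "?p \<in> L" "?p \<noteq> 0"
   "\<forall>w. lookup (deg ?p) w = lookup (deg k) w + (if w = bin_mon 3 s then 1 else 0) + int 3 * y w"
   using binary_first_coefficient[OF a(2,3,4) _ a(1,5)] by fastforce
  obtain D u where D: "D \<in> L" "D \<noteq> 0" "deg D = frag_cmul 4 (deg k) + frag_cmul 6 u +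
    frag_cmul 2 (single (bin_mon 3 0) 1 + single (bin_mon 3 3) 1)"
   using binary_cubic_discriminant[OF a(2,3,4,1,5)] by blast
  have "enat (card {..<1::nat}) \<le> trdeg base_field L"
  proof (rule trdeg_ge_degrees(2)[where z = "\<lambda>i. D / ?p ^ 4" and q = 3])
   fix c :: "nat \<Rightarrow> int"
   assume "\<And>v. 3 dvd (\<Sum>i<1. c i * lookup (deg (D / ?p ^ 4)) v)"
   then have dvd: "3 dvd c 0 * lookup (deg (D / ?p ^ 4)) (bin_mon 3 s)" by simp
   have eq: "lookup (deg (D / ?p ^ 4)) (bin_mon 3 s) =
     - 2 + 3 * (2 * lookup u (bin_mon 3 s) - 4 * y (bin_mon 3 s))"
    using p(1,3) D(2) by (auto simp: deg_divide deg_power p(4) D(3) lookup_minus lookup_add lookup_single when_def bin_mon_inj)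
   have "c 0 * lookup (deg (D / ?p ^ 4)) (bin_mon 3 s) =
     - 2 * c 0 + 3 * (c 0 * (2 * lookup u (bin_mon 3 s) - 4 * y (bin_mon 3 s)))"
    unfolding eq by (simp add: algebra_simps)
   then have "3 dvd - 2 * c 0" using dvd by (simp only: dvd_add_left_iff dvd_triv_left)
   then have "3 dvd c 0" by presburger
   then show "\<forall>i\<in>{..<1}. 3 dvd c i" by auto
  qed (use p D a(1) in \<open>auto intro!: subfield_divide subfield_power\<close>)
  then show "enat 1 \<le> trdeg base_field L" by simp
 qed
qed

lemma binary_quartic_invariants:
 fixes L :: "'k::field_char_0 ratfun set"
 assumes g: "g \<in> GL 2 UNIV" and f: "f \<in> forms 2 4 L" and c: "c \<noteq> 0" and L: "is_subfield L"
  and fg: "\<And>x. ev id x f = c * ev id (row_times 2 x g) (general_form 2 4)"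
 shows "\<exists>I\<in>L. \<exists>J\<in>L. \<exists>u. I \<noteq> 0 \<and> J \<noteq> 0 \<and>
  deg I = frag_cmul 2 (deg c) + frag_cmul 4 u + (single (bin_mon 4 0) 1 + single (bin_mon 4 4) 1) \<and>
  deg J = frag_cmul 3 (deg c) + frag_cmul 6 u +
   (single (bin_mon 4 0) 1 + single (bin_mon 4 2) 1 + single (bin_mon 4 4) 1)"
proof -
 let ?a = "\<lambda>i. gen_coeff (bin_mon 4 i) :: 'k ratfun" and ?b = "\<lambda>i. lookup f (bin_mon 4 i)"
 have keys: "keys f \<subseteq> monomials 2 4" using f by (simp add: forms_def)
 have five: "{..4} = {0, 1, 2, 3, 4 :: nat}" by auto
 let ?X = "\<lambda>x y. x * g $$ (0, 0) + y * g $$ (1, 0)" and ?Y = "\<lambda>x y. x * g $$ (0, 1) + y * g $$ (1, 1)"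
 have rel: "?b 0 * x ^ 4 + ?b 1 * x ^ 3 * y + ?b 2 * x\<^sup>2 * y\<^sup>2 + ?b 3 * x * y ^ 3 + ?b 4 * y ^ 4 =
   c * (?a 0 * ?X x y ^ 4 + ?a 1 * ?X x y ^ 3 * ?Y x y + ?a 2 * (?X x y)\<^sup>2 * (?Y x y)\<^sup>2 +
    ?a 3 * ?X x y * ?Y x y ^ 3 + ?a 4 * ?Y x y ^ 4)" for x y
 proof -
  let ?x = "\<lambda>i. if i = 0 then x else if i = 1 then y else 0 :: 'k ratfun"
  show ?thesis using fg[of ?x] unfolding ev_binary[OF keys] ev_binary[OF keys_general_form]
   by (simp add: five lookup_general_form_bin row_times_2 mult_ac add_ac)
 qed
 let ?I = "12 * ?b 0 * ?b 4 - 3 * ?b 1 * ?b 3 + (?b 2)\<^sup>2"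
 let ?J = "72 * ?b 0 * ?b 2 * ?b 4 + 9 * ?b 1 * ?b 2 * ?b 3 - 27 * ?b 0 * (?b 3)\<^sup>2 - 27 * ?b 4 * (?b 1)\<^sup>2 - 2 * ?b 2 ^ 3"
 have IL: "?I \<in> L" "?J \<in> L" by (intro subfield_closed L forms_lookup[OF L f])+
 define det2 where "det2 = g $$ (0, 0) * g $$ (1, 1) - g $$ (0, 1) * g $$ (1, 0)"
 have det2: "det2 \<noteq> 0" unfolding det2_def by (rule GL_2_det[OF g])
 note inv = general_quartic_invariant_degrees[OF refl refl refl refl refl, where ?'k = 'k]
 have "?I \<noteq> 0 \<and> deg ?I = frag_cmul 2 (deg c) + frag_cmul 4 (deg det2) +
   (single (bin_mon 4 0) 1 + single (bin_mon 4 4) 1)"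
  unfolding quartic_invariants_covariance(1)[OF rel] det2_def[symmetric]
  using inv(1,2) c det2 by (simp add: deg_mult deg_power)
 moreover have "?J \<noteq> 0 \<and> deg ?J = frag_cmul 3 (deg c) + frag_cmul 6 (deg det2) +
   (single (bin_mon 4 0) 1 + single (bin_mon 4 2) 1 + single (bin_mon 4 4) 1)"
  unfolding quartic_invariants_covariance(2)[OF rel] det2_def[symmetric]
  using inv(3,4) c det2 by (simp add: deg_mult deg_power)
 ultimately show ?thesis using IL by blast
qed

text \<open>Modulo 2 the degrees of \<open>p\<close>, \<open>I\<close> and \<open>J\<close> are those of one pure coefficient, of both, and of both and the middle
 coefficient. For hypersurfaces the factor \<open>c\<close> cancels in \<open>I / p\<^sup>2\<close> and \<open>J / p\<^sup>3\<close>.\<close>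

lemma binary_quartic_lower:
 "enat 3 \<le> ed_general_form TYPE('k::field_char_0) 2 4"
 "enat 2 \<le> ed_general_hypersurface TYPE('k) 2 4"
proof -
 have two: "{..<2} = {0, 1 :: nat}" by auto
 have three: "{..<3} = {0, 1, 2 :: nat}" by auto
 have even_split: "even (x + 2 * y) \<longleftrightarrow> even x" for x y :: int by simp
 show "enat 3 \<le> ed_general_form TYPE('k) 2 4"
 proof (rule ed_general_form_ge)
  fix L :: "'k ratfun set" and g f
  assume a: "is_subfield L" "g \<in> GL 2 UNIV" "f \<in> forms 2 4 L"
   "\<And>x. ev id x f = ev id (row_times 2 x g) (general_form 2 4)"
  have a4: "ev id x f = 1 * ev id (row_times 2 x g) (general_form 2 4)" for x using a(4) by simp
  let ?p = "lookup f (bin_mon 4 0)"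
  obtain s y where p: "s = 0 \<or> s = 4" "?p \<in> L" "?p \<noteq> 0"
   "\<forall>w. lookup (deg ?p) w = lookup (deg (1::'k ratfun)) w + (if w = bin_mon 4 s then 1 else 0) + int 4 * y w"
   using binary_first_coefficient[OF a(2,3) one_neq_zero _ a(1) a4] by fastforce
  obtain I J u where IJ: "I \<in> L" "J \<in> L" "I \<noteq> 0" "J \<noteq> 0"
   "deg I = frag_cmul 2 (deg (1::'k ratfun)) + frag_cmul 4 u + (single (bin_mon 4 0) 1 + single (bin_mon 4 4) 1)"
   "deg J = frag_cmul 3 (deg (1::'k ratfun)) + frag_cmul 6 u +
    (single (bin_mon 4 0) 1 + single (bin_mon 4 2) 1 + single (bin_mon 4 4) 1)"
   using binary_quartic_invariants[OF a(2,3) one_neq_zero a(1) a4] by blast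
  let ?z = "\<lambda>i :: nat. if i = 0 then ?p else if i = 1 then I else J"
  have "enat (card {..<3::nat}) \<le> trdeg base_field L"
  proof (rule trdeg_ge_degrees(2)[where z = ?z and q = 2])
   fix c :: "nat \<Rightarrow> int"
   assume "\<And>v. 2 dvd (\<Sum>i<3. c i * lookup (deg (?z i)) v)"
   then have dvd: "even (c 0 * lookup (deg ?p) v + (c 1 * lookup (deg I) v + c 2 * lookup (deg J) v))" for v
    by (simp add: three)
   have par: "even (lookup (deg ?p) (bin_mon 4 i)) \<longleftrightarrow> i \<noteq> s"
    "even (lookup (deg I) (bin_mon 4 i)) \<longleftrightarrow> i \<noteq> 0 \<and> i \<noteq> 4"
    "even (lookup (deg J) (bin_mon 4 i)) \<longleftrightarrow> i \<noteq> 0 \<and> i \<noteq> 2 \<and> i \<noteq> 4" for i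
    using p(4) by (auto simp: IJ(5,6) deg_1 lookup_add lookup_single when_def bin_mon_inj)
   show "\<forall>i\<in>{..<3}. 2 dvd c i"
    using dvd[of "bin_mon 4 0"] dvd[of "bin_mon 4 2"] dvd[of "bin_mon 4 4"] p(1)
    by (auto simp: three par)
  qed (use p IJ in auto)
  then show "enat 3 \<le> trdeg base_field L" by simp
 qed
 show "enat 2 \<le> ed_general_hypersurface TYPE('k) 2 4"
 proof (rule ed_general_hypersurface_ge)
  fix L :: "'k ratfun set" and g f k
  assume a: "is_subfield L" "g \<in> GL 2 UNIV" "f \<in> forms 2 4 L" "k \<noteq> 0"
   "\<And>x. ev id x f = k * ev id (row_times 2 x g) (general_form 2 4)"
  let ?p = "lookup f (bin_mon 4 0)"
  obtain s y where p: "s = 0 \<or> s = 4" "?p \<in> L" "?p \<noteq> 0"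
   "\<forall>w. lookup (deg ?p) w = lookup (deg k) w + (if w = bin_mon 4 s then 1 else 0) + int 4 * y w"
   using binary_first_coefficient[OF a(2,3,4) _ a(1,5)] by fastforce
  obtain I J u where IJ: "I \<in> L" "J \<in> L" "I \<noteq> 0" "J \<noteq> 0"
   "deg I = frag_cmul 2 (deg k) + frag_cmul 4 u + (single (bin_mon 4 0) 1 + single (bin_mon 4 4) 1)"
   "deg J = frag_cmul 3 (deg k) + frag_cmul 6 u +
    (single (bin_mon 4 0) 1 + single (bin_mon 4 2) 1 + single (bin_mon 4 4) 1)"
   using binary_quartic_invariants[OF a(2,3,4,1,5)] by blast
  let ?z = "\<lambda>i :: nat. if i = 0 then I / ?p\<^sup>2 else J / ?p ^ 3"
  have "enat (card {..<2::nat}) \<le> trdeg base_field L"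
  proof (rule trdeg_ge_degrees(2)[where z = ?z and q = 2])
   fix c :: "nat \<Rightarrow> int"
   assume "\<And>v. 2 dvd (\<Sum>i<2. c i * lookup (deg (?z i)) v)"
   then have dvd: "even (c 0 * lookup (deg (I / ?p\<^sup>2)) v + c 1 * lookup (deg (J / ?p ^ 3)) v)" for v
    by (simp add: two)
   have par: "even (lookup (deg (I / ?p\<^sup>2)) (bin_mon 4 i)) \<longleftrightarrow> i \<noteq> 0 \<and> i \<noteq> 4" for i
    using p(3) IJ(3) by (auto simp: IJ(5) p(4) deg_divide deg_power lookup_minus lookup_add lookup_single when_def bin_mon_inj)
   have par2: "odd (lookup (deg (J / ?p ^ 3)) (bin_mon 4 2))"
    using p(1,3) IJ(4) by (auto simp: IJ(6) p(4) deg_divide deg_power lookup_minus lookup_add lookup_single when_def bin_mon_inj)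
   show "\<forall>i\<in>{..<2}. 2 dvd c i"
    using dvd[of "bin_mon 4 0"] dvd[of "bin_mon 4 2"] par2 by (auto simp: two par)
  qed (use p IJ a(1) in \<open>auto intro!: subfield_divide subfield_power\<close>)
  then show "enat 2 \<le> trdeg base_field L" by simp
 qed
qed

section \<open>Normal forms of binary forms\<close>

text \<open>Scaling by \<open>p / r\<close> turns the coefficients of \<open>y\<^sup>m\<close> and \<open>y\<^bsup>m+1\<^esup>\<close> into the same element; if one
 of them vanishes, one parameter suffices anyway.\<close>

lemma equalize_coefficients:
 assumes K: "is_subfield K" and "p \<in> K" "r \<in> K"
 obtains b w where "b \<in> K" "b \<noteq> 0" "w \<in> K" "b ^ m * p \<in> {0, w}" "b ^ Suc m * r \<in> {0, w}"
proof (cases "p = 0 \<or> r = 0")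
 case True
 then show ?thesis using that[of 1 p] that[of 1 r] assms subfieldD(2)[OF K] by auto
next
 case False
 have "(p / r) ^ Suc m * r = (p / r) ^ m * p" using False by simp
 then show ?thesis using that[of "p / r" "(p / r) ^ m * p"] False assms
  by (auto intro!: subfield_closed K)
qed

lemma GL_2_shear:
 assumes K: "is_subfield K" and "t \<in> K" "b \<in> K" "b \<noteq> 0"
 obtains g where "g \<in> GL 2 K" "\<And>x. row_times 2 x g 0 = x 0 + t * (b * x 1)" "\<And>x. row_times 2 x g 1 = b * x 1"
proof -
 define G where "G i j = (if i = 0 then if j = 0 then 1 else 0 else if j = 0 then t * b else b)" for i j :: nat
 have "mat 2 2 (\<lambda>(i, j). G i j) \<in> GL 2 K"
  by (rule GL_lower_triangular[OF K]) (use assms in \<open>auto simp: G_def intro!: subfield_closed K\<close>)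
 moreover have "row_times 2 x (mat 2 2 (\<lambda>(i, j). G i j)) 0 = x 0 + t * (b * x 1)"
  "row_times 2 x (mat 2 2 (\<lambda>(i, j). G i j)) 1 = b * x 1" for x
  by (simp_all add: row_times_2 G_def mult_ac)
 ultimately show ?thesis using that by blast
qed

lemma binary_cubic_normal_form:
 fixes f :: "'a::field_char_0 form"
 assumes K: "is_subfield K" and f: "f \<in> forms 2 3 K" and a: "lookup f (bin_mon 3 0) = a" "a \<noteq> 0"
 obtains g w u v where "g \<in> GL 2 K" "w \<in> K" "u \<in> {0, w}" "v \<in> {0, w}"
  "\<And>x. ev id (row_times 2 x g) f = a * x 0 ^ 3 + u * (x 0 * (x 1)\<^sup>2) + v * x 1 ^ 3"
proof -
 let ?b = "\<lambda>i. lookup f (bin_mon 3 i)"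
 have bK: "?b i \<in> K" for i by (rule forms_lookup[OF K f])
 have aK: "a \<in> K" using bK[of 0] a by simp
 have keys: "keys f \<subseteq> monomials 2 3" using f by (simp add: forms_def)
 have four: "{..3} = {0, 1, 2, 3 :: nat}" by auto
 define t where "t = - ?b 1 / (3 * a)"
 have tK: "t \<in> K" unfolding t_def by (intro subfield_closed K bK aK)
 have b1: "?b 1 = - 3 * a * t" using a(2) by (simp add: t_def)
 define p r where "p = 3 * a * t\<^sup>2 + 2 * ?b 1 * t + ?b 2" and "r = a * t ^ 3 + ?b 1 * t\<^sup>2 + ?b 2 * t + ?b 3"
 have prK: "p \<in> K" "r \<in> K" unfolding p_def r_def by (intro subfield_closed K bK aK tK)+
 obtain b w where bw: "b \<in> K" "b \<noteq> 0" "w \<in> K" "b ^ 2 * p \<in> {0, w}" "b ^ Suc 2 * r \<in> {0, w}"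
  by (rule equalize_coefficients[OF K prK])
 have bw3: "b ^ 3 * r \<in> {0, w}" using bw(5) unfolding numeral_3_eq_3 numeral_2_eq_2 .
 obtain g where g: "g \<in> GL 2 K" "\<And>x. row_times 2 x g 0 = x 0 + t * (b * x 1)" "\<And>x. row_times 2 x g 1 = b * x 1"
  using GL_2_shear[OF K tK bw(1,2)] by metis
 have "ev id (row_times 2 x g) f = a * x 0 ^ 3 + (b ^ 2 * p) * (x 0 * (x 1)\<^sup>2) + (b ^ 3 * r) * x 1 ^ 3" for x
 proof -
  have "ev id (row_times 2 x g) f = a * (x 0 + t * (b * x 1)) ^ 3 + ?b 1 * (x 0 + t * (b * x 1))\<^sup>2 * (b * x 1) +
    ?b 2 * (x 0 + t * (b * x 1)) * (b * x 1)\<^sup>2 + ?b 3 * (b * x 1) ^ 3"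
   unfolding ev_binary[OF keys] g(2,3) by (simp add: four a(1) mult_ac)
  then show ?thesis unfolding p_def r_def b1 by Groebner_Basis.algebra
 qed
 then show ?thesis using that[OF g(1) bw(3,4) bw3] by blast
qed

lemma binary_quartic_normal_form:
 fixes f :: "'a::field_char_0 form"
 assumes K: "is_subfield K" and f: "f \<in> forms 2 4 K" and a: "lookup f (bin_mon 4 0) = a" "a \<noteq> 0"
 obtains g w u v z where "g \<in> GL 2 K" "w \<in> K" "u \<in> {0, w}" "v \<in> {0, w}" "z \<in> K"
  "\<And>x. ev id (row_times 2 x g) f = a * x 0 ^ 4 + u * ((x 0)\<^sup>2 * (x 1)\<^sup>2) + v * (x 0 * x 1 ^ 3) + z * x 1 ^ 4"
proof -
 let ?b = "\<lambda>i. lookup f (bin_mon 4 i)"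
 have bK: "?b i \<in> K" for i by (rule forms_lookup[OF K f])
 have aK: "a \<in> K" using bK[of 0] a by simp
 have keys: "keys f \<subseteq> monomials 2 4" using f by (simp add: forms_def)
 have five: "{..4} = {0, 1, 2, 3, 4 :: nat}" by auto
 define t where "t = - ?b 1 / (4 * a)"
 have tK: "t \<in> K" unfolding t_def by (intro subfield_closed K bK aK)
 have b1: "?b 1 = - 4 * a * t" using a(2) by (simp add: t_def)
 define p r q where "p = 6 * a * t\<^sup>2 + 3 * ?b 1 * t + ?b 2" and "r = 4 * a * t ^ 3 + 3 * ?b 1 * t\<^sup>2 + 2 * ?b 2 * t + ?b 3"
  and "q = a * t ^ 4 + ?b 1 * t ^ 3 + ?b 2 * t\<^sup>2 + ?b 3 * t + ?b 4"
 have prK: "p \<in> K" "r \<in> K" "q \<in> K" unfolding p_def r_def q_def by (intro subfield_closed K bK aK tK)+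
 obtain b w where bw: "b \<in> K" "b \<noteq> 0" "w \<in> K" "b ^ 2 * p \<in> {0, w}" "b ^ Suc 2 * r \<in> {0, w}"
  by (rule equalize_coefficients[OF K prK(1,2)])
 have bw3: "b ^ 3 * r \<in> {0, w}" using bw(5) unfolding numeral_3_eq_3 numeral_2_eq_2 .
 obtain g where g: "g \<in> GL 2 K" "\<And>x. row_times 2 x g 0 = x 0 + t * (b * x 1)" "\<And>x. row_times 2 x g 1 = b * x 1"
  using GL_2_shear[OF K tK bw(1,2)] by metis
 have "ev id (row_times 2 x g) f = a * x 0 ^ 4 + (b ^ 2 * p) * ((x 0)\<^sup>2 * (x 1)\<^sup>2) + (b ^ 3 * r) * (x 0 * x 1 ^ 3) + (b ^ 4 * q) * x 1 ^ 4" for x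
 proof -
  have "ev id (row_times 2 x g) f = a * (x 0 + t * (b * x 1)) ^ 4 + ?b 1 * (x 0 + t * (b * x 1)) ^ 3 * (b * x 1) +
    ?b 2 * (x 0 + t * (b * x 1))\<^sup>2 * (b * x 1)\<^sup>2 + ?b 3 * (x 0 + t * (b * x 1)) * (b * x 1) ^ 3 + ?b 4 * (b * x 1) ^ 4"
   unfolding ev_binary[OF keys] g(2,3) by (simp add: five a(1) mult_ac)
  then show ?thesis unfolding p_def r_def q_def b1 by Groebner_Basis.algebra
 qed
 moreover have "b ^ 4 * q \<in> K" by (intro subfield_closed K bw prK)
 ultimately show ?thesis using that[OF g(1) bw(3,4) bw3] by blast
qed

text \<open>One normal form gives both bounds: dividing the general form by one of its coefficients makes
 that coefficient 1, which costs no parameter.\<close>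

lemma pure_coefficient_normal_form_upper:
 assumes w: "w \<in> monomials n d"
  and nf: "\<And>(K :: 'k::field_char_0 ratfun set) f a. is_subfield K \<Longrightarrow> f \<in> forms n d K \<Longrightarrow> lookup f w = a \<Longrightarrow> a \<noteq> 0 \<Longrightarrow>
   \<exists>g\<in>GL n K. \<exists>C\<subseteq>K. finite C \<and> card C \<le> r \<and> (\<exists>T\<in>forms n d (adjoin base_field (insert a C)).
    T \<noteq> 0 \<and> (\<forall>x. ev id x T = ev id (row_times n x g) f))"
 shows "ed_general_form TYPE('k) n d \<le> enat (Suc r)"
  "ed_general_hypersurface TYPE('k) n d \<le> enat r"
proof -
 let ?a = "gen_coeff w :: 'k ratfun"
 have lk: "lookup (general_form n d) w = ?a" using w by (simp add: lookup_general_form)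
 obtain g C T where g: "g \<in> GL n (affine_function_field n d)" "C \<subseteq> affine_function_field n d" "finite C" "card C \<le> r"
  "T \<in> forms n d (adjoin base_field (insert ?a C))" "\<forall>x. ev id x T = ev id (row_times n x g) (general_form n d)"
  using nf[OF subfield_function_fields(1) general_form_in_forms lk gen_coeff_nonzero] by (elim bexE exE conjE)
 have "?a \<in> affine_function_field n d"
  using w by (auto simp: affine_function_field_def intro: subsetD[OF adjoin_gen])
 moreover have "card (insert ?a C) \<le> Suc r" using g(3,4) by (simp add: card_insert_if)
 ultimately show "ed_general_form TYPE('k) n d \<le> enat (Suc r)"
  by (intro ed_general_form_le[OF g(1) _ _ _ g(5)]) (use g in auto)
 let ?f = "const (1 / ?a) * general_form n d"
 have "?f = (\<Sum>m\<in>monomials n d. single m (gen_coeff m / ?a))"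
  by (simp add: general_form_def sum_distrib_left const_def mult_single)
 then have lk': "lookup ?f w = 1"
  using w gen_coeff_nonzero[of w] by (simp add: lookup_sum lookup_single when_def finite_monomials)
 obtain h D S where h: "h \<in> GL n (proj_function_field n d)" "D \<subseteq> proj_function_field n d" "finite D" "card D \<le> r"
  "S \<in> forms n d (adjoin base_field (insert 1 D))" "S \<noteq> 0" "\<forall>x. ev id x S = ev id (row_times n x h) ?f"
  using nf[OF subfield_function_fields(2) scaled_general_form_in_forms[OF w] lk' one_neq_zero] by (elim bexE exE conjE)
 have "adjoin base_field (insert 1 D) \<subseteq> adjoin base_field D"
  by (rule adjoin_least[OF subfield_adjoin adjoin_base]) (use adjoin_gen subfieldD(2)[OF subfield_adjoin] in auto)
 then have S: "S \<in> forms n d (adjoin base_field D)" using h(5) by (auto simp: forms_def)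
 have ev: "ev id x S = 1 / ?a * ev id (row_times n x h) (general_form n d)" for x
  using h(7) by (simp add: ev_const_mult)
 show "ed_general_hypersurface TYPE('k) n d \<le> enat r"
  by (rule ed_general_hypersurface_le[OF h(1,3,2,4) S h(6) _ ev]) (simp add: gen_coeff_nonzero)
qed

lemma binary_cubic_upper:
 "ed_general_form TYPE('k::field_char_0) 2 3 \<le> enat 2"
 "ed_general_hypersurface TYPE('k) 2 3 \<le> enat 1"
proof -
 have four: "{..3} = {0, 1, 2, 3 :: nat}" by auto
 have m0: "bin_mon 3 0 \<in> monomials 2 3" using bij_betwE[OF monomials_2[of 3]] by simp
 have nf: "\<exists>g\<in>GL 2 K. \<exists>C\<subseteq>K. finite C \<and> card C \<le> 1 \<and> (\<exists>T\<in>forms 2 3 (adjoin base_field (insert a C)).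
   T \<noteq> 0 \<and> (\<forall>x. ev id x T = ev id (row_times 2 x g) f))"
  if K: "is_subfield K" and f: "f \<in> forms 2 3 K" and a: "lookup f (bin_mon 3 0) = a" "a \<noteq> 0" for K :: "'k ratfun set" and f a
 proof -
  obtain g w u v where g: "g \<in> GL 2 K" "w \<in> K" "u \<in> {0, w}" "v \<in> {0, w}"
   "\<And>x. ev id (row_times 2 x g) f = a * x 0 ^ 3 + u * (x 0 * (x 1)\<^sup>2) + v * x 1 ^ 3"
   using binary_cubic_normal_form[OF K f a] by metis
  define T where "T = bin_form 3 (\<lambda>i. if i = 0 then a else if i = 2 then u else if i = 3 then v else 0)"
  have ev: "ev id x T = ev id (row_times 2 x g) f" for x
   unfolding T_def ev_bin_form g(5) by (simp add: four)
  have "ev id (\<lambda>i. if i = 0 then 1 else 0) T = a" unfolding ev g(5) by simp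
  then have "T \<noteq> 0" using a(2) by auto
  moreover have "T \<in> forms 2 3 (adjoin base_field (insert a {w}))" unfolding T_def
   by (rule bin_form_in_forms[OF subfield_adjoin])
    (use g(3,4) adjoin_gen[of "insert a {w}" base_field] subfieldD(1)[OF subfield_adjoin] in auto)
  ultimately show ?thesis using ev g(1,2) by (intro bexI[of _ g] exI[of _ "{w}"]) auto
 qed
 have "ed_general_form TYPE('k) 2 3 \<le> enat (Suc 1)" "ed_general_hypersurface TYPE('k) 2 3 \<le> enat 1"
  by (rule pure_coefficient_normal_form_upper[OF m0]; rule nf; assumption)+
 then show "ed_general_form TYPE('k) 2 3 \<le> enat 2" "ed_general_hypersurface TYPE('k) 2 3 \<le> enat 1"
  by (simp_all only: numeral_2_eq_2 One_nat_def)
qed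

lemma binary_quartic_upper:
 "ed_general_form TYPE('k::field_char_0) 2 4 \<le> enat 3"
 "ed_general_hypersurface TYPE('k) 2 4 \<le> enat 2"
proof -
 have five: "{..4} = {0, 1, 2, 3, 4 :: nat}" by auto
 have m0: "bin_mon 4 0 \<in> monomials 2 4" using bij_betwE[OF monomials_2[of 4]] by simp
 have nf: "\<exists>g\<in>GL 2 K. \<exists>C\<subseteq>K. finite C \<and> card C \<le> 2 \<and> (\<exists>T\<in>forms 2 4 (adjoin base_field (insert a C)).
   T \<noteq> 0 \<and> (\<forall>x. ev id x T = ev id (row_times 2 x g) f))"
  if K: "is_subfield K" and f: "f \<in> forms 2 4 K" and a: "lookup f (bin_mon 4 0) = a" "a \<noteq> 0" for K :: "'k ratfun set" and f a
 proof -
  obtain g w u v z where g: "g \<in> GL 2 K" "w \<in> K" "u \<in> {0, w}" "v \<in> {0, w}" "z \<in> K"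
   "\<And>x. ev id (row_times 2 x g) f = a * x 0 ^ 4 + u * ((x 0)\<^sup>2 * (x 1)\<^sup>2) + v * (x 0 * x 1 ^ 3) + z * x 1 ^ 4"
   using binary_quartic_normal_form[OF K f a] by metis
  define T where "T = bin_form 4 (\<lambda>i. if i = 0 then a else if i = 2 then u else if i = 3 then v else if i = 4 then z else 0)"
  have ev: "ev id x T = ev id (row_times 2 x g) f" for x
   unfolding T_def ev_bin_form g(6) by (simp add: five)
  have "ev id (\<lambda>i. if i = 0 then 1 else 0) T = a" unfolding ev g(6) by simp
  then have "T \<noteq> 0" using a(2) by auto
  moreover have "T \<in> forms 2 4 (adjoin base_field (insert a {w, z}))" unfolding T_def
   by (rule bin_form_in_forms[OF subfield_adjoin])
    (use g(3,4) adjoin_gen[of "insert a {w, z}" base_field] subfieldD(1)[OF subfield_adjoin] in auto)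
  moreover have "card {w, z} \<le> 2" by (simp add: card_insert_if)
  ultimately show ?thesis using ev g(1,2,5) by (intro bexI[of _ g] exI[of _ "{w, z}"]) auto
 qed
 have "ed_general_form TYPE('k) 2 4 \<le> enat (Suc 2)" "ed_general_hypersurface TYPE('k) 2 4 \<le> enat 2"
  by (rule pure_coefficient_normal_form_upper[OF m0]; rule nf; assumption)+
 then show "ed_general_form TYPE('k) 2 4 \<le> enat 3" "ed_general_hypersurface TYPE('k) 2 4 \<le> enat 2"
  by (simp_all only: numeral_2_eq_2 numeral_3_eq_3 One_nat_def)
qed

section \<open>Ternary cubics: the upper bound\<close>

text \<open>Monomials of degree 3 as products of three variables; the order of \<open>i, j, l\<close> does not matter.\<close>

definition cubic_mon :: "nat \<Rightarrow> nat \<Rightarrow> nat \<Rightarrow> nat \<Rightarrow>\<^sub>0 nat" where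
 "cubic_mon i j l = single i 1 + (single j 1 + single l 1)"

definition cubic_mons :: "(nat \<Rightarrow>\<^sub>0 nat) list" where
 "cubic_mons = [cubic_mon 0 0 0, cubic_mon 0 0 1, cubic_mon 0 0 2, cubic_mon 0 1 1, cubic_mon 0 1 2,
   cubic_mon 0 2 2, cubic_mon 1 1 1, cubic_mon 1 1 2, cubic_mon 1 2 2, cubic_mon 2 2 2]"

lemma mon_cubic_mon: "mon x (cubic_mon i j l) = x i * (x j * x l)"
 by (simp add: cubic_mon_def mon_add)

lemma lookup_cubic_mon: "lookup (cubic_mon i j l) t =
  (if t = i then 1 else 0) + ((if t = j then 1 else 0) + (if t = l then 1 else 0))"
 by (simp add: cubic_mon_def lookup_add lookup_single when_def)

lemma distinct_cubic_mons: "distinct cubic_mons"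
proof -
 have "distinct (map (\<lambda>m. (lookup m 0, lookup m 1)) cubic_mons)"
  by (simp add: cubic_mons_def lookup_cubic_mon)
 then show ?thesis by (rule distinct_map[THEN iffD1, THEN conjunct1])
qed

lemma cubic_mon_in: "i < 3 \<Longrightarrow> j < 3 \<Longrightarrow> l < 3 \<Longrightarrow> cubic_mon i j l \<in> monomials 3 3"
 by (auto simp: monomials_def lookup_cubic_mon sum.distrib in_keys_iff split: if_splits)

lemma set_cubic_mons: "set cubic_mons = monomials 3 3"
proof
 show "set cubic_mons \<subseteq> monomials 3 3" by (auto simp: cubic_mons_def intro!: cubic_mon_in)
 show "monomials 3 3 \<subseteq> set cubic_mons"
 proof
  fix m assume m: "m \<in> monomials 3 3"
  obtain a m1 where a: "a < 3" "m1 \<in> monomials 3 2" "m = single a 1 + m1"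
   using monomials_Suc_cases[of m 3 2] m by (auto simp: eval_nat_numeral)
  obtain b m2 where b: "b < 3" "m2 \<in> monomials 3 1" "m1 = single b 1 + m2"
   using monomials_Suc_cases[of m1 3 1] a(2) by (auto simp: eval_nat_numeral)
  obtain c where c: "c < 3" "m2 = single c 1"
   using b(2) unfolding monomials_1 by auto
  have m: "m = cubic_mon a b c" using a(3) b(3) c(2) by (simp add: cubic_mon_def)
  have com: "cubic_mon i j l = cubic_mon j i l" "cubic_mon i j l = cubic_mon i l j" for i j l
   by (simp_all add: cubic_mon_def ac_simps)
  have three: "x = 0 \<or> x = 1 \<or> x = 2" if "x < 3" for x :: nat using that by auto
  have "cubic_mon 0 1 0 = cubic_mon 0 0 1" "cubic_mon 1 0 0 = cubic_mon 0 0 1" "cubic_mon 0 2 0 = cubic_mon 0 0 2"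
   "cubic_mon 2 0 0 = cubic_mon 0 0 2" "cubic_mon 1 0 1 = cubic_mon 0 1 1" "cubic_mon 1 1 0 = cubic_mon 0 1 1"
   "cubic_mon 0 2 1 = cubic_mon 0 1 2" "cubic_mon 1 0 2 = cubic_mon 0 1 2" "cubic_mon 1 2 0 = cubic_mon 0 1 2"
   "cubic_mon 2 0 1 = cubic_mon 0 1 2" "cubic_mon 2 1 0 = cubic_mon 0 1 2" "cubic_mon 2 0 2 = cubic_mon 0 2 2"
   "cubic_mon 2 2 0 = cubic_mon 0 2 2" "cubic_mon 1 2 1 = cubic_mon 1 1 2" "cubic_mon 2 1 1 = cubic_mon 1 1 2"
   "cubic_mon 2 1 2 = cubic_mon 1 2 2" "cubic_mon 2 2 1 = cubic_mon 1 2 2"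
   by (simp_all add: cubic_mon_def ac_simps)
  note eqs = this
  show "m \<in> set cubic_mons"
   using three[OF a(1)] three[OF b(1)] three[OF c(1)] unfolding m
   by (elim disjE) (simp_all only: eqs cubic_mons_def list.set insert_iff simp_thms)
 qed
qed

lemma sum_cubic_monomials: "(\<Sum>m\<in>monomials 3 3. F m) = sum_list (map F cubic_mons)"
 unfolding set_cubic_mons[symmetric] by (rule sum.distinct_set_conv_list[OF distinct_cubic_mons])

definition ternary_cubic :: "((nat \<Rightarrow>\<^sub>0 nat) \<Rightarrow> 'a::field) \<Rightarrow> 'a form" where
 "ternary_cubic t = (\<Sum>m\<in>monomials 3 3. single m (t m))"

lemma ev_ternary_cubic: "ev id x (ternary_cubic t) = sum_list (map (\<lambda>m. t m * mon x m) cubic_mons)"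
proof -
 have "ev id x (ternary_cubic t) = (\<Sum>m\<in>monomials 3 3. t m * mon x m)"
  unfolding ternary_cubic_def ev_sum[OF hom_id(1)] ev_single_id ..
 then show ?thesis unfolding sum_cubic_monomials .
qed

lemma GL_3_explicit:
 fixes G :: "nat \<Rightarrow> nat \<Rightarrow> 'a::field"
 assumes K: "is_subfield K" and in_K: "\<And>i j. i < 3 \<Longrightarrow> j < 3 \<Longrightarrow> G i j \<in> K"
  and d: "G 0 0 * (G 1 1 * G 2 2 - G 1 2 * G 2 1) - G 0 1 * (G 1 0 * G 2 2 - G 1 2 * G 2 0) + G 0 2 * (G 1 0 * G 2 1 - G 1 1 * G 2 0) \<noteq> 0"
 shows "mat 3 3 (\<lambda>(i, j). G i j) \<in> GL 3 K"
proof (rule GL_I[OF K])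
 let ?g = "mat 3 3 (\<lambda>(i, j). G i j)"
 have three: "{..<3} = {0, 1, 2 :: nat}" by auto
 show "?g $$ (i, j) \<in> K" if "i < 3" "j < 3" for i j using that in_K by simp
 show "det ?g \<noteq> 0"
 proof
  assume "det ?g = 0"
  then obtain w where w: "w \<in> carrier_vec 3" "w \<noteq> 0\<^sub>v 3" "?g *\<^sub>v w = 0\<^sub>v 3"
   using det_0_iff_vec_prod_zero_field[of ?g 3] by auto
  have "(?g *\<^sub>v w) $ i = 0" if "i < 3" for i using w(3) that by simp
  then have "(\<Sum>j<3. G i j * w $ j) = 0" if "i < 3" for i
   using that w(1) by (simp add: scalar_prod_def lessThan_atLeast0)
  then have z: "G i 0 * w $ 0 + G i 1 * w $ 1 + G i 2 * w $ 2 = 0" if "i < 3" for i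
   using that by (simp add: three add.assoc)
  let ?D = "G 0 0 * (G 1 1 * G 2 2 - G 1 2 * G 2 1) - G 0 1 * (G 1 0 * G 2 2 - G 1 2 * G 2 0) + G 0 2 * (G 1 0 * G 2 1 - G 1 1 * G 2 0)"
  have "?D * w $ 0 = 0" "?D * w $ 1 = 0" "?D * w $ 2 = 0"
   using z[of 0, simplified] z[of 1, simplified] z[of 2, simplified] unfolding One_nat_def by Groebner_Basis.algebra+
  then have wi: "w $ 0 = 0" "w $ 1 = 0" "w $ 2 = 0" using d by simp_all
  have "w = 0\<^sub>v 3"
  proof (rule eq_vecI)
   fix i assume "i < dim_vec (0\<^sub>v 3 :: 'a vec)"
   then have "i = 0 \<or> i = 1 \<or> i = 2" by auto
   then show "w $ i = 0\<^sub>v 3 $ i" using wi by auto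
  qed (use w(1) in auto)
  then show False using w(2) by simp
 qed
qed simp

lemma GL_3_block:
 assumes K: "is_subfield K" and in_K: "p \<in> K" "q \<in> K" "r \<in> K" "s \<in> K" "u \<in> K" "v \<in> K" and d: "p * s - q * r \<noteq> 0"
 shows "\<exists>g\<in>GL 3 K. \<forall>x. row_times 3 x g 0 = x 0 + (u * x 1 + v * x 2) \<and>
  row_times 3 x g 1 = p * x 1 + r * x 2 \<and> row_times 3 x g 2 = q * x 1 + s * x 2"
proof -
 define G where "G i j = (if i = 0 then (if j = 0 then 1 else 0) else if i = 1 then (if j = 0 then u else if j = 1 then p else q)
   else (if j = 0 then v else if j = 1 then r else s))" for i j :: nat
 let ?g = "mat 3 3 (\<lambda>(i, j). G i j)"
 have three: "{..<3} = {0, 1, 2 :: nat}" by auto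
 have "?g \<in> GL 3 K"
  by (rule GL_3_explicit[OF K]) (use in_K subfieldD(1,2)[OF K] d in \<open>simp_all add: G_def\<close>)
 moreover have "row_times 3 x ?g 0 = x 0 + (u * x 1 + v * x 2)" "row_times 3 x ?g 1 = p * x 1 + r * x 2"
  "row_times 3 x ?g 2 = q * x 1 + s * x 2" for x
  by (simp_all add: row_times_mat three G_def mult_ac)
 ultimately show ?thesis by blast
qed

text \<open>The condition says that the Laplacian dual to \<open>b y\<^sup>2 + e z\<^sup>2\<close>, applied to the cubic, is a linear form not
 involving the second coordinate. So the second basis vector spans the kernel of that linear form, and the first
 one is orthogonal to it.\<close>

lemma apolar_basis:
 fixes b e :: "'a::field_char_0"
 assumes K: "is_subfield K" and in_K: "b \<in> K" "e \<in> K" "\<alpha> \<in> K" "\<beta> \<in> K" "\<gamma> \<in> K" "\<delta> \<in> K"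
  and aniso: "\<And>y z. y \<noteq> 0 \<or> z \<noteq> 0 \<Longrightarrow> b * y\<^sup>2 + e * z\<^sup>2 \<noteq> 0"
 shows "\<exists>p\<in>K. \<exists>q\<in>K. \<exists>r\<in>K. \<exists>s\<in>K. p * s - q * r \<noteq> 0 \<and> b * p * r + e * q * s = 0 \<and>
  (b * r\<^sup>2 + e * s\<^sup>2) * (3 * \<alpha> * p\<^sup>2 * r + \<beta> * (p\<^sup>2 * s + 2 * p * q * r) + \<gamma> * (2 * p * q * s + q\<^sup>2 * r) + 3 * \<delta> * q\<^sup>2 * s) +
   3 * (b * p\<^sup>2 + e * q\<^sup>2) * (\<alpha> * r ^ 3 + \<beta> * r\<^sup>2 * s + \<gamma> * r * s\<^sup>2 + \<delta> * s ^ 3) = 0"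
proof (cases "3 * e * \<alpha> + b * \<gamma> = 0 \<and> e * \<beta> + 3 * b * \<delta> = 0")
 case True
 then show ?thesis
  by (intro bexI[of _ 1] bexI[of _ 0]) (auto simp: subfieldD(1,2)[OF K])
next
 case False
 \<comment> \<open>the coefficients of the Laplacian of the cubic, up to a common factor\<close>
 define l m where "l = 3 * e * \<alpha> + b * \<gamma>" and "m = e * \<beta> + 3 * b * \<delta>"
 have lm: "l \<in> K" "m \<in> K" unfolding l_def m_def by (intro subfield_closed K in_K)+
 have "b * m\<^sup>2 + e * l\<^sup>2 \<noteq> 0" using aniso[of m l] False by (auto simp: l_def m_def)
 then have d: "(e * l) * l - (b * m) * (- m) \<noteq> 0" by (simp add: power2_eq_square algebra_simps)
 have id: "(b * (- m)\<^sup>2 + e * l\<^sup>2) * (3 * \<alpha> * (e * l)\<^sup>2 * (- m) + \<beta> * ((e * l)\<^sup>2 * l + 2 * (e * l) * (b * m) * (- m)) +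
   \<gamma> * (2 * (e * l) * (b * m) * l + (b * m)\<^sup>2 * (- m)) + 3 * \<delta> * (b * m)\<^sup>2 * l) +
   3 * (b * (e * l)\<^sup>2 + e * (b * m)\<^sup>2) * (\<alpha> * (- m) ^ 3 + \<beta> * (- m)\<^sup>2 * l + \<gamma> * (- m) * l\<^sup>2 + \<delta> * l ^ 3) = 0"
  unfolding l_def m_def by Groebner_Basis.algebra
 show ?thesis
 proof (intro bexI conjI)
  show "b * (e * l) * (- m) + e * (b * m) * l = 0" by (simp add: algebra_simps)
 qed (rule d id subfield_closed K in_K lm)+
qed

text \<open>After the two changes of basis the apolarity condition determines the coefficient of \<open>z\<^sup>3\<close>. Scaling \<open>y\<close> and \<open>z\<close> then makes
 those of \<open>y\<^sup>3\<close> and \<open>y\<^sup>2 z\<close> equal to \<open>b\<close> if they are not zero.\<close>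

lemma ternary_pair_normal_form:
 fixes q0 q1 q2 :: "'a::field_char_0"
 assumes K: "is_subfield K" and in_K: "q0 \<in> K" "q1 \<in> K" "q2 \<in> K" "c0 \<in> K" "c1 \<in> K" "c2 \<in> K" "c3 \<in> K"
  and an0: "\<forall>y z. y \<noteq> 0 \<or> z \<noteq> 0 \<longrightarrow> q0 * y\<^sup>2 + q1 * y * z + q2 * z\<^sup>2 \<noteq> 0"
 shows "\<exists>p\<in>K. \<exists>q\<in>K. \<exists>r\<in>K. \<exists>s\<in>K. \<exists>b\<in>K. \<exists>e\<in>K. \<exists>\<gamma>\<in>K. \<exists>\<alpha>\<in>{0, b}. \<exists>\<beta>\<in>{0, b}. b \<noteq> 0 \<and> p * s - q * r \<noteq> 0 \<and>
  (\<forall>y z. q0 * (p * y + r * z)\<^sup>2 + q1 * (p * y + r * z) * (q * y + s * z) + q2 * (q * y + s * z)\<^sup>2 = b * y\<^sup>2 + e * z\<^sup>2) \<and>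
  (\<forall>y z. c0 * (p * y + r * z) ^ 3 + c1 * (p * y + r * z)\<^sup>2 * (q * y + s * z) + c2 * (p * y + r * z) * (q * y + s * z)\<^sup>2 +
    c3 * (q * y + s * z) ^ 3 = \<alpha> * y ^ 3 + \<beta> * y\<^sup>2 * z + \<gamma> * y * z\<^sup>2 - (e * \<beta> / (3 * b)) * z ^ 3)"
proof -
 note aniso = an0[rule_format]
 have q0: "q0 \<noteq> 0" using aniso[of 1 0] by simp
 define t where "t = - q1 / (2 * q0)"
 define e where "e = q2 - q0 * t\<^sup>2"
 define \<beta> \<gamma> \<delta> where "\<beta> = 3 * c0 * t + c1" and "\<gamma> = 3 * c0 * t\<^sup>2 + 2 * c1 * t + c2" and "\<delta> = c0 * t ^ 3 + c1 * t\<^sup>2 + c2 * t + c3"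
 have q1: "q1 = - 2 * q0 * t" using q0 by (simp add: t_def)
 have q2: "q2 = e + q0 * t\<^sup>2" by (simp add: e_def)
 have tK: "t \<in> K" unfolding t_def by (intro subfield_closed K in_K)
 have eK: "e \<in> K" "\<beta> \<in> K" "\<gamma> \<in> K" "\<delta> \<in> K" unfolding e_def \<beta>_def \<gamma>_def \<delta>_def by (intro subfield_closed K in_K tK)+
 have an: "q0 * y\<^sup>2 + e * z\<^sup>2 \<noteq> 0" if "y \<noteq> 0 \<or> z \<noteq> 0" for y z
 proof -
  have "y + t * z \<noteq> 0 \<or> z \<noteq> 0" using that by auto
  from aniso[OF this] show ?thesis unfolding q1 q2 by (simp add: power2_eq_square algebra_simps)
 qed
 have ex: "\<exists>p\<in>K. \<exists>q\<in>K. \<exists>r\<in>K. \<exists>s\<in>K. p * s - q * r \<noteq> 0 \<and> q0 * p * r + e * q * s = 0 \<and>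
  (q0 * r\<^sup>2 + e * s\<^sup>2) * (3 * c0 * p\<^sup>2 * r + \<beta> * (p\<^sup>2 * s + 2 * p * q * r) + \<gamma> * (2 * p * q * s + q\<^sup>2 * r) + 3 * \<delta> * q\<^sup>2 * s) +
   3 * (q0 * p\<^sup>2 + e * q\<^sup>2) * (c0 * r ^ 3 + \<beta> * r\<^sup>2 * s + \<gamma> * r * s\<^sup>2 + \<delta> * s ^ 3) = 0"
  by (rule apolar_basis[OF K in_K(1) eK(1) in_K(4) eK(2,3,4)]) (rule an)
 obtain p q r s where pq: "p \<in> K" "q \<in> K" "r \<in> K" "s \<in> K" "p * s - q * r \<noteq> 0" "q0 * p * r + e * q * s = 0"
  and ap: "(q0 * r\<^sup>2 + e * s\<^sup>2) * (3 * c0 * p\<^sup>2 * r + \<beta> * (p\<^sup>2 * s + 2 * p * q * r) + \<gamma> * (2 * p * q * s + q\<^sup>2 * r) + 3 * \<delta> * q\<^sup>2 * s) +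
   3 * (q0 * p\<^sup>2 + e * q\<^sup>2) * (c0 * r ^ 3 + \<beta> * r\<^sup>2 * s + \<gamma> * r * s\<^sup>2 + \<delta> * s ^ 3) = 0"
  using ex by (elim bexE conjE)
 define B E where "B = q0 * p\<^sup>2 + e * q\<^sup>2" and "E = q0 * r\<^sup>2 + e * s\<^sup>2"
 define A1 A2 A3 A4 where "A1 = c0 * p ^ 3 + \<beta> * p\<^sup>2 * q + \<gamma> * p * q\<^sup>2 + \<delta> * q ^ 3"
  and "A2 = 3 * c0 * p\<^sup>2 * r + \<beta> * (p\<^sup>2 * s + 2 * p * q * r) + \<gamma> * (2 * p * q * s + q\<^sup>2 * r) + 3 * \<delta> * q\<^sup>2 * s"
  and "A3 = 3 * c0 * p * r\<^sup>2 + \<beta> * (r\<^sup>2 * q + 2 * p * s * r) + \<gamma> * (2 * r * q * s + s\<^sup>2 * p) + 3 * \<delta> * q * s\<^sup>2"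
  and "A4 = c0 * r ^ 3 + \<beta> * r\<^sup>2 * s + \<gamma> * r * s\<^sup>2 + \<delta> * s ^ 3"
 have AK: "B \<in> K" "E \<in> K" "A1 \<in> K" "A2 \<in> K" "A3 \<in> K" "A4 \<in> K"
  unfolding B_def E_def A1_def A2_def A3_def A4_def by (intro subfield_closed K in_K eK pq)+
 have ap': "E * A2 + 3 * B * A4 = 0" using ap unfolding B_def E_def A2_def A4_def .
 have B0: "B \<noteq> 0" unfolding B_def by (rule an) (use pq(5) in auto)
 define u where "u = (if A1 = 0 then 1 else B / A1)"
 have u: "u \<in> K" "u \<noteq> 0" using B0 AK subfieldD(2)[OF K] by (auto simp: u_def intro: subfield_closed K)
 define v where "v = (if A2 = 0 then 1 else B / A2)"
 have v: "v \<in> K" "v \<noteq> 0" using B0 AK subfieldD(2)[OF K] by (auto simp: v_def intro: subfield_closed K)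
 have s1: "A1 * u ^ 3 \<in> {0, B * u\<^sup>2}" by (auto simp: u_def power2_eq_square power3_eq_cube)
 have s2: "A2 * u\<^sup>2 * v \<in> {0, B * u\<^sup>2}" by (auto simp: v_def)
 have A4: "A4 = - (E * A2) / (3 * B)" using ap' B0 by (simp add: field_simps add_eq_0_iff2)
 let ?P = "u * (p + t * q)" and ?Q = "u * q" and ?R = "v * (r + t * s)" and ?S = "v * s"
 have det: "?P * ?S - ?Q * ?R \<noteq> 0"
 proof -
  have "?P * ?S - ?Q * ?R = u * v * (p * s - q * r)" by (simp add: algebra_simps)
  then show ?thesis using u v pq(5) by simp
 qed
 have quad: "q0 * (?P * y + ?R * z)\<^sup>2 + q1 * (?P * y + ?R * z) * (?Q * y + ?S * z) + q2 * (?Q * y + ?S * z)\<^sup>2 =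
   (B * u\<^sup>2) * y\<^sup>2 + (E * v\<^sup>2) * z\<^sup>2" for y z
  using pq(6) unfolding q1 q2 B_def E_def by Groebner_Basis.algebra
 have cub: "c0 * (?P * y + ?R * z) ^ 3 + c1 * (?P * y + ?R * z)\<^sup>2 * (?Q * y + ?S * z) + c2 * (?P * y + ?R * z) * (?Q * y + ?S * z)\<^sup>2 +
    c3 * (?Q * y + ?S * z) ^ 3 = (A1 * u ^ 3) * y ^ 3 + (A2 * u\<^sup>2 * v) * y\<^sup>2 * z + (A3 * u * v\<^sup>2) * y * z\<^sup>2 + (A4 * v ^ 3) * z ^ 3" for y z
  unfolding A1_def A2_def A3_def A4_def \<beta>_def \<gamma>_def \<delta>_def by Groebner_Basis.algebra
 have "A4 * v ^ 3 = - ((E * v\<^sup>2) * (A2 * u\<^sup>2 * v) / (3 * (B * u\<^sup>2)))"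
  unfolding A4 using B0 u(2) by (simp add: field_simps power2_eq_square power3_eq_cube)
 then have cub': "c0 * (?P * y + ?R * z) ^ 3 + c1 * (?P * y + ?R * z)\<^sup>2 * (?Q * y + ?S * z) + c2 * (?P * y + ?R * z) * (?Q * y + ?S * z)\<^sup>2 +
    c3 * (?Q * y + ?S * z) ^ 3 = (A1 * u ^ 3) * y ^ 3 + (A2 * u\<^sup>2 * v) * y\<^sup>2 * z + (A3 * u * v\<^sup>2) * y * z\<^sup>2
    - ((E * v\<^sup>2) * (A2 * u\<^sup>2 * v) / (3 * (B * u\<^sup>2))) * z ^ 3" for y z
  using cub[of y z] by simp
 have nz: "B * u\<^sup>2 \<noteq> 0" using B0 u by simp
 show ?thesis
 proof (rule bexI[of _ ?P], rule bexI[of _ ?Q], rule bexI[of _ ?R], rule bexI[of _ ?S], rule bexI[of _ "B * u\<^sup>2"], rule bexI[of _ "E * v\<^sup>2"],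
   rule bexI[of _ "A3 * u * v\<^sup>2"], rule bexI[of _ "A1 * u ^ 3"], rule bexI[of _ "A2 * u\<^sup>2 * v"], intro conjI allI)
 qed (rule nz det quad cub' s1 s2 subfield_closed K AK u v pq tK)+
qed

text \<open>An isotropic vector would make the discriminant of \<open>q\<close> a square, but the exponent of the
 coefficient of \<open>x y\<^sup>2\<close> in its leading monomial is 1.\<close>

lemma general_ternary_cubic_anisotropic:
 fixes y z :: "'k::field_char_0 ratfun"
 defines "A \<equiv> \<lambda>m. gen_coeff m / gen_coeff (cubic_mon 0 0 0) :: 'k ratfun"
 assumes yz: "y \<noteq> 0 \<or> z \<noteq> 0"
 shows "(A (cubic_mon 0 1 1) - (A (cubic_mon 0 0 1))\<^sup>2 / 3) * y\<^sup>2 +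
   (A (cubic_mon 0 1 2) - 2 * A (cubic_mon 0 0 1) * A (cubic_mon 0 0 2) / 3) * y * z +
   (A (cubic_mon 0 2 2) - (A (cubic_mon 0 0 2))\<^sup>2 / 3) * z\<^sup>2 \<noteq> 0"
proof
 define g h1 h2 k0 k1 k2 :: "'k ratfun" where "g = gen_coeff (cubic_mon 0 0 0)" and "h1 = gen_coeff (cubic_mon 0 0 1)"
  and "h2 = gen_coeff (cubic_mon 0 0 2)" and "k0 = gen_coeff (cubic_mon 0 1 1)" and "k1 = gen_coeff (cubic_mon 0 1 2)"
  and "k2 = gen_coeff (cubic_mon 0 2 2)"
 note defs = g_def h1_def h2_def k0_def k1_def k2_def
 have nz: "g \<noteq> 0" "h1 \<noteq> 0" "h2 \<noteq> 0" "k0 \<noteq> 0" "k1 \<noteq> 0" "k2 \<noteq> 0" by (simp_all add: defs gen_coeff_nonzero)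
 let ?q0 = "k0 / g - (h1 / g)\<^sup>2 / 3" and ?q1 = "k1 / g - 2 * (h1 / g) * (h2 / g) / 3" and ?q2 = "k2 / g - (h2 / g)\<^sup>2 / 3"
 assume "(A (cubic_mon 0 1 1) - (A (cubic_mon 0 0 1))\<^sup>2 / 3) * y\<^sup>2 +
   (A (cubic_mon 0 1 2) - 2 * A (cubic_mon 0 0 1) * A (cubic_mon 0 0 2) / 3) * y * z +
   (A (cubic_mon 0 2 2) - (A (cubic_mon 0 0 2))\<^sup>2 / 3) * z\<^sup>2 = 0"
 then have iso: "?q0 * y\<^sup>2 + ?q1 * y * z + ?q2 * z\<^sup>2 = 0" unfolding A_def defs .
 let ?x = "- (36 * k0 * k2 * g\<^sup>2)"
 let ?ys = "[9 * k1\<^sup>2 * g\<^sup>2, - (12 * k1 * h1 * h2 * g), 12 * k0 * h2\<^sup>2 * g, 12 * k2 * h1\<^sup>2 * g]"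
 have disc: "9 * g ^ 4 * (?q1\<^sup>2 - 4 * ?q0 * ?q2) = ?x + sum_list ?ys"
  using nz by (simp add: field_simps power2_eq_square power4_eq_xxxx)
 have "\<exists>w. ?q1\<^sup>2 - 4 * ?q0 * ?q2 = w\<^sup>2"
 proof (cases "y = 0")
  case True
  then have "?q2 = 0" using yz iso by simp
  then show ?thesis by (intro exI[of _ ?q1]) simp
 next
  case False
  have "(?q1\<^sup>2 - 4 * ?q0 * ?q2) * y\<^sup>2 = (2 * ?q2 * z + ?q1 * y)\<^sup>2"
   using iso by Groebner_Basis.algebra
  then show ?thesis using False by (intro exI[of _ "(2 * ?q2 * z + ?q1 * y) / y"]) (simp add: power_divide field_simps)
 qed
 then obtain w where w: "?q1\<^sup>2 - 4 * ?q0 * ?q2 = w\<^sup>2" by blast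
 have inj: "cubic_mon 0 1 1 \<noteq> cubic_mon 0 2 2" "cubic_mon 0 1 1 \<noteq> cubic_mon 0 0 0"
  "cubic_mon 0 0 0 \<noteq> cubic_mon 0 2 2" "cubic_mon 0 0 1 \<noteq> cubic_mon 0 2 2" "cubic_mon 0 0 2 \<noteq> cubic_mon 0 2 2"
  "cubic_mon 0 1 2 \<noteq> cubic_mon 0 2 2" "cubic_mon 0 0 1 \<noteq> cubic_mon 0 1 1" "cubic_mon 0 0 2 \<noteq> cubic_mon 0 1 1"
  "cubic_mon 0 1 2 \<noteq> cubic_mon 0 1 1"
  using distinct_cubic_mons unfolding cubic_mons_def by auto
 have lt: "cubic_mon 0 2 2 < cubic_mon 0 0 0" "cubic_mon 0 2 2 < cubic_mon 0 0 1" "cubic_mon 0 2 2 < cubic_mon 0 0 2"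
  "cubic_mon 0 1 1 < cubic_mon 0 0 0" "cubic_mon 0 1 1 < cubic_mon 0 0 1" "cubic_mon 0 1 1 < cubic_mon 0 0 2"
  unfolding less_exponents_iff by (intro exI[of _ 0]; simp add: lookup_cubic_mon)+
 have lt': "cubic_mon 0 2 2 < cubic_mon 0 1 1" "cubic_mon 0 2 2 < cubic_mon 0 1 2"
  unfolding less_exponents_iff by (intro exI[of _ 1]; simp add: lookup_cubic_mon)+
 have nlt: "\<not> cubic_mon 0 0 0 < cubic_mon 0 2 2" "\<not> cubic_mon 0 0 1 < cubic_mon 0 2 2" "\<not> cubic_mon 0 0 2 < cubic_mon 0 2 2"
  "\<not> cubic_mon 0 1 1 < cubic_mon 0 2 2" "\<not> cubic_mon 0 1 2 < cubic_mon 0 2 2"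
  "\<not> cubic_mon 0 0 0 < cubic_mon 0 1 1" "\<not> cubic_mon 0 0 1 < cubic_mon 0 1 1" "\<not> cubic_mon 0 0 2 < cubic_mon 0 1 1"
  using lt lt' by (simp_all add: order.asym)
 have dx: "deg ?x = single (cubic_mon 0 1 1) 1 + single (cubic_mon 0 2 2) 1 + frag_cmul 2 (single (cubic_mon 0 0 0) 1)"
  using nz by (simp add: deg_simps defs frag_cmul_distrib2)
 have less1: "v < deg ?x"
  if "lookup v (cubic_mon 0 2 2) = 0" "\<And>w. w < cubic_mon 0 2 2 \<Longrightarrow> lookup v w = 0" for v
  unfolding dx less_exponents_iff[of v]
  using that nlt inj by (intro exI[of _ "cubic_mon 0 2 2"]) (auto simp: lookup_add lookup_single when_def)
 have less2: "v < deg ?x"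
  if "lookup v (cubic_mon 0 1 1) = 0" "\<And>w. w < cubic_mon 0 1 1 \<Longrightarrow> lookup v w = (if w = cubic_mon 0 2 2 then 1 else 0)" for v
  unfolding dx less_exponents_iff[of v]
  using that nlt inj by (intro exI[of _ "cubic_mon 0 1 1"]) (auto simp: lookup_add lookup_single when_def)
 have "deg y < deg ?x" if "y \<in> set ?ys" for y
 proof -
  from that consider "y \<in> {9 * k1\<^sup>2 * g\<^sup>2, - (12 * k1 * h1 * h2 * g), 12 * k0 * h2\<^sup>2 * g}" | "y = 12 * k2 * h1\<^sup>2 * g" by auto
  then show ?thesis
  proof cases
   case 1
   show ?thesis
    by (rule less1; use 1 nz inj nlt in \<open>auto simp: deg_simps defs lookup_add lookup_single when_def\<close>)
  next
   case 2
   show ?thesis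
    by (rule less2; use 2 nz inj nlt in \<open>auto simp: deg_simps defs lookup_add lookup_single when_def\<close>)
  qed
 qed
 then have dom: "?x + sum_list ?ys \<noteq> 0 \<and> deg (?x + sum_list ?ys) = deg ?x"
  by (intro deg_dominant_list) (use nz in auto)
 have eq: "?x + sum_list ?ys = 9 * g ^ 4 * w\<^sup>2" using disc unfolding w by simp
 have w0: "w \<noteq> 0" using dom unfolding eq by auto
 have "lookup (deg ?x) (cubic_mon 0 1 1) = lookup (deg (9 * g ^ 4 * w\<^sup>2)) (cubic_mon 0 1 1)"
  using dom unfolding eq by simp
 then have "1 = 2 * lookup (deg w) (cubic_mon 0 1 1)"
  unfolding dx using w0 nz(1) inj by (simp add: deg_simps defs lookup_add lookup_single when_def)
 then show False by presburger
qed

lemma ternary_cubic_upper: "ed_general_hypersurface TYPE('k::field_char_0) 3 3 \<le> enat 3"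
proof -
 let ?g = "gen_coeff (cubic_mon 0 0 0) :: 'k ratfun" and ?K = "proj_function_field 3 3 :: 'k ratfun set"
 have K: "is_subfield ?K" by (rule subfield_function_fields(2))
 define A :: "(nat \<Rightarrow>\<^sub>0 nat) \<Rightarrow> 'k ratfun" where "A m = gen_coeff m / ?g" for m
 have AK: "A (cubic_mon i j l) \<in> ?K" if "i < 3" "j < 3" "l < 3" for i j l
  unfolding A_def by (rule ratio_in_proj_function_field) (use that cubic_mon_in in auto)
 define h1 h2 k0 k1 k2 c0 c1 c2 c3 where "h1 = A (cubic_mon 0 0 1)" and "h2 = A (cubic_mon 0 0 2)" and "k0 = A (cubic_mon 0 1 1)"
  and "k1 = A (cubic_mon 0 1 2)" and "k2 = A (cubic_mon 0 2 2)" and "c0 = A (cubic_mon 1 1 1)" and "c1 = A (cubic_mon 1 1 2)"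
  and "c2 = A (cubic_mon 1 2 2)" and "c3 = A (cubic_mon 2 2 2)"
 note defs = h1_def h2_def k0_def k1_def k2_def c0_def c1_def c2_def c3_def
 have hK: "h1 \<in> ?K" "h2 \<in> ?K" "k0 \<in> ?K" "k1 \<in> ?K" "k2 \<in> ?K" "c0 \<in> ?K" "c1 \<in> ?K" "c2 \<in> ?K" "c3 \<in> ?K"
  unfolding defs by (rule AK; simp)+
 define q0 q1 q2 where "q0 = k0 - h1\<^sup>2 / 3" and "q1 = k1 - 2 * h1 * h2 / 3" and "q2 = k2 - h2\<^sup>2 / 3"
 define d0 d1 d2 d3 where "d0 = 2 * (h1 / 3) ^ 3 - k0 * (h1 / 3) + c0"
  and "d1 = 6 * (h1 / 3)\<^sup>2 * (h2 / 3) - k0 * (h2 / 3) - k1 * (h1 / 3) + c1"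
  and "d2 = 6 * (h1 / 3) * (h2 / 3)\<^sup>2 - k1 * (h2 / 3) - k2 * (h1 / 3) + c2"
  and "d3 = 2 * (h2 / 3) ^ 3 - k2 * (h2 / 3) + c3"
 have qK: "q0 \<in> ?K" "q1 \<in> ?K" "q2 \<in> ?K" "d0 \<in> ?K" "d1 \<in> ?K" "d2 \<in> ?K" "d3 \<in> ?K"
  unfolding q0_def q1_def q2_def d0_def d1_def d2_def d3_def by (intro subfield_closed K hK)+
 have aniso: "\<forall>y z. y \<noteq> 0 \<or> z \<noteq> 0 \<longrightarrow> q0 * y\<^sup>2 + q1 * y * z + q2 * z\<^sup>2 \<noteq> 0"
  unfolding q0_def q1_def q2_def defs A_def by (intro allI impI) (rule general_ternary_cubic_anisotropic)
 obtain p q r s b e \<gamma> \<alpha> \<beta> where nf: "p \<in> ?K" "q \<in> ?K" "r \<in> ?K" "s \<in> ?K" "b \<in> ?K" "e \<in> ?K" "\<gamma> \<in> ?K" "\<alpha> \<in> {0, b}" "\<beta> \<in> {0, b}"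
   "b \<noteq> 0" "p * s - q * r \<noteq> 0"
  and quad: "\<forall>y z. q0 * (p * y + r * z)\<^sup>2 + q1 * (p * y + r * z) * (q * y + s * z) + q2 * (q * y + s * z)\<^sup>2 = b * y\<^sup>2 + e * z\<^sup>2"
  and cub: "\<forall>y z. d0 * (p * y + r * z) ^ 3 + d1 * (p * y + r * z)\<^sup>2 * (q * y + s * z) + d2 * (p * y + r * z) * (q * y + s * z)\<^sup>2 +
    d3 * (q * y + s * z) ^ 3 = \<alpha> * y ^ 3 + \<beta> * y\<^sup>2 * z + \<gamma> * y * z\<^sup>2 - (e * \<beta> / (3 * b)) * z ^ 3"
  using ternary_pair_normal_form[OF K qK aniso] by (elim bexE conjE)
 define u v where "u = - (h1 * p + h2 * q) / 3" and "v = - (h1 * r + h2 * s) / 3"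
 have uv: "u \<in> ?K" "v \<in> ?K" unfolding u_def v_def by (intro subfield_closed K hK nf)+
 obtain G where G: "G \<in> GL 3 ?K" and rows: "\<forall>x. row_times 3 x G 0 = x 0 + (u * x 1 + v * x 2) \<and>
  row_times 3 x G 1 = p * x 1 + r * x 2 \<and> row_times 3 x G 2 = q * x 1 + s * x 2"
  using GL_3_block[OF K nf(1-4) uv nf(11)] by (elim bexE)
 define t where "t m = (let i = lookup m 0; j = lookup m 1 in
   if i = 3 then 1 else if i = 2 then 0 else if i = 1 then (if j = 2 then b else if j = 1 then 0 else e)
   else if j = 3 then \<alpha> else if j = 2 then \<beta> else if j = 1 then \<gamma> else - (e * \<beta> / (3 * b)))" for m :: "nat \<Rightarrow>\<^sub>0 nat"
 have evt: "ev id x (ternary_cubic t) = x 0 ^ 3 + x 0 * (b * (x 1)\<^sup>2 + e * (x 2)\<^sup>2) +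
   (\<alpha> * x 1 ^ 3 + \<beta> * (x 1)\<^sup>2 * x 2 + \<gamma> * x 1 * (x 2)\<^sup>2 - (e * \<beta> / (3 * b)) * x 2 ^ 3)" for x
  unfolding ev_ternary_cubic cubic_mons_def
  by (simp add: mon_cubic_mon t_def Let_def lookup_cubic_mon) (simp add: algebra_simps power2_eq_square power3_eq_cube)
 have complete: "X0 ^ 3 + h1 * X0\<^sup>2 * Y + h2 * X0\<^sup>2 * Z + k0 * X0 * Y\<^sup>2 + k1 * X0 * Y * Z + k2 * X0 * Z\<^sup>2 +
   c0 * Y ^ 3 + c1 * Y\<^sup>2 * Z + c2 * Y * Z\<^sup>2 + c3 * Z ^ 3 =
   x ^ 3 + x * (q0 * Y\<^sup>2 + q1 * Y * Z + q2 * Z\<^sup>2) + (d0 * Y ^ 3 + d1 * Y\<^sup>2 * Z + d2 * Y * Z\<^sup>2 + d3 * Z ^ 3)"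
  if "X0 = x - (h1 / 3 * Y + h2 / 3 * Z)" for X0 Y Z x
 proof -
  define \<eta>1 \<eta>2 where "\<eta>1 = h1 / 3" and "\<eta>2 = h2 / 3"
  have h: "h1 = 3 * \<eta>1" "h2 = 3 * \<eta>2" by (simp_all add: \<eta>1_def \<eta>2_def)
  have q: "q0 = k0 - 3 * \<eta>1\<^sup>2" "q1 = k1 - 6 * \<eta>1 * \<eta>2" "q2 = k2 - 3 * \<eta>2\<^sup>2"
   by (simp_all add: q0_def q1_def q2_def h power2_eq_square)
  show ?thesis unfolding that q d0_def d1_def d2_def d3_def \<eta>1_def[symmetric] \<eta>2_def[symmetric] h by Groebner_Basis.algebra
 qed
 have evG: "ev id (row_times 3 x G) (general_form 3 3) = ?g * ev id x (ternary_cubic t)" for x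
 proof -
  let ?X = "row_times 3 x G"
  have gA: "gen_coeff m = ?g * A m" for m by (simp add: A_def gen_coeff_nonzero)
  have A0: "A (cubic_mon 0 0 0) = 1" by (simp add: A_def gen_coeff_nonzero)
  have X0: "?X 0 = x 0 - (h1 / 3 * ?X 1 + h2 / 3 * ?X 2)"
   unfolding rows[rule_format, of x, THEN conjunct1] rows[rule_format, of x, THEN conjunct2, THEN conjunct1]
    rows[rule_format, of x, THEN conjunct2, THEN conjunct2] u_def v_def by (simp add: field_simps)
  have "ev id ?X (general_form 3 3) = (\<Sum>m\<in>monomials 3 3. ?g * A m * mon ?X m)"
   unfolding ev_general_form by (simp only: gA[symmetric])
  also have "\<dots> = ?g * (?X 0 ^ 3 + h1 * (?X 0)\<^sup>2 * ?X 1 + h2 * (?X 0)\<^sup>2 * ?X 2 + k0 * ?X 0 * (?X 1)\<^sup>2 + k1 * ?X 0 * ?X 1 * ?X 2 + k2 * ?X 0 * (?X 2)\<^sup>2 +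
   c0 * ?X 1 ^ 3 + c1 * (?X 1)\<^sup>2 * ?X 2 + c2 * ?X 1 * (?X 2)\<^sup>2 + c3 * ?X 2 ^ 3)"
   unfolding sum_cubic_monomials cubic_mons_def list.map sum_list.Cons sum_list.Nil mon_cubic_mon A0 defs[symmetric]
   by Groebner_Basis.algebra
  also have "\<dots> = ?g * ev id x (ternary_cubic t)"
   unfolding complete[OF X0] evt using rows quad cub by metis
  finally show ?thesis .
 qed
 show ?thesis
 proof (rule ed_general_hypersurface_le[OF G, of "{b, e, \<gamma>}"])
  let ?L = "adjoin base_field {b, e, \<gamma>} :: 'k ratfun set"
  note L = subfield_adjoin[of base_field "{b, e, \<gamma>}"]
  have bL: "b \<in> ?L" "e \<in> ?L" "\<gamma> \<in> ?L" using adjoin_gen[of "{b, e, \<gamma>}" base_field] by auto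
  have aL: "\<alpha> \<in> ?L" "\<beta> \<in> ?L" using nf(8,9) bL(1) subfieldD(1)[OF L] by auto
  have "- (e * \<beta> / (3 * b)) \<in> ?L" by (intro subfield_closed L bL aL)
  then have "t m \<in> ?L" for m using bL aL subfieldD(1,2)[OF L] by (simp add: t_def Let_def)
  then show "ternary_cubic t \<in> forms 3 3 ?L"
   unfolding ternary_cubic_def by (intro sum_in_forms L)
  have "ev id (\<lambda>i. if i = 0 then 1 else 0) (ternary_cubic t) = 1" unfolding evt by simp
  then show "ternary_cubic t \<noteq> 0" by auto
  show "1 / ?g \<noteq> 0" by (simp add: gen_coeff_nonzero)
  show "ev id x (ternary_cubic t) = 1 / ?g * ev id (row_times 3 x G) (general_form 3 3)" for x
   by (simp add: evG gen_coeff_nonzero)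
  show "card {b, e, \<gamma>} \<le> 3" by (simp add: card_insert_if)
  show "{b, e, \<gamma>} \<subseteq> ?K" using nf(5-7) by simp
 qed simp
qed

section \<open>Generators of rational function fields\<close>

definition pev :: "('f::field \<Rightarrow> 'z::field) \<Rightarrow> 'f poly \<Rightarrow> 'z \<Rightarrow> 'z" where
 "pev h p z = (\<Sum>i\<le>degree p. h (coeff p i) * z ^ i)"

lemma pev_bound:
 assumes "h 0 = 0" "degree p \<le> n"
 shows "pev h p z = (\<Sum>i\<le>n. h (coeff p i) * z ^ i)"
 unfolding pev_def by (rule sum.mono_neutral_left) (use assms in \<open>auto simp: coeff_eq_0\<close>)

lemma pev_pCons:
 assumes h: "is_hom h" shows "pev h (pCons a p) z = h a + z * pev h p z"
proof -
 have "pev h (pCons a p) z = (\<Sum>i\<le>Suc (degree p). h (coeff (pCons a p) i) * z ^ i)"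
  by (rule pev_bound) (auto simp: homD(1)[OF h] degree_pCons_le)
 also have "\<dots> = h a + (\<Sum>i\<le>degree p. h (coeff p i) * z ^ Suc i)"
  by (subst sum.atMost_Suc_shift) simp
 finally show ?thesis by (simp add: pev_def sum_distrib_left mult_ac)
qed

lemma pev_0: "is_hom h \<Longrightarrow> pev h 0 z = 0"
 by (simp add: pev_def homD(1))

lemma pev_1: "is_hom h \<Longrightarrow> pev h 1 z = 1"
 by (simp add: pev_def homD(2))

lemma pev_add:
 assumes h: "is_hom h" shows "pev h (p + q) z = pev h p z + pev h q z"
proof -
 let ?n = "max (degree p) (degree q)"
 have d: "degree (p + q) \<le> ?n" by (rule degree_add_le_max)
 show ?thesis
  using pev_bound[of h "p + q" ?n z] pev_bound[of h p ?n z] pev_bound[of h q ?n z] d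
  by (simp add: homD[OF h] distrib_right sum.distrib)
qed

lemma pev_smult:
 assumes h: "is_hom h" shows "pev h (smult c p) z = h c * pev h p z"
 using pev_bound[of h "smult c p" "degree p" z] homD[OF h] degree_smult_le[of c p]
 by (simp add: pev_def sum_distrib_left mult_ac)

lemma pev_mult:
 assumes h: "is_hom h" shows "pev h (p * q) z = pev h p z * pev h q z"
proof (induction p)
 case 0 then show ?case by (simp add: pev_0[OF h])
next
 case (pCons a p)
 have "pCons a p * q = smult a q + pCons 0 (p * q)" by simp
 then show ?case using pCons by (simp add: pev_add[OF h] pev_smult[OF h] pev_pCons[OF h] homD[OF h] algebra_simps)
qed

lemma pev_hom: "is_hom h \<Longrightarrow> is_hom (\<lambda>p. pev h p z)"
 unfolding is_hom_def[of "\<lambda>p. pev h p z"] by (simp add: pev_0 pev_1 pev_add pev_mult)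

lemma pev_const: "is_hom h \<Longrightarrow> pev h [:a:] z = h a"
 by (simp add: pev_def)

lemma pev_X: "is_hom h \<Longrightarrow> pev h [:0, 1:] z = z"
 by (simp only: pev_pCons pev_0 homD(1,2)) simp

lemma range_hom_subfield:
 fixes h :: "'f::field \<Rightarrow> 'z::field"
 assumes h: "is_hom h" shows "is_subfield (range h)"
proof (rule is_subfieldI)
 show "0 \<in> range h" "1 \<in> range h" using rangeI[of h 0] rangeI[of h 1] by (simp_all add: homD(1,2)[OF h])
 show "x + y \<in> range h" "x * y \<in> range h" if "x \<in> range h" "y \<in> range h" for x y
  using that by (auto simp: homD(3,4)[OF h, symmetric])
 show "- x \<in> range h" if "x \<in> range h" for x using that by (auto simp: hom_uminus[OF h, symmetric])
 show "inverse x \<in> range h" if "x \<in> range h" for x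
 proof -
  obtain y where y: "x = h y" using \<open>x \<in> range h\<close> by (rule rangeE)
  have "inverse x = h (1 / y)" unfolding y hom_divide[OF h] homD(2)[OF h] by (simp add: inverse_eq_divide)
  then show ?thesis by simp
 qed
qed

lemma pev_injective:
 assumes h: "is_hom h" and s: "\<not> algebraic_over (range h) s" and p: "pev h p s = 0"
 shows "p = 0"
proof (rule ccontr)
 assume p0: "p \<noteq> 0"
 let ?p = "\<Sum>i\<le>degree p. Polynomial.monom (h (coeff p i)) i"
 have c: "coeff ?p i = h (coeff p i)" for i
  by (simp add: coeff_sum homD(1)[OF h] coeff_eq_0)
 have "h (lead_coeff p) \<noteq> 0" using p0 hom_inj[OF h, of "lead_coeff p" 0] homD(1)[OF h] by auto
 then have "?p \<noteq> 0" using c[of "degree p"] by auto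
 moreover have "coeffs_in (range h) ?p" unfolding coeffs_in_def c by simp
 moreover have "poly ?p s = 0" using p by (simp add: poly_sum poly_monom pev_def)
 ultimately show False using s unfolding algebraic_over_def by blast
qed

lemma adjoin_rational_function:
 fixes h :: "'f::field_gcd \<Rightarrow> 'z::field"
 assumes h: "is_hom h" and s: "\<not> algebraic_over (range h) s" and x: "x \<in> adjoin (range h) {s}"
 shows "\<exists>a b. pev h b s \<noteq> 0 \<and> x = pev h a s / pev h b s \<and> coprime a b"
proof -
 let ?F = "{pev h a s / pev h b s | a b. pev h b s \<noteq> 0}"
 note ph = pev_hom[OF h, of s]
 have I: "pev h a s / pev h b s \<in> ?F" if "pev h b s \<noteq> 0" for a b using that by blast
 have "is_subfield ?F"
 proof (rule is_subfieldI)
  show "0 \<in> ?F" "1 \<in> ?F" using I[of 1 0] I[of 1 1] by (simp_all add: pev_1[OF h] pev_0[OF h])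
  fix x assume "x \<in> ?F"
  then obtain a b where x: "x = pev h a s / pev h b s" "pev h b s \<noteq> 0" by blast
  show "- x \<in> ?F" using I[of b "- a"] x by (simp add: hom_uminus[OF ph])
  show "inverse x \<in> ?F" if "x \<noteq> 0" using I[of a b] x that by auto
  fix y assume "y \<in> ?F"
  then obtain c d where y: "y = pev h c s / pev h d s" "pev h d s \<noteq> 0" by blast
  show "x + y \<in> ?F" using I[of "b * d" "a * d + c * b"] x y by (simp add: homD[OF ph] add_frac_eq)
  show "x * y \<in> ?F" using I[of "b * d" "a * c"] x y by (simp add: homD[OF ph])
 qed
 moreover have "range h \<subseteq> ?F"
 proof (rule image_subsetI)
  fix c show "h c \<in> ?F" using I[of 1 "[:c:]"] by (simp add: pev_1[OF h] pev_const[OF h])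
 qed
 moreover have "{s} \<subseteq> ?F" using I[of 1 "[:0, 1:]"] unfolding pev_1[OF h] pev_X[OF h] by simp
 ultimately have "x \<in> ?F" using adjoin_least[of ?F "range h" "{s}"] x by blast
 then obtain a b where ab: "x = pev h a s / pev h b s" "pev h b s \<noteq> 0" by blast
 have "b \<noteq> 0" using ab(2) pev_0[OF h] by auto
 then have "gcd a b \<noteq> 0" by simp
 then obtain a' b' where g: "a = a' * gcd a b" "b = b' * gcd a b" "coprime a' b'"
  using gcd_coprime_exists by blast
 have eq: "pev h a s = pev h a' s * pev h (gcd a b) s" "pev h b s = pev h b' s * pev h (gcd a b) s"
  by (metis g(1) pev_mult[OF h], metis g(2) pev_mult[OF h])
 show ?thesis
  by (rule exI[of _ a'], rule exI[of _ b']) (use ab eq g(3) in auto)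
qed

lemma homogenized_value:
 assumes h: "is_hom h" and "degree p \<le> n" and d: "pev h d s \<noteq> 0"
 shows "pev h (\<Sum>i\<le>n. smult (coeff p i) (c ^ i * d ^ (n - i))) s = pev h d s ^ n * pev h p (pev h c s / pev h d s)"
proof -
 note ph = pev_hom[OF h, of s]
 have "pev h (\<Sum>i\<le>n. smult (coeff p i) (c ^ i * d ^ (n - i))) s = (\<Sum>i\<le>n. h (coeff p i) * (pev h c s ^ i * pev h d s ^ (n - i)))"
  by (simp add: hom_sum[OF ph] pev_smult[OF h] homD(4)[OF ph] hom_power[OF ph])
 also have "\<dots> = (\<Sum>i\<le>n. pev h d s ^ n * (h (coeff p i) * (pev h c s / pev h d s) ^ i))"
  by (rule sum.cong) (use d in \<open>auto simp: power_divide power_diff field_simps\<close>)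
 finally show ?thesis using pev_bound[of h p n, OF homD(1)[OF h] assms(2)] by (simp add: sum_distrib_left)
qed

text \<open>If \<open>r = c / d\<close> generates the field, say \<open>s = c'(r) / d'(r)\<close>, then clearing denominators gives a
 homogeneous relation between \<open>c\<close> and \<open>d\<close> whose coefficients are linear in \<open>s\<close>. So \<open>d\<close> divides the first and \<open>c\<close>
 the last of these coefficients.\<close>

lemma inverse_rational_functions_linear:
 fixes h :: "'f::field_gcd \<Rightarrow> 'z::field"
 assumes h: "is_hom h" and s: "\<not> algebraic_over (range h) s"
  and cd: "coprime c d" "pev h d s \<noteq> 0" and cd': "coprime c' d'"
  and inv: "pev h c' (pev h c s / pev h d s) = s * pev h d' (pev h c s / pev h d s)"
 shows "degree c \<le> 1" "degree d \<le> 1"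
proof -
 note ph = pev_hom[OF h, of s]
 define n where "n = max (degree c') (degree d')"
 define \<kappa> where "\<kappa> i = [:coeff c' i, - coeff d' i:]" for i
 let ?S = "\<Sum>i\<le>n. \<kappa> i * (c ^ i * d ^ (n - i))"
 have \<kappa>: "\<kappa> i * q = smult (coeff c' i) q - [:0, 1:] * smult (coeff d' i) q" for i q
  by (simp add: \<kappa>_def algebra_simps)
 have "?S = (\<Sum>i\<le>n. smult (coeff c' i) (c ^ i * d ^ (n - i))) - [:0, 1:] * (\<Sum>i\<le>n. smult (coeff d' i) (c ^ i * d ^ (n - i)))"
  unfolding \<kappa> by (simp only: sum_subtractf sum_distrib_left)
 then have "pev h ?S s = pev h d s ^ n * pev h c' (pev h c s / pev h d s) - s * (pev h d s ^ n * pev h d' (pev h c s / pev h d s))"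
  using homogenized_value[OF h _ cd(2), of c' n c] homogenized_value[OF h _ cd(2), of d' n c]
  by (simp only: hom_diff[OF ph] homD(4)[OF ph] pev_X[OF h] n_def max.cobounded1 max.cobounded2 simp_thms)
 then have S0: "?S = 0" using pev_injective[OF h s, of ?S] unfolding inv by (simp add: algebra_simps)
 have nz: "c' \<noteq> 0 \<or> d' \<noteq> 0" using cd' by auto
 have \<kappa>n: "\<kappa> n \<noteq> 0"
 proof -
  have "coeff c' n \<noteq> 0 \<or> coeff d' n \<noteq> 0"
   using nz unfolding n_def by (metis degree_0 le_zero_eq leading_coeff_0_iff max_def linear)
  then show ?thesis by (auto simp: \<kappa>_def)
 qed
 have \<kappa>0: "\<kappa> 0 \<noteq> 0"
 proof
  assume "\<kappa> 0 = 0"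
  then have "[:0, 1:] dvd c'" "[:0, 1:] dvd d'"
   using poly_eq_0_iff_dvd[of c' 0] poly_eq_0_iff_dvd[of d' 0] by (auto simp: \<kappa>_def poly_0_coeff_0)
  then have "is_unit [:0, 1 :: 'f:]" using cd' coprime_common_divisor by blast
  then show False by (simp add: is_unit_iff_degree)
 qed
 have deg_dvd: "degree q \<le> 1" if "q dvd \<kappa> i" "\<kappa> i \<noteq> 0" for q i
 proof -
  have "degree q \<le> degree (\<kappa> i)" by (rule dvd_imp_degree_le) (use that in auto)
  also have "\<dots> \<le> 1" by (simp add: \<kappa>_def)
  finally show ?thesis .
 qed
 show "degree d \<le> 1"
 proof (rule deg_dvd[OF _ \<kappa>n])
  have "d dvd (\<Sum>i\<in>{..n} - {n}. \<kappa> i * (c ^ i * d ^ (n - i)))"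
   by (intro dvd_sum dvd_mult) (auto simp: dvd_power)
  moreover have "?S = \<kappa> n * c ^ n + (\<Sum>i\<in>{..n} - {n}. \<kappa> i * (c ^ i * d ^ (n - i)))"
   by (subst sum.remove[of _ n]) auto
  ultimately have "d dvd \<kappa> n * c ^ n" using S0 by (simp add: add_eq_0_iff2)
  moreover have "coprime d (c ^ n)" using cd(1) by (simp add: ac_simps)
  ultimately show "d dvd \<kappa> n" using coprime_dvd_mult_left_iff by blast
 qed
 show "degree c \<le> 1"
 proof (rule deg_dvd[OF _ \<kappa>0])
  have "c dvd (\<Sum>i\<in>{..n} - {0}. \<kappa> i * (c ^ i * d ^ (n - i)))"
   by (intro dvd_sum dvd_mult dvd_mult2) (auto simp: dvd_power)
  moreover have "?S = \<kappa> 0 * d ^ n + (\<Sum>i\<in>{..n} - {0}. \<kappa> i * (c ^ i * d ^ (n - i)))"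
   by (subst sum.remove[of _ 0]) auto
  ultimately have "c dvd \<kappa> 0 * d ^ n" using S0 by (simp add: add_eq_0_iff2)
  moreover have "coprime c (d ^ n)" using cd(1) by (simp add: ac_simps)
  ultimately show "c dvd \<kappa> 0" using coprime_dvd_mult_left_iff by blast
 qed
qed

section \<open>Automorphisms of order three of a rational function field\<close>

lemma algebraic_over_base: "is_subfield K \<Longrightarrow> x \<in> K \<Longrightarrow> algebraic_over K x"
 unfolding algebraic_over_def
 by (rule exI[of _ "[:- x, 1:]"]) (auto simp: coeffs_in_def coeff_pCons subfieldD split: nat.splits)

lemma transcendental_quadratic:
 assumes K: "is_subfield K" and s: "\<not> algebraic_over K s" and in_K: "x \<in> K" "y \<in> K" "z \<in> K"
  and e: "x * s\<^sup>2 + y * s + z = 0"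
 shows "x = 0" "y = 0" "z = 0"
proof -
 have "coeffs_in K [:z, y, x:]"
  using in_K subfieldD(1)[OF K] by (auto simp: coeffs_in_def coeff_pCons split: nat.splits)
 moreover have "poly [:z, y, x:] s = 0" using e by (simp add: power2_eq_square algebra_simps)
 ultimately have "[:z, y, x:] = 0" using s unfolding algebraic_over_def by blast
 then show "x = 0" "y = 0" "z = 0" by simp_all
qed

lemma hom_pev:
 assumes A: "is_hom A" and fix_K: "\<And>c. A (h c) = h c"
 shows "A (pev h p z) = pev h p (A z)"
 by (simp add: pev_def hom_sum[OF A] homD(4)[OF A] hom_power[OF A] fix_K)

lemma hom_of_order_three_mobius:
 fixes h :: "'f::field_gcd \<Rightarrow> 'z::field" and A :: "'z \<Rightarrow> 'z"
 assumes h: "is_hom h" and s: "\<not> algebraic_over (range h) s"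
  and A: "is_hom A" and fix_K: "\<And>c. A (h c) = h c"
  and As: "A s \<in> adjoin (range h) {s}" "A (A s) \<in> adjoin (range h) {s}" and A3: "A (A (A s)) = s"
 shows "\<exists>a b c d. c \<in> range h \<and> d \<in> range h \<and> a \<in> range h \<and> b \<in> range h \<and> c * s + d \<noteq> 0 \<and> A s = (a * s + b) / (c * s + d) \<and> a * d - b * c \<noteq> 0"
proof -
 obtain p q where pq: "pev h q s \<noteq> 0" "A s = pev h p s / pev h q s" "coprime p q"
  using adjoin_rational_function[OF h s As(1)] by (elim exE conjE)
 obtain p' q' where pq': "pev h q' s \<noteq> 0" "A (A s) = pev h p' s / pev h q' s" "coprime p' q'"
  using adjoin_rational_function[OF h s As(2)] by (elim exE conjE)
 have "pev h q' (A s) \<noteq> 0"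
  using pq'(1) hom_inj[OF A, of "pev h q' s" 0] by (auto simp: hom_pev[OF A fix_K, symmetric] homD(1)[OF A])
 moreover have "s = pev h p' (A s) / pev h q' (A s)"
  using A3 unfolding pq'(2) hom_divide[OF A] hom_pev[OF A fix_K] by simp
 ultimately have inv: "pev h p' (pev h p s / pev h q s) = s * pev h q' (pev h p s / pev h q s)"
  unfolding pq(2)[symmetric] by (simp add: field_simps)
 note lin = inverse_rational_functions_linear[OF h s pq(3,1) pq'(3) inv]
 have K: "is_subfield (range h)" by (rule range_hom_subfield[OF h])
 have ev1: "pev h r s = h (coeff r 1) * s + h (coeff r 0)" if "degree r \<le> 1" for r
  using pev_bound[of h r 1 s, OF homD(1)[OF h] that] by simp
 define a b c d where "a = h (coeff p 1)" and "b = h (coeff p 0)" and "c = h (coeff q 1)" and "d = h (coeff q 0)"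
 have abcd: "a \<in> range h" "b \<in> range h" "c \<in> range h" "d \<in> range h" by (simp_all add: a_def b_def c_def d_def)
 have nz: "c * s + d \<noteq> 0" and As': "A s = (a * s + b) / (c * s + d)"
  using pq(1,2) ev1[OF lin(1)] ev1[OF lin(2)] by (simp_all add: a_def b_def c_def d_def)
 have "a * d - b * c \<noteq> 0"
 proof
  assume det: "a * d - b * c = 0"
  have "A s \<in> range h"
  proof (cases "c = 0")
   case True
   then have "d \<noteq> 0" "a = 0" using nz det by auto
   then show ?thesis unfolding As' True by (simp add: subfield_divide[OF K] abcd)
  next
   case False
   have "(a * s + b) * c = a * (c * s + d)" using det by (simp add: algebra_simps)
   then have "A s = a / c" unfolding As' using False nz by (simp add: field_simps)
   then show ?thesis by (simp add: subfield_divide[OF K] abcd)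
  qed
  then obtain x where "A s = h x" by blast
  then have "s = h x" using A3 fix_K by simp
  then show False using s algebraic_over_base[OF K, of s] by simp
 qed
 then show ?thesis using abcd nz As' by blast
qed

text \<open>The cube of the matrix is scalar. By Cayley-Hamilton it equals
 \<open>(T\<^sup>2 - D) P - T D\<close> with trace \<open>T\<close> and determinant \<open>D\<close>, and \<open>P\<close> is not scalar
 because \<open>A s \<noteq> s\<close>.\<close>

lemma mobius_order_three_trace:
 fixes A :: "'z::field \<Rightarrow> 'z"
 assumes A: "is_hom A" and fixed: "A a = a" "A b = b" "A c = c" "A d = d"
  and nz: "c * s + d \<noteq> 0" and As: "A s = (a * s + b) / (c * s + d)" "A s \<noteq> s" and A3: "A (A (A s)) = s"
 shows "(a + d)\<^sup>2 = a * d - b * c"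
proof -
 define w x1 w1 x2 where "w = c * s + d" and "x1 = A s" and "w1 = c * x1 + d" and "x2 = A x1"
 have Aw: "A w = w1" "A w1 = c * x2 + d"
  by (simp_all add: w_def w1_def x1_def x2_def homD[OF A] fixed)
 have w1: "w1 \<noteq> 0" using nz hom_inj[OF A, of w 0] Aw(1) by (auto simp: w_def homD(1)[OF A])
 have e1: "x1 * w = a * s + b" using As nz by (simp add: x1_def w_def)
 have "A (x1 * w) = A (a * s + b)" using e1 by simp
 then have e2: "x2 * w1 = a * x1 + b" by (simp add: homD[OF A] fixed Aw x1_def x2_def)
 have "A (x2 * w1) = A (a * x1 + b)" using e2 by simp
 then have e3: "s * (c * x2 + d) = a * x2 + b" using A3 by (simp add: homD[OF A] fixed Aw x1_def x2_def)
 have r1: "w1 * w = c * (a * s + b) + d * w" using e1 unfolding w1_def by Groebner_Basis.algebra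
 have r2: "x2 * (w1 * w) = a * (a * s + b) + b * w" using e1 e2 by Groebner_Basis.algebra
 have "s * (c * (a * (a * s + b) + b * w) + d * (c * (a * s + b) + d * w)) = a * (a * (a * s + b) + b * w) + b * (c * (a * s + b) + d * w)"
  unfolding r2[symmetric] r1[symmetric] using e3 by Groebner_Basis.algebra
 then have "((a + d)\<^sup>2 - (a * d - b * c)) * (s * w - (a * s + b)) = 0"
  unfolding w_def by Groebner_Basis.algebra
 moreover have "s * w - (a * s + b) \<noteq> 0" using As nz by (auto simp: w_def x1_def field_simps)
 ultimately show ?thesis by simp
qed

text \<open>The eigenvalues are \<open>- \<omega> T\<close> and \<open>- \<omega>\<^sup>2 T\<close>. The rows of \<open>P - \<tau>'\<close> are left eigenvectors for
 \<open>\<tau>\<close>; as numerator and denominator they give a coordinate on which the transformation acts by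
 \<open>\<tau> / \<tau>'\<close>.\<close>

lemma mobius_eigenbasis:
 fixes a b c d \<omega> :: "'z::field_char_0"
 assumes K: "is_subfield K" and in_K: "a \<in> K" "b \<in> K" "c \<in> K" "d \<in> K" "\<omega> \<in> K"
  and \<omega>: "\<omega>\<^sup>2 + \<omega> + 1 = 0" and tr: "(a + d)\<^sup>2 = a * d - b * c" and det: "a * d - b * c \<noteq> 0"
 shows "\<exists>x\<in>K. \<exists>y\<in>K. \<exists>x'\<in>K. \<exists>y'\<in>K. \<exists>\<tau>\<in>K. \<exists>\<tau>'\<in>K. x * y' - x' * y \<noteq> 0 \<and> \<tau>' \<noteq> 0 \<and> \<tau>\<^sup>2 + \<tau> * \<tau>' + \<tau>'\<^sup>2 = 0 \<and>
  x * a + y * c = \<tau> * x \<and> x * b + y * d = \<tau> * y \<and> x' * a + y' * c = \<tau>' * x' \<and> x' * b + y' * d = \<tau>' * y'"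
proof -
 define T \<tau> \<tau>' where "T = a + d" and "\<tau> = - \<omega> * T" and "\<tau>' = - (\<omega>\<^sup>2) * T"
 have T: "T \<noteq> 0" using tr det by (auto simp: T_def)
 have \<omega>0: "\<omega> \<noteq> 0" "\<omega> \<noteq> 1" using \<omega> by auto
 have s: "\<tau> + \<tau>' = T" using \<omega> unfolding \<tau>_def \<tau>'_def by Groebner_Basis.algebra
 have p: "\<tau> * \<tau>' = a * d - b * c" using \<omega> tr unfolding \<tau>_def \<tau>'_def T_def by Groebner_Basis.algebra
 have q: "\<tau>\<^sup>2 + \<tau> * \<tau>' + \<tau>'\<^sup>2 = 0" using s p tr unfolding T_def by Groebner_Basis.algebra
 have ne: "\<tau> \<noteq> \<tau>'"
 proof
  assume "\<tau> = \<tau>'"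
  then have "\<omega> * T * (\<omega> - 1) = 0" unfolding \<tau>_def \<tau>'_def by Groebner_Basis.algebra
  then show False using T \<omega>0 by simp
 qed
 have nz: "\<tau>' \<noteq> 0" using T \<omega>0 by (simp add: \<tau>'_def)
 have \<tau>K: "\<tau> \<in> K" "\<tau>' \<in> K" unfolding \<tau>_def \<tau>'_def T_def by (intro subfield_closed K in_K)+
 show ?thesis
 proof (cases "b = 0")
  case False
  have "(a - \<tau>') * b - (a - \<tau>) * b = b * (\<tau> - \<tau>')" by (simp add: algebra_simps)
  then have d1: "(a - \<tau>') * b - (a - \<tau>) * b \<noteq> 0" using False ne by simp
  have e: "(a - \<tau>') * a + b * c = \<tau> * (a - \<tau>')" "(a - \<tau>') * b + b * d = \<tau> * b"
   "(a - \<tau>) * a + b * c = \<tau>' * (a - \<tau>)" "(a - \<tau>) * b + b * d = \<tau>' * b"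
   using s p unfolding T_def by Groebner_Basis.algebra+
  show ?thesis
   by (rule bexI[of _ "a - \<tau>'"], rule bexI[of _ b], rule bexI[of _ "a - \<tau>"], rule bexI[of _ b], rule bexI[of _ \<tau>], rule bexI[of _ \<tau>'])
    (intro conjI d1 nz q e subfield_closed K in_K \<tau>K)+
 next
  case b: True
  show ?thesis
  proof (cases "c = 0")
   case False
   have "c * (d - \<tau>) - c * (d - \<tau>') = c * (\<tau>' - \<tau>)" by (simp add: algebra_simps)
   then have d1: "c * (d - \<tau>) - c * (d - \<tau>') \<noteq> 0" using False ne by simp
   have e: "c * a + (d - \<tau>') * c = \<tau> * c" "c * b + (d - \<tau>') * d = \<tau> * (d - \<tau>')"
    "c * a + (d - \<tau>) * c = \<tau>' * c" "c * b + (d - \<tau>) * d = \<tau>' * (d - \<tau>)"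
    using s p unfolding T_def by Groebner_Basis.algebra+
   show ?thesis
    by (rule bexI[of _ c], rule bexI[of _ "d - \<tau>'"], rule bexI[of _ c], rule bexI[of _ "d - \<tau>"], rule bexI[of _ \<tau>], rule bexI[of _ \<tau>'])
     (intro conjI d1 nz q e subfield_closed K in_K \<tau>K)+
  next
   case True
   have "a\<^sup>2 + a * d + d\<^sup>2 = 0" using tr b by Groebner_Basis.algebra
   note facts = this
   have "d \<noteq> 0" "0 \<in> K" "1 \<in> K" using b det subfieldD(1,2)[OF K] by auto
   note facts = facts this
   show ?thesis
    by (rule bexI[of _ 1], rule bexI[of _ 0], rule bexI[of _ 0], rule bexI[of _ 1], rule bexI[of _ a], rule bexI[of _ d])
     (simp_all add: in_K b True facts)
  qed
 qed
qed

lemma pev_pcompose: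
 assumes h: "is_hom h" shows "pev h (pcompose p q) s = pev h p (pev h q s)"
proof (induction p)
 case 0 then show ?case by (simp add: pev_0[OF h])
next
 case (pCons a p)
 then show ?case unfolding pcompose_pCons pev_add[OF h] pev_mult[OF h] pev_const[OF h] pev_pCons[OF h, of a p] by simp
qed

text \<open>An algebraic generator would be killed by a derivation that does not kill \<open>s\<close>.\<close>

lemma adjoin_change_generator:
 fixes s s' :: "'z::field_char_0"
 assumes K: "is_subfield K" and s: "\<not> algebraic_over K s" and s': "s \<in> adjoin K {s'}"
 shows "\<not> algebraic_over K s'" "adjoin K {s} \<subseteq> adjoin K {s'}"
proof -
 show "adjoin K {s} \<subseteq> adjoin K {s'}"
  by (rule adjoin_least[OF subfield_adjoin adjoin_base]) (use s' in simp)
 obtain d where d: "derivation d" "\<And>y. y \<in> K \<Longrightarrow> d y = 0" "d s = 1"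
  using transcendental_derivation[OF K s] by metis
 show "\<not> algebraic_over K s'"
 proof
  assume "algebraic_over K s'"
  from d(1) _ K this have z: "d s' = 0" by (rule derivation_algebraic) (rule d(2))
  have "d s = 0" using d(1) d(2) _ s' by (rule derivation_adjoin) (auto simp: z)
  then show False using d(3) by simp
 qed
qed

lemma commuting_mobius_diagonal:
 fixes s :: "'z::field_char_0"
 assumes K: "is_subfield K" and s: "\<not> algebraic_over K s" and in_K: "a \<in> K" "b \<in> K" "c \<in> K" "d \<in> K" "\<zeta> \<in> K"
  and \<zeta>: "\<zeta>\<^sup>2 + \<zeta> + 1 = 0" and det: "a * d - b * c \<noteq> 0"
  and com: "(a * (\<zeta> * s) + b) * (c * s + d) = \<zeta> * (a * s + b) * (c * (\<zeta> * s) + d)"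
 shows "b = 0" "c = 0"
proof -
 have "(a * c * (\<zeta> - \<zeta>\<^sup>2)) * s\<^sup>2 + (a * d * (\<zeta> - \<zeta>) + b * c * (1 - \<zeta>\<^sup>2)) * s + b * d * (1 - \<zeta>) = 0"
  using com by Groebner_Basis.algebra
 moreover have "a * c * (\<zeta> - \<zeta>\<^sup>2) \<in> K" "a * d * (\<zeta> - \<zeta>) + b * c * (1 - \<zeta>\<^sup>2) \<in> K" "b * d * (1 - \<zeta>) \<in> K"
  by (intro subfield_closed K in_K)+
 ultimately have z: "a * c * (\<zeta> - \<zeta>\<^sup>2) = 0" "a * d * (\<zeta> - \<zeta>) + b * c * (1 - \<zeta>\<^sup>2) = 0" "b * d * (1 - \<zeta>) = 0"
  using transcendental_quadratic[OF K s] by metis+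
 have \<zeta>': "\<zeta> \<noteq> 0" "\<zeta> \<noteq> 1" using \<zeta> by auto
 have "\<zeta> - \<zeta>\<^sup>2 = \<zeta> * (1 - \<zeta>)" by (simp add: power2_eq_square algebra_simps)
 then have 1: "\<zeta> - \<zeta>\<^sup>2 \<noteq> 0" using \<zeta>' by simp
 have "1 - \<zeta>\<^sup>2 = (1 - \<zeta>) * (1 + \<zeta>)" by (simp add: power2_eq_square algebra_simps)
 moreover have "1 + \<zeta> \<noteq> 0"
 proof
  assume "1 + \<zeta> = 0"
  then have "\<zeta>\<^sup>2 = 0" using \<zeta> by Groebner_Basis.algebra
  then show False using \<zeta>' by simp
 qed
 ultimately have 2: "1 - \<zeta>\<^sup>2 \<noteq> 0" using \<zeta>' by simp
 have ac: "a * c = 0" and bc: "b * c = 0" and bd: "b * d = 0" using z 1 2 \<zeta>' by simp_all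
 then have "a \<noteq> 0" "d \<noteq> 0" using det by auto
 then show "b = 0" "c = 0" using ac bd by simp_all
qed

text \<open>In a coordinate \<open>r\<close> with \<open>A r = \<zeta> r\<close>, also \<open>B r = \<kappa> r\<close>. Then \<open>u = p(r) / q(r)\<close> is defined and
 nonzero at \<open>r = 0\<close> because the product of its conjugates under \<open>B\<close> is 1, whereas \<open>A u = \<omega> u\<close> evaluated
 at this fixed point of \<open>A\<close> gives \<open>\<omega> = 1\<close>.\<close>

theorem rational_function_field_no_heisenberg_action:
 fixes h :: "'f::field_gcd \<Rightarrow> 'z::field_char_0" and A B :: "'z \<Rightarrow> 'z"
 defines "K \<equiv> range h"
 assumes h: "is_hom h" and s: "\<not> algebraic_over K s" "s \<in> E" and E: "E \<subseteq> adjoin K {s}" "is_subfield E" "K \<subseteq> E"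
  and A: "is_hom A" "\<And>c. A (h c) = h c" "\<And>x. x \<in> E \<Longrightarrow> A x \<in> E" "\<And>x. x \<in> E \<Longrightarrow> A (A (A x)) = x"
  and B: "is_hom B" "\<And>c. B (h c) = h c" "\<And>x. x \<in> E \<Longrightarrow> B x \<in> E" "\<And>x. x \<in> E \<Longrightarrow> B (B (B x)) = x"
  and AB: "\<And>x. x \<in> E \<Longrightarrow> A (B x) = B (A x)"
  and U: "U \<in> E" "A U = \<omega> * U" "U * B U * B (B U) = 1" and \<omega>: "\<omega> \<in> K" "\<omega>\<^sup>2 + \<omega> + 1 = 0"
 shows False
proof -
 have K: "is_subfield K" unfolding K_def by (rule range_hom_subfield[OF h])
 have fixA: "A x = x" if "x \<in> K" for x using that A(2) by (auto simp: K_def)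
 have fixB: "B x = x" if "x \<in> K" for x using that B(2) by (auto simp: K_def)
 have \<omega>01: "\<omega> \<noteq> 0" "\<omega> \<noteq> 1" using \<omega>(2) by auto
 have U0: "U \<noteq> 0" using U(3) by auto
 have mobius: "\<exists>a b c d. c \<in> K \<and> d \<in> K \<and> a \<in> K \<and> b \<in> K \<and> c * s + d \<noteq> 0 \<and> C s = (a * s + b) / (c * s + d) \<and> a * d - b * c \<noteq> 0"
  if "\<not> algebraic_over K s" "s \<in> E" "E \<subseteq> adjoin K {s}" "is_hom C" "\<forall>c. C (h c) = h c" "\<forall>x\<in>E. C x \<in> E" "\<forall>x\<in>E. C (C (C x)) = x"
  for s C
  unfolding K_def
  by (rule hom_of_order_three_mobius[OF h _ that(4) that(5)[rule_format]]) (use that in \<open>auto simp: K_def\<close>)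
 have A': "\<forall>c. A (h c) = h c" "\<forall>x\<in>E. A x \<in> E" "\<forall>x\<in>E. A (A (A x)) = x" using A by blast+
 have B': "\<forall>c. B (h c) = h c" "\<forall>x\<in>E. B x \<in> E" "\<forall>x\<in>E. B (B (B x)) = x" using B by blast+
 obtain a b c d where m: "c \<in> K" "d \<in> K" "a \<in> K" "b \<in> K" "c * s + d \<noteq> 0" "A s = (a * s + b) / (c * s + d)" "a * d - b * c \<noteq> 0"
  using mobius[OF s E(1) A(1) A'] by (elim exE conjE)
 have "A s \<noteq> s"
 proof
  assume e: "A s = s"
  obtain p q where pq: "pev h q s \<noteq> 0" "U = pev h p s / pev h q s" "coprime p q"
   using adjoin_rational_function[OF h s(1)[unfolded K_def]] U(1) E(1) unfolding K_def by blast
  have "A U = U" unfolding pq(2) hom_divide[OF A(1)] hom_pev[OF A(1,2)] e ..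
  then show False using U(2) U0 \<omega>01 by simp
 qed
 then have tr: "(a + d)\<^sup>2 = a * d - b * c"
  by (intro mobius_order_three_trace[OF A(1) fixA[OF m(3)] fixA[OF m(4)] fixA[OF m(1)] fixA[OF m(2)] m(5,6)] A(4) s(2))
 obtain x y x' y' \<tau> \<tau>' where xy: "x \<in> K" "y \<in> K" "x' \<in> K" "y' \<in> K" "\<tau> \<in> K" "\<tau>' \<in> K" "x * y' - x' * y \<noteq> 0" "\<tau>' \<noteq> 0"
  "\<tau>\<^sup>2 + \<tau> * \<tau>' + \<tau>'\<^sup>2 = 0" "x * a + y * c = \<tau> * x" "x * b + y * d = \<tau> * y" "x' * a + y' * c = \<tau>' * x'" "x' * b + y' * d = \<tau>' * y'"
  using mobius_eigenbasis[OF K m(3,4,1,2) \<omega> tr m(7)] by (elim bexE conjE)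
 define \<zeta> where "\<zeta> = \<tau> / \<tau>'"
 have \<zeta>: "\<zeta>\<^sup>2 + \<zeta> + 1 = 0" using xy(8,9) by (simp add: \<zeta>_def power_divide field_simps power2_eq_square)
 have \<zeta>K: "\<zeta> \<in> K" unfolding \<zeta>_def by (intro subfield_closed K xy)
 have den: "x' * s + y' \<noteq> 0"
 proof
  assume "x' * s + y' = 0"
  then have "0 * s\<^sup>2 + x' * s + y' = 0" by simp
  then have "x' = 0" "y' = 0" using transcendental_quadratic[OF K s(1) subfieldD(1)[OF K] xy(3,4)] by metis+
  then show False using xy(7) by simp
 qed
 define r where "r = (x * s + y) / (x' * s + y')"
 have As: "A (u * s + v) = ((u * a + v * c) * s + (u * b + v * d)) / (c * s + d)" if "u \<in> K" "v \<in> K" for u v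
  using m(5) unfolding homD[OF A(1)] fixA[OF that(1)] fixA[OF that(2)] m(6) by (simp add: field_simps)
 have Ar: "A r = \<zeta> * r"
  unfolding r_def hom_divide[OF A(1)] As[OF xy(1,2)] As[OF xy(3,4)] xy(10-13) \<zeta>_def
  using m(5) xy(8) den by (simp add: distrib_left[symmetric] mult.assoc)
 have rE: "r \<in> E" unfolding r_def using xy(1-4) E(3) by (intro subfield_closed E(2) s(2)) auto
 have "s \<in> adjoin K {r}"
 proof -
  have rK: "r \<in> adjoin K {r}" using adjoin_gen[of "{r}" K] by simp
  have xyr: "x \<in> adjoin K {r}" "y \<in> adjoin K {r}" "x' \<in> adjoin K {r}" "y' \<in> adjoin K {r}"
   using xy(1-4) adjoin_base[of K "{r}"] by auto
  have e: "r * (x' * s + y') = x * s + y" using den by (simp add: r_def)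
  then have e': "s * (r * x' - x) = y - r * y'" by Groebner_Basis.algebra
  have "r * x' - x \<noteq> 0"
  proof
   assume z: "r * x' - x = 0"
   then have "y - r * y' = 0" using e' by simp
   then have "x * y' - x' * y = 0" using z by Groebner_Basis.algebra
   then show False using xy(7) by simp
  qed
  then have "s = (y - r * y') / (r * x' - x)" using e' by (simp add: field_simps)
  then show ?thesis by (simp only:) (intro subfield_closed subfield_adjoin rK xyr)
 qed
 note ch = adjoin_change_generator[OF K s(1) this]
 have Er: "E \<subseteq> adjoin K {r}" using E(1) ch(2) by blast
 obtain a1 b1 c1 d1 where mB: "c1 \<in> K" "d1 \<in> K" "a1 \<in> K" "b1 \<in> K" "c1 * r + d1 \<noteq> 0" "B r = (a1 * r + b1) / (c1 * r + d1)" "a1 * d1 - b1 * c1 \<noteq> 0"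
  using mobius[OF ch(1) rE Er B(1) B'] by (elim exE conjE)
 have "A (B r) = \<zeta> * B r" using AB[OF rE] unfolding Ar homD(4)[OF B(1)] fixB[OF \<zeta>K] by simp
 moreover have "A (B r) = (a1 * (\<zeta> * r) + b1) / (c1 * (\<zeta> * r) + d1)"
  unfolding mB(6) hom_divide[OF A(1)] homD[OF A(1)] fixA[OF mB(1)] fixA[OF mB(2)] fixA[OF mB(3)] fixA[OF mB(4)] Ar ..
 moreover have "c1 * (\<zeta> * r) + d1 \<noteq> 0"
 proof -
  have "A (c1 * r + d1) = c1 * (\<zeta> * r) + d1" by (simp add: homD[OF A(1)] fixA mB Ar)
  then show ?thesis using mB(5) hom_inj[OF A(1), of "c1 * r + d1" 0] by (auto simp: homD(1)[OF A(1)])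
 qed
 ultimately have com: "(a1 * (\<zeta> * r) + b1) * (c1 * r + d1) = \<zeta> * (a1 * r + b1) * (c1 * (\<zeta> * r) + d1)"
  using mB(5) unfolding mB(6) by (simp add: frac_eq_eq)
 have diag: "b1 = 0" "c1 = 0"
  using commuting_mobius_diagonal[OF K ch(1) mB(3,4,1,2) \<zeta>K \<zeta> mB(7) com] by auto
 define \<kappa> where "\<kappa> = a1 / d1"
 have Br: "B r = \<kappa> * r" unfolding mB(6) diag \<kappa>_def by simp
 have \<kappa>K: "\<kappa> \<in> K" unfolding \<kappa>_def by (intro subfield_closed K mB)
 obtain \<zeta>0 \<kappa>0 \<omega>0 where h0: "\<zeta> = h \<zeta>0" "\<kappa> = h \<kappa>0" "\<omega> = h \<omega>0"
  using \<zeta>K \<kappa>K \<omega>(1) unfolding K_def by blast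
 obtain p q where pq: "pev h q r \<noteq> 0" "U = pev h p r / pev h q r" "coprime p q"
  using adjoin_rational_function[OF h ch(1)[unfolded K_def]] U(1) Er unfolding K_def by blast
 let ?c = "\<lambda>p k. pcompose p [:0, k:]"
 have lin: "pev h [:0, k:] r = h k * r" for k
  by (simp only: pev_pCons[OF h] pev_0[OF h] homD(1)[OF h]) simp
 have comp: "pev h (?c f k) r = pev h f (h k * r)" for f k by (simp add: pev_pcompose[OF h] lin)
 have BBr: "B (B r) = h (\<kappa>0 * \<kappa>0) * r" by (simp add: Br homD[OF B(1)] homD[OF h] h0(2) B(2))
 have UB: "U = pev h p r / pev h q r" "B U = pev h (?c p \<kappa>0) r / pev h (?c q \<kappa>0) r"
  "B (B U) = pev h (?c p (\<kappa>0 * \<kappa>0)) r / pev h (?c q (\<kappa>0 * \<kappa>0)) r"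
  "A U = pev h (?c p \<zeta>0) r / pev h (?c q \<zeta>0) r"
  using pq(2) by (simp_all only: comp hom_divide[OF B(1)] hom_divide[OF A(1)] hom_pev[OF B(1,2)] hom_pev[OF A(1,2)] BBr)
   (simp_all only: Br Ar h0)
 have nz: "pev h (?c q \<kappa>0) r \<noteq> 0" "pev h (?c q (\<kappa>0 * \<kappa>0)) r \<noteq> 0" "pev h (?c q \<zeta>0) r \<noteq> 0"
 proof -
  have "pev h (?c q \<kappa>0) r = B (pev h q r)" "pev h (?c q (\<kappa>0 * \<kappa>0)) r = B (B (pev h q r))" "pev h (?c q \<zeta>0) r = A (pev h q r)"
   by (simp_all only: comp hom_pev[OF B(1,2)] hom_pev[OF A(1,2)] BBr) (simp_all only: Br Ar h0)
  moreover have "B x \<noteq> 0" "A x \<noteq> 0" if "x \<noteq> 0" for x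
   using that hom_inj[OF B(1), of x 0] hom_inj[OF A(1), of x 0] homD(1)[OF B(1)] homD(1)[OF A(1)] by auto
  ultimately show "pev h (?c q \<kappa>0) r \<noteq> 0" "pev h (?c q (\<kappa>0 * \<kappa>0)) r \<noteq> 0" "pev h (?c q \<zeta>0) r \<noteq> 0"
   using pq(1) by simp_all
 qed
 have norm: "(pev h p r / pev h q r) * (pev h (?c p \<kappa>0) r / pev h (?c q \<kappa>0) r) *
   (pev h (?c p (\<kappa>0 * \<kappa>0)) r / pev h (?c q (\<kappa>0 * \<kappa>0)) r) = 1"
  unfolding UB(1)[symmetric] UB(2)[symmetric] UB(3)[symmetric] by (rule U(3))
 have eigen: "pev h (?c p \<zeta>0) r / pev h (?c q \<zeta>0) r = h \<omega>0 * (pev h p r / pev h q r)"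
  unfolding UB(1)[symmetric] UB(4)[symmetric] h0(3)[symmetric] by (rule U(2))
 have inj: "f = g" if "pev h f r = pev h g r" for f g
  using pev_injective[OF h ch(1)[unfolded K_def], of "f - g"] that by (simp add: hom_diff[OF pev_hom[OF h]])
 have "p * ?c p \<kappa>0 * ?c p (\<kappa>0 * \<kappa>0) = q * ?c q \<kappa>0 * ?c q (\<kappa>0 * \<kappa>0)"
  by (rule inj) (use norm pq(1) nz in \<open>simp add: pev_mult[OF h] field_simps\<close>)
 then have "poly (p * ?c p \<kappa>0 * ?c p (\<kappa>0 * \<kappa>0)) 0 = poly (q * ?c q \<kappa>0 * ?c q (\<kappa>0 * \<kappa>0)) 0" by simp
 then have cubes: "poly p 0 * poly p 0 * poly p 0 = poly q 0 * poly q 0 * poly q 0" by (simp add: poly_pcompose)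
 have pq0: "poly p 0 \<noteq> 0" "poly q 0 \<noteq> 0"
 proof -
  have "\<not> (poly p 0 = 0 \<and> poly q 0 = 0)"
  proof
   assume "poly p 0 = 0 \<and> poly q 0 = 0"
   then have "[:0, 1:] dvd p" "[:0, 1:] dvd q" using poly_eq_0_iff_dvd[of p 0] poly_eq_0_iff_dvd[of q 0] by auto
   then have "is_unit [:0, 1 :: 'f:]" using pq(3) coprime_common_divisor by blast
   then show False by (simp add: is_unit_iff_degree)
  qed
  then show "poly p 0 \<noteq> 0" "poly q 0 \<noteq> 0" using cubes by auto
 qed
 have "?c p \<zeta>0 * q = smult \<omega>0 (p * ?c q \<zeta>0)"
  by (rule inj) (use eigen pq(1) nz in \<open>simp add: pev_mult[OF h] pev_smult[OF h] field_simps\<close>)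
 then have "poly (?c p \<zeta>0 * q) 0 = poly (smult \<omega>0 (p * ?c q \<zeta>0)) 0" by simp
 then have "poly p 0 * poly q 0 = \<omega>0 * (poly p 0 * poly q 0)" by (simp add: poly_pcompose)
 then have "\<omega>0 = 1" using pq0 by simp
 then show False using \<omega>01 h0 homD(2)[OF h] by simp
qed

section \<open>Subfields of a rational function field\<close>

definition cst :: "'f::field \<Rightarrow> 'f poly fract" where
 "cst c = to_fract [:c:]"

lemma cst_hom: "is_hom cst"
 by (simp add: is_hom_def cst_def to_fract_add[symmetric] to_fract_mult[symmetric] one_pCons[symmetric])

lemma to_fract_hom: "is_hom to_fract"
 by (simp add: is_hom_def)

lemma pev_cst: "pev cst p (to_fract q) = to_fract (pcompose p q)"
proof (induction p)
 case 0 then show ?case by (simp add: pev_0[OF cst_hom])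
next
 case (pCons a p)
 then show ?case by (simp only: pev_pCons[OF cst_hom] pcompose_pCons to_fract_add to_fract_mult) (simp only: cst_def)
qed

lemma reduced_fraction:
 fixes z :: "'f::field_gcd poly fract"
 shows "\<exists>p q. q \<noteq> 0 \<and> z = to_fract p / to_fract q \<and> coprime p q"
proof -
 obtain a b where ab: "z = Fract a b" "b \<noteq> 0" by (cases z) auto
 then have "gcd a b \<noteq> 0" by simp
 then obtain p q where g: "a = p * gcd a b" "b = q * gcd a b" "coprime p q"
  using gcd_coprime_exists by blast
 have q: "q \<noteq> 0" using g(2) ab(2) by auto
 have "z = to_fract a / to_fract b" using ab(1) by (simp add: Fract_conv_to_fract)
 also have "\<dots> = to_fract (p * gcd a b) / to_fract (q * gcd a b)" using g(1,2) by simp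
 also have "\<dots> = to_fract p / to_fract q" using \<open>gcd a b \<noteq> 0\<close> by simp
 finally show ?thesis using q g(3) by blast
qed

lemma unit_poly_const:
 fixes p :: "'f::field poly"
 assumes "is_unit p" obtains c where "p = [:c:]" "c \<noteq> 0"
proof -
 have "p \<noteq> 0" "degree p = 0" using assms by (auto simp: is_unit_iff_degree)
 then obtain c where "p = [:c:]" by (elim degree_eq_zeroE)
 then show ?thesis using that \<open>p \<noteq> 0\<close> by simp
qed

lemma algebraic_over_range:
 assumes h: "is_hom h" and "algebraic_over (range h) z"
 shows "\<exists>R. R \<noteq> 0 \<and> pev h R z = 0"
proof -
 obtain P where P: "P \<noteq> 0" "coeffs_in (range h) P" "poly P z = 0" using assms unfolding algebraic_over_def by blast
 define R where "R = (\<Sum>i\<le>degree P. Polynomial.monom (inv_into UNIV h (coeff P i)) i)"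
 have inv: "h (inv_into UNIV h (coeff P i)) = coeff P i" for i
  using P(2) by (simp add: coeffs_in_def f_inv_into_f)
 have cR: "h (coeff R i) = coeff P i" for i
  by (simp add: R_def coeff_sum inv coeff_eq_0 homD(1)[OF h])
 have dR: "degree R \<le> degree P"
  unfolding R_def by (rule degree_sum_le) (auto intro: order_trans[OF degree_monom_le])
 have "R \<noteq> 0" using cR[of "degree P"] P(1) by (auto simp: homD(1)[OF h])
 moreover have "pev h R z = 0"
  using pev_bound[of h R "degree P" z, OF homD(1)[OF h] dR] P(3) by (simp add: cR poly_altdef)
 ultimately show ?thesis by blast
qed

text \<open>An element algebraic over the constants is integral over the polynomials, hence a polynomial, and a
 polynomial of positive degree is transcendental.\<close>

lemma algebraic_over_constants:
 fixes z :: "'f::field_gcd poly fract"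
 assumes "algebraic_over (range cst) z" shows "z \<in> range cst"
proof -
 obtain R where R0: "R \<noteq> 0" and Rz: "pev cst R z = 0" using algebraic_over_range[OF cst_hom assms] by blast
 obtain p q where pq: "q \<noteq> 0" "z = to_fract p / to_fract q" "coprime p q" using reduced_fraction[of z] by (elim exE conjE)
 define n where "n = degree R"
 let ?t = "to_fract [:0, 1 :: 'f:]"
 have pt: "pev cst f ?t = to_fract f" for f :: "'f poly" unfolding pev_cst pcompose_idR ..
 let ?S = "\<Sum>i\<le>n. smult (coeff R i) (p ^ i * q ^ (n - i))"
 have "to_fract ?S = to_fract q ^ n * pev cst R z"
  using homogenized_value[of cst R n q ?t p, OF cst_hom] pq(1) unfolding pt pq(2) by (simp add: n_def)
 then have "to_fract ?S = 0" unfolding Rz by simp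
 then have "?S = 0" by (simp only: to_fract_eq_0_iff)
 moreover have "?S = smult (lead_coeff R) (p ^ n) + (\<Sum>i\<in>{..n} - {n}. smult (coeff R i) (p ^ i * q ^ (n - i)))"
  by (subst sum.remove[of _ n]) (auto simp: n_def)
 moreover have "q dvd (\<Sum>i\<in>{..n} - {n}. smult (coeff R i) (p ^ i * q ^ (n - i)))"
  by (intro dvd_sum dvd_smult dvd_mult) (auto simp: dvd_power)
 ultimately have "q dvd smult (lead_coeff R) (p ^ n)" by (simp add: add_eq_0_iff2)
 then have "q dvd p ^ n" using R0 by (simp add: dvd_smult_iff)
 moreover have "coprime q (p ^ n)" using pq(3) by (simp add: ac_simps)
 ultimately have "is_unit q" using coprime_common_divisor[of q "p ^ n" q] by simp
 then obtain k where k: "q = [:k:]" "k \<noteq> 0" by (rule unit_poly_const)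
 define r where "r = smult (inverse k) p"
 have "r * q = p" by (simp add: r_def k)
 then have "to_fract r * to_fract q = to_fract p" by (simp only: to_fract_mult[symmetric])
 then have zr: "z = to_fract r" using pq(1) unfolding pq(2) by (simp add: field_simps)
 have "pcompose R r = 0" using Rz unfolding zr pev_cst by simp
 then have "degree r = 0" using pcompose_eq_0[of R r] R0 by auto
 then obtain c where "r = [:c:]" by (rule degree_eq_zeroE)
 then show ?thesis unfolding zr cst_def by simp
qed

definition poly_swap :: "'a::comm_ring_1 poly poly \<Rightarrow> 'a poly poly" where
 "poly_swap G = (\<Sum>i\<le>degree G. map_poly (\<lambda>c. Polynomial.monom c i) (coeff G i))"

lemma coeff_poly_swap: "coeff (coeff (poly_swap G) a) i = coeff (coeff G i) a"
 by (simp add: poly_swap_def coeff_sum coeff_map_poly coeff_eq_0)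

lemma poly_swap_mult: "poly_swap (G * H) = poly_swap G * poly_swap H"
proof (intro poly_eqI)
 fix a i
 have "coeff (coeff (poly_swap (G * H)) a) i = (\<Sum>j\<le>i. \<Sum>b\<le>a. coeff (coeff G j) b * coeff (coeff H (i - j)) (a - b))"
  by (simp add: coeff_poly_swap coeff_mult coeff_sum)
 also have "\<dots> = (\<Sum>b\<le>a. \<Sum>j\<le>i. coeff (coeff G j) b * coeff (coeff H (i - j)) (a - b))"
  by (rule sum.swap)
 also have "\<dots> = coeff (coeff (poly_swap G * poly_swap H) a) i"
  by (simp add: coeff_poly_swap coeff_mult coeff_sum)
 finally show "coeff (coeff (poly_swap (G * H)) a) i = coeff (coeff (poly_swap G * poly_swap H) a) i" .
qed

lemma poly_swap_swap: "poly_swap (poly_swap G) = G"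
 by (intro poly_eqI) (simp add: coeff_poly_swap)

definition outer_const :: "'a::comm_ring_1 poly \<Rightarrow> 'a poly poly" where
 "outer_const p = map_poly (\<lambda>c. [:c:]) p"

lemma coeff_outer_const: "coeff (outer_const p) i = [:coeff p i:]"
 by (simp add: outer_const_def coeff_map_poly)

text \<open>Let \<open>\<Psi> = q(t) p(X) - p(t) q(X)\<close>. Its degree in \<open>t\<close> is at most that of \<open>\<Phi>\<close>, so the
 cofactor \<open>\<Gamma>\<close> is free of \<open>t\<close>. It divides all coefficients of \<open>\<Psi>\<close> with respect to \<open>t\<close>, which are
 combinations of \<open>p(X)\<close> and \<open>q(X)\<close>, and thus \<open>p\<close> and \<open>q\<close> themselves.\<close>

lemma fraction_kernel_divisor:
 fixes p q :: "'f::field_gcd poly"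
 assumes pq: "coprime p q" "q \<noteq> 0" and nonconst: "to_fract p / to_fract q \<notin> range cst"
  and dvd: "\<Phi> * \<Gamma> = smult q (outer_const p) - smult p (outer_const q)"
  and degs: "degree p \<le> degree (coeff \<Phi> i)" "degree q \<le> degree (coeff \<Phi> j)" "coeff \<Phi> i \<noteq> 0" "coeff \<Phi> j \<noteq> 0"
 shows "\<exists>g. g \<noteq> 0 \<and> \<Gamma> = [:[:g:]:]"
proof -
 define N where "N = max (degree p) (degree q)"
 let ?\<Psi> = "smult q (outer_const p) - smult p (outer_const q)"
 have \<Psi>: "coeff (poly_swap ?\<Psi>) a = smult (coeff q a) p - smult (coeff p a) q" for a
  by (rule poly_eqI) (simp add: coeff_poly_swap coeff_outer_const mult.commute)
 have exi: "\<exists>a b. coeff q a * coeff p b - coeff p a * coeff q b \<noteq> 0"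
 proof (rule ccontr)
  assume "\<not> ?thesis"
  then have z: "coeff q a * coeff p b = coeff p a * coeff q b" for a b by simp
  have lq: "lead_coeff q \<noteq> 0" using pq(2) by simp
  let ?k = "coeff p (degree q) / lead_coeff q"
  have "p = smult ?k q"
  proof (rule poly_eqI)
   fix b show "coeff p b = coeff (smult ?k q) b"
    using z[of "degree q" b] lq by (simp add: field_simps)
  qed
  then have "to_fract p = cst ?k * to_fract q" unfolding cst_def to_fract_mult[symmetric] by (simp only: mult_pCons_left) simp
  then have "to_fract p / to_fract q = cst ?k" using pq(2) by simp
  then show False using nonconst by simp
 qed
 then obtain a b where ab: "coeff q a * coeff p b - coeff p a * coeff q b \<noteq> 0" by blast
 have "coeff (poly_swap ?\<Psi>) a \<noteq> 0 \<or> coeff (poly_swap ?\<Psi>) b \<noteq> 0"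
 proof (rule ccontr)
  assume "\<not> ?thesis"
  then have "smult (coeff q a) p = smult (coeff p a) q" unfolding \<Psi> by simp
  then have "coeff (smult (coeff q a) p) b = coeff (smult (coeff p a) q) b" by simp
  then show False using ab by simp
 qed
 then have \<Psi>0: "poly_swap ?\<Psi> \<noteq> 0" by auto
 have prod: "poly_swap \<Phi> * poly_swap \<Gamma> = poly_swap ?\<Psi>" unfolding dvd[symmetric] poly_swap_mult ..
 then have nz: "poly_swap \<Phi> \<noteq> 0" "poly_swap \<Gamma> \<noteq> 0" using \<Psi>0 by auto
 have "degree (poly_swap ?\<Psi>) \<le> N"
  by (rule degree_le) (auto simp: \<Psi> N_def coeff_eq_0)
 moreover have le: "degree (coeff \<Phi> l) \<le> degree (poly_swap \<Phi>)" if "coeff \<Phi> l \<noteq> 0" for l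
 proof (rule le_degree)
  have "coeff (coeff (poly_swap \<Phi>) (degree (coeff \<Phi> l))) l \<noteq> 0"
   using that by (simp add: coeff_poly_swap)
  then show "coeff (poly_swap \<Phi>) (degree (coeff \<Phi> l)) \<noteq> 0" by auto
 qed
 have "N \<le> degree (poly_swap \<Phi>)" using le[OF degs(3)] le[OF degs(4)] degs(1,2) by (simp add: N_def)
 moreover have "degree (poly_swap ?\<Psi>) = degree (poly_swap \<Phi>) + degree (poly_swap \<Gamma>)"
  unfolding prod[symmetric] by (rule degree_mult_eq[OF nz])
 ultimately have "degree (poly_swap \<Gamma>) = 0" by simp
 then obtain \<gamma> where \<gamma>: "poly_swap \<Gamma> = [:\<gamma>:]" by (rule degree_eq_zeroE)
 have dv: "\<gamma> dvd smult (coeff q l) p - smult (coeff p l) q" for l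
  unfolding \<Psi>[symmetric] prod[symmetric] \<gamma> by simp
 have comb: "\<gamma> dvd smult u (smult (coeff q a) p - smult (coeff p a) q) -
   smult v (smult (coeff q b) p - smult (coeff p b) q)" for u v
  by (intro dvd_diff dvd_smult dv)
 let ?D = "coeff q a * coeff p b - coeff p a * coeff q b"
 have "smult (coeff q b) (smult (coeff q a) p - smult (coeff p a) q) -
   smult (coeff q a) (smult (coeff q b) p - smult (coeff p b) q) = smult ?D q"
  by (rule poly_eqI) (simp add: algebra_simps)
 then have "\<gamma> dvd smult ?D q" using comb[of "coeff q b" "coeff q a"] by simp
 then have gq: "\<gamma> dvd q" using ab by (simp add: dvd_smult_iff)
 have "smult (coeff p b) (smult (coeff q a) p - smult (coeff p a) q) -
   smult (coeff p a) (smult (coeff q b) p - smult (coeff p b) q) = smult ?D p"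
  by (rule poly_eqI) (simp add: algebra_simps)
 then have "\<gamma> dvd smult ?D p" using comb[of "coeff p b" "coeff p a"] by simp
 then have gp: "\<gamma> dvd p" using ab by (simp add: dvd_smult_iff)
 have "is_unit \<gamma>" using coprime_common_divisor[OF pq(1) gp gq] .
 then obtain g where g: "\<gamma> = [:g:]" "g \<noteq> 0" by (rule unit_poly_const)
 have "\<Gamma> = poly_swap [:[:g:]:]" using poly_swap_swap[of \<Gamma>] unfolding \<gamma> g(1) by simp
 also have "\<dots> = [:[:g:]:]" by (intro poly_eqI) (simp add: coeff_poly_swap coeff_pCons split: nat.split)
 finally show ?thesis using g(2) by blast
qed

definition lift_poly :: "'f::field poly \<Rightarrow> 'f poly fract poly" where
 "lift_poly p = map_poly cst p"

lemma coeff_lift_poly: "coeff (lift_poly p) i = cst (coeff p i)"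
 by (simp add: lift_poly_def coeff_map_poly homD(1)[OF cst_hom])

lemma poly_lift_poly: "poly (lift_poly p) (to_fract (pCons 0 1)) = to_fract p"
proof -
 have "degree (lift_poly p) \<le> degree p"
  by (rule degree_le) (simp add: coeff_lift_poly coeff_eq_0 homD(1)[OF cst_hom])
 note d = this
 have "poly (lift_poly p) z = pev cst p z" for z
  unfolding poly_altdef pev_def coeff_lift_poly[symmetric]
  by (rule sum.mono_neutral_left) (use d in \<open>auto simp: coeff_eq_0\<close>)
 then show ?thesis by (simp only: pev_cst one_pCons pcompose_idR)
qed

lemma fract_poly_outer_const: "map_poly to_fract (outer_const p) = lift_poly p"
 by (rule poly_eqI) (simp add: coeff_map_poly coeff_outer_const coeff_lift_poly cst_def)

text \<open>The generator \<open>s = p / q\<close> is a nonconstant coefficient of the minimal polynomial \<open>\<chi>\<close> of \<open>t\<close> over \<open>E\<close>.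
 By Gauss' lemma the primitive multiple of \<open>\<chi>\<close> divides \<open>q(t) p(X) - p(t) q(X)\<close>, and by
 \<open>fraction_kernel_divisor\<close> the two agree up to a constant. So \<open>\<chi>\<close> has coefficients in \<open>k(s)\<close>, that is, \<open>t\<close> has
 the same degree over both fields; this is expressed by division with remainder.\<close>

theorem luroth:
 fixes E :: "'f::field_gcd poly fract set"
 assumes E: "is_subfield E" "range cst \<subseteq> E" and U: "U \<in> E" "U \<notin> range cst"
 shows "\<exists>s\<in>E. \<not> algebraic_over (range cst) s \<and> E \<subseteq> adjoin (range cst) {s}"
proof -
 let ?t = "to_fract (pCons 0 (1 :: 'f poly))"
 have cstE: "cst c \<in> E" for c using E(2) by auto
 have liftE: "coeffs_in E (lift_poly p)" for p by (simp add: coeffs_in_def coeff_lift_poly cstE)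
 have alg: "algebraic_over E ?t"
 proof -
  obtain p q where pq: "q \<noteq> 0" "U = to_fract p / to_fract q" "coprime p q" using reduced_fraction[of U] by (elim exE conjE)
  let ?P = "lift_poly p - smult U (lift_poly q)"
  have "?P \<noteq> 0"
  proof
   assume "?P = 0"
   then have "coeff ?P (degree q) = 0" by simp
   then have "cst (coeff p (degree q)) = U * cst (lead_coeff q)" by (simp add: coeff_lift_poly)
   moreover have "cst (lead_coeff q) \<noteq> 0" using pq(1) by (simp add: cst_def)
   ultimately have "U = cst (coeff p (degree q) / lead_coeff q)" by (simp add: hom_divide[OF cst_hom] field_simps)
   then show False using U(2) by simp
  qed
  moreover have "coeffs_in E ?P" by (intro coeffs_in_diff coeffs_in_smult E liftE U)
  moreover have "poly ?P ?t = 0" using pq(1) by (simp add: poly_lift_poly pq(2))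
  ultimately show ?thesis unfolding algebraic_over_def by blast
 qed
 obtain \<chi> where \<chi>: "coeffs_in E \<chi>" "lead_coeff \<chi> = 1" "poly \<chi> ?t = 0" "degree \<chi> > 0"
  and \<chi>_dvd: "\<forall>p. coeffs_in E p \<longrightarrow> poly p ?t = 0 \<longrightarrow> (\<exists>r. coeffs_in E r \<and> p = \<chi> * r)"
  and \<chi>_min: "\<forall>p. coeffs_in E p \<longrightarrow> poly p ?t = 0 \<longrightarrow> p \<noteq> 0 \<longrightarrow> degree \<chi> \<le> degree p"
  using minimal_polynomial[OF E(1) alg] by metis
 have "\<exists>i. coeff \<chi> i \<notin> range cst"
 proof (rule ccontr)
  assume "\<not> ?thesis"
  then have "coeffs_in (range cst) \<chi>" by (simp add: coeffs_in_def)
  moreover have "\<chi> \<noteq> 0" using \<chi>(4) by auto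
  ultimately have "algebraic_over (range cst) ?t" using \<chi>(3) unfolding algebraic_over_def by blast
  then have "?t \<in> range cst" by (rule algebraic_over_constants)
  then show False by (auto simp: cst_def)
 qed
 then obtain i where i: "coeff \<chi> i \<notin> range cst" by blast
 define s where "s = coeff \<chi> i"
 have sE: "s \<in> E" using \<chi>(1) by (simp add: s_def coeffs_in_def)
 have s_nc: "s \<notin> range cst" using i by (simp add: s_def)
 have s0: "s \<noteq> 0" using s_nc homD(1)[OF cst_hom] rangeI[of cst 0] by metis
 obtain c \<Phi> where \<Phi>: "\<chi> = smult c (map_poly to_fract \<Phi>)" "content \<Phi> = 1"
  by (rule content_decompose_fract[of \<chi>])
 have \<chi>c: "coeff \<chi> l = c * to_fract (coeff \<Phi> l)" for l unfolding \<Phi>(1) by (simp add: coeff_map_poly)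
 define n where "n = degree \<chi>"
 have lead: "c * to_fract (coeff \<Phi> n) = 1" using \<chi>c[of n] \<chi>(2) by (simp add: n_def)
 then have c0: "c \<noteq> 0" and \<Phi>n: "coeff \<Phi> n \<noteq> 0" by auto
 have si: "s = c * to_fract (coeff \<Phi> i)" unfolding s_def by (rule \<chi>c)
 then have \<Phi>i: "coeff \<Phi> i \<noteq> 0" using s0 by auto
 obtain p q where pq: "q \<noteq> 0" "s = to_fract p / to_fract q" "coprime p q" using reduced_fraction[of s] by (elim exE conjE)
 have "s * (c * to_fract (coeff \<Phi> n)) = c * to_fract (coeff \<Phi> i)" unfolding lead using si by simp
 then have "s * to_fract (coeff \<Phi> n) = to_fract (coeff \<Phi> i)" using c0 by simp
 then have "to_fract (p * coeff \<Phi> n) = to_fract (coeff \<Phi> i * q)" using pq(1) unfolding pq(2) by (simp add: field_simps)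
 then have cross: "p * coeff \<Phi> n = coeff \<Phi> i * q" by (simp only: to_fract_eq_iff)
 have "q dvd p * coeff \<Phi> n" unfolding cross by simp
 then have "q dvd coeff \<Phi> n" using pq(3) by (simp add: coprime_dvd_mult_right_iff ac_simps)
 then have dq: "degree q \<le> degree (coeff \<Phi> n)" using \<Phi>n by (rule dvd_imp_degree_le)
 have "p dvd coeff \<Phi> i * q" unfolding cross[symmetric] by simp
 then have "p dvd coeff \<Phi> i" using pq(3) by (simp add: coprime_dvd_mult_left_iff)
 then have dp: "degree p \<le> degree (coeff \<Phi> i)" using \<Phi>i by (rule dvd_imp_degree_le)
 let ?\<Psi> = "smult q (outer_const p) - smult p (outer_const q)"
 define G where "G = lift_poly p - smult s (lift_poly q)"
 have GE: "coeffs_in E G" unfolding G_def by (intro coeffs_in_diff coeffs_in_smult E liftE sE)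
 have "poly G ?t = 0" using pq(1) by (simp add: G_def poly_lift_poly pq(2))
 then obtain r where r: "G = \<chi> * r" using \<chi>_dvd GE by blast
 have \<Psi>G: "map_poly to_fract ?\<Psi> = smult (to_fract q) G"
  using pq(1) by (simp add: G_def fract_poly_outer_const smult_diff_right pq(2))
 have "map_poly to_fract \<Phi> dvd map_poly to_fract ?\<Psi>"
  unfolding \<Psi>G r \<Phi>(1) by (intro dvd_smult dvd_mult2) simp
 then have "\<Phi> dvd ?\<Psi>" using \<Phi>(2) by (rule fract_poly_dvdD)
 then obtain \<Gamma> where \<Gamma>: "?\<Psi> = \<Phi> * \<Gamma>" by (rule dvdE)
 obtain g where g: "g \<noteq> 0" "\<Gamma> = [:[:g:]:]"
  using fraction_kernel_divisor[OF pq(3,1) _ \<Gamma>[symmetric] dp dq \<Phi>i \<Phi>n] s_nc unfolding pq(2) by blast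
 have cg: "cst g \<noteq> 0" using g(1) by (simp add: cst_def)
 have "smult (to_fract q) G = smult (cst g) (map_poly to_fract \<Phi>)"
  unfolding \<Psi>G[symmetric] \<Gamma> g(2) by (simp add: cst_def)
 then have "smult (c * inverse (cst g)) (smult (to_fract q) G) = smult (c * inverse (cst g)) (smult (cst g) (map_poly to_fract \<Phi>))"
  by simp
 then have \<chi>G: "\<chi> = smult (c * inverse (cst g) * to_fract q) G"
  using cg \<Phi>(1) by (simp add: mult.assoc)
 let ?K = "adjoin (range cst) {s}"
 have K: "is_subfield ?K" by (rule subfield_adjoin)
 have KE: "?K \<subseteq> E" by (rule adjoin_least[OF E]) (use sE in simp)
 have cK: "cst x \<in> ?K" for x using adjoin_base[of "range cst" "{s}"] by auto
 have sK: "s \<in> ?K" using adjoin_gen[of "{s}" "range cst"] by simp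
 have liftK: "coeffs_in ?K (lift_poly p)" for p by (simp add: coeffs_in_def coeff_lift_poly cK)
 have GK: "coeffs_in ?K G" unfolding G_def by (intro coeffs_in_diff coeffs_in_smult K liftK sK)
 have \<chi>K: "coeffs_in ?K \<chi>"
 proof -
  let ?k = "c * inverse (cst g) * to_fract q"
  have "?k * coeff G n = 1" using \<chi>(2) \<chi>G by (metis coeff_smult n_def)
  then have "?k = inverse (coeff G n)" by (metis inverse_unique mult.commute inverse_inverse_eq)
  then have "?k \<in> ?K" using GK subfieldD(6)[OF K, of "coeff G n"] by (simp add: coeffs_in_def)
  then show ?thesis by (subst \<chi>G) (intro coeffs_in_smult K GK)
 qed
 have "e \<in> ?K" if e: "e \<in> E" for e
 proof -
  obtain a b where ab: "b \<noteq> 0" "e = to_fract a / to_fract b" "coprime a b" using reduced_fraction[of e] by (elim exE conjE)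
  have \<chi>0: "\<chi> \<noteq> 0" using \<chi>(4) by auto
  obtain Q R where R: "coeffs_in ?K R" "lift_poly b = Q * \<chi> + R" "R = 0 \<or> degree R < degree \<chi>"
   using division_over_subfield[OF K \<chi>K \<chi>0 liftK[of b]] by blast
  obtain Q' R' where R': "coeffs_in ?K R'" "lift_poly a = Q' * \<chi> + R'" "R' = 0 \<or> degree R' < degree \<chi>"
   using division_over_subfield[OF K \<chi>K \<chi>0 liftK[of a]] by blast
  have Rt: "poly R ?t = to_fract b" using poly_lift_poly[of b] \<chi>(3) unfolding R(2) by simp
  have R't: "poly R' ?t = to_fract a" using poly_lift_poly[of a] \<chi>(3) unfolding R'(2) by simp
  let ?D = "smult e R - R'"
  have "?D = 0"
  proof (rule ccontr)
   assume D0: "?D \<noteq> 0"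
   have "coeffs_in E R" "coeffs_in E R'" using R(1) R'(1) KE by (auto simp: coeffs_in_def)
   then have "coeffs_in E ?D" by (intro coeffs_in_diff coeffs_in_smult E(1) e)
   moreover have "poly ?D ?t = 0" using ab(1) by (simp add: Rt R't ab(2))
   ultimately have "degree \<chi> \<le> degree ?D" using \<chi>_min D0 by blast
   moreover have "degree ?D < degree \<chi>"
    using R(3) R'(3) \<chi>(4) by (intro degree_diff_less) (auto intro: le_less_trans[OF degree_smult_le])
   ultimately show False by simp
  qed
  moreover have "R \<noteq> 0" using Rt ab(1) by auto
  ultimately have "e * lead_coeff R = coeff R' (degree R)" "lead_coeff R \<noteq> 0"
   by (metis coeff_smult eq_iff_diff_eq_0, simp)
  then have "e = coeff R' (degree R) / lead_coeff R" by (simp add: field_simps)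
  then show ?thesis using R(1) R'(1) by (simp add: coeffs_in_def subfield_divide[OF K])
 qed
 moreover have "\<not> algebraic_over (range cst) s" using algebraic_over_constants[of s] s_nc by blast
 ultimately show ?thesis using sE by blast
qed

section \<open>Specialisation to a line\<close>

lemma hom_ev:
 assumes F: "is_hom F" shows "F (ev h x p) = ev (\<lambda>c. F (h c)) (\<lambda>v. F (x v)) p"
 by (simp add: ev_def mon_def hom_sum[OF F] hom_prod[OF F] homD(4)[OF F] hom_power[OF F])

lemma hom_comp: "is_hom F \<Longrightarrow> is_hom G \<Longrightarrow> is_hom (\<lambda>x. F (G x))"
 by (simp add: is_hom_def)

lemma poly_const_hom: "is_hom (\<lambda>c. [:c:])"
 by (simp add: is_hom_def)

lemma poly_eval_hom: "is_hom (\<lambda>p. poly p x)"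
 by (simp add: is_hom_def)

text \<open>All variables except \<open>X\<close> are specialised to constants; \<open>X\<close> becomes the variable of \<open>k(X)\<close>.\<close>

definition at_point :: "'v \<Rightarrow> ('v \<Rightarrow> 'k::field) \<Rightarrow> (('v \<Rightarrow>\<^sub>0 nat) \<Rightarrow>\<^sub>0 'k) \<Rightarrow> 'k poly fract" where
 "at_point X a p = ev cst (\<lambda>v. if v = X then to_fract (pCons 0 1) else cst (a v)) p"

text \<open>The line joining the points \<open>a\<close> (at \<open>t = 0\<close>) and \<open>b\<close> (at \<open>t = 1\<close>).\<close>

definition on_line :: "'v \<Rightarrow> ('v \<Rightarrow> 'k::field) \<Rightarrow> ('v \<Rightarrow> 'k) \<Rightarrow> (('v \<Rightarrow>\<^sub>0 nat) \<Rightarrow>\<^sub>0 'k) \<Rightarrow> 'k poly fract poly" where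
 "on_line X a b p = ev (\<lambda>c. [:cst c:]) (\<lambda>v. if v = X then [:to_fract (pCons 0 1):] else [:cst (a v), cst (b v - a v):]) p"

lemma at_point_hom: "is_hom (at_point X a)"
 using ev_hom[OF cst_hom] by (simp add: at_point_def[abs_def])

lemma on_line_hom: "is_hom (on_line X a b)"
 using ev_hom[OF hom_comp[OF poly_const_hom cst_hom]] by (simp add: on_line_def[abs_def])

lemma poly_on_line: "poly (on_line X a b p) 0 = at_point X a p" "poly (on_line X a b p) 1 = at_point X b p"
proof -
 have "poly (on_line X a b p) x = ev cst (\<lambda>v. if v = X then to_fract (pCons 0 1) else cst (a v) + x * cst (b v - a v)) p" for x
  unfolding on_line_def hom_ev[OF poly_eval_hom] by (rule arg_cong2[of _ _ _ _ "\<lambda>h x. ev h x p"]) auto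
 from this[of 0] this[of 1] show "poly (on_line X a b p) 0 = at_point X a p" "poly (on_line X a b p) 1 = at_point X b p"
  by (simp_all add: at_point_def hom_diff[OF cst_hom] cong: if_cong)
qed

lemma at_point_nonzero:
 fixes p :: "('v \<Rightarrow>\<^sub>0 nat) \<Rightarrow>\<^sub>0 'k::field_char_0"
 assumes "p \<noteq> 0" shows "\<exists>a. at_point X a p \<noteq> 0"
proof -
 obtain y where y: "ev id y p \<noteq> 0" using polynomial_nonvanishing_point[OF hom_id(1) _ assms] by auto
 let ?P = "ev (\<lambda>c. [:c:]) (\<lambda>v. if v = X then pCons 0 1 else [:y v:]) p"
 have "poly ?P (y X) = ev id y p"
  unfolding hom_ev[OF poly_eval_hom] by (rule arg_cong2[of _ _ _ _ "\<lambda>h x. ev h x p"]) auto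
 then have "?P \<noteq> 0" using y by auto
 moreover have "at_point X y p = to_fract ?P"
  unfolding at_point_def hom_ev[OF to_fract_hom] by (rule arg_cong2[of _ _ _ _ "\<lambda>h x. ev h x p"]) (auto simp: cst_def)
 ultimately show ?thesis by (intro exI[of _ y]) simp
qed

lemma gen_coeff_transcendental: "\<not> algebraic_over base_field (gen_coeff X :: 'k::field_char_0 ratfun)"
proof -
 have "alg_independent base_field (gen_coeff ` {X} :: 'k ratfun set)" by (rule gen_coeff_alg_independent) simp
 from alg_independent_transcendental[OF subfield_base this, of "gen_coeff X"]
 have n: "\<not> algebraic_over (adjoin base_field ({gen_coeff X} - {gen_coeff X})) (gen_coeff X :: 'k ratfun)" by simp
 have "base_field \<subseteq> adjoin base_field ({gen_coeff X} - {gen_coeff X} :: 'k ratfun set)" by (rule adjoin_base)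
 then show ?thesis using n unfolding algebraic_over_def coeffs_in_def by blast
qed

definition embed_univariate :: "(nat \<Rightarrow>\<^sub>0 nat) \<Rightarrow> 'k::field_char_0 poly fract \<Rightarrow> 'k ratfun" where
 "embed_univariate X = place (\<lambda>p. pev scalar p (gen_coeff X))"

lemma embed_univariate:
 fixes p :: "'k::field_char_0 poly"
 shows "is_hom (embed_univariate X :: 'k poly fract \<Rightarrow> 'k ratfun)" "embed_univariate X (to_fract p) = pev scalar p (gen_coeff X)"
proof -
 note ph = pev_hom[OF scalar_hom, of "gen_coeff X"]
 have inj: "p = 0" if "pev scalar p (gen_coeff X) = 0" for p :: "'k poly"
  by (rule pev_injective[OF scalar_hom _ that]) (use gen_coeff_transcendental[of X] in \<open>simp add: base_field_eq\<close>)
 show "is_hom (embed_univariate X :: 'k poly fract \<Rightarrow> 'k ratfun)"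
  unfolding embed_univariate_def by (rule place_hom[OF ph inj])
 show "embed_univariate X (to_fract p) = pev scalar p (gen_coeff X)"
  unfolding embed_univariate_def to_fract_def by (rule place_of_ring(2)[OF ph])
qed

lemma embed_univariate_gen: "embed_univariate X (to_fract (pCons 0 1)) = gen_coeff X" "embed_univariate X (cst c) = scalar c"
proof -
 show "embed_univariate X (to_fract (pCons 0 1)) = gen_coeff X"
  unfolding embed_univariate(2) by (simp add: pev_pCons[OF scalar_hom] pev_1[OF scalar_hom] homD(1)[OF scalar_hom])
 show "embed_univariate X (cst c) = scalar c"
  unfolding cst_def embed_univariate(2) by (rule pev_const[OF scalar_hom])
qed

definition univariate_poly :: "'v \<Rightarrow> 'k::field poly \<Rightarrow> ('v \<Rightarrow>\<^sub>0 nat) \<Rightarrow>\<^sub>0 'k" where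
 "univariate_poly X p = (\<Sum>i\<le>degree p. const (coeff p i) * var X ^ i)"

lemma univariate_poly_eval:
 assumes h: "is_hom h" shows "ev h x (univariate_poly X p) = pev h p (x X)"
 by (simp add: univariate_poly_def pev_def ev_sum[OF h] ev_mult[OF h] ev_const[OF h] hom_power[OF ev_hom[OF h]] ev_var[OF h])

lemma at_point_univariate: "at_point X a (univariate_poly X p) = to_fract p"
 unfolding at_point_def univariate_poly_eval[OF cst_hom] by (simp only: simp_thms if_True pev_cst one_pCons pcompose_idR)

text \<open>If \<open>u = p / q\<close> took the same value at all points, this value would be \<open>u\<close>. Otherwise the line joins two points
 with different values; \<open>b\<close> is chosen outside the poles of both \<open>u\<close> and \<open>v\<close>.\<close>

lemma nonconstant_on_line:
 fixes u v :: "'k::field_char_0 ratfun"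
 assumes u: "u \<notin> range (embed_univariate X)"
 shows "\<exists>f. is_hom f \<and> u \<in> place_ring f \<and> v \<in> place_ring f \<and> (place f u :: 'k poly fract poly fract) \<notin> range cst \<and>
  (\<forall>p. f p = ev (\<lambda>c. cst (cst c)) (\<lambda>w. f (var w)) p) \<and> f (var X) = cst (to_fract (pCons 0 1))"
proof -
 obtain p q where pq: "u = Fract p q" "q \<noteq> 0" by (cases u) auto
 obtain p' q' where pq': "v = Fract p' q'" "q' \<noteq> 0" by (cases v) auto
 have "q * q' \<noteq> 0" using pq(2) pq'(2) by simp
 then have "\<exists>b. at_point X b (q * q') \<noteq> 0" by (rule at_point_nonzero)
 then obtain b where "at_point X b (q * q') \<noteq> 0" by (rule exE)
 then have b: "at_point X b q \<noteq> 0" "at_point X b q' \<noteq> 0" by (auto simp: homD[OF at_point_hom])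
 have "\<exists>a. at_point X a q \<noteq> 0 \<and> at_point X a p * at_point X b q \<noteq> at_point X b p * at_point X a q"
 proof (rule ccontr)
  assume neg: "\<not> ?thesis"
  obtain e1 e2 where e: "at_point X b p / at_point X b q = Fract e1 e2" "e2 \<noteq> 0" by (cases "at_point X b p / at_point X b q") auto
  have eb: "at_point X b p * to_fract e2 = to_fract e1 * at_point X b q"
   using e b(1) by (simp add: Fract_conv_to_fract field_simps)
  let ?D = "p * univariate_poly X e2 - univariate_poly X e1 * q"
  have z: "at_point X a (?D * q) = 0" for a
  proof (cases "at_point X a q = 0")
   case True then show ?thesis by (simp add: homD[OF at_point_hom])
  next
   case False
   then have "at_point X a p * at_point X b q = at_point X b p * at_point X a q" using neg by blast
   then have "(at_point X a p * to_fract e2 - to_fract e1 * at_point X a q) * at_point X b q = 0"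
    using eb by Groebner_Basis.algebra
   then show ?thesis using b(1) by (simp add: homD[OF at_point_hom] hom_diff[OF at_point_hom] at_point_univariate)
  qed
  have "?D * q = 0"
  proof (rule ccontr)
   assume "?D * q \<noteq> 0"
   then have "\<exists>a. at_point X a (?D * q) \<noteq> 0" by (rule at_point_nonzero)
   then show False using z by simp
  qed
  then have D: "p * univariate_poly X e2 = univariate_poly X e1 * q" using pq(2) by simp
  have emb: "to_fract (univariate_poly X r) = embed_univariate X (to_fract r)" for r
   using Fract_eq_ev[of "univariate_poly X r"] unfolding univariate_poly_eval[OF scalar_hom]
   by (simp only: embed_univariate(2)) (simp only: to_fract_def)
  have "embed_univariate X (to_fract e2) \<noteq> 0"
   using e(2) hom_inj[OF embed_univariate(1)[of X], of "to_fract e2" 0] homD(1)[OF embed_univariate(1)[of X]] by auto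
  moreover have "to_fract p * to_fract (univariate_poly X e2) = to_fract (univariate_poly X e1) * to_fract q"
   using D by (simp only: to_fract_mult[symmetric])
  ultimately have "u = embed_univariate X (to_fract e1) / embed_univariate X (to_fract e2)"
   using pq(2) unfolding emb pq(1) Fract_conv_to_fract by (simp add: frac_eq_eq)
  also have "\<dots> = embed_univariate X (to_fract e1 / to_fract e2)" unfolding hom_divide[OF embed_univariate(1)] ..
  finally show False using u by blast
 qed
 then obtain a where a: "at_point X a q \<noteq> 0" "at_point X a p * at_point X b q \<noteq> at_point X b p * at_point X a q" by blast
 let ?l = "on_line X a b"
 define f where "f r = to_fract (?l r)" for r
 have f: "is_hom f" unfolding f_def[abs_def] by (rule hom_comp[OF to_fract_hom on_line_hom])
 have lq: "?l q \<noteq> 0" using a(1) poly_on_line(1)[of X a b q] by auto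
 have lq': "?l q' \<noteq> 0" using b(2) poly_on_line(2)[of X a b q'] by auto
 have fq: "f q \<noteq> 0" "f q' \<noteq> 0" using lq lq' by (simp_all add: f_def)
 have "u \<in> place_ring f" "v \<in> place_ring f" unfolding place_ring_def pq pq' using fq by blast+
 moreover have "place f u \<notin> range cst"
 proof
  assume "place f u \<in> range cst"
  then obtain e where "f p / f q = cst e" unfolding pq(1) place_Fract[OF f fq(1)] by blast
  then have "f p = cst e * f q" using fq(1) by (simp add: field_simps)
  then have "to_fract (?l p) = to_fract ([:e:] * ?l q)" unfolding f_def cst_def to_fract_mult .
  then have l: "?l p = [:e:] * ?l q" by (simp only: to_fract_eq_iff)
  have "at_point X a p = e * at_point X a q" "at_point X b p = e * at_point X b q"
   using arg_cong[OF l, of "\<lambda>r. poly r 0"] arg_cong[OF l, of "\<lambda>r. poly r 1"] by (simp_all add: poly_on_line)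
  then show False using a(2) by simp
 qed
 moreover have fX: "f (var X) = cst (to_fract (pCons 0 1))"
  unfolding f_def on_line_def ev_var[OF hom_comp[OF poly_const_hom cst_hom]] by (simp add: cst_def)
 moreover have "f r = ev (\<lambda>c. cst (cst c)) (\<lambda>w. f (var w)) r" for r
 proof -
  have "f r = ev (\<lambda>c. to_fract [:cst c:]) (\<lambda>w. to_fract (if w = X then [:to_fract (pCons 0 1):] else [:cst (a w), cst (b w - a w):])) r"
   unfolding f_def on_line_def hom_ev[OF to_fract_hom] ..
  also have "\<dots> = ev (\<lambda>c. cst (cst c)) (\<lambda>w. f (var w)) r"
   unfolding f_def on_line_def ev_var[OF hom_comp[OF poly_const_hom cst_hom]] by (simp only: cst_def)
  finally show ?thesis .
 qed
 ultimately show ?thesis using f by blast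
qed

lemma place_inverse:
 assumes f: "is_hom f" and x: "x \<in> place_ring f" "place f x \<noteq> 0"
 shows "inverse x \<in> place_ring f" "place f (inverse x) = inverse (place f x)"
proof -
 show i: "inverse x \<in> place_ring f" by (rule place_closed(5)[OF f x(1,1,2)])
 have "x \<noteq> 0" using x(2) place_of_ring(2)[OF f, of 0] homD(1)[OF f] by (auto simp: Zero_fract_def)
 then have "place f x * place f (inverse x) = place f 1" unfolding place_closed(4)[OF f x(1) i, symmetric] by simp
 also have "place f 1 = 1" using place_of_ring(2)[OF f, of 1] homD(2)[OF f] by (simp add: One_fract_def)
 finally show "place f (inverse x) = inverse (place f x)" by (metis inverse_unique)
qed

lemma algebraic_over_derivation_criterion:
 fixes z :: "'a::field_char_0"
 assumes K: "is_subfield K" and z: "\<And>d. derivation d \<Longrightarrow> \<forall>x\<in>K. d x = 0 \<Longrightarrow> d z = 0"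
 shows "algebraic_over K z"
proof (rule ccontr)
 assume "\<not> algebraic_over K z"
 then obtain d where d: "derivation d" "\<And>y. y \<in> K \<Longrightarrow> d y = 0" "d z = 1"
  using transcendental_derivation[OF K] by metis
 then show False using z[OF d(1)] by simp
qed

text \<open>Specialisation to a line on which \<open>u\<close> is not constant is injective on \<open>k(X)(u)\<close>, and then also on elements
 algebraic over it: the constant term of a minimal polynomial is not zero and remains so. So
 \<open>k(X)(u, v)\<close> embeds into \<open>k(X)(t)\<close>, and the generator of the image is pulled back.\<close>

theorem generator_of_plane_curve:
 fixes u v :: "'k::field_char_0 ratfun" and X :: "nat \<Rightarrow>\<^sub>0 nat"
 defines "h \<equiv> embed_univariate X"
 defines "E \<equiv> adjoin (range h) {u, v}"
 assumes u: "u \<notin> range h" and v: "algebraic_over (adjoin (range h) {u}) v"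
 shows "\<exists>s\<in>E. \<not> algebraic_over (range h) s \<and> E \<subseteq> adjoin (range h) {s}"
proof -
 have h: "is_hom h" unfolding h_def by (rule embed_univariate(1))
 have K0: "is_subfield (range h)" by (rule range_hom_subfield[OF h])
 obtain f :: "(((nat \<Rightarrow>\<^sub>0 nat) \<Rightarrow>\<^sub>0 nat) \<Rightarrow>\<^sub>0 'k) \<Rightarrow> 'k poly fract poly fract"
  where f: "is_hom f" and up: "u \<in> place_ring f" and vp: "v \<in> place_ring f" and u_nc: "place f u \<notin> range cst"
   and fev: "\<forall>p. f p = ev (\<lambda>c. cst (cst c)) (\<lambda>w. f (var w)) p" and fX: "f (var X) = cst (to_fract (pCons 0 1))"
  using nonconstant_on_line[OF u[unfolded h_def], of v] by (elim exE conjE)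
 let ?P = "place_ring f" and ?th = "place f"
 have P0: "0 \<in> ?P" "?th 0 = 0" using place_of_ring[OF f, of 0] homD(1)[OF f] by (simp_all add: Zero_fract_def)
 have P1: "1 \<in> ?P" "?th 1 = 1" using place_of_ring[OF f, of 1] homD(2)[OF f] by (simp_all add: One_fract_def)
 note Pc = place_closed[OF f]
 have poly_case: "h (to_fract p) \<in> ?P \<and> ?th (h (to_fract p)) = cst (to_fract p)" for p
 proof -
  have e: "h (to_fract p) = Fract (univariate_poly X p) 1"
   unfolding h_def embed_univariate(2) Fract_eq_ev univariate_poly_eval[OF scalar_hom] ..
  have "f (univariate_poly X p) = ev (\<lambda>c. cst (cst c)) (\<lambda>w. f (var w)) (univariate_poly X p)" using fev by blast
  also have "\<dots> = pev (\<lambda>c. cst (cst c)) p (f (var X))" by (rule univariate_poly_eval[OF hom_comp[OF cst_hom cst_hom]])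
  also have "\<dots> = cst (pev cst p (to_fract (pCons 0 1)))"
   unfolding fX by (simp add: pev_def hom_sum[OF cst_hom] homD(4)[OF cst_hom] hom_power[OF cst_hom])
  also have "\<dots> = cst (to_fract p)" by (simp only: pev_cst one_pCons pcompose_idR)
  finally show ?thesis unfolding e using place_of_ring[OF f] by simp
 qed
 have th_h: "h e \<in> ?P" "?th (h e) = cst e" for e
 proof -
  obtain a b where ab: "e = Fract a b" "b \<noteq> 0" by (cases e) auto
  have e: "e = to_fract a / to_fract b" using ab(1) by (simp add: Fract_conv_to_fract)
  have hb: "?th (h (to_fract b)) \<noteq> 0" using poly_case[of b] ab(2) by (simp add: cst_def)
  have he: "h e = h (to_fract a) * inverse (h (to_fract b))" unfolding e hom_divide[OF h] by (simp add: field_simps)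
  note inv = place_inverse[OF f conjunct1[OF poly_case[of b]] hb]
  show "h e \<in> ?P" unfolding he by (rule Pc(3)[OF conjunct1[OF poly_case] inv(1)])
  show "?th (h e) = cst e"
   unfolding he Pc(4)[OF conjunct1[OF poly_case] inv(1)] inv(2) using poly_case[of a] poly_case[of b]
   by (simp add: e hom_divide[OF cst_hom] field_simps)
 qed
 have th_pev: "pev h R z \<in> ?P \<and> ?th (pev h R z) = pev cst R (?th z)" if z: "z \<in> ?P" for R z
 proof (induction R)
  case 0 then show ?case using P0 by (simp add: pev_0[OF h] pev_0[OF cst_hom])
 next
  case (pCons a R)
  have m: "z * pev h R z \<in> ?P" by (rule Pc(3)[OF z]) (use pCons in simp)
  show ?case
   unfolding pev_pCons[OF h] pev_pCons[OF cst_hom] Pc(2)[OF th_h(1) m] th_h(2)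
   using Pc(1)[OF th_h(1) m] Pc(4)[OF z conjunct1[OF pCons(2)]] pCons by simp
 qed
 have tu: "\<not> algebraic_over (range cst) (?th u)" using algebraic_over_constants[of "?th u"] u_nc by blast
 \<comment> \<open>a relation over \<open>k(X)\<close> would survive the specialisation\<close>
 have reflect: "\<not> algebraic_over (range h) z" if z: "z \<in> ?P" "\<not> algebraic_over (range cst) (?th z)" for z
 proof
  assume "algebraic_over (range h) z"
  then obtain R where R: "R \<noteq> 0" "pev h R z = 0" using algebraic_over_range[OF h] by blast
  have "pev cst R (?th z) = 0" using th_pev[OF z(1), of R] R(2) P0 by simp
  then show False using pev_injective[OF cst_hom z(2)] R(1) by blast
 qed
 let ?K = "adjoin (range h) {u}"
 have K: "is_subfield ?K" by (rule subfield_adjoin)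
 have KP: "x \<in> ?P \<and> (x \<noteq> 0 \<longrightarrow> ?th x \<noteq> 0)" if x: "x \<in> ?K" for x
 proof -
  obtain a b where ab: "pev h b u \<noteq> 0" "x = pev h a u / pev h b u" "coprime a b"
   using adjoin_rational_function[OF h reflect[OF up tu] x] by (elim exE conjE)
  have nz: "?th (pev h r u) \<noteq> 0" if "pev h r u \<noteq> 0" for r
  proof
   assume "?th (pev h r u) = 0"
   then have "r = 0" using th_pev[OF up, of r] pev_injective[OF cst_hom tu, of r] by simp
   then show False using that pev_0[OF h] by simp
  qed
  note inv = place_inverse[OF f conjunct1[OF th_pev[OF up]] nz[OF ab(1)]]
  have xe: "x = pev h a u * inverse (pev h b u)" using ab(2) by (simp add: field_simps)
  have "?th x = ?th (pev h a u) * inverse (?th (pev h b u))"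
   unfolding xe Pc(4)[OF conjunct1[OF th_pev[OF up]] inv(1)] inv(2) ..
  moreover have "x \<in> ?P" unfolding xe by (rule Pc(3)[OF conjunct1[OF th_pev[OF up]] inv(1)])
  ultimately show ?thesis using nz[of a] nz[OF ab(1)] ab(2) by auto
 qed
 define S where "S = {z \<in> ?P. \<forall>d. derivation d \<longrightarrow> (\<forall>x\<in>?K. d x = 0) \<longrightarrow> d z = 0}"
 \<comment> \<open>\<open>S\<close> consists of the elements algebraic over \<open>?K\<close> at which the specialisation is defined\<close>
 have SP: "z \<in> ?P" if "z \<in> S" for z using that by (simp add: S_def)
 have S_nz: "?th z \<noteq> 0" if z: "z \<in> S" "z \<noteq> 0" for z
 proof
  assume tz: "?th z = 0"
  have "algebraic_over ?K z" by (rule algebraic_over_derivation_criterion[OF K]) (use z(1) in \<open>simp add: S_def\<close>)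
  then obtain c where c: "coeffs_in ?K c" "poly c z = 0" "degree c > 0"
   and c_min: "\<forall>p. coeffs_in ?K p \<longrightarrow> poly p z = 0 \<longrightarrow> p \<noteq> 0 \<longrightarrow> degree c \<le> degree p"
   using minimal_polynomial[OF K] by metis
  obtain c0 c' where cc: "c = pCons c0 c'" by (cases c) auto
  have c0K: "c0 \<in> ?K" and c'K: "coeffs_in ?K c'"
   using c(1) unfolding cc coeffs_in_def by (metis coeff_pCons_0, metis coeff_pCons_Suc)
  have c'0: "c' \<noteq> 0" using c(3) cc by auto
  have "c0 \<noteq> 0"
  proof
   assume "c0 = 0"
   then have "poly c' z = 0" using c(2) z(2) cc by simp
   then have "degree c \<le> degree c'" using c_min c'K c'0 by blast
   then show False using c'0 by (simp add: cc)
  qed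
  moreover have val: "poly p z \<in> ?P" if "coeffs_in ?K p" for p
   using that
  proof (induction p)
   case 0 then show ?case using P0 by simp
  next
   case (pCons a p)
   have "a \<in> ?K" "coeffs_in ?K p" using pCons(3) unfolding coeffs_in_def by (metis coeff_pCons_0, metis coeff_pCons_Suc)
   then show ?case using KP[of a] pCons(2) SP[OF z(1)] by (simp add: Pc(1,3))
  qed
  have "?th (c0 + z * poly c' z) = ?th c0 + ?th z * ?th (poly c' z)"
   using KP[OF c0K] val[OF c'K] SP[OF z(1)] by (simp add: Pc(2,3,4))
  then have "?th c0 = 0" using c(2) tz P0 by (simp add: cc)
  ultimately show False using KP[OF c0K] by simp
 qed
 have S: "is_subfield S"
 proof (rule is_subfieldI)
  show "0 \<in> S" "1 \<in> S" using P0 P1 by (simp_all add: S_def derivation_0 derivation_1)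
  fix x assume x: "x \<in> S"
  show "- x \<in> S" using x Pc(6)[OF SP[OF x] SP[OF x]] by (simp add: S_def derivation_uminus)
  show "inverse x \<in> S" if x0: "x \<noteq> 0"
   using x place_inverse(1)[OF f SP[OF x] S_nz[OF x x0]] x0 by (simp add: S_def derivation_inverse)
  fix y assume y: "y \<in> S"
  have zero: "d x = 0 \<and> d y = 0" if "derivation d" "\<forall>x\<in>?K. d x = 0" for d using x y that by (simp add: S_def)
  have "d (x + y) = 0 \<and> d (x * y) = 0" if "derivation d" "\<forall>x\<in>?K. d x = 0" for d
   using zero[OF that] by (simp add: derivationD[OF that(1)])
  then show "x + y \<in> S" "x * y \<in> S"
   unfolding S_def using Pc(1,3)[OF SP[OF x] SP[OF y]] by blast+
 qed
 have KS: "?K \<subseteq> S" using KP by (auto simp: S_def)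
 have vS: "v \<in> S"
 proof -
  have "d v = 0" if d: "derivation d" "\<forall>x\<in>?K. d x = 0" for d
   using d(1) _ K v by (rule derivation_algebraic) (use d(2) in blast)
  then show ?thesis using vp by (simp add: S_def)
 qed
 have ES: "E \<subseteq> S" unfolding E_def
  by (rule adjoin_least[OF S]) (use KS vS adjoin_base[of "range h" "{u}"] adjoin_gen[of "{u}" "range h"] in auto)
 have E: "is_subfield E" "range h \<subseteq> E" "u \<in> E"
  unfolding E_def using subfield_adjoin adjoin_base[of "range h" "{u, v}"] adjoin_gen[of "{u, v}" "range h"] by auto
 have EP: "x \<in> ?P" if "x \<in> E" for x using that ES SP by blast
 have E_nz: "?th x \<noteq> 0" if "x \<in> E" "x \<noteq> 0" for x using that ES S_nz by blast
 let ?E = "?th ` E"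
 have thE: "is_subfield ?E"
 proof (rule is_subfieldI)
  show "0 \<in> ?E" "1 \<in> ?E" using P0(2) P1(2) subfieldD(1,2)[OF E(1)] by (metis imageI)+
  fix x assume "x \<in> ?E"
  then obtain x' where x': "x' \<in> E" "x = ?th x'" by blast
  have "?th (- x') = - x"
   using Pc(2)[OF EP[OF x'(1)] Pc(6)[OF EP[OF x'(1)] EP[OF x'(1)]]] P0(2) x'(2) by (simp add: eq_neg_iff_add_eq_0 add.commute)
  then show "- x \<in> ?E" using subfieldD(5)[OF E(1) x'(1)] by (metis imageI)
  show "inverse x \<in> ?E" if "x \<noteq> 0"
   using place_inverse(2)[OF f EP[OF x'(1)]] that x'(2) subfieldD(6)[OF E(1) x'(1)] by (metis imageI)
  fix y assume "y \<in> ?E"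
  then obtain y' where y': "y' \<in> E" "y = ?th y'" by blast
  have "?th (x' + y') = x + y" "?th (x' * y') = x * y"
   using Pc(2,4)[OF EP[OF x'(1)] EP[OF y'(1)]] x'(2) y'(2) by simp_all
  then show "x + y \<in> ?E" "x * y \<in> ?E" using subfieldD(3,4)[OF E(1) x'(1) y'(1)] by (metis imageI)+
 qed
 have cE: "range cst \<subseteq> ?E"
 proof (rule image_subsetI)
  fix c have "h c \<in> E" using E(2) by blast
  then show "cst c \<in> ?E" using th_h(2)[of c] by (metis imageI)
 qed
 obtain s' where s': "s' \<in> ?E" "\<not> algebraic_over (range cst) s'" "?E \<subseteq> adjoin (range cst) {s'}"
  using luroth[OF thE cE imageI[OF E(3)] u_nc] by (elim bexE conjE)
 obtain s where s: "s \<in> E" "s' = ?th s" using s'(1) by (rule imageE)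
 have sP: "s \<in> ?P" by (rule EP[OF s(1)])
 have pE: "pev h R s \<in> E" for R
  unfolding pev_def by (intro subfield_closed E(1) s(1)) (use E(2) in auto)
 have "e \<in> adjoin (range h) {s}" if e: "e \<in> E" for e
 proof -
  obtain a b where ab: "pev cst b s' \<noteq> 0" "?th e = pev cst a s' / pev cst b s'" "coprime a b"
   using adjoin_rational_function[OF cst_hom s'(2)] s'(3) imageI[OF e, of ?th] by blast
  have pb: "pev h b s \<noteq> 0" using th_pev[OF sP, of b] ab(1) s(2) P0(2) by auto
  have eb: "e * pev h b s \<in> E" by (intro subfield_closed E(1) e pE)
  have d: "e * pev h b s - pev h a s \<in> E" by (intro subfield_closed E(1) eb pE)
  have "?th (e * pev h b s) = ?th (e * pev h b s - pev h a s) + ?th (pev h a s)"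
   using Pc(2)[OF EP[OF d] EP[OF pE[of a]]] by simp
  moreover have "?th (e * pev h b s) = ?th (pev h a s)"
   using Pc(4)[OF EP[OF e] EP[OF pE[of b]]] th_pev[OF sP] s(2) ab(1,2) by simp
  ultimately have "?th (e * pev h b s - pev h a s) = 0" by simp
  then have "e * pev h b s - pev h a s = 0" using E_nz[OF d] by blast
  then have e': "e = pev h a s / pev h b s" using pb by (simp add: field_simps)
  have in_s: "pev h R s \<in> adjoin (range h) {s}" for R
   unfolding pev_def
   by (intro subfield_closed subfield_adjoin) (use adjoin_base[of "range h" "{s}"] adjoin_gen[of "{s}" "range h"] in auto)
  show ?thesis unfolding e' by (intro subfield_closed subfield_adjoin in_s)
 qed
 moreover have "\<not> algebraic_over (range h) s" by (rule reflect[OF sP]) (use s'(2) s(2) in simp)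
 ultimately show ?thesis using s(1) by blast
qed

lemma algebraic_over_mono: "K \<subseteq> L \<Longrightarrow> algebraic_over K x \<Longrightarrow> algebraic_over L x"
 unfolding algebraic_over_def coeffs_in_def by blast

lemma hom_adjoin_closed:
 assumes A: "is_hom A" and E: "is_subfield E" and k: "\<And>x. x \<in> k \<Longrightarrow> A x \<in> E" and S: "\<And>x. x \<in> S \<Longrightarrow> A x \<in> E"
  and x: "x \<in> adjoin k S"
 shows "A x \<in> E"
proof -
 have "A (inverse x) = inverse (A x)" for x using hom_divide[OF A, of 1 x] homD(2)[OF A] by (simp add: inverse_eq_divide)
 then have "is_subfield {x. A x \<in> E}"
  using subfieldD[OF E] by (intro is_subfieldI) (auto simp: homD[OF A] hom_uminus[OF A])
 then have "adjoin k S \<subseteq> {x. A x \<in> E}" by (rule adjoin_least) (use k S in auto)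
 then show ?thesis using x by blast
qed

lemma homs_agree_adjoin:
 assumes A: "is_hom A" and B: "is_hom B" and k: "\<And>x. x \<in> k \<Longrightarrow> A x = B x" and S: "\<And>x. x \<in> S \<Longrightarrow> A x = B x"
  and x: "x \<in> adjoin k S"
 shows "A x = (B x :: 'b::field)"
proof -
 have "A (inverse x) = inverse (A x)" "B (inverse x) = inverse (B x)" for x
  using hom_divide[OF A, of 1 x] hom_divide[OF B, of 1 x] homD(2)[OF A] homD(2)[OF B] by (simp_all add: inverse_eq_divide)
 then have "is_subfield {x. A x = B x}"
  by (intro is_subfieldI) (auto simp: homD[OF A] homD[OF B] hom_uminus[OF A] hom_uminus[OF B])
 then have "adjoin k S \<subseteq> {x. A x = B x}" by (rule adjoin_least) (use k S in auto)
 then show ?thesis using x by blast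
qed

lemma range_embed_univariate: "adjoin base_field {gen_coeff X} \<subseteq> range (embed_univariate X)"
proof (rule adjoin_least)
 show "is_subfield (range (embed_univariate X))" by (rule range_hom_subfield[OF embed_univariate(1)])
 show "base_field \<subseteq> range (embed_univariate X)" unfolding base_field_eq using embed_univariate_gen(2) by (metis image_subsetI rangeI)
 show "{gen_coeff X} \<subseteq> range (embed_univariate X)" using embed_univariate_gen(1) by (metis empty_subsetI insert_subset rangeI)
qed

text \<open>Otherwise \<open>k(X)(u)\<close> would be algebraic over \<open>k(X)\<close>, but it has a transcendental generator by
 \<open>generator_of_plane_curve\<close>.\<close>

lemma univariate_field_closed:
 fixes u :: "'k::field_char_0 ratfun"
 assumes u: "u \<notin> range (embed_univariate X)"
 shows "\<not> algebraic_over (range (embed_univariate X)) u"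
proof
 let ?K = "range (embed_univariate X) :: 'k ratfun set"
 assume alg: "algebraic_over ?K u"
 have K: "is_subfield ?K" by (rule range_hom_subfield[OF embed_univariate(1)])
 have "algebraic_over (adjoin ?K {u}) u" by (rule algebraic_over_mono[OF adjoin_base alg])
 then obtain s where s: "s \<in> adjoin ?K {u, u}" "\<not> algebraic_over ?K s"
  using generator_of_plane_curve[OF u, of u] by blast
 obtain d where d: "derivation d" "\<And>y. y \<in> ?K \<Longrightarrow> d y = 0" "d s = 1"
  using transcendental_derivation[OF K s(2)] by metis
 from d(1) _ K alg have du: "d u = 0" by (rule derivation_algebraic) (rule d(2))
 have "d s = 0" using d(1) d(2) _ s(1) by (rule derivation_adjoin) (auto simp: du)
 then show False using d(3) by simp
qed

text \<open>If \<open>v\<close> were algebraic over \<open>k(X)(u)\<close>, then \<open>k(X)(u, v)\<close> would be rational over \<open>k(X)\<close>, with an impossible action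
 of \<open>A\<close> and \<open>B\<close>.\<close>

theorem heisenberg_pair_independent:
 fixes u v :: "'k::field_char_0 ratfun" and A B :: "'k ratfun \<Rightarrow> 'k ratfun" and \<omega> :: 'k
 assumes \<omega>: "\<omega>\<^sup>2 + \<omega> + 1 = 0" and nz: "u \<noteq> 0" "v \<noteq> 0"
  and A: "is_hom A" "\<And>c. A (scalar c) = scalar c" "A (gen_coeff X) = gen_coeff X"
  and B: "is_hom B" "\<And>c. B (scalar c) = scalar c" "B (gen_coeff X) = gen_coeff X"
  and Auv: "A u = scalar \<omega> * u" "A v = scalar \<omega> * (scalar \<omega> * v)" and Buv: "B u = v / u" "B v = 1 / u"
 shows "\<not> algebraic_over (adjoin base_field {gen_coeff X}) u" "\<not> algebraic_over (adjoin base_field {gen_coeff X, u}) v"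
proof -
 let ?h = "embed_univariate X :: 'k poly fract \<Rightarrow> 'k ratfun"
 note h = embed_univariate(1)[of X, where ?'k = 'k]
 let ?K = "range ?h"
 have K: "is_subfield ?K" by (rule range_hom_subfield[OF h])
 have fix_h: "C (?h e) = ?h e" if C: "is_hom C" "\<forall>c. C (scalar c) = scalar c" "C (gen_coeff X) = gen_coeff X" for C e
 proof -
  have p: "C (?h (to_fract p)) = ?h (to_fract p)" for p
   unfolding embed_univariate(2) using hom_pev[OF C(1), of scalar p "gen_coeff X"] C(2,3) by simp
  obtain a b where "e = Fract a b" by (cases e) auto
  then have "e = to_fract a / to_fract b" by (simp add: Fract_conv_to_fract)
  then show ?thesis by (simp only: hom_divide[OF h] hom_divide[OF C(1)] p)
 qed
 have A_h: "A (?h e) = ?h e" and B_h: "B (?h e) = ?h e" for e using fix_h A B by blast+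
 define w :: "'k ratfun" where "w = scalar \<omega>"
 have wK: "w \<in> ?K" unfolding w_def using embed_univariate_gen(2)[of X \<omega>] by (metis rangeI)
 have w: "w\<^sup>2 + w + 1 = 0"
  using arg_cong[OF \<omega>, of scalar] by (simp add: w_def homD[OF scalar_hom] hom_power[OF scalar_hom])
 have w3: "w * (w * w) = 1" using w by Groebner_Basis.algebra
 have w01: "w \<noteq> 0" "w \<noteq> 1" using w by auto
 have Aw: "A w = w" "B w = w" by (simp_all add: w_def A(2) B(2))
 have u_nc: "u \<notin> ?K"
 proof
  assume "u \<in> ?K"
  then have "A u = u" using A_h by blast
  then show False using Auv(1) nz w01 by (simp add: w_def)
 qed
 show "\<not> algebraic_over (adjoin base_field {gen_coeff X}) u"
  using univariate_field_closed[OF u_nc] algebraic_over_mono[OF range_embed_univariate] by blast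
 show "\<not> algebraic_over (adjoin base_field {gen_coeff X, u}) v"
 proof
  assume "algebraic_over (adjoin base_field {gen_coeff X, u}) v"
  moreover have "adjoin base_field {gen_coeff X, u} \<subseteq> adjoin ?K {u}"
  proof (rule adjoin_least[OF subfield_adjoin])
   have "adjoin base_field {gen_coeff X} \<subseteq> adjoin ?K {u}" using range_embed_univariate[of X] adjoin_base[of ?K "{u}"] by (rule order_trans)
   then show "base_field \<subseteq> adjoin ?K {u}" "{gen_coeff X, u} \<subseteq> adjoin ?K {u}"
    using adjoin_base[of base_field "{gen_coeff X}"] adjoin_gen[of "{gen_coeff X}" base_field] adjoin_gen[of "{u}" ?K] by auto
  qed
  ultimately have v_alg: "algebraic_over (adjoin ?K {u}) v" using algebraic_over_mono by blast
  define E where "E = adjoin ?K {u, v}"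
  have E: "is_subfield E" "?K \<subseteq> E" unfolding E_def by (rule subfield_adjoin, rule adjoin_base)
  have uv: "u \<in> E" "v \<in> E" unfolding E_def using adjoin_gen[of "{u, v}" ?K] by auto
  have wE: "w \<in> E" using wK E(2) by blast
  obtain s where s: "s \<in> E" "\<not> algebraic_over ?K s" "E \<subseteq> adjoin ?K {s}"
   using generator_of_plane_curve[OF u_nc v_alg] unfolding E_def by blast
  have A_uv: "A u = w * u" "A v = w * (w * v)" using Auv by (simp_all add: w_def)
  have B_uv: "B (B u) = 1 / v" "B (B v) = u / v"
   using nz by (simp_all add: Buv hom_divide[OF B(1)] homD(2)[OF B(1)])
  have A_E: "A x \<in> E" if "x \<in> E" for x
  proof (rule hom_adjoin_closed[OF A(1) E(1) _ _ that[unfolded E_def]])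
   show "A y \<in> E" if "y \<in> ?K" for y using that A_h E(2) by auto
   show "A y \<in> E" if "y \<in> {u, v}" for y
    using that A_uv subfieldD(4)[OF E(1) wE] uv by auto
  qed
  have B_E: "B x \<in> E" if "x \<in> E" for x
  proof (rule hom_adjoin_closed[OF B(1) E(1) _ _ that[unfolded E_def]])
   show "B y \<in> E" if "y \<in> ?K" for y using that B_h E(2) by auto
   show "B y \<in> E" if "y \<in> {u, v}" for y
    using that Buv subfield_divide[OF E(1) uv(2,1)] subfield_divide[OF E(1) subfieldD(2)[OF E(1)] uv(1)] by auto
  qed
  have A3: "A (A (A x)) = x" if "x \<in> E" for x
  proof (rule homs_agree_adjoin[OF hom_comp[OF A(1) hom_comp[OF A(1) A(1)]] hom_id(2) _ _ that[unfolded E_def]])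
   show "A (A (A y)) = y" if "y \<in> ?K" for y using that A_h by auto
   have "A (A (A u)) = w * (w * w) * u" "A (A (A v)) = w * (w * w) * (w * (w * w)) * v"
    by (simp_all add: A_uv homD(4)[OF A(1)] Aw mult_ac)
   then show "A (A (A y)) = y" if "y \<in> {u, v}" for y using that w3 by auto
  qed
  have B3: "B (B (B x)) = x" if "x \<in> E" for x
  proof (rule homs_agree_adjoin[OF hom_comp[OF B(1) hom_comp[OF B(1) B(1)]] hom_id(2) _ _ that[unfolded E_def]])
   show "B (B (B y)) = y" if "y \<in> ?K" for y using that B_h by auto
   have "B (B (B u)) = u" "B (B (B v)) = v"
    unfolding B_uv hom_divide[OF B(1)] homD(2)[OF B(1)] Buv using nz by simp_all
   then show "B (B (B y)) = y" if "y \<in> {u, v}" for y using that by auto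
  qed
  have AB: "A (B x) = B (A x)" if "x \<in> E" for x
  proof (rule homs_agree_adjoin[OF hom_comp[OF A(1) B(1)] hom_comp[OF B(1) A(1)] _ _ that[unfolded E_def]])
   show "A (B y) = B (A y)" if "y \<in> ?K" for y using that A_h B_h by auto
   have "A (B u) = B (A u)" unfolding Buv A_uv hom_divide[OF A(1)] homD(4)[OF B(1)] Aw using nz w01 by (simp add: field_simps)
   moreover have "A (B v) = B (A v)"
   proof -
    have "A (B v) = 1 / (w * u)" unfolding Buv hom_divide[OF A(1)] homD(2)[OF A(1)] A_uv ..
    moreover have "B (A v) = w * (w * (1 / u))" unfolding A_uv homD(4)[OF B(1)] Aw Buv ..
    moreover have "1 / (w * u) = w * (w * w) / (w * u)" using w3 by simp
    ultimately show ?thesis using nz w01 by simp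
   qed
   ultimately show "A (B y) = B (A y)" if "y \<in> {u, v}" for y using that by auto
  qed
  have "u * B u * B (B u) = u * (v / u) * (1 / v)" by (simp only: B_uv(1)) (simp only: Buv)
  then have "u * B u * B (B u) = 1" using nz by simp
  then show False
   using rational_function_field_no_heisenberg_action[OF h s(2,1,3) E A(1) A_h A_E A3 B(1) B_h B_E B3 AB uv(1) A_uv(1) _ wK w] by blast
 qed
qed

section \<open>The Hesse pencil\<close>

text \<open>Only the existence of coefficients is used, so that an expression in linear forms is
 recognised as a cubic form without expanding it.\<close>

definition cubic_map :: "((nat \<Rightarrow> 'a::field) \<Rightarrow> 'a) \<Rightarrow> bool" where
 "cubic_map F \<longleftrightarrow> (\<exists>C. \<forall>x. F x = (\<Sum>m\<in>monomials 3 3. C m * mon x m))"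

lemma cubic_map_add: "cubic_map F \<Longrightarrow> cubic_map G \<Longrightarrow> cubic_map (\<lambda>x. F x + G x)"
proof -
 assume "cubic_map F" "cubic_map G"
 then obtain C D where "\<forall>x. F x = (\<Sum>m\<in>monomials 3 3. C m * mon x m)" "\<forall>x. G x = (\<Sum>m\<in>monomials 3 3. D m * mon x m)"
  unfolding cubic_map_def by (elim exE)
 then have "\<forall>x. F x + G x = (\<Sum>m\<in>monomials 3 3. (C m + D m) * mon x m)"
  by (simp add: sum.distrib distrib_right)
 then show ?thesis unfolding cubic_map_def by (rule exI[of _ "\<lambda>m. C m + D m"])
qed

lemma cubic_map_scale: "cubic_map F \<Longrightarrow> cubic_map (\<lambda>x. k * F x)"
proof -
 assume "cubic_map F"
 then obtain C where "\<forall>x. F x = (\<Sum>m\<in>monomials 3 3. C m * mon x m)" unfolding cubic_map_def by (elim exE)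
 then have "\<forall>x. k * F x = (\<Sum>m\<in>monomials 3 3. (k * C m) * mon x m)" by (simp add: sum_distrib_left mult.assoc)
 then show ?thesis unfolding cubic_map_def by (rule exI[of _ "\<lambda>m. k * C m"])
qed

lemma cubic_map_product:
 "cubic_map (\<lambda>x. (\<Sum>i<3. x i * a i) * ((\<Sum>i<3. x i * b i) * (\<Sum>i<3. x i * c i)))"
proof -
 let ?I = "{..<3::nat} \<times> {..<3::nat} \<times> {..<3::nat}"
 let ?name = "\<lambda>(i, j, l). cubic_mon i j l" and ?coef = "\<lambda>(i, j, l). a i * (b j * c l)"
 define C where "C m = (\<Sum>t\<in>{t\<in>?I. ?name t = m}. ?coef t)" for m
 have "(\<Sum>i<3. x i * a i) * ((\<Sum>i<3. x i * b i) * (\<Sum>i<3. x i * c i)) = (\<Sum>m\<in>monomials 3 3. C m * mon x m)" for x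
 proof -
  have "(\<Sum>i<3. x i * a i) * ((\<Sum>i<3. x i * b i) * (\<Sum>i<3. x i * c i)) = (\<Sum>i<3. \<Sum>j<3. \<Sum>l<3. (x i * a i) * ((x j * b j) * (x l * c l)))"
   by (simp only: sum_distrib_left[symmetric] sum_distrib_right[symmetric])
  also have "\<dots> = (\<Sum>t\<in>?I. ?coef t * mon x (?name t))"
   unfolding sum.cartesian_product by (rule sum.cong) (auto simp: mon_cubic_mon)
  also have "\<dots> = (\<Sum>m\<in>monomials 3 3. \<Sum>t\<in>{t\<in>?I. ?name t = m}. ?coef t * mon x (?name t))"
   by (rule sum.group[symmetric]) (auto simp: finite_monomials intro!: cubic_mon_in)
  also have "\<dots> = (\<Sum>m\<in>monomials 3 3. C m * mon x m)"
   unfolding C_def sum_distrib_right by (intro sum.cong) auto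
  finally show ?thesis .
 qed
 then show ?thesis unfolding cubic_map_def by blast
qed

lemma cubic_map_zero:
 fixes F :: "(nat \<Rightarrow> 'a::field_char_0) \<Rightarrow> 'a"
 assumes "cubic_map F" and z: "\<And>x. (\<And>v. x v \<in> of_nat ` {1..}) \<Longrightarrow> F x = 0"
 shows "F x = 0"
proof -
 obtain C where C: "\<forall>x. F x = (\<Sum>m\<in>monomials 3 3. C m * mon x m)" using assms(1) unfolding cubic_map_def by (elim exE)
 have "C m = 0" if "m \<in> monomials 3 3" for m
  by (rule monomials_independent[OF finite_monomials _ that]) (use z C in auto)
 then show ?thesis using C by simp
qed

definition hesse :: "'a::field \<Rightarrow> (nat \<Rightarrow> 'a) \<Rightarrow> 'a" where
 "hesse m y = y 0 * (y 0 * y 0) + (y 1 * (y 1 * y 1) + (y 2 * (y 2 * y 2) + m * (y 0 * (y 1 * y 2))))"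

lemma cubic_map_hesse: "cubic_map (\<lambda>x. hesse m (row_times 3 x M))"
 unfolding hesse_def row_times_def by (intro cubic_map_add cubic_map_scale cubic_map_product)

text \<open>Comparing coefficients of the tangent equation: the off-diagonal entries of \<open>X\<close> form two cycles of
 equations \<open>3 x + m y = 0\<close>, which have a nonzero solution only if \<open>m\<^sup>3 = -27\<close>, that is, for a singular cubic.\<close>

lemma hesse_tangent_solution:
 fixes m \<kappa> \<mu> :: "'a::field_char_0" and X :: "nat \<Rightarrow> nat \<Rightarrow> 'a"
 assumes m: "m ^ 3 + 27 \<noteq> 0"
  and eq: "\<And>a b c. \<kappa> * (a ^ 3 + b ^ 3 + c ^ 3 + m * a * b * c) + 3 * a\<^sup>2 * (a * X 0 0 + b * X 1 0 + c * X 2 0) +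
   3 * b\<^sup>2 * (a * X 0 1 + b * X 1 1 + c * X 2 1) + 3 * c\<^sup>2 * (a * X 0 2 + b * X 1 2 + c * X 2 2) +
   m * ((a * X 0 0 + b * X 1 0 + c * X 2 0) * b * c + a * (a * X 0 1 + b * X 1 1 + c * X 2 1) * c + a * b * (a * X 0 2 + b * X 1 2 + c * X 2 2)) +
   \<mu> * a * b * c = 0"
 shows "\<mu> = 0" "i < 3 \<Longrightarrow> j < 3 \<Longrightarrow> X i j = (if i = j then - \<kappa> / 3 else 0)"
proof -
 have d: "3 * X 0 0 = - \<kappa>" "3 * X 1 1 = - \<kappa>" "3 * X 2 2 = - \<kappa>"
  using eq[of 1 0 0] eq[of 0 1 0] eq[of 0 0 1] by (simp_all add: eq_neg_iff_add_eq_0 add.commute)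
 have two: "x = 0" if "x + y = 0" "x - y = 0" for x y :: 'a
 proof -
  have "2 * x = 0" using that by Groebner_Basis.algebra
  then show ?thesis by simp
 qed
 have p01: "(3 * X 0 1 + m * X 1 2) + (3 * X 1 0 + m * X 0 2) = 0" using eq[of 1 1 0] d by (simp add: power2_eq_square) (Groebner_Basis.algebra)
 have n01: "(3 * X 0 1 + m * X 1 2) - (3 * X 1 0 + m * X 0 2) = 0" using eq[of 1 "-1" 0] d by (simp add: power2_eq_square power3_eq_cube) (Groebner_Basis.algebra)
 have p02: "(3 * X 0 2 + m * X 2 1) + (3 * X 2 0 + m * X 0 1) = 0" using eq[of 1 0 1] d by (simp add: power2_eq_square) (Groebner_Basis.algebra)
 have n02: "(3 * X 0 2 + m * X 2 1) - (3 * X 2 0 + m * X 0 1) = 0" using eq[of 1 0 "-1"] d by (simp add: power2_eq_square power3_eq_cube) (Groebner_Basis.algebra)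
 have p12: "(3 * X 1 2 + m * X 2 0) + (3 * X 2 1 + m * X 1 0) = 0" using eq[of 0 1 1] d by (simp add: power2_eq_square) (Groebner_Basis.algebra)
 have n12: "(3 * X 1 2 + m * X 2 0) - (3 * X 2 1 + m * X 1 0) = 0" using eq[of 0 1 "-1"] d by (simp add: power2_eq_square power3_eq_cube) (Groebner_Basis.algebra)
 have a: "3 * X 0 1 + m * X 1 2 = 0" "3 * X 0 2 + m * X 2 1 = 0" "3 * X 1 2 + m * X 2 0 = 0"
  using two[OF p01 n01] two[OF p02 n02] two[OF p12 n12] .
 have b: "3 * X 1 0 + m * X 0 2 = 0" "3 * X 2 0 + m * X 0 1 = 0" "3 * X 2 1 + m * X 1 0 = 0"
  using p01 p02 p12 a by simp_all
 have cycle: "x = 0 \<and> y = 0 \<and> z = 0" if "3 * x + m * y = 0" "3 * y + m * z = 0" "3 * z + m * x = 0" for x y z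
 proof -
  have "(m ^ 3 + 27) * x = 0" "(m ^ 3 + 27) * y = 0" "(m ^ 3 + 27) * z = 0"
   using that by Groebner_Basis.algebra+
  then show ?thesis using m by simp
 qed
 have off: "X 0 1 = 0 \<and> X 1 2 = 0 \<and> X 2 0 = 0" "X 0 2 = 0 \<and> X 2 1 = 0 \<and> X 1 0 = 0"
  using cycle[OF a(1,3) b(2)] cycle[OF a(2) b(3,1)] .
 show "\<mu> = 0" using eq[of 1 1 1] d off by simp (Groebner_Basis.algebra)
 assume "i < 3" "j < 3"
 then have "i = 0 \<or> i = 1 \<or> i = 2" "j = 0 \<or> j = 1 \<or> j = 2" by auto
 moreover have "X 0 0 = - \<kappa> / 3" "X 1 1 = - \<kappa> / 3" "X 2 2 = - \<kappa> / 3" using d by (simp_all add: field_simps)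
 ultimately show "X i j = (if i = j then - \<kappa> / 3 else 0)" using off by auto
qed

lemma GL_inverseE:
 assumes M: "M \<in> GL n L"
 shows "\<exists>N. (\<forall>i<n. \<forall>j<n. (\<Sum>l<n. M $$ (i, l) * N l j) = (if i = j then 1 else 0)) \<and>
  (\<forall>i<n. \<forall>j<n. (\<Sum>l<n. N i l * M $$ (l, j)) = (if i = j then 1 else 0))"
proof -
 obtain h where c: "M \<in> carrier_mat n n" "h \<in> carrier_mat n n" and e: "M * h = 1\<^sub>m n" "h * M = 1\<^sub>m n"
  using M unfolding GL_def by blast
 have "(\<Sum>l<n. M $$ (i, l) * h $$ (l, j)) = (if i = j then 1 else 0)" "(\<Sum>l<n. h $$ (i, l) * M $$ (l, j)) = (if i = j then 1 else 0)"
  if "i < n" "j < n" for i j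
 proof -
  have "(M * h) $$ (i, j) = (\<Sum>l<n. M $$ (i, l) * h $$ (l, j))" "(h * M) $$ (i, j) = (\<Sum>l<n. h $$ (i, l) * M $$ (l, j))"
   using c that by (simp_all add: scalar_prod_def lessThan_atLeast0)
  then show "(\<Sum>l<n. M $$ (i, l) * h $$ (l, j)) = (if i = j then 1 else 0)" "(\<Sum>l<n. h $$ (i, l) * M $$ (l, j)) = (if i = j then 1 else 0)"
   using that unfolding e by simp_all
 qed
 then show ?thesis by (intro exI[of _ "\<lambda>l j. h $$ (l, j)"]) simp
qed

text \<open>Infinitesimally, a Hesse cubic determines its parameter, and its
 linear stabiliser consists of scalars. The tangent equation holds at integral points, where \<open>d\<close> kills the coordinates; it is a
 cubic identity in \<open>x\<close>, hence true everywhere, and \<open>x M\<close> may be replaced by arbitrary coordinates.\<close>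

lemma hesse_tangent:
 fixes M :: "'a::field_char_0 mat"
 assumes M: "M \<in> GL 3 UNIV" and m: "m ^ 3 + 27 \<noteq> 0" and lam: "lam \<noteq> 0" and d: "derivation d"
  and kill: "\<forall>x. (\<forall>v. x v \<in> of_nat ` {1..}) \<longrightarrow> d (lam * hesse m (row_times 3 x M)) = 0"
 shows "d m = 0" "i < 3 \<Longrightarrow> j < 3 \<Longrightarrow> d (M $$ (i, j)) = - (d lam / lam) / 3 * M $$ (i, j)"
proof -
 have three: "{..<3} = {0, 1, 2 :: nat}" by auto
 let ?w = "\<lambda>x j. \<Sum>i<3. x i * d (M $$ (i, j))"
 let ?T = "\<lambda>x z. d lam * hesse m z + lam * (3 * (z 0 * (z 0 * ?w x 0)) + (3 * (z 1 * (z 1 * ?w x 1)) + (3 * (z 2 * (z 2 * ?w x 2)) +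
   (m * (?w x 0 * (z 1 * z 2)) + (m * (z 0 * (?w x 1 * z 2)) + (m * (z 0 * (z 1 * ?w x 2)) + d m * (z 0 * (z 1 * z 2))))))))"
 have T0: "?T x (row_times 3 x M) = 0" for x
 proof (rule cubic_map_zero[of "\<lambda>x. ?T x (row_times 3 x M)"])
  show "cubic_map (\<lambda>x. ?T x (row_times 3 x M))"
   unfolding hesse_def row_times_def by (intro cubic_map_add cubic_map_scale cubic_map_product)
  fix x :: "nat \<Rightarrow> 'a" assume x: "\<And>v. x v \<in> of_nat ` {1..}"
  have dx: "d (x v) = 0" for v using x[of v] derivation_of_nat[OF d] by auto
  have dz: "d (row_times 3 x M j) = ?w x j" for j
   by (simp add: row_times_def derivation_sum[OF d] derivationD(2)[OF d] dx)
  have "?T x (row_times 3 x M) = d (lam * hesse m (row_times 3 x M))"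
   unfolding hesse_def derivationD[OF d] dz by (simp add: algebra_simps)
  then show "?T x (row_times 3 x M) = 0" using kill x by simp
 qed
 obtain N where N1: "\<forall>i<3. \<forall>j<3. (\<Sum>l<3. M $$ (i, l) * N l j) = (if i = j then 1 else 0)"
  and N2: "\<forall>i<3. \<forall>j<3. (\<Sum>l<3. N i l * M $$ (l, j)) = (if i = j then 1 else 0)"
  using GL_inverseE[OF M] by (elim exE conjE)
 define X where "X l j = (\<Sum>i<3. N l i * d (M $$ (i, j)))" for l j
 define \<kappa> where "\<kappa> = d lam / lam"
 have dlam: "d lam = lam * \<kappa>" using lam by (simp add: \<kappa>_def)
 have eq: "\<kappa> * (a ^ 3 + b ^ 3 + c ^ 3 + m * a * b * c) + 3 * a\<^sup>2 * (a * X 0 0 + b * X 1 0 + c * X 2 0) +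
   3 * b\<^sup>2 * (a * X 0 1 + b * X 1 1 + c * X 2 1) + 3 * c\<^sup>2 * (a * X 0 2 + b * X 1 2 + c * X 2 2) +
   m * ((a * X 0 0 + b * X 1 0 + c * X 2 0) * b * c + a * (a * X 0 1 + b * X 1 1 + c * X 2 1) * c + a * b * (a * X 0 2 + b * X 1 2 + c * X 2 2)) +
   d m * a * b * c = 0" for a b c
 proof -
  define \<zeta> where "\<zeta> l = (if l = 0 then a else if l = 1 then b else c)" for l :: nat
  define x where "x i = (\<Sum>l<3. \<zeta> l * N l i)" for i
  have swap: "(\<Sum>i<3. x i * Y i) = (\<Sum>l<3. \<zeta> l * (\<Sum>i<3. N l i * Y i))" for Y
   unfolding x_def sum_distrib_right sum_distrib_left by (subst sum.swap) (simp add: mult.assoc)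
  have z: "row_times 3 x M j = \<zeta> j" if "j < 3" for j
  proof -
   have "row_times 3 x M j = (\<Sum>l<3. \<zeta> l * (if l = j then 1 else 0))"
    unfolding row_times_def swap using N2 that by (intro sum.cong) auto
   also have "\<dots> = (\<Sum>l<3. if l = j then \<zeta> l else 0)" by (intro sum.cong) auto
   also have "\<dots> = \<zeta> j" using that by (simp only: sum.delta finite_lessThan lessThan_iff if_True)
   finally show ?thesis .
  qed
  have w: "?w x j = a * X 0 j + b * X 1 j + c * X 2 j" for j
   unfolding swap X_def[symmetric] by (simp add: three \<zeta>_def)
  have zz: "row_times 3 x M 0 = a" "row_times 3 x M 1 = b" "row_times 3 x M 2 = c"
   using z[of 0] z[of 1] z[of 2] by (simp_all add: \<zeta>_def)
  have T: "?T x (row_times 3 x M) = lam * (\<kappa> * (a ^ 3 + b ^ 3 + c ^ 3 + m * a * b * c) + 3 * a\<^sup>2 * (a * X 0 0 + b * X 1 0 + c * X 2 0) +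
   3 * b\<^sup>2 * (a * X 0 1 + b * X 1 1 + c * X 2 1) + 3 * c\<^sup>2 * (a * X 0 2 + b * X 1 2 + c * X 2 2) +
   m * ((a * X 0 0 + b * X 1 0 + c * X 2 0) * b * c + a * (a * X 0 1 + b * X 1 1 + c * X 2 1) * c + a * b * (a * X 0 2 + b * X 1 2 + c * X 2 2)) +
   d m * a * b * c)"
   unfolding hesse_def zz w dlam by Groebner_Basis.algebra
  show ?thesis using T0[of x] lam unfolding T by simp
 qed
 note sol = hesse_tangent_solution[OF m eq]
 show "d m = 0" by (rule sol(1))
 assume ij: "i < 3" "j < 3"
 have "(\<Sum>l<3. M $$ (i, l) * X l j) = (\<Sum>l<3. \<Sum>a<3. M $$ (i, l) * N l a * d (M $$ (a, j)))"
  by (simp add: X_def sum_distrib_left mult.assoc)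
 also have "\<dots> = (\<Sum>a<3. (\<Sum>l<3. M $$ (i, l) * N l a) * d (M $$ (a, j)))"
  by (subst sum.swap) (simp add: sum_distrib_right)
 also have "\<dots> = (\<Sum>a<3. (if i = a then 1 else 0) * d (M $$ (a, j)))"
  using N1 ij by (intro sum.cong) auto
 also have "\<dots> = (\<Sum>a<3. if a = i then d (M $$ (a, j)) else 0)" by (intro sum.cong) auto
 also have "\<dots> = d (M $$ (i, j))" using ij by (simp only: sum.delta finite_lessThan lessThan_iff if_True)
 finally have "d (M $$ (i, j)) = (\<Sum>l<3. M $$ (i, l) * X l j)" by simp
 also have "\<dots> = (\<Sum>l<3. M $$ (i, l) * (if l = j then - \<kappa> / 3 else 0))"
  using sol(2)[OF _ ij(2)] by (intro sum.cong) auto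
 also have "\<dots> = (\<Sum>l<3. if l = j then - \<kappa> / 3 * M $$ (i, l) else 0)" by (intro sum.cong) auto
 also have "\<dots> = - \<kappa> / 3 * M $$ (i, j)" using ij by (simp only: sum.delta finite_lessThan lessThan_iff if_True)
 finally show "d (M $$ (i, j)) = - (d lam / lam) / 3 * M $$ (i, j)" by (simp add: \<kappa>_def)
qed

section \<open>Ternary cubics: the lower bound\<close>

lemma GL_mult:
 assumes A: "A \<in> GL n UNIV" and B: "B \<in> GL n UNIV" shows "A * B \<in> GL n UNIV"
proof (rule GL_I[OF subfield_UNIV])
 show "A * B \<in> carrier_mat n n" using GL_D(1)[OF A] GL_D(1)[OF B] by simp
 show "det (A * B) \<noteq> 0" using det_mult[OF GL_D(1)[OF A] GL_D(1)[OF B]] GL_D(3)[OF A] GL_D(3)[OF B] by simp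
qed simp

lemma GL_map:
 fixes F :: "'a::field \<Rightarrow> 'b::field"
 assumes F: "is_hom F" and A: "A \<in> GL n UNIV" shows "map_mat F A \<in> GL n UNIV"
proof -
 obtain h where c: "A \<in> carrier_mat n n" "h \<in> carrier_mat n n" and e: "A * h = 1\<^sub>m n" "h * A = 1\<^sub>m n"
  using A unfolding GL_def by blast
 have prod: "map_mat F B * map_mat F C = map_mat F (B * C)" if "B \<in> carrier_mat n n" "C \<in> carrier_mat n n" for B C
  by (rule eq_matI) (use that in \<open>auto simp: scalar_prod_def hom_sum[OF F] homD(4)[OF F]\<close>)
 have one: "map_mat F (1\<^sub>m n) = 1\<^sub>m n" by (rule eq_matI) (auto simp: homD[OF F])
 show ?thesis
  unfolding GL_def using c prod[OF c] prod[OF c(2,1)] e one by (intro CollectI conjI bexI[of _ "map_mat F h"]) auto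
qed

text \<open>Preimages of algebraically independent elements are independent.\<close>

lemma trdeg_hom_image:
 fixes F :: "'a::field_char_0 \<Rightarrow> 'a"
 assumes F: "is_hom F" and k: "is_subfield k" and fix_k: "\<And>x. x \<in> k \<Longrightarrow> F x = x"
 shows "trdeg k (F ` L) \<le> trdeg k L"
 unfolding trdeg_def[of k "F ` L"]
proof (rule Sup_least)
 fix r assume "r \<in> {enat (card S) | S. S \<subseteq> F ` L \<and> finite S \<and> alg_independent k S}"
 then obtain S where S: "r = enat (card S)" "S \<subseteq> F ` L" "finite S" "alg_independent k S" by blast
 obtain T where T: "T \<subseteq> L" "F ` T = S" using S(2) by (metis subset_imageE)
 have inj: "inj_on F T" using hom_inj[OF F] by (simp add: inj_on_def)
 have fT: "finite T" using S(3) T(2) inj finite_imageD by blast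
 obtain d where d: "\<forall>s\<in>S. derivation (d s) \<and> (\<forall>x\<in>k. d s x = 0) \<and> (\<forall>t\<in>S. t \<noteq> s \<longrightarrow> d s t = 0) \<and> d s s = 1"
  using alg_independent_dual_basis[OF k S(4)] by (rule exE)
 have "alg_independent k T"
  unfolding alg_independent_iff
 proof (intro allI impI)
  fix p assume p: "poly_over k T p" "ev id id p = 0"
  have pk: "lookup p m \<in> k" "keys m \<subseteq> T" if "m \<in> keys p" for m
   using p(1) that by (simp_all add: poly_over_def)
  have FS: "F v \<in> S" if "v \<in> T" for v using that T(2) by blast
  have "F (ev id id p) = (\<Sum>m\<in>keys p. lookup p m * mon F m)"
   unfolding hom_ev[OF F] unfolding ev_def by (intro sum.cong) (auto simp: fix_k pk)
  then have z: "(\<Sum>m\<in>keys p. lookup p m * mon F m) = 0" using p(2) homD(1)[OF F] by simp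
  have "lookup p m = 0" if m: "m \<in> keys p" for m
  proof (rule dual_derivations_monomials_independent[of T "\<lambda>v. d (F v)" k F "keys p" "lookup p" m])
   show "d (F v) (F w) = 0" if "v \<in> T" "w \<in> T" "v \<noteq> w" for v w
    using d FS[OF that(1)] FS[OF that(2)] inj that by (metis inj_onD)
  qed (use d FS pk k z m in auto)
  then show "p = 0" by (intro poly_mapping_eqI) (metis in_keys_iff lookup_zero)
 qed
 then have "enat (card T) \<le> trdeg k L" by (rule trdeg_ge[OF T(1) fT])
 moreover have "card T = card S" using card_image[OF inj] T(2) by simp
 ultimately show "r \<le> trdeg k L" using S(1) by simp
qed

text \<open>The field has one variable for each monomial. For a generic \<open>3 \<times> 3\<close> matrix \<open>h\<close> and the parameter \<open>m\<close>, the ten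
 cubic monomials serve as names: \<open>h\<^sub>i\<^sub>j\<close> is called \<open>x\<^sub>i x\<^sub>j\<^sup>2\<close>, and \<open>m\<close> is called \<open>x y z\<close>.\<close>

abbreviation hesse_name :: "nat \<Rightarrow> nat \<Rightarrow> nat \<Rightarrow>\<^sub>0 nat" where
 "hesse_name i j \<equiv> cubic_mon i j j"

lemma hesse_name_inj: "hesse_name i j = hesse_name i' j' \<longleftrightarrow> i = i' \<and> j = j'"
proof
 assume e: "hesse_name i j = hesse_name i' j'"
 have l: "lookup (hesse_name i j) t = lookup (hesse_name i' j') t" for t unfolding e ..
 have j: "j = j'" using l[of j] l[of j'] by (auto simp: lookup_cubic_mon split: if_splits)
 show "i = i' \<and> j = j'" using l[of i] j by (auto simp: lookup_cubic_mon split: if_splits)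
qed simp

lemma hesse_name_parameter: "hesse_name i j \<noteq> cubic_mon 0 1 2"
proof
 assume "hesse_name i j = cubic_mon 0 1 2"
 then have "lookup (hesse_name i j) j = lookup (cubic_mon 0 1 2) j" by simp
 then show False by (auto simp: lookup_cubic_mon split: if_splits)
qed

lemma monomials_3_3_cases:
 assumes "v \<in> monomials 3 3"
 shows "v = cubic_mon 0 1 2 \<or> (\<exists>i<3. \<exists>j<3. v = hesse_name i j)"
proof -
 have "cubic_mon 0 0 1 = hesse_name 1 0" "cubic_mon 0 0 2 = hesse_name 2 0" "cubic_mon 1 1 2 = hesse_name 2 1"
  by (simp_all add: cubic_mon_def ac_simps)
 then have "v = cubic_mon 0 1 2 \<or> v \<in> (\<Union>i\<in>{0, 1, 2}. \<Union>j\<in>{0, 1, 2}. {hesse_name i j})"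
  using assms unfolding set_cubic_mons[symmetric] cubic_mons_def by auto
 moreover have "{0, 1, 2} = {..<3 :: nat}" by auto
 ultimately show ?thesis by auto
qed

text \<open>Endomorphisms of the field are given by their values on the matrix, provided that these values are
 algebraically independent.\<close>

lemma hesse_hom_exists:
 fixes g :: "nat \<Rightarrow> nat \<Rightarrow> 'k::field_char_0 ratfun"
 assumes jac: "\<And>d. derivation d \<Longrightarrow> \<forall>x\<in>base_field. d x = 0 \<Longrightarrow> \<forall>i<3. \<forall>j<3. d (g i j) = 0 \<Longrightarrow>
  \<forall>i<3. \<forall>j<3. d (gen_coeff (hesse_name i j)) = 0"
 shows "\<exists>F. is_hom F \<and> (\<forall>c. F (scalar c) = scalar c) \<and> F (gen_coeff (cubic_mon 0 1 2)) = gen_coeff (cubic_mon 0 1 2) \<and>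
  (\<forall>i<3. \<forall>j<3. F (gen_coeff (hesse_name i j)) = g i j) \<and> (\<forall>v. v \<notin> monomials 3 3 \<longrightarrow> F (gen_coeff v) = gen_coeff v)"
proof -
 let ?I = "{..<3::nat} \<times> {..<3::nat}" and ?nm = "\<lambda>(i, j). hesse_name i j"
 have inj: "inj_on ?nm ?I" by (auto simp: inj_on_def hesse_name_inj)
 define y where "y v = (if v \<in> ?nm ` ?I then case inv_into ?I ?nm v of (i, j) \<Rightarrow> g i j else gen_coeff v)" for v
 have y1: "y (hesse_name i j) = g i j" if "i < 3" "j < 3" for i j
 proof -
  have "inv_into ?I ?nm (?nm (i, j)) = (i, j)" by (rule inv_into_f_f[OF inj]) (use that in simp)
  moreover have "?nm (i, j) \<in> ?nm ` ?I" using that by (intro imageI) simp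
  ultimately show ?thesis by (simp add: y_def)
 qed
 have y2: "y (cubic_mon 0 1 2) = gen_coeff (cubic_mon 0 1 2)"
 proof -
  have "cubic_mon 0 1 2 \<notin> ?nm ` ?I"
  proof
   assume "cubic_mon 0 1 2 \<in> ?nm ` ?I"
   then obtain i j where "cubic_mon 0 1 2 = hesse_name i j" by auto
   then show False using hesse_name_parameter[of i j] by simp
  qed
  then show ?thesis unfolding y_def by (rule if_not_P)
 qed
 have y3: "y v = gen_coeff v" if "v \<notin> monomials 3 3" for v
 proof -
  have "v \<notin> ?nm ` ?I" using that cubic_mon_in by auto
  then show ?thesis by (simp add: y_def)
 qed
 have "p = 0" if p: "ev scalar y p = 0" for p
 proof (rule jacobian_criterion[OF finite_monomials[of 3 3] y3 _ p])
  fix d :: "'k ratfun \<Rightarrow> 'k ratfun" assume d: "derivation d" "\<forall>x\<in>base_field. d x = 0" "\<forall>v\<in>monomials 3 3. d (y v) = 0"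
  have "d (g i j) = 0" if "i < 3" "j < 3" for i j
   using d(3) cubic_mon_in[OF that(1,2,2)] y1[OF that] by metis
  then have h: "\<forall>i<3. \<forall>j<3. d (gen_coeff (hesse_name i j)) = 0" using jac[OF d(1,2)] by blast
  have "cubic_mon 0 1 2 \<in> monomials 3 3" by (rule cubic_mon_in) auto
  then have "d (gen_coeff (cubic_mon 0 1 2)) = 0" using d(3) y2 by metis
  then show "\<forall>v\<in>monomials 3 3. d (gen_coeff v) = 0" using monomials_3_3_cases h by metis
 qed
 then obtain F where F: "is_hom F" "\<forall>c. F (scalar c) = scalar c" "\<forall>v. F (gen_coeff v) = y v"
  using ratfun_hom_exists[OF scalar_hom, of y] by blast
 show ?thesis
  by (rule exI[of _ F]) (simp add: F y1 y2[unfolded One_nat_def] y3)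
qed

definition hesse_matrix :: "'k::field ratfun mat" where
 "hesse_matrix = mat 3 3 (\<lambda>(i, j). gen_coeff (hesse_name i j))"

lemma hesse_matrix_GL: "(hesse_matrix :: 'k::field_char_0 ratfun mat) \<in> GL 3 UNIV"
 unfolding hesse_matrix_def
proof (rule GL_3_explicit[OF subfield_UNIV])
 let ?a = "\<lambda>i j. gen_coeff (hesse_name i j) :: 'k ratfun"
 obtain D :: "(nat \<Rightarrow>\<^sub>0 nat) \<Rightarrow> 'k ratfun \<Rightarrow> 'k ratfun" where D: "\<forall>v\<in>monomials 3 3. derivation (D v) \<and>
  (\<forall>x\<in>base_field. D v x = 0) \<and> (\<forall>w\<in>monomials 3 3. D v (gen_coeff w) = (if v = w then 1 else 0))"
  using gen_coeff_dual_derivations[OF finite_monomials[of 3 3]] by (rule exE)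
 have der: "derivation (D (hesse_name i i))" if "i < 3" for i using D cubic_mon_in[OF that that that] by blast
 have val: "D (hesse_name i i) (?a k l) = (if i = k \<and> i = l then 1 else 0)" if "i < 3" "k < 3" "l < 3" for i k l
  using D cubic_mon_in[OF that(1,1,1)] cubic_mon_in[OF that(2,3,3)] by (simp add: hesse_name_inj)
 note rules = derivationD[OF der] derivation_diff[OF der] derivation_0[OF der] derivation_1[OF der] val
 show "?a 0 0 * (?a 1 1 * ?a 2 2 - ?a 1 2 * ?a 2 1) - ?a 0 1 * (?a 1 0 * ?a 2 2 - ?a 1 2 * ?a 2 0) + ?a 0 2 * (?a 1 0 * ?a 2 1 - ?a 1 1 * ?a 2 0) \<noteq> 0"
  (is "?det \<noteq> 0")
 proof
  assume "?det = 0"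
  then have "D (hesse_name 2 2) (D (hesse_name 1 1) (D (hesse_name 0 0) ?det)) = 0" by (simp add: rules)
  then show False by (simp add: rules)
 qed
qed simp

lemma integral_kernel:
 assumes d: "derivation d" and x: "\<And>v. x v \<in> of_nat ` {1..}" and C: "\<And>m. m \<in> A \<Longrightarrow> d (C m) = 0"
 shows "d (\<Sum>m\<in>A. C m * mon x m) = 0"
proof -
 let ?K = "{z. d z = 0}"
 have K: "is_subfield ?K" by (rule derivation_kernel[OF d])
 have xK: "x v \<in> ?K" for v using x[of v] derivation_of_nat[OF d] by auto
 have "(\<Sum>m\<in>A. C m * mon x m) \<in> ?K"
  unfolding mon_def by (intro subfield_sum[OF K] subfieldD(4)[OF K] subfield_prod[OF K] subfield_power[OF K] xK) (use C in simp)
 then show ?thesis by simp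
qed

lemma parameter_generic: "(gen_coeff v :: 'k::field_char_0 ratfun) ^ 3 + 27 \<noteq> 0"
proof
 assume e: "gen_coeff v ^ 3 + 27 = (0 :: 'k ratfun)"
 let ?p = "[:27, 0, 0, 1:] :: 'k ratfun poly"
 have "coeffs_in base_field ?p"
  using subfieldD(1,2)[OF subfield_base] subfield_numeral[OF subfield_base]
  by (auto simp: coeffs_in_def coeff_pCons split: nat.splits)
 moreover have "poly ?p (gen_coeff v) = 0" using e by (simp add: power3_eq_cube algebra_simps)
 moreover have "?p \<noteq> 0" by simp
 ultimately have "algebraic_over base_field (gen_coeff v :: 'k ratfun)" unfolding algebraic_over_def by blast
 then show False using gen_coeff_transcendental by blast
qed

text \<open>The embedding \<open>F\<close> sends the general cubic to \<open>\<psi>(x h)\<close>. It is injective because a derivation that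
 kills the coefficients of \<open>\<psi>(x h)\<close> kills \<open>m\<close> and \<open>h\<close>.\<close>

lemma hesse_coefficient_map:
 "\<exists>C F. (\<forall>x. hesse (gen_coeff (cubic_mon 0 1 2)) (row_times 3 x hesse_matrix) = (\<Sum>m\<in>monomials 3 3. C m * mon x m)) \<and>
  is_hom F \<and> (\<forall>c. F (scalar c) = scalar c) \<and> (\<forall>v\<in>monomials 3 3. F (gen_coeff v) = C v) \<and>
  (\<forall>v. v \<notin> monomials 3 3 \<longrightarrow> F (gen_coeff v :: 'k::field_char_0 ratfun) = gen_coeff v)"
proof -
 let ?m = "gen_coeff (cubic_mon 0 1 2) :: 'k ratfun"
 obtain C where C: "\<forall>x. hesse ?m (row_times 3 x hesse_matrix) = (\<Sum>m\<in>monomials 3 3. C m * mon x m)"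
  using cubic_map_hesse[of ?m hesse_matrix] unfolding cubic_map_def by (rule exE)
 define y where "y v = (if v \<in> monomials 3 3 then C v else gen_coeff v)" for v
 have "p = 0" if p: "ev scalar y p = 0" for p
 proof (rule jacobian_criterion[OF finite_monomials[of 3 3] _ _ p])
  fix d :: "'k ratfun \<Rightarrow> 'k ratfun" assume d: "derivation d" "\<forall>x\<in>base_field. d x = 0" "\<forall>v\<in>monomials 3 3. d (y v) = 0"
  have dC: "d (C v) = 0" if "v \<in> monomials 3 3" for v using d(3) that by (auto simp: y_def)
  have kill: "\<forall>x. (\<forall>v. x v \<in> of_nat ` {1..}) \<longrightarrow> d (1 * hesse ?m (row_times 3 x hesse_matrix)) = 0"
   unfolding C[rule_format] mult_1 by (intro allI impI, rule integral_kernel[OF d(1)]) (blast, rule dC)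
  note tan = hesse_tangent[OF hesse_matrix_GL parameter_generic one_neq_zero d(1) kill]
  have h: "d (gen_coeff (hesse_name i j)) = 0" if "i < 3" "j < 3" for i j
   using tan(2)[OF that] that derivation_1[OF d(1)] by (simp add: hesse_matrix_def)
  have "d ?m = 0" by (rule tan(1))
  then show "\<forall>v\<in>monomials 3 3. d (gen_coeff v) = 0" using monomials_3_3_cases h by metis
 qed (simp add: y_def)
 then obtain F where F: "is_hom F" "\<forall>c. F (scalar c) = scalar c" "\<forall>v. F (gen_coeff v) = y v"
  using ratfun_hom_exists[OF scalar_hom, of y] by blast
 show ?thesis
  by (rule exI[of _ C], rule exI[of _ F]) (simp add: C[unfolded One_nat_def] F y_def)
qed

lemma hesse_symmetry_fixes_coefficients:
 fixes C :: "(nat \<Rightarrow>\<^sub>0 nat) \<Rightarrow> 'k::field_char_0 ratfun"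
 assumes A: "is_hom A" "A m = m"
  and C: "\<forall>x. hesse m (row_times 3 x M) = (\<Sum>v\<in>monomials 3 3. C v * mon x v)"
  and inv: "\<And>x. hesse m (\<lambda>j. \<Sum>i<3. x i * A (M $$ (i, j))) = hesse m (row_times 3 x M)"
  and v: "v \<in> monomials 3 3"
 shows "A (C v) = C v"
proof -
 have "A (C v) - C v = 0"
 proof (rule monomials_independent[OF finite_monomials _ v, of "\<lambda>v. A (C v) - C v"])
  fix x :: "nat \<Rightarrow> 'k ratfun" assume x: "\<And>v. x v \<in> of_nat ` {1..}"
  have Ax: "A (x v) = x v" for v using x[of v] hom_of_nat[OF A(1)] by auto
  have "(\<Sum>v\<in>monomials 3 3. A (C v) * mon x v) = A (\<Sum>v\<in>monomials 3 3. C v * mon x v)"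
   by (simp add: hom_sum[OF A(1)] homD(4)[OF A(1)] mon_def hom_prod[OF A(1)] hom_power[OF A(1)] Ax)
  also have "\<dots> = A (hesse m (row_times 3 x M))" using C by simp
  also have "\<dots> = hesse m (\<lambda>j. \<Sum>i<3. x i * A (M $$ (i, j)))"
   by (simp add: hesse_def row_times_def homD[OF A(1)] hom_sum[OF A(1)] Ax A(2))
  also have "\<dots> = (\<Sum>v\<in>monomials 3 3. C v * mon x v)" unfolding inv using C by simp
  finally show "(\<Sum>v\<in>monomials 3 3. (A (C v) - C v) * mon x v) = 0" by (simp add: left_diff_distrib sum_subtractf)
 qed
 then show ?thesis by simp
qed

lemma sum_3: "(\<Sum>i<3. F i) = F 0 + (F 1 + F (2 :: nat))"
proof -
 have "{..<3} = {0, 1, 2 :: nat}" by auto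
 then show ?thesis by simp
qed

text \<open>\<open>A\<close> and \<open>B\<close> act on the columns of \<open>h\<close> by symmetries of \<open>\<psi>\<close>, so that they fix the coefficients of
 \<open>\<psi>(x h)\<close>, and these generate the image of \<open>F\<close>.\<close>

lemma hesse_heisenberg_homs:
 fixes \<omega> :: "'k::field_char_0"
 assumes \<omega>: "\<omega>\<^sup>2 + \<omega> + 1 = 0"
 shows "\<exists>A B F. is_hom A \<and> is_hom B \<and> is_hom F \<and>
  (\<forall>c. A (scalar c) = scalar c \<and> B (scalar c) = scalar c \<and> F (scalar c) = scalar c) \<and>
  A (gen_coeff (cubic_mon 0 1 2)) = gen_coeff (cubic_mon 0 1 2) \<and> B (gen_coeff (cubic_mon 0 1 2)) = gen_coeff (cubic_mon 0 1 2) \<and>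
  (\<forall>z. A (F z) = F z \<and> B (F z) = F z) \<and>
  (\<forall>i<3. \<forall>j<3. A (gen_coeff (hesse_name i j)) = scalar \<omega> ^ j * gen_coeff (hesse_name i j)) \<and>
  (\<forall>i<3. \<forall>j<3. B (gen_coeff (hesse_name i j)) = gen_coeff (hesse_name i (Suc j mod 3))) \<and>
  (\<forall>x. hesse (gen_coeff (cubic_mon 0 1 2)) (row_times 3 x hesse_matrix) = (\<Sum>v\<in>monomials 3 3. F (gen_coeff v) * mon x v))"
proof -
 let ?m = "gen_coeff (cubic_mon 0 1 2) :: 'k ratfun" and ?H = "hesse_matrix :: 'k ratfun mat"
 define w :: "'k ratfun" where "w = scalar \<omega>"
 have w: "w\<^sup>2 + w + 1 = 0" using arg_cong[OF \<omega>, of scalar] by (simp add: w_def homD[OF scalar_hom] hom_power[OF scalar_hom])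
 have w3: "w * (w * w) = 1" using w by Groebner_Basis.algebra
 have w0: "w \<noteq> 0" using w by auto
 obtain C F where C: "\<forall>x. hesse ?m (row_times 3 x ?H) = (\<Sum>v\<in>monomials 3 3. C v * mon x v)"
  and F: "is_hom F" "\<forall>c. F (scalar c) = scalar c" "\<forall>v\<in>monomials 3 3. F (gen_coeff v) = C v"
   "\<forall>v. v \<notin> monomials 3 3 \<longrightarrow> F (gen_coeff v) = gen_coeff v"
  using hesse_coefficient_map by (elim exE conjE)
 have FC: "\<forall>x. hesse ?m (row_times 3 x ?H) = (\<Sum>v\<in>monomials 3 3. F (gen_coeff v) * mon x v)"
  using C F(3) by simp
 have "\<exists>A. is_hom A \<and> (\<forall>c. A (scalar c) = scalar c) \<and> A ?m = ?m \<and>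
  (\<forall>i<3. \<forall>j<3. A (gen_coeff (hesse_name i j)) = w ^ j * gen_coeff (hesse_name i j)) \<and> (\<forall>v. v \<notin> monomials 3 3 \<longrightarrow> A (gen_coeff v) = gen_coeff v)"
 proof (rule hesse_hom_exists)
  fix d :: "'k ratfun \<Rightarrow> 'k ratfun" assume d: "derivation d" "\<forall>x\<in>base_field. d x = 0"
   and z: "\<forall>i<3. \<forall>j<3. d (w ^ j * gen_coeff (hesse_name i j)) = 0"
  have dw: "d (w ^ j) = 0" for j
  proof -
   have "w ^ j \<in> base_field" by (rule subfield_power[OF subfield_base]) (simp add: w_def base_field_eq)
   then show ?thesis using d(2) by blast
  qed
  show "\<forall>i<3. \<forall>j<3. d (gen_coeff (hesse_name i j)) = 0"
   using z w0 by (simp add: derivationD(2)[OF d(1)] dw)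
 qed
 then obtain A where A: "is_hom A" "\<forall>c. A (scalar c) = scalar c" "A ?m = ?m"
  "\<forall>i<3. \<forall>j<3. A (gen_coeff (hesse_name i j)) = w ^ j * gen_coeff (hesse_name i j)" "\<forall>v. v \<notin> monomials 3 3 \<longrightarrow> A (gen_coeff v) = gen_coeff v"
  by (elim exE conjE)
 have "\<exists>B. is_hom B \<and> (\<forall>c. B (scalar c) = scalar c) \<and> B ?m = ?m \<and>
  (\<forall>i<3. \<forall>j<3. B (gen_coeff (hesse_name i j)) = gen_coeff (hesse_name i (Suc j mod 3))) \<and> (\<forall>v. v \<notin> monomials 3 3 \<longrightarrow> B (gen_coeff v) = gen_coeff v)"
 proof (rule hesse_hom_exists)
  fix d :: "'k ratfun \<Rightarrow> 'k ratfun" assume z: "\<forall>i<3. \<forall>j<3. d (gen_coeff (hesse_name i (Suc j mod 3))) = 0"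
  show "\<forall>i<3. \<forall>j<3. d (gen_coeff (hesse_name i j)) = 0"
  proof (intro allI impI)
   fix i j :: nat assume ij: "i < 3" "j < 3"
   then have "Suc ((j + 2) mod 3) mod 3 = j" by presburger
   then show "d (gen_coeff (hesse_name i j)) = 0" using z ij(1) by (metis mod_less_divisor zero_less_numeral)
  qed
 qed
 then obtain B where B: "is_hom B" "\<forall>c. B (scalar c) = scalar c" "B ?m = ?m"
  "\<forall>i<3. \<forall>j<3. B (gen_coeff (hesse_name i j)) = gen_coeff (hesse_name i (Suc j mod 3))" "\<forall>v. v \<notin> monomials 3 3 \<longrightarrow> B (gen_coeff v) = gen_coeff v"
  by (elim exE conjE)
 have H: "?H $$ (i, j) = gen_coeff (hesse_name i j)" if "i < 3" "j < 3" for i j using that by (simp add: hesse_matrix_def)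
 have row: "row_times 3 x ?H j = (\<Sum>i<3. x i * gen_coeff (hesse_name i j))" if "j < 3" for x j
  unfolding row_times_def by (rule sum.cong) (use that H in auto)
 have invA: "hesse ?m (\<lambda>j. \<Sum>i<3. x i * A (?H $$ (i, j))) = hesse ?m (row_times 3 x ?H)" for x
 proof -
  have e: "(\<Sum>i<3. x i * A (?H $$ (i, j))) = w ^ j * row_times 3 x ?H j" if "j < 3" for j
   unfolding row[OF that] sum_distrib_left by (rule sum.cong) (use A(4) H that in \<open>auto simp: mult_ac\<close>)
  have "hesse ?m (\<lambda>j. \<Sum>i<3. x i * A (?H $$ (i, j))) = hesse ?m (\<lambda>j. w ^ j * row_times 3 x ?H j)"
   unfolding hesse_def using e[of 0] e[of 1] e[of 2] by simp
  also have "\<dots> = hesse ?m (row_times 3 x ?H)"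
   unfolding hesse_def using w3 by (simp add: power2_eq_square) (Groebner_Basis.algebra)
  finally show ?thesis .
 qed
 have invB: "hesse ?m (\<lambda>j. \<Sum>i<3. x i * B (?H $$ (i, j))) = hesse ?m (row_times 3 x ?H)" for x
 proof -
  have e: "(\<Sum>i<3. x i * B (?H $$ (i, j))) = row_times 3 x ?H (Suc j mod 3)" if "j < 3" for j
  proof -
   have j': "Suc j mod 3 < 3" by simp
   show ?thesis unfolding row[OF j'] by (rule sum.cong) (use B(4) H that in auto)
  qed
  have "hesse ?m (\<lambda>j. \<Sum>i<3. x i * B (?H $$ (i, j))) = hesse ?m (\<lambda>j. row_times 3 x ?H (Suc j mod 3))"
   unfolding hesse_def using e[of 0] e[of 1] e[of 2] by simp
  also have "\<dots> = hesse ?m (row_times 3 x ?H)"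
  proof -
   have "Suc 0 mod 3 = 1" "Suc 1 mod 3 = 2" "Suc 2 mod 3 = 0" by simp_all
   then show ?thesis unfolding hesse_def by (simp only:) (simp add: algebra_simps)
  qed
  finally show ?thesis .
 qed
 have fixC: "A (C v) = C v" "B (C v) = C v" if "v \<in> monomials 3 3" for v
  using hesse_symmetry_fixes_coefficients[OF A(1,3) C invA that] hesse_symmetry_fixes_coefficients[OF B(1,3) C invB that] .
 have fixF: "D (F z) = F z" if D: "is_hom D" "\<forall>c. D (scalar c) = scalar c" "\<forall>v\<in>monomials 3 3. D (C v) = C v"
  "\<forall>v. v \<notin> monomials 3 3 \<longrightarrow> D (gen_coeff v) = gen_coeff v" for D z
 proof (rule ratfun_hom_eqI[OF hom_comp[OF D(1) F(1)] F(1)])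
  show "D (F (scalar c)) = F (scalar c)" for c using D(2) F(2) by simp
  show "D (F (gen_coeff v)) = F (gen_coeff v)" for v
   by (cases "v \<in> monomials 3 3") (use D F in auto)
 qed
 have AF: "A (F z) = F z" for z by (rule fixF[OF A(1,2) _ A(5)]) (use fixC in blast)
 have BF: "B (F z) = F z" for z by (rule fixF[OF B(1,2) _ B(5)]) (use fixC in blast)
 show ?thesis
  by (rule exI[of _ A], rule exI[of _ B], rule exI[of _ F]) (use A B F AF BF FC in \<open>simp add: w_def\<close>)
qed

text \<open>Everything is transported by \<open>F\<close>, so that \<open>L\<close> becomes the field \<open>F ` L\<close> over which \<open>\<lambda> \<psi>(x M)\<close> is defined. Three
 derivations dual to \<open>m, u, v\<close> have a combination killing this field if its transcendence degree is at most 2,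
 but every derivation killing this field kills \<open>m\<close>, \<open>u\<close> and \<open>v\<close>, which makes the combination trivial.\<close>

theorem ternary_cubic_lower:
 "enat 3 \<le> ed_general_hypersurface TYPE('k::{alg_closed_field, field_char_0}) 3 3"
proof (rule ed_general_hypersurface_ge)
 fix L :: "'k ratfun set" and g f c
 assume L: "is_subfield L" "base_field \<subseteq> L" and g: "g \<in> GL 3 UNIV" and f: "f \<in> forms 3 3 L" and c: "c \<noteq> 0"
  and fg: "\<And>x. ev id x f = c * ev id (row_times 3 x g) (general_form 3 3)"
 let ?m = "gen_coeff (cubic_mon 0 1 2) :: 'k ratfun" and ?H = "hesse_matrix :: 'k ratfun mat"
 obtain \<omega> :: 'k where "poly [:1, 1, 1:] \<omega> = 0" using alg_closed_imp_poly_has_root[of "[:1, 1, 1 :: 'k:]"] by auto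
 then have \<omega>: "\<omega>\<^sup>2 + \<omega> + 1 = 0" by (simp add: power2_eq_square algebra_simps)
 obtain A B F where A: "is_hom A" and B: "is_hom B" and F: "is_hom F"
  and fixed: "\<forall>c. A (scalar c) = scalar c \<and> B (scalar c) = scalar c \<and> F (scalar c) = scalar c"
  and mA: "A ?m = ?m" and mB: "B ?m = ?m" and ABF: "\<forall>z. A (F z) = F z \<and> B (F z) = F z"
  and HA: "\<forall>i<3. \<forall>j<3. A (gen_coeff (hesse_name i j)) = scalar \<omega> ^ j * gen_coeff (hesse_name i j)"
  and HB: "\<forall>i<3. \<forall>j<3. B (gen_coeff (hesse_name i j)) = gen_coeff (hesse_name i (Suc j mod 3))"
  and C: "\<forall>x. hesse ?m (row_times 3 x ?H) = (\<Sum>v\<in>monomials 3 3. F (gen_coeff v) * mon x v)"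
  using hesse_heisenberg_homs[OF \<omega>] by (elim exE conjE)
 have F_base: "F x = x" if "x \<in> base_field" for x using that fixed by (auto simp: base_field_eq)
 define M where "M = map_mat F g * ?H"
 have gc: "g \<in> carrier_mat 3 3" by (rule GL_D(1)[OF g])
 have M: "M \<in> GL 3 UNIV" unfolding M_def by (intro GL_mult GL_map F g hesse_matrix_GL)
 have Mij: "M $$ (i, j) = (\<Sum>l<3. F (g $$ (i, l)) * gen_coeff (hesse_name l j))" if "i < 3" "j < 3" for i j
  using that gc by (simp add: M_def hesse_matrix_def scalar_prod_def lessThan_atLeast0)
 define w :: "'k ratfun" where "w = scalar \<omega>"
 have MA: "A (M $$ (i, j)) = w ^ j * M $$ (i, j)" if "i < 3" "j < 3" for i j
  unfolding Mij[OF that] hom_sum[OF A] sum_distrib_left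
  by (rule sum.cong) (use ABF HA that in \<open>auto simp: homD(4)[OF A] w_def mult_ac\<close>)
 have MB: "B (M $$ (i, j)) = M $$ (i, Suc j mod 3)" if "i < 3" "j < 3" for i j
 proof -
  have j': "Suc j mod 3 < 3" by simp
  show ?thesis unfolding Mij[OF that] Mij[OF that(1) j'] hom_sum[OF B]
   by (rule sum.cong) (use ABF HB that in \<open>auto simp: homD(4)[OF B]\<close>)
 qed
 define p q r where "p = M $$ (0, 0)" and "q = M $$ (0, 1)" and "r = M $$ (0, 2)"
 have Bpqr: "B p = q" "B q = r" "B r = p" using MB[of 0 0] MB[of 0 1] MB[of 0 2] by (simp_all add: p_def q_def r_def numeral_2_eq_2)
 have Apqr: "A p = p" "A q = w * q" "A r = w * (w * r)"
  using MA[of 0 0] MA[of 0 1] MA[of 0 2] by (simp_all add: p_def q_def r_def power2_eq_square mult.assoc)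
 have nz: "p \<noteq> 0" "q \<noteq> 0" "r \<noteq> 0"
 proof -
  have B0: "B x = 0 \<longleftrightarrow> x = 0" for x using hom_inj[OF B, of x 0] homD(1)[OF B] by auto
  have eq: "p = 0 \<longleftrightarrow> q = 0" "q = 0 \<longleftrightarrow> r = 0" using B0[of p] B0[of q] Bpqr by auto
  have "\<exists>j<3. row_times 3 (\<lambda>i. if i = 0 then 1 else 0) M j \<noteq> 0"
   by (rule row_times_nonzero[OF M, of 0]) auto
  then obtain j where j: "j < 3" "row_times 3 (\<lambda>i. if i = 0 then 1 else 0) M j \<noteq> 0" by blast
  have "row_times 3 (\<lambda>i. if i = 0 then 1 else 0) M j = M $$ (0, j)" by (simp add: row_times_def sum_3)
  then have "M $$ (0, j) \<noteq> 0" using j(2) by simp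
  moreover have "j = 0 \<or> j = 1 \<or> j = 2" using j(1) by auto
  ultimately have "p \<noteq> 0 \<or> q \<noteq> 0 \<or> r \<noteq> 0" by (auto simp: p_def q_def r_def)
  then show "p \<noteq> 0" "q \<noteq> 0" "r \<noteq> 0" using eq by auto
 qed
 define u v where "u = q / p" and "v = r / p"
 have uv: "u \<noteq> 0" "v \<noteq> 0" using nz by (simp_all add: u_def v_def)
 have Auv: "A u = scalar \<omega> * u" "A v = scalar \<omega> * (scalar \<omega> * v)"
  by (simp_all add: u_def v_def hom_divide[OF A] Apqr w_def)
 have Buv: "B u = v / u" "B v = 1 / u" using nz by (simp_all add: u_def v_def hom_divide[OF B] Bpqr)
 have fA: "\<And>c. A (scalar c) = scalar c" and fB: "\<And>c. B (scalar c) = scalar c" using fixed by blast+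
 note ind = heisenberg_pair_independent[OF \<omega> uv A fA mA B fB mB Auv Buv]
 obtain d1 where d1: "derivation d1" "\<And>y. y \<in> base_field \<Longrightarrow> d1 y = 0" "d1 ?m = 1"
  using transcendental_derivation[OF subfield_base gen_coeff_transcendental[of "cubic_mon 0 1 2"]] by metis
 obtain d2 where d2: "derivation d2" "\<And>y. y \<in> adjoin base_field {?m} \<Longrightarrow> d2 y = 0" "d2 u = 1"
  using transcendental_derivation[OF subfield_adjoin ind(1)] by metis
 obtain d3 where d3: "derivation d3" "\<And>y. y \<in> adjoin base_field {?m, u} \<Longrightarrow> d3 y = 0" "d3 v = 1"
  using transcendental_derivation[OF subfield_adjoin ind(2)] by metis
 have d2m: "d2 ?m = 0" by (rule d2(2)) (use adjoin_gen[of "{?m}" base_field] in simp)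
 have d3m: "d3 ?m = 0" by (rule d3(2)) (use adjoin_gen[of "{?m, u}" base_field] in simp)
 have d3u: "d3 u = 0" by (rule d3(2)) (use adjoin_gen[of "{?m, u}" base_field] in simp)
 have d2b: "d2 y = 0" if "y \<in> base_field" for y by (rule d2(2)) (use that adjoin_base[of base_field "{?m}"] in blast)
 have d3b: "d3 y = 0" if "y \<in> base_field" for y by (rule d3(2)) (use that adjoin_base[of base_field "{?m, u}"] in blast)
 define d where "d i = (if i = 0 then d1 else if i = 1 then d2 else d3)" for i :: nat
 have d_der: "derivation (d i)" for i using d1(1) d2(1) d3(1) by (simp add: d_def)
 have d_base: "d i x = 0" if "x \<in> base_field" for i x using d1(2) d2b d3b that by (simp add: d_def)
 show "enat 3 \<le> trdeg base_field L"
 proof (rule ccontr)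
  assume "\<not> enat 3 \<le> trdeg base_field L"
  then have "trdeg base_field L < enat 3" by simp
  then have "trdeg base_field L \<le> enat 2" by (cases "trdeg base_field L") auto
  then have tr: "trdeg base_field (F ` L) \<le> enat 2"
   using trdeg_hom_image[OF F subfield_base F_base, of L] by (rule order_trans[rotated])
  have FL: "is_subfield (F ` L)"
  proof (rule is_subfieldI)
   show "0 \<in> F ` L" "1 \<in> F ` L" using subfieldD(1,2)[OF L(1)] homD(1,2)[OF F] by (metis imageI)+
   fix x assume "x \<in> F ` L"
   then obtain x' where x: "x' \<in> L" "x = F x'" by blast
   show "- x \<in> F ` L" unfolding x(2) hom_uminus[OF F, symmetric] by (intro imageI subfieldD(5)[OF L(1) x(1)])
   have "inverse x = F (inverse x')" using hom_divide[OF F, of 1 x'] homD(2)[OF F] x(2) by (simp add: inverse_eq_divide)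
   then show "inverse x \<in> F ` L" using subfieldD(6)[OF L(1) x(1)] by simp
   fix y assume "y \<in> F ` L"
   then obtain y' where y: "y' \<in> L" "y = F y'" by blast
   show "x + y \<in> F ` L" unfolding x(2) y(2) homD(3)[OF F, symmetric] by (intro imageI subfieldD(3)[OF L(1) x(1) y(1)])
   show "x * y \<in> F ` L" unfolding x(2) y(2) homD(4)[OF F, symmetric] by (intro imageI subfieldD(4)[OF L(1) x(1) y(1)])
  qed
  have base_FL: "base_field \<subseteq> F ` L" using L(2) F_base by (metis image_eqI subsetD subsetI)
  have "\<exists>l. (\<exists>i\<in>{..<3::nat}. l i \<noteq> 0) \<and> (\<forall>x\<in>F ` L. (\<Sum>i\<in>{..<3}. l i * d i x) = 0)"
   by (rule trdeg_derivation_relation[OF subfield_base FL base_FL tr]) (use d_der d_base in auto)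
  then obtain l where l: "\<exists>i\<in>{..<3::nat}. l i \<noteq> 0" "\<forall>x\<in>F ` L. (\<Sum>i\<in>{..<3}. l i * d i x) = 0" by (elim exE conjE)
  define D where "D x = (\<Sum>i\<in>{..<3}. l i * d i x)" for x
  have D: "derivation D" unfolding D_def[abs_def] by (rule derivation_combination) (rule d_der)
  have kill: "\<forall>x. (\<forall>v. x v \<in> of_nat ` {1..}) \<longrightarrow> D (F c * hesse ?m (row_times 3 x M)) = 0"
  proof (intro allI impI)
   fix x :: "nat \<Rightarrow> 'k ratfun" assume "\<forall>v. x v \<in> of_nat ` {1..}"
   then have x: "x v \<in> of_nat ` {1..}" for v by blast
   have xL: "x i \<in> L" for i using x[of i] subfield_of_nat[OF L(1)] by auto
   have Fx: "F (x i) = x i" for i using x[of i] hom_of_nat[OF F] by auto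
   have Frow: "F (row_times 3 x g j) = row_times 3 x (map_mat F g) j" if "j < 3" for j
    unfolding row_times_def hom_sum[OF F] homD(4)[OF F] Fx by (rule sum.cong) (use gc that in auto)
   have rowM: "row_times 3 (row_times 3 x (map_mat F g)) ?H j = row_times 3 x M j" if "j < 3" for j
   proof -
    have "row_times 3 (row_times 3 x (map_mat F g)) ?H j = (\<Sum>l<3. \<Sum>i<3. x i * (F (g $$ (i, l)) * gen_coeff (hesse_name l j)))"
     unfolding row_times_def sum_distrib_right using gc that by (intro sum.cong) (auto simp: hesse_matrix_def mult.assoc)
    also have "\<dots> = (\<Sum>i<3. x i * M $$ (i, j))"
     by (subst sum.swap) (rule sum.cong, use that in \<open>auto simp: Mij sum_distrib_left\<close>)
    finally show ?thesis by (simp add: row_times_def)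
   qed
   have "F (ev id (row_times 3 x g) (general_form 3 3)) = (\<Sum>v\<in>monomials 3 3. F (gen_coeff v) * mon (\<lambda>j. F (row_times 3 x g j)) v)"
    unfolding ev_general_form by (simp add: hom_sum[OF F] homD(4)[OF F] mon_def hom_prod[OF F] hom_power[OF F])
   also have "\<dots> = (\<Sum>v\<in>monomials 3 3. F (gen_coeff v) * mon (row_times 3 x (map_mat F g)) v)"
   proof (rule sum.cong)
    fix v assume v: "v \<in> monomials 3 3"
    have "mon (\<lambda>j. F (row_times 3 x g j)) v = mon (row_times 3 x (map_mat F g)) v"
     unfolding mon_def by (rule prod.cong) (use Frow monomials_keys[OF v] in auto)
    then show "F (gen_coeff v) * mon (\<lambda>j. F (row_times 3 x g j)) v = F (gen_coeff v) * mon (row_times 3 x (map_mat F g)) v" by simp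
   qed simp
   also have "\<dots> = hesse ?m (row_times 3 (row_times 3 x (map_mat F g)) ?H)" using C by simp
   also have "\<dots> = hesse ?m (row_times 3 x M)" unfolding hesse_def using rowM[of 0] rowM[of 1] rowM[of 2] by simp
   finally have "F (ev id x f) = F c * hesse ?m (row_times 3 x M)" unfolding fg homD(4)[OF F] by simp
   moreover have "F (ev id x f) \<in> F ` L" by (intro imageI ev_in_subfield[OF L(1) f] xL)
   ultimately have "F c * hesse ?m (row_times 3 x M) \<in> F ` L" by simp
   then show "D (F c * hesse ?m (row_times 3 x M)) = 0" using l(2) unfolding D_def by blast
  qed
  have Fc: "F c \<noteq> 0" using c hom_inj[OF F, of c 0] homD(1)[OF F] by auto
  note tan = hesse_tangent[OF M parameter_generic Fc D kill]
  have D3: "D x = l 0 * d1 x + (l 1 * d2 x + l 2 * d3 x)" for x by (simp add: D_def sum_3 d_def)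
  have quot: "D (y / p) = 0" if "D y = \<rho> * y" "D p = \<rho> * p" for y \<rho>
  proof -
   have "D (y / p * p) = y / p * D p + D (y / p) * p" by (rule derivationD(2)[OF D])
   then have "D (y / p) * p = 0" using that nz(1) by simp
   then show ?thesis using nz(1) by simp
  qed
  have Dp: "D p = - (D (F c) / F c) / 3 * p" unfolding p_def by (rule tan(2)) auto
  have Du: "D u = 0" unfolding u_def by (rule quot[OF _ Dp]) (unfold q_def, rule tan(2), auto)
  have Dv: "D v = 0" unfolding v_def by (rule quot[OF _ Dp]) (unfold r_def, rule tan(2), auto)
  have l0: "l 0 = 0" using tan(1) unfolding D3 d1(3) d2m d3m by simp
  have l1: "l 1 = 0" using Du unfolding D3 l0 d2(3) d3u by simp
  have l2: "l 2 = 0" using Dv unfolding D3 l0 l1 d3(3) by simp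
  obtain i where "i < 3" "l i \<noteq> 0" using l(1) by auto
  then have "i = 0 \<or> i = 1 \<or> i = 2" by auto
  then show False using l0 l1 l2 \<open>l i \<noteq> 0\<close> by auto
 qed
qed

theorem proposition16p2:
  fixes n :: nat
  assumes "n > 0"
  shows
    "(ed_general_form TYPE('k::{alg_closed_field, field_char_0}) n 1 = 0
        \<and> ed_general_hypersurface TYPE('k) n 1 = 0)
     \<and> (ed_general_form TYPE('k) n 2 = enat n
        \<and> ed_general_hypersurface TYPE('k) n 2 = enat (n - 1))
     \<and> (ed_general_form TYPE('k) 2 3 = 2 \<and> ed_general_hypersurface TYPE('k) 2 3 = 1)
     \<and> (ed_general_form TYPE('k) 2 4 = 3 \<and> ed_general_hypersurface TYPE('k) 2 4 = 2)
     \<and> ed_general_hypersurface TYPE('k) 3 3 = 3"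
proof -
 have e: "(0 :: enat) = enat 0" "(1 :: enat) = enat 1" "(2 :: enat) = enat 2" "(3 :: enat) = enat 3"
  by (simp_all add: numeral_eq_enat zero_enat_def one_enat_def)
 have a: "ed_general_form TYPE('k) n 1 = 0" "ed_general_hypersurface TYPE('k) n 1 = 0"
  using linear_upper[OF assms, where ?'k = 'k] by (simp_all add: zero_enat_def[symmetric])
 have b: "ed_general_form TYPE('k) n 2 = enat n" "ed_general_hypersurface TYPE('k) n 2 = enat (n - 1)"
  by (rule antisym[OF quadratic_upper(1) quadratic_lower(1)], rule antisym[OF quadratic_upper(2)[OF assms] quadratic_lower(2)])
 have c: "ed_general_form TYPE('k) 2 3 = 2" "ed_general_hypersurface TYPE('k) 2 3 = 1"
  unfolding e by (rule antisym[OF binary_cubic_upper(1) binary_cubic_lower(1)], rule antisym[OF binary_cubic_upper(2) binary_cubic_lower(2)])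
 have d: "ed_general_form TYPE('k) 2 4 = 3" "ed_general_hypersurface TYPE('k) 2 4 = 2"
  unfolding e by (rule antisym[OF binary_quartic_upper(1) binary_quartic_lower(1)], rule antisym[OF binary_quartic_upper(2) binary_quartic_lower(2)])
 have h: "ed_general_hypersurface TYPE('k) 3 3 = 3"
  unfolding e by (rule antisym[OF ternary_cubic_upper ternary_cubic_lower])
 show ?thesis by (intro conjI a b c d h)
qed

end
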